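(* There is an absolute constant $c>0$ such that for every positive integer $n$, the alternating group $A_n$ is $0.01$-mixing for $100$-global $e^{-cn^{1/3}}$-dense products. That is: if $A,B,C\subseteq A_n$ are $100$-global with $\mu(A),\mu(B),\mu(C)\ge e^{-cn^{1/3}}$, then for independent uniformly random $a,b\sim A_n$, $$(1-0.01)\,\mu(A)\mu(B)\mu(C)<\Pr[a\in A,\ b\in B,\ ab\in C]<(1+0.01)\,\mu(A)\mu(B)\mu(C).$$
   Context: $A_n$ is the alternating group on $[n]$ and $\mu(A)=|A|/|A_n|$. Globalness: let $[n]_t$ be the set of $t$-tuples of distinct elements of $[n]$. For $I,J\in[n]_t$ let $U_{I\to J}=\{\sigma\in S_n:\sigma(I_s)=J_s \text{ for all } s\}$. A set $A\subseteq S_n$ (in particular a subset of $A_n\subseteq S_n$) is $r$-global if its indicator function $1_A$ satisfies $\|(1_A)_{I\to J}\|_2\le r^t\|1_A\|_2$ for every $t$ and all $I,J\in[n]_t$, where $(1_A)_{I\to J}$ is the restriction to $U_{I\to J}$, and $\|\cdot\|_2$ is with respect to the uniform probability measure on $U_{I\to J}$, respectively on $S_n$. *)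

theory Defs
  imports "HOL-Probability.Probability" "HOL-Algebra.Sym_Groups"
begin

definition alt_density :: "nat \<Rightarrow> (nat \<Rightarrow> nat) set \<Rightarrow> real" where
  "alt_density n A = real (card A) / real (card (carrier (alt_group n)))"

text \<open>A $t$-tuple is a list of length $t$; the empty tuple ($t = 0$) is allowed.\<close>

definition tuples :: "nat \<Rightarrow> nat \<Rightarrow> nat list set" where
  "tuples n t = {I. length I = t \<and> distinct I \<and> set I \<subseteq> {1..n}}"

definition umvirate :: "nat \<Rightarrow> nat list \<Rightarrow> nat list \<Rightarrow> (nat \<Rightarrow> nat) set" where
  "umvirate n I J =
     {\<sigma> \<in> carrier (sym_group n). \<forall>s < length I. \<sigma> (I ! s) = J ! s}"

text \<open>The $L^2$ norm, with respect to the uniform probability measure on a nonempty finite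
  set $U$, of the restriction of $f$ to $U$: the values of $f$ outside $U$ are irrelevant.\<close>

definition l2norm_on :: "'a set \<Rightarrow> ('a \<Rightarrow> real) \<Rightarrow> real" where
  "l2norm_on U f = sqrt (measure_pmf.expectation (pmf_of_set U) (\<lambda>x. \<bar>f x\<bar>\<^sup>2))"

text \<open>The ambient group for globalness is the symmetric group, also for sets of even
  permutations.\<close>

definition global_set :: "nat \<Rightarrow> real \<Rightarrow> (nat \<Rightarrow> nat) set \<Rightarrow> bool" where
  "global_set n r A \<longleftrightarrow>
     A \<subseteq> carrier (sym_group n) \<and>
     (\<forall>t. \<forall>I \<in> tuples n t. \<forall>J \<in> tuples n t.
        l2norm_on (umvirate n I J) (indicator A)
          \<le> r ^ t * l2norm_on (carrier (sym_group n)) (indicator A))"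

end

(*
The trilinear count splits into a main term, contributions of pure degree d for 1 <= d <= D with D of
order n^(1/3), and a contribution of degree above D.

Degree d: a function of pure degree d is governed by its averages over d-umvirates, a harmonic array on
partial injections whose energy is comparable to its L^2 norm. Convolution contracts this energy by about
(d/n)^d, so it suffices to bound the energy of the degree d part of a global indicator by
mu^2 * O(log(1/mu)/d)^d. Such a level inequality holds on the product space [n]^[n], by induction on d with
a Rosenthal type moment inequality. It is transferred to the symmetric group by composing a random
permutation with a random idempotent self-map of [n], which produces a uniform point of [n]^[n] and keeps
degree d energies up to a factor C^d.

Degree above D: the operator h |-> conv g h commutes with left translations, so its top singular space is
invariant. A nonzero vector of that space which is orthogonal to low degree functions yields, from disjoint
blocks of four points, 2^(D/4) pairwise orthogonal translates of one vector. By Bessel's inequality the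
operator norm drops by a factor 2^(D/8), which beats the densities.

For small n the density hypothesis forces A, B and C to be the whole group.
*)

theory Submission
  imports Defs
begin

section \<open>Means over finite sets\<close>

text \<open>The exponent 1/3 comes from the bookkeeping in degree d. With L of order log(1/mu), the
  square root of three energies mu^2 (O(L)/d)^d times the contraction (d/n)^d is mu(A) mu(B) mu(C)
  (O(L)^3 / (n d^2))^(d/2), and the sum over d is small once L^3 is a small multiple of n. The level
  inequality covers only d <= L, whereas above D the gain must beat the inverse square root of the
  product of the densities; both are met by D = floor(L) with L a large multiple of log(1/mu). The
  obstacle is that a permutation has no independent coordinates, so that neither the Efron-Stein
  decomposition nor a moment inequality is at hand on the group. The random idempotent is the bridge
  to a space that has both: its law is invariant under conjugation, so averages over it follow from
  symmetry, and it fixes a given set of d points with probability at least 9^(-d), so degree d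
  survives. On the group side, the vanishing row and column sums of harmonic arrays play the part of
  irreducible representations.\<close>

definition mean :: "'a set \<Rightarrow> ('a \<Rightarrow> real) \<Rightarrow> real" where
  "mean A f = (\<Sum>x\<in>A. f x) / real (card A)"

lemma mean_cong [cong]:
  "A = B \<Longrightarrow> (\<And>x. x \<in> B =simp=> f x = g x) \<Longrightarrow> mean A f = mean B g"
  by (simp add: mean_def simp_implies_def)

lemma mean_add: "mean A (\<lambda>x. f x + g x) = mean A f + mean A g"
  by (simp add: mean_def sum.distrib add_divide_distrib)

lemma mean_diff: "mean A (\<lambda>x. f x - g x) = mean A f - mean A g"
  by (simp add: mean_def sum_subtractf diff_divide_distrib)

lemma mean_cmult: "mean A (\<lambda>x. c * f x) = c * mean A f"
  by (simp add: mean_def sum_distrib_left)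

lemma mean_multc: "mean A (\<lambda>x. f x * c) = mean A f * c"
  by (simp add: mean_def sum_distrib_right)

lemma mean_divide: "mean A (\<lambda>x. f x / c) = mean A f / c"
  by (simp add: mean_def sum_divide_distrib [symmetric] mult.commute)

lemma mean_minus: "mean A (\<lambda>x. - f x) = - mean A f"
  by (simp add: mean_def sum_negf)

lemma mean_sum: "mean A (\<lambda>x. \<Sum>i\<in>I. f i x) = (\<Sum>i\<in>I. mean A (f i))"
  by (simp add: mean_def sum.swap [of _ A] sum_divide_distrib)

lemma mean_zero [simp]: "mean A (\<lambda>x. 0) = 0"
  by (simp add: mean_def)

lemma mean_empty [simp]: "mean {} f = 0"
  by (simp add: mean_def)

lemma mean_const: "finite A \<Longrightarrow> A \<noteq> {} \<Longrightarrow> mean A (\<lambda>x. c) = c"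
  by (simp add: mean_def)

lemma mean_mono: "(\<And>x. x \<in> A \<Longrightarrow> f x \<le> g x) \<Longrightarrow> mean A f \<le> mean A g"
  by (simp add: mean_def divide_right_mono sum_mono)

lemma mean_nonneg: "(\<And>x. x \<in> A \<Longrightarrow> 0 \<le> f x) \<Longrightarrow> 0 \<le> mean A f"
  by (simp add: mean_def sum_nonneg)

text \<open>The hypothesis \<open>0 \<le> c\<close> covers the empty and the infinite
  \<open>A\<close>, where \<open>mean\<close> takes the default value 0.\<close>

lemma mean_le_const:
  assumes "\<And>x. x \<in> A \<Longrightarrow> f x \<le> c" "0 \<le> c"
  shows "mean A f \<le> c"
proof (cases "finite A \<and> A \<noteq> {}")
  case True
  then show ?thesis using mean_mono [of A f "\<lambda>_. c"] assms by (simp add: mean_const)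
next
  case False
  then show ?thesis using assms(2) by (auto simp: mean_def)
qed

lemma abs_mean_le: "\<bar>mean A f\<bar> \<le> mean A (\<lambda>x. \<bar>f x\<bar>)"
  by (simp add: mean_def abs_divide divide_right_mono sum_abs)

lemma mean_swap: "mean A (\<lambda>x. mean B (\<lambda>y. f x y)) = mean B (\<lambda>y. mean A (\<lambda>x. f x y))"
  by (simp add: mean_def sum_divide_distrib [symmetric] sum.swap [of _ A])

lemma mean_Times: "mean (A \<times> B) f = mean A (\<lambda>x. mean B (\<lambda>y. f (x, y)))"
  by (simp add: mean_def sum.cartesian_product sum_divide_distrib [symmetric] card_cartesian_product)

lemma mean_bij:
  assumes "bij_betw h A B"
  shows "mean A (\<lambda>x. f (h x)) = mean B f"
  using assms by (simp add: mean_def sum.reindex_bij_betw bij_betw_same_card)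

text \<open>A map whose fibres all have the same size pushes the uniform measure forward to the
  uniform measure.\<close>

lemma mean_fibres:
  assumes "finite A" "finite B" "\<And>x. x \<in> A \<Longrightarrow> key x \<in> B"
    and fib: "\<And>y. y \<in> B \<Longrightarrow> card {x \<in> A. key x = y} = N" and "0 < N"
  shows "mean A (\<lambda>x. f (key x)) = mean B f"
proof -
  have *: "(\<Sum>x\<in>A. g (key x)) = real N * (\<Sum>y\<in>B. g y)" for g :: "'b \<Rightarrow> real"
  proof -
    have "(\<Sum>x\<in>A. g (key x)) = (\<Sum>y\<in>B. \<Sum>x\<in>{x \<in> A. key x = y}. g (key x))"
      using assms(1-3) by (intro sum.group [symmetric]) auto
    also have "\<dots> = (\<Sum>y\<in>B. real N * g y)"
      by (intro sum.cong refl) (simp add: fib)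
    finally show ?thesis by (simp add: sum_distrib_left)
  qed
  from * [of "\<lambda>_. 1"] have "real (card A) = real N * real (card B)" by simp
  with * [of f] \<open>0 < N\<close> show ?thesis by (simp add: mean_def)
qed

lemma mean_Cauchy_Schwarz: "(mean A (\<lambda>x. f x * g x))\<^sup>2 \<le> mean A (\<lambda>x. (f x)\<^sup>2) * mean A (\<lambda>x. (g x)\<^sup>2)"
  using Cauchy_Schwarz_ineq_sum [of f g A]
  by (simp add: mean_def power_divide power2_eq_square divide_right_mono)

lemma abs_mean_mult_le:
  "\<bar>mean A (\<lambda>x. f x * g x)\<bar> \<le> sqrt (mean A (\<lambda>x. (f x)\<^sup>2)) * sqrt (mean A (\<lambda>x. (g x)\<^sup>2))"
  using mean_Cauchy_Schwarz [of A f g]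
  by (metis real_sqrt_le_iff real_sqrt_abs real_sqrt_mult)

text \<open>Jensen's inequality for the probability weights proportional to \<open>w\<close>. This
  is the form of Hoelder's inequality that the level inequality uses, with \<open>w\<close> a
  function with values in [0, 1] and \<open>g\<close> its degree d part.\<close>

lemma mean_weighted_power_le:
  assumes "finite A" "\<And>x. x \<in> A \<Longrightarrow> 0 \<le> w x" "even k" "0 < k"
  shows "(mean A (\<lambda>x. w x * g x)) ^ k \<le> mean A w ^ (k - 1) * mean A (\<lambda>x. w x * g x ^ k)"
proof (cases "mean A w = 0")
  case True
  show ?thesis
  proof (cases "A = {}")
    case False
    with True assms(1) have "(\<Sum>x\<in>A. w x) = 0" by (simp add: mean_def)
    then have "\<And>x. x \<in> A \<Longrightarrow> w x = 0"
      using assms(1,2) by (simp add: sum_nonneg_eq_0_iff)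
    then show ?thesis using assms(4) by (simp add: zero_power)
  qed (use assms(4) in \<open>simp add: zero_power\<close>)
next
  case False
  define W where "W = (\<Sum>x\<in>A. w x)"
  define m where "m = real (card A)"
  have W: "0 < W" and m: "0 < m" and ne: "A \<noteq> {}"
    using False assms(1,2) sum_nonneg [of A w]
    by (auto simp: W_def m_def mean_def less_le card_gt_0_iff)
  have "(\<Sum>x\<in>A. (w x / W) *\<^sub>R g x) ^ k \<le> (\<Sum>x\<in>A. (w x / W) * g x ^ k)"
    by (rule convex_on_sum [OF assms(1) ne convex_power_even [OF assms(3)]])
       (use W assms(2) in \<open>auto simp: sum_divide_distrib [symmetric] W_def [symmetric]\<close>)
  then have *: "((\<Sum>x\<in>A. w x * g x) / W) ^ k \<le> (\<Sum>x\<in>A. w x * g x ^ k) / W"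
    by (simp add: sum_divide_distrib)
  have "(\<Sum>x\<in>A. w x * g x) ^ k = W ^ k * ((\<Sum>x\<in>A. w x * g x) / W) ^ k"
    using W by (simp add: power_divide)
  also have "\<dots> \<le> W ^ k * ((\<Sum>x\<in>A. w x * g x ^ k) / W)"
    using * W by (intro mult_left_mono) auto
  also have "\<dots> = W ^ (k - 1) * (\<Sum>x\<in>A. w x * g x ^ k)"
    using W assms(4) by (cases k) auto
  finally have "(\<Sum>x\<in>A. w x * g x) ^ k / m ^ k \<le> W ^ (k - 1) * (\<Sum>x\<in>A. w x * g x ^ k) / m ^ k"
    using m by (simp add: divide_right_mono)
  then show ?thesis
    using assms(4) by (cases k) (auto simp: mean_def power_divide W_def m_def mult.commute)
qed

text \<open>Orthogonal projection onto the span of finitely many, possibly dependent, vectors,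
  expressed by coefficients. Each induction step is one Gram-Schmidt step.\<close>

lemma sum_projection:
  fixes v :: "'i \<Rightarrow> 'a \<Rightarrow> real"
  assumes "finite I" "finite X"
  shows "\<exists>c. \<forall>j\<in>I. (\<Sum>x\<in>X. (f x - (\<Sum>i\<in>I. c i * v i x)) * v j x) = 0"
  using assms(1)
proof (induction I arbitrary: f rule: finite_induct)
  case empty
  show ?case by simp
next
  case (insert a I)
  obtain c where c: "\<And>j. j \<in> I \<Longrightarrow> (\<Sum>x\<in>X. (f x - (\<Sum>i\<in>I. c i * v i x)) * v j x) = 0"
    using insert.IH by blast
  obtain e where e: "\<And>j. j \<in> I \<Longrightarrow> (\<Sum>x\<in>X. (v a x - (\<Sum>i\<in>I. e i * v i x)) * v j x) = 0"
    using insert.IH by blast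
  define r where "r x = f x - (\<Sum>i\<in>I. c i * v i x)" for x
  define w where "w x = v a x - (\<Sum>i\<in>I. e i * v i x)" for x
  \<comment> \<open>\<open>w\<close> is the part of \<open>v a\<close> orthogonal to the other
    vectors. If it vanishes, \<open>v a\<close> already lies in their span and the coefficient 0
    does.\<close>
  define t where "t = (if (\<Sum>x\<in>X. w x * w x) = 0 then 0 else (\<Sum>x\<in>X. r x * w x) / (\<Sum>x\<in>X. w x * w x))"
  define c' where "c' i = (if i = a then t else c i - t * e i)" for i
  have eq: "f x - (\<Sum>i\<in>insert a I. c' i * v i x) = r x - t * w x" for x
  proof -
    have "(\<Sum>i\<in>I. c' i * v i x) = (\<Sum>i\<in>I. c i * v i x) - t * (\<Sum>i\<in>I. e i * v i x)"
      unfolding sum_distrib_left sum_subtractf [symmetric]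
      using insert.hyps by (intro sum.cong) (auto simp: c'_def algebra_simps)
    then show ?thesis
      using insert.hyps by (simp add: r_def w_def c'_def algebra_simps)
  qed
  have I: "(\<Sum>x\<in>X. (r x - t * w x) * v j x) = 0" if "j \<in> I" for j
    using c [OF that] e [OF that]
    by (simp add: r_def [symmetric] w_def [symmetric] left_diff_distrib sum_subtractf mult.assoc
        sum_distrib_left [symmetric])
  have va: "v a x = w x + (\<Sum>i\<in>I. e i * v i x)" for x by (simp add: w_def)
  have "(\<Sum>x\<in>X. (r x - t * w x) * (\<Sum>i\<in>I. e i * v i x)) = (\<Sum>i\<in>I. e i * (\<Sum>x\<in>X. (r x - t * w x) * v i x))"
    unfolding sum_distrib_left by (subst sum.swap) (simp add: mult_ac)
  also have "\<dots> = 0" using I by simp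
  finally have 1: "(\<Sum>x\<in>X. (r x - t * w x) * (\<Sum>i\<in>I. e i * v i x)) = 0" .
  have 2: "(\<Sum>x\<in>X. (r x - t * w x) * w x) = 0"
  proof (cases "(\<Sum>x\<in>X. w x * w x) = 0")
    case True
    then have "\<And>x. x \<in> X \<Longrightarrow> w x = 0"
      using assms(2) by (subst (asm) sum_nonneg_eq_0_iff) auto
    then show ?thesis by simp
  next
    case False
    have "(\<Sum>x\<in>X. (r x - t * w x) * w x) = (\<Sum>x\<in>X. r x * w x) - t * (\<Sum>x\<in>X. w x * w x)"
      by (simp add: left_diff_distrib sum_subtractf mult.assoc sum_distrib_left)
    then show ?thesis using False by (simp add: t_def)
  qed
  have "(\<Sum>x\<in>X. (r x - t * w x) * v a x) = 0"
    using 1 2 by (simp add: va distrib_left sum.distrib)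
  with I show ?case by (intro exI [of _ c']) (simp add: eq)
qed

section \<open>A Rosenthal-type moment inequality\<close>

text \<open>A second order bound that also admits negative t; in the induction
  \<open>real p * t \<le> 1\<close> absorbs the cubic term.\<close>

lemma power_one_plus_le:
  fixes t :: real
  assumes "- 1 \<le> t" "real p * t \<le> 1"
  shows "(1 + t) ^ p \<le> 1 + real p * t + (real p)\<^sup>2 * t\<^sup>2"
  using assms(2)
proof (induction p)
  case (Suc p)
  have "real p * t \<le> 1"
  proof (cases "0 \<le> t")
    case True
    then have "real p * t \<le> real (Suc p) * t" by (intro mult_right_mono) auto
    with Suc.prems show ?thesis by linarith
  next
    case False
    then have "real p * t \<le> 0" by (simp add: mult_nonneg_nonpos)
    then show ?thesis by linarith
  qed
  with Suc.IH have "(1 + t) ^ p * (1 + t) \<le> (1 + real p * t + (real p)\<^sup>2 * t\<^sup>2) * (1 + t)"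
    using assms(1) by (intro mult_right_mono) auto
  also have "\<dots> = 1 + real (Suc p) * t + (real p + (real p)\<^sup>2) * t\<^sup>2 + (real p * t) * (real p * t\<^sup>2)"
    by (simp add: algebra_simps power2_eq_square)
  also have "\<dots> \<le> 1 + real (Suc p) * t + (real p + (real p)\<^sup>2) * t\<^sup>2 + 1 * (real p * t\<^sup>2)"
    using \<open>real p * t \<le> 1\<close> by (intro add_left_mono mult_right_mono) auto
  also have "\<dots> \<le> 1 + real (Suc p) * t + (real (Suc p))\<^sup>2 * t\<^sup>2"
    by (simp add: algebra_simps power2_eq_square)
  finally show ?case by (simp add: mult.commute)
qed simp

lemma add_power_le:
  fixes x y :: real
  assumes "0 \<le> x" "0 \<le> y" "0 < p"
  shows "x ^ p + y ^ p \<le> (x + y) ^ p"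
  using assms(3)
proof (induction p)
  case (Suc p)
  show ?case
  proof (cases "p = 0")
    case False
    have "x ^ Suc p + y ^ Suc p \<le> (x + y) * (x ^ p + y ^ p)"
      using assms by (simp add: algebra_simps)
    also have "\<dots> \<le> (x + y) * (x + y) ^ p"
      using Suc.IH False assms by (intro mult_left_mono) auto
    finally show ?thesis by simp
  qed simp
qed simp

text \<open>The deterministic core of the moment inequality: \<open>a\<close> is the length of a
  vector, \<open>b\<close> that of its perturbation, \<open>y\<close> twice their inner product. The
  linear term is kept exactly because it will vanish on averaging. For a <= 3 p b the crude bound (a
  + b)^(2 p) suffices; otherwise the relative change is of order 1 / p and a second order expansion
  applies.\<close>

lemma power_perturbation_le:
  fixes a b y :: real
  assumes a: "0 \<le> a" and b: "0 \<le> b" and y: "\<bar>y\<bar> \<le> 2 * a * b" and p: "0 < p"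
  shows "(a\<^sup>2 + y + b\<^sup>2) ^ p \<le>
    (a\<^sup>2) ^ p + real p * (a\<^sup>2) ^ (p - 1) * y + 8 * (real p)\<^sup>2 * (a\<^sup>2) ^ (p - 1) * b\<^sup>2
      + (6 * real p) ^ (2 * p) * (b\<^sup>2) ^ p"
proof -
  have p1: "1 \<le> real p" using p by simp
  have nonneg: "0 \<le> a\<^sup>2 + y + b\<^sup>2"
    using y sum_squares_ge_zero [of "a - b" 0] by (auto simp: power2_eq_square algebra_simps abs_le_iff)
  show ?thesis
  proof (cases "a \<le> 3 * real p * b")
    case True
    have "a\<^sup>2 + y + b\<^sup>2 \<le> (a + b)\<^sup>2"
      using y by (simp add: power2_sum abs_le_iff)
    also have "\<dots> \<le> (4 * real p * b)\<^sup>2"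
    proof (intro power_mono)
      have "b \<le> real p * b" using p1 b mult_right_mono [of 1 "real p" b] by simp
      with True show "a + b \<le> 4 * real p * b" by linarith
    qed (use a b in auto)
    finally have "(a\<^sup>2 + y + b\<^sup>2) ^ p \<le> ((4 * real p * b)\<^sup>2) ^ p"
      using nonneg by (intro power_mono) auto
    \<comment> \<open>The linear term may be negative. Moved to the other side it still fits, since
      16 + 9 <= 36.\<close>
    moreover have "- (real p * (a\<^sup>2) ^ (p - 1) * y) \<le> ((3 * real p * b)\<^sup>2) ^ p"
    proof -
      have "- (real p * (a\<^sup>2) ^ (p - 1) * y) \<le> real p * (a\<^sup>2) ^ (p - 1) * \<bar>y\<bar>"
        using abs_ge_minus_self [of "real p * (a\<^sup>2) ^ (p - 1) * y"] by (simp add: abs_mult)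
      also have "\<dots> \<le> real p * (a\<^sup>2) ^ (p - 1) * (2 * a * b)"
        using y by (intro mult_left_mono) auto
      also have "\<dots> \<le> real p * ((3 * real p * b)\<^sup>2) ^ (p - 1) * (2 * (3 * real p * b) * b)"
        using True a b by (intro mult_mono power_mono mult_nonneg_nonneg) auto
      also have "\<dots> = 2/3 * (((3 * real p * b)\<^sup>2) ^ (p - 1) * (3 * real p * b)\<^sup>2)"
        by (simp add: power2_eq_square)
      also have "\<dots> \<le> 1 * (((3 * real p * b)\<^sup>2) ^ (p - 1) * (3 * real p * b)\<^sup>2)"
        by (intro mult_right_mono) auto
      also have "\<dots> = ((3 * real p * b)\<^sup>2) ^ p"
        using p by (cases p) auto
      finally show ?thesis .
    qed
    moreover have "((4 * real p * b)\<^sup>2) ^ p + ((3 * real p * b)\<^sup>2) ^ p \<le> ((6 * real p * b)\<^sup>2) ^ p"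
    proof -
      have "((4 * real p * b)\<^sup>2) ^ p + ((3 * real p * b)\<^sup>2) ^ p \<le> ((4 * real p * b)\<^sup>2 + (3 * real p * b)\<^sup>2) ^ p"
        using p by (intro add_power_le) auto
      also have "\<dots> \<le> ((6 * real p * b)\<^sup>2) ^ p"
        by (intro power_mono) (auto simp: power_mult_distrib)
      finally show ?thesis .
    qed
    moreover have "((6 * real p * b)\<^sup>2) ^ p = (6 * real p) ^ (2 * p) * (b\<^sup>2) ^ p"
      by (simp only: power_mult_distrib power_mult)
    moreover have "0 \<le> 8 * (real p)\<^sup>2 * (a\<^sup>2) ^ (p - 1) * b\<^sup>2" "0 \<le> (a\<^sup>2) ^ p" by auto
    ultimately show ?thesis by linarith
  next
    case False
    then have ab: "3 * real p * b < a" by simp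
    have "0 \<le> 3 * real p * b" using b by simp
    with ab have a0: "0 < a" by linarith
    define t where "t = (y + b\<^sup>2) / a\<^sup>2"
    have b3: "b \<le> a / 3"
      using ab p1 b mult_right_mono [of 1 "real p" b] by simp
    have "b\<^sup>2 \<le> a * b / 3"
      using mult_right_mono [OF b3 b] by (simp add: power2_eq_square)
    moreover have "0 \<le> a * b" "0 \<le> b\<^sup>2" "\<bar>y\<bar> \<le> 2 * (a * b)" using a b y by auto
    ultimately have yz: "\<bar>y + b\<^sup>2\<bar> \<le> 7/3 * (a * b)"
      by linarith
    have "\<bar>real p * t\<bar> = real p * \<bar>y + b\<^sup>2\<bar> / a\<^sup>2"
      by (simp add: t_def abs_mult)
    also have "\<dots> \<le> real p * (7/3 * (a * b)) / a\<^sup>2"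
      using yz by (intro divide_right_mono mult_left_mono) auto
    also have "\<dots> = 7/9 * (3 * real p * b) / a"
      using a0 by (simp add: power2_eq_square)
    also have "\<dots> \<le> 7/9 * a / a"
      using ab a0 by (intro divide_right_mono mult_left_mono) auto
    also have "\<dots> \<le> 1" using a0 by simp
    finally have pt: "real p * t \<le> 1" by linarith
    have at: "a\<^sup>2 * t = y + b\<^sup>2"
      using a0 by (simp add: t_def)
    have sum: "a\<^sup>2 + y + b\<^sup>2 = a\<^sup>2 * (1 + t)"
      by (simp add: distrib_left at)
    have t1: "- 1 \<le> t"
      using nonneg a0 unfolding sum by (simp add: zero_le_mult_iff)
    have "(y + b\<^sup>2)\<^sup>2 \<le> (7/3 * (a * b))\<^sup>2"
      using yz by (metis abs_ge_zero power2_abs power_mono)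
    then have "a\<^sup>2 * (a\<^sup>2 * t\<^sup>2) \<le> a\<^sup>2 * (49/9 * b\<^sup>2)"
      by (simp only: at [symmetric]) (simp add: power2_eq_square mult_ac)
    then have at2: "a\<^sup>2 * t\<^sup>2 \<le> 49/9 * b\<^sup>2"
      using a0 by (simp only: mult_le_cancel_left_pos zero_less_power)
    have "(a\<^sup>2 + y + b\<^sup>2) ^ p = (a\<^sup>2) ^ p * (1 + t) ^ p"
      by (simp add: sum power_mult_distrib)
    also have "\<dots> \<le> (a\<^sup>2) ^ p * (1 + real p * t + (real p)\<^sup>2 * t\<^sup>2)"
      using power_one_plus_le [OF t1 pt] by (intro mult_left_mono) auto
    also have "\<dots> = (a\<^sup>2) ^ p + (a\<^sup>2) ^ (p - 1) * (real p * (a\<^sup>2 * t) + (real p)\<^sup>2 * (a\<^sup>2 * t\<^sup>2))"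
      using p by (cases p) (auto simp: algebra_simps)
    also have "\<dots> \<le> (a\<^sup>2) ^ p + (a\<^sup>2) ^ (p - 1) * (real p * y + 8 * (real p)\<^sup>2 * b\<^sup>2)"
    proof (intro add_left_mono mult_left_mono)
      have "real p * (a\<^sup>2 * t) = real p * y + real p * b\<^sup>2"
        by (simp add: at distrib_left)
      also have "real p * b\<^sup>2 \<le> (real p)\<^sup>2 * b\<^sup>2"
        using p1 by (intro mult_right_mono) (auto simp: power2_eq_square)
      finally have "real p * (a\<^sup>2 * t) \<le> real p * y + (real p)\<^sup>2 * b\<^sup>2" by simp
      moreover have "(real p)\<^sup>2 * (a\<^sup>2 * t\<^sup>2) \<le> (real p)\<^sup>2 * (49/9 * b\<^sup>2)"
        using at2 by (intro mult_left_mono) auto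
      moreover have "0 \<le> (real p)\<^sup>2 * b\<^sup>2" by simp
      ultimately show "real p * (a\<^sup>2 * t) + (real p)\<^sup>2 * (a\<^sup>2 * t\<^sup>2) \<le> real p * y + 8 * (real p)\<^sup>2 * b\<^sup>2"
        by linarith
    qed auto
    also have "\<dots> = (a\<^sup>2) ^ p + real p * (a\<^sup>2) ^ (p - 1) * y + 8 * (real p)\<^sup>2 * (a\<^sup>2) ^ (p - 1) * b\<^sup>2"
      by (simp add: algebra_simps)
    moreover have "0 \<le> (6 * real p) ^ (2 * p) * (b\<^sup>2) ^ p" by simp
    ultimately show ?thesis by linarith
  qed
qed

text \<open>The family \<open>(a k)\<close> is a vector with squared norm \<open>\<Sum>k. c k * (a k)\<^sup>2\<close>, perturbed by the centred
  random vector \<open>X\<close>.\<close>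

lemma vector_Rosenthal:
  fixes X :: "'k \<Rightarrow> 'v \<Rightarrow> real"
  assumes K: "\<And>k. k \<in> K \<Longrightarrow> 0 \<le> c k" and V: "finite V" "V \<noteq> {}"
    and X: "\<And>k. k \<in> K \<Longrightarrow> mean V (X k) = 0" and p: "0 < p"
  shows "mean V (\<lambda>v. (\<Sum>k\<in>K. c k * (a k + X k v)\<^sup>2) ^ p)
    \<le> (\<Sum>k\<in>K. c k * ((a k)\<^sup>2 + 8 * real p * mean V (\<lambda>v. (X k v)\<^sup>2))) ^ p
      + (6 * real p) ^ (2 * p) * mean V (\<lambda>v. (\<Sum>k\<in>K. c k * (X k v)\<^sup>2) ^ p)"
proof -
  define u where "u = (\<Sum>k\<in>K. c k * (a k)\<^sup>2)"
  define y where "y v = 2 * (\<Sum>k\<in>K. c k * (a k * X k v))" for v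
  define z where "z v = (\<Sum>k\<in>K. c k * (X k v)\<^sup>2)" for v
  have u0: "0 \<le> u" unfolding u_def using K by (intro sum_nonneg) auto
  have z0: "0 \<le> z v" for v unfolding z_def using K by (intro sum_nonneg) auto
  have expand: "(\<Sum>k\<in>K. c k * (a k + X k v)\<^sup>2) = u + y v + z v" for v
    by (simp add: u_def y_def z_def power2_sum distrib_left sum.distrib sum_distrib_left mult_ac)
  have y_le: "\<bar>y v\<bar> \<le> 2 * sqrt u * sqrt (z v)" for v
  proof -
    have "(\<Sum>k\<in>K. (sqrt (c k) * a k) * (sqrt (c k) * X k v))\<^sup>2
        \<le> (\<Sum>k\<in>K. (sqrt (c k) * a k)\<^sup>2) * (\<Sum>k\<in>K. (sqrt (c k) * X k v)\<^sup>2)"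
      by (rule Cauchy_Schwarz_ineq_sum)
    moreover have "(\<Sum>k\<in>K. (sqrt (c k) * a k) * (sqrt (c k) * X k v)) = (\<Sum>k\<in>K. c k * (a k * X k v))"
    proof (rule sum.cong [OF refl])
      fix k assume "k \<in> K"
      then have "sqrt (c k) * sqrt (c k) = c k" using K by simp
      moreover have "(sqrt (c k) * a k) * (sqrt (c k) * X k v) = (sqrt (c k) * sqrt (c k)) * (a k * X k v)"
        by (simp only: mult_ac)
      ultimately show "(sqrt (c k) * a k) * (sqrt (c k) * X k v) = c k * (a k * X k v)" by simp
    qed
    moreover have "(\<Sum>k\<in>K. (sqrt (c k) * a k)\<^sup>2) = u" "(\<Sum>k\<in>K. (sqrt (c k) * X k v)\<^sup>2) = z v"
      using K by (auto simp: u_def z_def power_mult_distrib intro!: sum.cong)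
    ultimately have "(\<Sum>k\<in>K. c k * (a k * X k v))\<^sup>2 \<le> u * z v" by simp
    then have "sqrt ((\<Sum>k\<in>K. c k * (a k * X k v))\<^sup>2) \<le> sqrt (u * z v)" by (rule real_sqrt_le_mono)
    then show ?thesis by (simp add: y_def real_sqrt_mult abs_mult)
  qed
  have point: "(u + y v + z v) ^ p \<le> u ^ p + real p * u ^ (p - 1) * y v
      + 8 * (real p)\<^sup>2 * u ^ (p - 1) * z v + (6 * real p) ^ (2 * p) * z v ^ p" for v
    using power_perturbation_le [of "sqrt u" "sqrt (z v)" "y v" p] u0 z0 y_le p by simp
  have my: "mean V y = 0"
    using X by (simp add: y_def mean_cmult mean_sum)
  have "mean V (\<lambda>v. (u + y v + z v) ^ p) \<le> mean V (\<lambda>v. u ^ p + real p * u ^ (p - 1) * y v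
      + 8 * (real p)\<^sup>2 * u ^ (p - 1) * z v + (6 * real p) ^ (2 * p) * z v ^ p)"
    by (rule mean_mono) (rule point)
  also have "\<dots> = u ^ p + real p * u ^ (p - 1) * (8 * real p * mean V z)
      + (6 * real p) ^ (2 * p) * mean V (\<lambda>v. z v ^ p)"
    using V my by (simp add: mean_add mean_cmult mean_const power2_eq_square)
  \<comment> \<open>What is left after averaging starts the binomial expansion of
    \<open>(u + 8 * real p * mean V z) ^ p\<close>; Bernoulli's inequality does the rest.\<close>
  also have "u ^ p + real p * u ^ (p - 1) * (8 * real p * mean V z) \<le> (u + 8 * real p * mean V z) ^ p"
  proof (cases "u = 0")
    case True
    have "0 \<le> mean V z" using z0 by (intro mean_nonneg)
    then have "0 \<le> (8 * real p * mean V z) ^ p" by simp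
    show ?thesis
    proof (cases "p = 1")
      case False
      then have "0 < p - 1" using p by simp
      with True \<open>0 \<le> (8 * real p * mean V z) ^ p\<close> p show ?thesis by (simp add: zero_power)
    qed (simp add: True)
  next
    case False
    define w where "w = 8 * real p * mean V z"
    have w0: "0 \<le> w" unfolding w_def using z0 by (intro mult_nonneg_nonneg mean_nonneg) auto
    have "1 + real p * (w / u) \<le> (1 + w / u) ^ p"
      using w0 u0 by (intro Bernoulli_inequality) (auto intro: order_trans [of _ 0])
    then have "u ^ p * (1 + real p * (w / u)) \<le> u ^ p * (1 + w / u) ^ p"
      using u0 by (intro mult_left_mono) auto
    also have "\<dots> = (u + w) ^ p"
      using False by (simp add: power_mult_distrib [symmetric] distrib_left)
    also have "u ^ p * (1 + real p * (w / u)) = u ^ p + real p * u ^ (p - 1) * w"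
      using False p by (cases p) (auto simp: field_simps)
    finally show ?thesis by (simp add: w_def)
  qed
  finally have "mean V (\<lambda>v. (u + y v + z v) ^ p)
      \<le> (u + 8 * real p * mean V z) ^ p + (6 * real p) ^ (2 * p) * mean V (\<lambda>v. z v ^ p)" by simp
  moreover have "u + 8 * real p * mean V z = (\<Sum>k\<in>K. c k * ((a k)\<^sup>2 + 8 * real p * mean V (\<lambda>v. (X k v)\<^sup>2)))"
    by (simp add: u_def z_def [abs_def] mean_sum mean_cmult distrib_left sum.distrib sum_distrib_left mult_ac)
  ultimately show ?thesis
    by (simp only: expand z_def)
qed

section \<open>Finite product spaces\<close>

definition mix :: "'i set \<Rightarrow> ('i \<Rightarrow> 'x) \<Rightarrow> ('i \<Rightarrow> 'x) \<Rightarrow> 'i \<Rightarrow> 'x" where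
  "mix A f g = (\<lambda>i. if i \<in> A then f i else g i)"

lemma mix_empty [simp]: "mix {} f g = g"
  by (simp add: mix_def)

lemma mix_apply: "mix A f g i = (if i \<in> A then f i else g i)"
  by (simp add: mix_def)

lemma sum_Pow_insert:
  assumes "finite A" "i \<notin> A"
  shows "(\<Sum>D\<in>Pow (insert i A). g D) = (\<Sum>D\<in>Pow A. g D) + (\<Sum>D\<in>Pow A. g (insert i D))"
proof -
  have "inj_on (insert i) (Pow A)"
    using assms(2) by (auto simp: inj_on_def)
  then show ?thesis
    using assms unfolding Pow_insert
    by (subst sum.union_disjoint) (auto simp: sum.reindex)
qed

locale finite_product =
  fixes I :: "'i set" and X :: "'x set"
  assumes finite_I: "finite I" and finite_X: "finite X" and X_nonempty: "X \<noteq> {}"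
begin

definition Om :: "('i \<Rightarrow> 'x) set" where
  "Om = (\<Pi>\<^sub>E i\<in>I. X)"

lemma finite_Om: "finite Om"
  unfolding Om_def using finite_I finite_X by (intro finite_PiE)

lemma Om_nonempty: "Om \<noteq> {}"
  unfolding Om_def using X_nonempty by (simp add: PiE_eq_empty_iff)

lemma mean_Om_const [simp]: "mean Om (\<lambda>_. c) = c"
  by (simp add: mean_const finite_Om Om_nonempty)

lemma mix_in_Om: "\<phi> \<in> Om \<Longrightarrow> w \<in> Om \<Longrightarrow> mix A \<phi> w \<in> Om"
  by (auto simp: Om_def mix_def PiE_iff extensional_def)

lemma upd_in_Om: "\<phi> \<in> Om \<Longrightarrow> i \<in> I \<Longrightarrow> v \<in> X \<Longrightarrow> \<phi>(i := v) \<in> Om"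
  by (auto simp: Om_def PiE_iff extensional_def)

text \<open>Two independent uniform points remain independent and uniform when they exchange their
  coordinates outside \<open>A\<close>.\<close>

lemma mean_mix: "mean Om (\<lambda>\<phi>. mean Om (\<lambda>w. H (mix A \<phi> w))) = mean Om H"
proof -
  define h where "h p = (mix A (fst p) (snd p), mix A (snd p) (fst p))" for p :: "('i \<Rightarrow> 'x) \<times> ('i \<Rightarrow> 'x)"
  have hh: "h (h p) = p" for p by (cases p) (auto simp: h_def mix_def fun_eq_iff)
  have "h p \<in> Om \<times> Om" if "p \<in> Om \<times> Om" for p
    using that by (auto simp: h_def intro!: mix_in_Om)
  then have bij: "bij_betw h (Om \<times> Om) (Om \<times> Om)"
    using hh by (intro bij_betw_byWitness [where f' = h]) blast+
  have "mean Om (\<lambda>\<phi>. mean Om (\<lambda>w. H (mix A \<phi> w))) = mean (Om \<times> Om) (\<lambda>p. H (fst (h p)))"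
    by (simp add: mean_Times h_def)
  also have "\<dots> = mean (Om \<times> Om) (\<lambda>p. H (fst p))"
    by (rule mean_bij [OF bij])
  also have "\<dots> = mean Om H" by (simp add: mean_Times)
  finally show ?thesis .
qed

lemma mean_coordinate:
  assumes "i \<in> I"
  shows "mean Om (\<lambda>w. g (w i)) = mean X g"
proof -
  define J where "J = I - {i}"
  have Om: "Om = (\<lambda>(y, h). h(i := y)) ` (X \<times> (\<Pi>\<^sub>E i\<in>J. X))"
    using assms PiE_insert_eq [of i J "\<lambda>_. X"] by (simp add: Om_def J_def insert_absorb)
  have "inj_on (\<lambda>(y, h). h(i := y)) (X \<times> (\<Pi>\<^sub>E i\<in>J. X))"
    using inj_combinator [of i J "\<lambda>_. X"] by (simp add: J_def)
  then have "bij_betw (\<lambda>(y, h). h(i := y)) (X \<times> (\<Pi>\<^sub>E i\<in>J. X)) Om"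
    unfolding Om by (rule inj_on_imp_bij_betw)
  from mean_bij [OF this, of "\<lambda>w. g (w i)"]
  have "mean Om (\<lambda>w. g (w i)) = mean (X \<times> (\<Pi>\<^sub>E i\<in>J. X)) (\<lambda>p. g (fst p))"
    by (simp add: case_prod_beta cong: mean_cong)
  also have "\<dots> = mean X g"
    using finite_I finite_X X_nonempty
    by (simp add: mean_Times mean_const finite_PiE J_def PiE_eq_empty_iff)
  finally show ?thesis .
qed

lemma mean_upd:
  assumes "i \<in> I"
  shows "mean Om (\<lambda>\<phi>. mean X (\<lambda>v. H (\<phi>(i := v)))) = mean Om H"
proof -
  have "mean Om (\<lambda>\<phi>. mean X (\<lambda>v. H (\<phi>(i := v)))) = mean Om (\<lambda>\<phi>. mean Om (\<lambda>w. H (mix {i} w \<phi>)))"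
  proof (rule mean_cong [OF refl], unfold simp_implies_def)
    fix \<phi> :: "'i \<Rightarrow> 'x"
    have "mix {i} w \<phi> = \<phi>(i := w i)" for w by (rule ext) (simp add: mix_def)
    then show "mean X (\<lambda>v. H (\<phi>(i := v))) = mean Om (\<lambda>w. H (mix {i} w \<phi>))"
      using mean_coordinate [OF assms, of "\<lambda>v. H (\<phi>(i := v))"] by simp
  qed
  also have "\<dots> = mean Om H"
    by (subst mean_swap) (rule mean_mix)
  finally show ?thesis .
qed

text \<open>Interpolates between the trivial case of empty \<open>J\<close> and the full inequality.
  The coordinates in \<open>J\<close> have been treated one at a time by
  \<open>vector_Rosenthal\<close>, whose two terms offer a choice: a coordinate either joins
  \<open>S\<close> and stays outside the p-th power at the price
  \<open>(6 * real p) ^ (2 * p)\<close>, or it is averaged inside the square, with weight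
  \<open>8 * real p\<close> if the component depends on it, that is, if it joins
  \<open>T\<close>.\<close>

lemma product_Rosenthal_partial:
  assumes dep: "\<And>D \<phi> \<psi>. D \<subseteq> I \<Longrightarrow> \<phi> \<in> Om \<Longrightarrow> \<psi> \<in> Om \<Longrightarrow> (\<And>i. i \<in> D \<Longrightarrow> \<phi> i = \<psi> i) \<Longrightarrow> f D \<phi> = f D \<psi>"
    and cent: "\<And>D i \<phi>. D \<subseteq> I \<Longrightarrow> i \<in> D \<Longrightarrow> \<phi> \<in> Om \<Longrightarrow> mean X (\<lambda>v. f D (\<phi>(i := v))) = 0"
    and p: "0 < p" and J: "J \<subseteq> I"
  shows "mean Om (\<lambda>\<phi>. (\<Sum>D\<in>Pow I. f D \<phi>) ^ (2 * p)) \<le>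
    (\<Sum>S\<in>Pow J. (6 * real p) ^ (2 * p * card S) * mean Om (\<lambda>\<phi>.
      (\<Sum>T\<in>Pow (J - S). (8 * real p) ^ card T *
        mean Om (\<lambda>w. (\<Sum>D\<in>Pow (I - J). f (D \<union> S \<union> T) (mix (J - S) w \<phi>))\<^sup>2)) ^ p))"
  using finite_subset [OF J finite_I] J
proof (induction J rule: finite_induct)
  case empty
  show ?case by (simp add: power_mult)
next
  case (insert i J)
  define I' where "I' = I - insert i J"
  have iI: "i \<in> I" and JI: "J \<subseteq> I" and iJ: "i \<notin> J" and finJ: "finite J" using insert by auto
  have I': "I - J = insert i I'" "i \<notin> I'" "finite I'" "I' \<subseteq> I"
    using iI iJ finite_I by (auto simp: I'_def)
  define old where "old S \<phi> = (\<Sum>T\<in>Pow (J - S). (8 * real p) ^ card T *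
        mean Om (\<lambda>w. (\<Sum>D\<in>Pow (I - J). f (D \<union> S \<union> T) (mix (J - S) w \<phi>))\<^sup>2)) ^ p" for S \<phi>
  define new where "new S \<phi> = (\<Sum>T\<in>Pow (insert i J - S). (8 * real p) ^ card T *
        mean Om (\<lambda>w. (\<Sum>D\<in>Pow I'. f (D \<union> S \<union> T) (mix (insert i J - S) w \<phi>))\<^sup>2)) ^ p" for S \<phi>
  have step: "mean Om (old S) \<le> mean Om (new S) + (6 * real p) ^ (2 * p) * mean Om (new (insert i S))"
    if S: "S \<subseteq> J" for S
  proof -
    \<comment> \<open>Split off the coordinate \<open>i\<close>: \<open>a\<close> collects the
      components whose set avoids \<open>i\<close>, \<open>Y\<close> those whose set contains it.
      Both are vectors indexed by pairs \<open>(T, w)\<close>, with weights \<open>c\<close> that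
      reproduce the sum over \<open>T\<close> and the mean over \<open>w\<close>.\<close>
    define a where "a \<phi> k = (\<Sum>D\<in>Pow I'. f (D \<union> S \<union> fst k) (mix (J - S) (snd k) \<phi>))" for \<phi> k
    define Y where "Y \<phi> k v = (\<Sum>D\<in>Pow I'. f (insert i (D \<union> S \<union> fst k)) (mix (J - S) (snd k) (\<phi>(i := v))))" for \<phi> k v
    define K where "K = Pow (J - S) \<times> Om"
    define c where "c k = (8 * real p) ^ card (fst k) / real (card Om)" for k :: "'i set \<times> ('i \<Rightarrow> 'x)"
    have sumK: "(\<Sum>k\<in>K. c k * g (fst k) (snd k)) = (\<Sum>T\<in>Pow (J - S). (8 * real p) ^ card T * mean Om (g T))" for g
      unfolding K_def c_def mean_def
      by (simp add: sum.cartesian_product' sum_distrib_left sum_divide_distrib)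
    have mixupd: "mix (J - S) w (\<phi>(i := v)) = (mix (J - S) w \<phi>)(i := v)" for w \<phi> v
      by (rule ext) (use iJ in \<open>auto simp: mix_def\<close>)
    have mixupd': "(mix (J - S) w \<phi>)(i := v) = mix (insert i (J - S)) (w(i := v)) \<phi>" for w \<phi> v
      by (rule ext) (use iJ in \<open>auto simp: mix_def\<close>)
    have split: "(\<Sum>D\<in>Pow (I - J). f (D \<union> S \<union> T) (mix (J - S) w (\<phi>(i := v)))) = a \<phi> (T, w) + Y \<phi> (T, w) v"
      if "T \<subseteq> J - S" "w \<in> Om" "\<phi> \<in> Om" "v \<in> X" for T w \<phi> v
    proof -
      have "f (D \<union> S \<union> T) (mix (J - S) w (\<phi>(i := v))) = f (D \<union> S \<union> T) (mix (J - S) w \<phi>)" if "D \<in> Pow I'" for D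
      proof (rule dep)
        show "D \<union> S \<union> T \<subseteq> I" using that \<open>T \<subseteq> J - S\<close> S JI I'(4) by blast
        fix j assume "j \<in> D \<union> S \<union> T"
        then have "j \<noteq> i" using that \<open>T \<subseteq> J - S\<close> S iJ I'(2) by blast
        then show "mix (J - S) w (\<phi>(i := v)) j = mix (J - S) w \<phi> j" by (simp add: mix_def)
      qed (use \<open>w \<in> Om\<close> \<open>\<phi> \<in> Om\<close> \<open>v \<in> X\<close> iI in \<open>auto intro!: mix_in_Om upd_in_Om\<close>)
      then have "(\<Sum>D\<in>Pow I'. f (D \<union> S \<union> T) (mix (J - S) w (\<phi>(i := v)))) = a \<phi> (T, w)"
        unfolding a_def by (intro sum.cong) simp_all
      then show ?thesis
        unfolding I'(1) sum_Pow_insert [OF I'(3,2)] by (simp add: Y_def)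
    qed
    have one: "mean X (\<lambda>v. old S (\<phi>(i := v))) \<le> new S \<phi>
        + (6 * real p) ^ (2 * p) * mean X (\<lambda>v. new (insert i S) (\<phi>(i := v)))" if \<phi>: "\<phi> \<in> Om" for \<phi>
    proof -
      have eq1: "mean X (\<lambda>v. old S (\<phi>(i := v))) = mean X (\<lambda>v. (\<Sum>k\<in>K. c k * (a \<phi> k + Y \<phi> k v)\<^sup>2) ^ p)"
      proof (rule mean_cong [OF refl], unfold simp_implies_def)
        fix v assume v: "v \<in> X"
        have "old S (\<phi>(i := v)) = (\<Sum>T\<in>Pow (J - S). (8 * real p) ^ card T *
            mean Om (\<lambda>w. (a \<phi> (T, w) + Y \<phi> (T, w) v)\<^sup>2)) ^ p"
          unfolding old_def using split \<phi> v by (simp cong: sum.cong_simp)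
        then show "old S (\<phi>(i := v)) = (\<Sum>k\<in>K. c k * (a \<phi> k + Y \<phi> k v)\<^sup>2) ^ p"
          using sumK [of "\<lambda>T w. (a \<phi> (T, w) + Y \<phi> (T, w) v)\<^sup>2"] by simp
      qed
      have eq3: "(\<Sum>k\<in>K. c k * (Y \<phi> k v)\<^sup>2) ^ p = new (insert i S) (\<phi>(i := v))" for v
      proof -
        have ii: "insert i J - insert i S = J - S" using iJ by auto
        show ?thesis
          using sumK [of "\<lambda>T w. (Y \<phi> (T, w) v)\<^sup>2"] unfolding new_def ii Y_def by simp
      qed
      have eq2: "(\<Sum>k\<in>K. c k * ((a \<phi> k)\<^sup>2 + 8 * real p * mean X (\<lambda>v. (Y \<phi> k v)\<^sup>2))) ^ p = new S \<phi>"
      proof -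
        have ii: "insert i J - S = insert i (J - S)" "i \<notin> J - S" using S iJ by auto
        have A: "mean Om (\<lambda>w. (a \<phi> (T, w))\<^sup>2) =
            mean Om (\<lambda>w. (\<Sum>D\<in>Pow I'. f (D \<union> S \<union> T) (mix (insert i (J - S)) w \<phi>))\<^sup>2)"
          if T: "T \<in> Pow (J - S)" for T
        proof -
          have "f (D \<union> S \<union> T) (mix (J - S) w \<phi>) = f (D \<union> S \<union> T) (mix (insert i (J - S)) w \<phi>)"
            if "D \<in> Pow I'" "w \<in> Om" for D w
          proof (rule dep)
            show "D \<union> S \<union> T \<subseteq> I" using that T S JI I'(4) by blast
            fix j assume "j \<in> D \<union> S \<union> T"
            then have "j \<noteq> i" using that T S iJ I'(2) by blast
            then show "mix (J - S) w \<phi> j = mix (insert i (J - S)) w \<phi> j" by (simp add: mix_def)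
          qed (use \<open>w \<in> Om\<close> \<phi> in \<open>auto intro!: mix_in_Om\<close>)
          then show ?thesis by (simp add: a_def cong: sum.cong_simp)
        qed
        \<comment> \<open>Averaging the squared perturbation over the new coordinate is what adds
          \<open>i\<close> to \<open>T\<close>; the factor \<open>8 * real p\<close> turns into the
          weight of the larger set.\<close>
        have B: "mean Om (\<lambda>w. mean X (\<lambda>v. (Y \<phi> (T, w) v)\<^sup>2)) =
            mean Om (\<lambda>w. (\<Sum>D\<in>Pow I'. f (D \<union> S \<union> insert i T) (mix (insert i (J - S)) w \<phi>))\<^sup>2)" for T
          using mean_upd [OF iI, of "\<lambda>w. (\<Sum>D\<in>Pow I'. f (D \<union> S \<union> insert i T) (mix (insert i (J - S)) w \<phi>))\<^sup>2"]
          by (simp add: Y_def mixupd mixupd')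
        have "(\<Sum>k\<in>K. c k * ((a \<phi> k)\<^sup>2 + 8 * real p * mean X (\<lambda>v. (Y \<phi> k v)\<^sup>2)))
          = (\<Sum>T\<in>Pow (J - S). (8 * real p) ^ card T * mean Om (\<lambda>w. (a \<phi> (T, w))\<^sup>2)) +
            (\<Sum>T\<in>Pow (J - S). (8 * real p) ^ card T * (8 * real p * mean Om (\<lambda>w. mean X (\<lambda>v. (Y \<phi> (T, w) v)\<^sup>2))))"
          using sumK [of "\<lambda>T w. (a \<phi> (T, w))\<^sup>2 + 8 * real p * mean X (\<lambda>v. (Y \<phi> (T, w) v)\<^sup>2)"]
          by (simp add: mean_add mean_cmult distrib_left sum.distrib)
        also have "\<dots> = (\<Sum>T\<in>Pow (insert i (J - S)). (8 * real p) ^ card T *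
            mean Om (\<lambda>w. (\<Sum>D\<in>Pow I'. f (D \<union> S \<union> T) (mix (insert i (J - S)) w \<phi>))\<^sup>2))"
        proof -
          have "card (insert i T) = Suc (card T)" if "T \<in> Pow (J - S)" for T
            using that iJ finJ finite_subset [of T J] by (subst card_insert_disjoint) auto
          then show ?thesis
            using ii finJ by (simp add: sum_Pow_insert A B mult.assoc mult.left_commute cong: sum.cong_simp)
        qed
        finally show ?thesis by (simp add: new_def ii)
      qed
      have "mean X (\<lambda>v. (\<Sum>k\<in>K. c k * (a \<phi> k + Y \<phi> k v)\<^sup>2) ^ p)
        \<le> (\<Sum>k\<in>K. c k * ((a \<phi> k)\<^sup>2 + 8 * real p * mean X (\<lambda>v. (Y \<phi> k v)\<^sup>2))) ^ p
          + (6 * real p) ^ (2 * p) * mean X (\<lambda>v. (\<Sum>k\<in>K. c k * (Y \<phi> k v)\<^sup>2) ^ p)"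
      proof (rule vector_Rosenthal [OF _ finite_X X_nonempty _ p])
        fix k assume "k \<in> K"
        show "0 \<le> c k" by (simp add: c_def)
        have "mean X (\<lambda>v. f (insert i (D \<union> S \<union> fst k)) ((mix (J - S) (snd k) \<phi>)(i := v))) = 0" if "D \<in> Pow I'" for D
          using \<open>k \<in> K\<close> that S JI iI I'(4) \<phi> by (intro cent) (auto simp: K_def intro!: mix_in_Om)
        then show "mean X (Y \<phi> k) = 0"
          by (simp add: Y_def mixupd mean_sum)
      qed
      then show ?thesis by (simp add: eq1 eq2 eq3)
    qed
    have "mean Om (old S) = mean Om (\<lambda>\<phi>. mean X (\<lambda>v. old S (\<phi>(i := v))))"
      by (rule mean_upd [OF iI, symmetric])
    also have "\<dots> \<le> mean Om (\<lambda>\<phi>. new S \<phi>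
        + (6 * real p) ^ (2 * p) * mean X (\<lambda>v. new (insert i S) (\<phi>(i := v))))"
      by (rule mean_mono) (rule one)
    also have "\<dots> = mean Om (new S) + (6 * real p) ^ (2 * p) * mean Om (new (insert i S))"
      by (simp add: mean_add mean_cmult mean_upd [OF iI])
    finally show ?thesis .
  qed
  have "mean Om (\<lambda>\<phi>. (\<Sum>D\<in>Pow I. f D \<phi>) ^ (2 * p)) \<le>
      (\<Sum>S\<in>Pow J. (6 * real p) ^ (2 * p * card S) * mean Om (old S))"
    using insert.IH [OF JI] by (simp add: old_def [abs_def])
  also have "\<dots> \<le> (\<Sum>S\<in>Pow J. (6 * real p) ^ (2 * p * card S) *
      (mean Om (new S) + (6 * real p) ^ (2 * p) * mean Om (new (insert i S))))"
    using step by (intro sum_mono mult_left_mono) auto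
  also have "\<dots> = (\<Sum>S\<in>Pow (insert i J). (6 * real p) ^ (2 * p * card S) * mean Om (new S))"
  proof -
    have "card (insert i S) = Suc (card S)" if "S \<in> Pow J" for S
      using that iJ finJ finite_subset [of S J] by (subst card_insert_disjoint) auto
    then show ?thesis
      using iJ finJ by (simp add: sum_Pow_insert distrib_left sum.distrib power_add mult_ac cong: sum.cong_simp)
  qed
  finally show ?case by (simp add: new_def [abs_def] I'_def)
qed

text \<open>All coordinates have been treated, so the inner sum over \<open>D\<close> retains only
  the empty set.\<close>

lemma product_Rosenthal:
  assumes "\<And>D \<phi> \<psi>. D \<subseteq> I \<Longrightarrow> \<phi> \<in> Om \<Longrightarrow> \<psi> \<in> Om \<Longrightarrow> (\<And>i. i \<in> D \<Longrightarrow> \<phi> i = \<psi> i) \<Longrightarrow> f D \<phi> = f D \<psi>"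
    and "\<And>D i \<phi>. D \<subseteq> I \<Longrightarrow> i \<in> D \<Longrightarrow> \<phi> \<in> Om \<Longrightarrow> mean X (\<lambda>v. f D (\<phi>(i := v))) = 0"
    and "0 < p"
  shows "mean Om (\<lambda>\<phi>. (\<Sum>D\<in>Pow I. f D \<phi>) ^ (2 * p)) \<le>
    (\<Sum>S\<in>Pow I. (6 * real p) ^ (2 * p * card S) * mean Om (\<lambda>\<phi>.
      (\<Sum>T\<in>Pow (I - S). (8 * real p) ^ card T *
        mean Om (\<lambda>w. (f (S \<union> T) (mix (I - S) w \<phi>))\<^sup>2)) ^ p))"
proof -
  have single: "(\<Sum>D\<in>{{}}. g D) = g {}" for g :: "'i set \<Rightarrow> real" by simp
  show ?thesis
    using product_Rosenthal_partial [where f = f and J = I, OF assms subset_refl]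
    unfolding Diff_cancel Pow_empty single Un_empty_left .
qed

end

section \<open>Signed sums over subsets and the Efron-Stein decomposition\<close>

lemma sum_Pow_signs_Un:
  fixes g :: "'a set \<Rightarrow> real"
  assumes "finite S" "finite T" "S \<inter> T = {}"
  shows "(\<Sum>D\<in>Pow (S \<union> T). (- 1) ^ card (S \<union> T - D) * g D)
    = (\<Sum>S'\<in>Pow S. (- 1) ^ card (S - S') * (\<Sum>T'\<in>Pow T. (- 1) ^ card (T - T') * g (S' \<union> T')))"
proof -
  have bij: "bij_betw (\<lambda>(A, B). A \<union> B) (Pow S \<times> Pow T) (Pow (S \<union> T))"
    using assms(3) by (intro bij_betw_byWitness [where f' = "\<lambda>D. (D \<inter> S, D \<inter> T)"]) auto
  have "(\<Sum>D\<in>Pow (S \<union> T). (- 1) ^ card (S \<union> T - D) * g D)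
    = (\<Sum>p\<in>Pow S \<times> Pow T. (- 1) ^ card (S \<union> T - (fst p \<union> snd p)) * g (fst p \<union> snd p))"
    by (subst sum.reindex_bij_betw [OF bij, symmetric]) (simp add: case_prod_beta)
  also have "\<dots> = (\<Sum>p\<in>Pow S \<times> Pow T. (- 1) ^ card (S - fst p) * ((- 1) ^ card (T - snd p) * g (fst p \<union> snd p)))"
  proof (rule sum.cong [OF refl])
    fix p assume "p \<in> Pow S \<times> Pow T"
    then have "S \<union> T - (fst p \<union> snd p) = (S - fst p) \<union> (T - snd p)" "(S - fst p) \<inter> (T - snd p) = {}"
      using assms(3) by auto
    then have "card (S \<union> T - (fst p \<union> snd p)) = card (S - fst p) + card (T - snd p)"
      using assms(1,2) by (simp add: card_Un_disjoint)
    then show "(- 1) ^ card (S \<union> T - (fst p \<union> snd p)) * g (fst p \<union> snd p)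
      = (- 1) ^ card (S - fst p) * ((- 1) ^ card (T - snd p) * g (fst p \<union> snd p))"
      by (simp add: power_add)
  qed
  finally show ?thesis
    by (simp add: sum.cartesian_product' sum_distrib_left)
qed

text \<open>The terms of \<open>T\<close> and \<open>insert i T\<close> cancel.\<close>

lemma sum_Pow_signs:
  fixes g :: "'a set \<Rightarrow> real"
  assumes "finite D" "i \<in> D" "\<And>T. T \<subseteq> D - {i} \<Longrightarrow> g (insert i T) = g T"
  shows "(\<Sum>T\<in>Pow D. (- 1) ^ card (D - T) * g T) = 0"
proof -
  define D' where "D' = D - {i}"
  have D: "D = insert i D'" "i \<notin> D'" "finite D'" using assms by (auto simp: D'_def)
  have "(- 1) ^ card (insert i D' - T) * g T = - ((- 1) ^ card (insert i D' - insert i T) * g (insert i T))"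
    if "T \<in> Pow D'" for T
  proof -
    have "insert i D' - T = insert i (D' - T)" "insert i D' - insert i T = D' - T"
      using D(2) that by auto
    moreover have "card (insert i (D' - T)) = Suc (card (D' - T))" using D by simp
    moreover have "g (insert i T) = g T" using assms(3) that by (simp add: D'_def)
    ultimately show ?thesis by simp
  qed
  then have "(\<Sum>T\<in>Pow D'. (- 1) ^ card (insert i D' - T) * g T) =
      (\<Sum>T\<in>Pow D'. - ((- 1) ^ card (insert i D' - insert i T) * g (insert i T)))"
    by (rule sum.cong [OF refl])
  then show ?thesis
    unfolding D(1) sum_Pow_insert [OF D(3,2)] sum_negf by simp
qed

context finite_product
begin

text \<open>The conditional expectation given the coordinates in \<open>T\<close>, obtained by
  resampling the others.\<close>

definition cavg :: "'i set \<Rightarrow> (('i \<Rightarrow> 'x) \<Rightarrow> real) \<Rightarrow> ('i \<Rightarrow> 'x) \<Rightarrow> real" where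
  "cavg T F \<phi> = mean Om (\<lambda>w. F (mix T \<phi> w))"

text \<open>The Efron--Stein (Hoeffding) component of \<open>F\<close> on the coordinate set \<open>D\<close>.\<close>

definition pure_part :: "'i set \<Rightarrow> (('i \<Rightarrow> 'x) \<Rightarrow> real) \<Rightarrow> ('i \<Rightarrow> 'x) \<Rightarrow> real" where
  "pure_part D F \<phi> = (\<Sum>T\<in>Pow D. (- 1) ^ card (D - T) * cavg T F \<phi>)"

definition level_weight :: "nat \<Rightarrow> (('i \<Rightarrow> 'x) \<Rightarrow> real) \<Rightarrow> real" where
  "level_weight d F = (\<Sum>D\<in>{D. D \<subseteq> I \<and> card D = d}. mean Om (\<lambda>\<phi>. (pure_part D F \<phi>)\<^sup>2))"

lemma cavg_dep: "(\<And>i. i \<in> T \<Longrightarrow> \<phi> i = \<psi> i) \<Longrightarrow> cavg T F \<phi> = cavg T F \<psi>"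
proof -
  assume "\<And>i. i \<in> T \<Longrightarrow> \<phi> i = \<psi> i"
  then have "mix T \<phi> w = mix T \<psi> w" for w by (auto simp: mix_def)
  then show ?thesis by (simp add: cavg_def)
qed

lemma pure_part_dep: "(\<And>i. i \<in> D \<Longrightarrow> \<phi> i = \<psi> i) \<Longrightarrow> pure_part D F \<phi> = pure_part D F \<psi>"
  unfolding pure_part_def by (intro sum.cong refl arg_cong2 [where f = "(*)"] cavg_dep) auto

lemma mean_cavg_upd:
  assumes "i \<in> I" "i \<notin> T"
  shows "mean X (\<lambda>v. cavg (insert i T) F (\<phi>(i := v))) = cavg T F \<phi>"
proof -
  have "mix (insert i T) (\<phi>(i := v)) w = (mix T \<phi> w)(i := v)" for v w
    by (rule ext) (auto simp: mix_def)
  moreover have "(mix T \<phi> w)(i := v) = mix T \<phi> (w(i := v))" for v w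
    by (rule ext) (use assms in \<open>auto simp: mix_def\<close>)
  ultimately have "mean X (\<lambda>v. cavg (insert i T) F (\<phi>(i := v)))
      = mean Om (\<lambda>w. mean X (\<lambda>v. F (mix T \<phi> (w(i := v)))))"
    by (simp add: cavg_def mean_swap [of X])
  also have "\<dots> = cavg T F \<phi>"
    unfolding cavg_def by (rule mean_upd [OF assms(1)])
  finally show ?thesis .
qed

lemma mean_pure_part_upd:
  assumes "D \<subseteq> I" "i \<in> D"
  shows "mean X (\<lambda>v. pure_part D F (\<phi>(i := v))) = 0"
proof -
  have iI: "i \<in> I" and fin: "finite D" using assms finite_I finite_subset by auto
  have "mean X (\<lambda>v. pure_part D F (\<phi>(i := v))) =
      (\<Sum>T\<in>Pow D. (- 1) ^ card (D - T) * mean X (\<lambda>v. cavg T F (\<phi>(i := v))))"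
    by (simp add: pure_part_def mean_sum mean_cmult)
  also have "\<dots> = 0"
  proof (rule sum_Pow_signs [OF fin assms(2)])
    fix T assume T: "T \<subseteq> D - {i}"
    then have "cavg T F (\<phi>(i := v)) = cavg T F \<phi>" for v by (intro cavg_dep) auto
    then show "mean X (\<lambda>v. cavg (insert i T) F (\<phi>(i := v))) = mean X (\<lambda>v. cavg T F (\<phi>(i := v)))"
      using mean_cavg_upd [OF iI, of T F \<phi>] T finite_X X_nonempty by (auto simp: mean_const)
  qed
  finally show ?thesis .
qed

text \<open>Conditional expectation is an orthogonal projection: both sides equal the mean of
  \<open>cavg T F \<phi> * cavg T g \<phi>\<close>.\<close>

lemma mean_cavg_mult: "mean Om (\<lambda>\<phi>. cavg T F \<phi> * g \<phi>) = mean Om (\<lambda>\<phi>. F \<phi> * cavg T g \<phi>)"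
proof -
  have "mean Om (\<lambda>\<phi>. cavg T F \<phi> * g \<phi>) = mean Om (\<lambda>\<phi>. cavg T F \<phi> * cavg T g \<phi>)" for F g
  proof -
    have "cavg T F (mix T \<phi> w) = cavg T F \<phi>" for \<phi> w by (rule cavg_dep) (simp add: mix_def)
    then have "mean Om (\<lambda>\<phi>. mean Om (\<lambda>w. cavg T F (mix T \<phi> w) * g (mix T \<phi> w))) = mean Om (\<lambda>\<phi>. cavg T F \<phi> * cavg T g \<phi>)"
      by (simp add: mean_cmult cavg_def [of T g])
    then show ?thesis by (simp add: mean_mix [of "\<lambda>\<phi>. cavg T F \<phi> * g \<phi>"])
  qed
  from this [of F g] this [of g F] show ?thesis by (simp add: mult.commute)
qed

text \<open>A function centred in each coordinate of \<open>D\<close> is orthogonal to every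
  function that ignores one of these coordinates, so only the term \<open>T = D\<close> of the
  alternating sum survives.\<close>

lemma mean_mult_pure:
  assumes D: "D \<subseteq> I"
    and dep: "\<And>\<phi> \<psi>. \<phi> \<in> Om \<Longrightarrow> \<psi> \<in> Om \<Longrightarrow> (\<And>i. i \<in> D \<Longrightarrow> \<phi> i = \<psi> i) \<Longrightarrow> g \<phi> = g \<psi>"
    and cent: "\<And>i \<phi>. i \<in> D \<Longrightarrow> \<phi> \<in> Om \<Longrightarrow> mean X (\<lambda>v. g (\<phi>(i := v))) = 0"
  shows "mean Om (\<lambda>\<phi>. F \<phi> * g \<phi>) = mean Om (\<lambda>\<phi>. pure_part D F \<phi> * g \<phi>)"
proof -
  have fin: "finite D" using D finite_I finite_subset by auto
  have proper: "mean Om (\<lambda>\<phi>. cavg T F \<phi> * g \<phi>) = 0" if "T \<in> Pow D - {D}" for T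
  proof -
    obtain i where i: "i \<in> D" "i \<notin> T" using \<open>T \<in> Pow D - {D}\<close> by auto
    have "cavg T g \<phi> = 0" if "\<phi> \<in> Om" for \<phi>
    proof -
      have "cavg T g \<phi> = mean Om (\<lambda>w. mean X (\<lambda>v. g (mix T \<phi> (w(i := v)))))"
        unfolding cavg_def using i D by (intro mean_upd [symmetric]) auto
      also have "\<dots> = mean Om (\<lambda>w. mean X (\<lambda>v. g ((mix T \<phi> w)(i := v))))"
      proof -
        have "mix T \<phi> (w(i := v)) = (mix T \<phi> w)(i := v)" for w v
          by (rule ext) (use i in \<open>auto simp: mix_def\<close>)
        then show ?thesis by simp
      qed
      also have "\<dots> = mean Om (\<lambda>w. 0)"
        by (rule mean_cong) (use i that in \<open>auto simp: simp_implies_def intro!: cent mix_in_Om\<close>)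
      finally show ?thesis by simp
    qed
    then show ?thesis by (simp add: mean_cavg_mult)
  qed
  have whole: "mean Om (\<lambda>\<phi>. cavg D F \<phi> * g \<phi>) = mean Om (\<lambda>\<phi>. F \<phi> * g \<phi>)"
  proof -
    have "cavg D g \<phi> = mean Om (\<lambda>w. g \<phi>)" if "\<phi> \<in> Om" for \<phi>
      unfolding cavg_def
      by (rule mean_cong) (use that in \<open>auto simp: simp_implies_def mix_apply intro!: dep mix_in_Om\<close>)
    then show ?thesis by (simp add: mean_cavg_mult)
  qed
  have "mean Om (\<lambda>\<phi>. pure_part D F \<phi> * g \<phi>)
      = (\<Sum>T\<in>Pow D. (- 1) ^ card (D - T) * mean Om (\<lambda>\<phi>. cavg T F \<phi> * g \<phi>))"
    by (simp add: pure_part_def sum_distrib_right mean_sum mult.assoc mean_cmult)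
  also have "\<dots> = (\<Sum>T\<in>{D}. (- 1) ^ card (D - T) * mean Om (\<lambda>\<phi>. cavg T F \<phi> * g \<phi>))"
    using fin proper by (intro sum.mono_neutral_right) auto
  finally show ?thesis using whole by simp
qed

lemma mean_pure_part_square:
  assumes "D \<subseteq> I"
  shows "mean Om (\<lambda>\<phi>. (pure_part D F \<phi>)\<^sup>2) = mean Om (\<lambda>\<phi>. F \<phi> * pure_part D F \<phi>)"
proof -
  have "mean Om (\<lambda>\<phi>. F \<phi> * pure_part D F \<phi>) = mean Om (\<lambda>\<phi>. pure_part D F \<phi> * pure_part D F \<phi>)"
  proof (rule mean_mult_pure [OF assms])
    fix \<phi> \<psi> :: "'i \<Rightarrow> 'x"
    assume "\<And>i. i \<in> D \<Longrightarrow> \<phi> i = \<psi> i"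
    then show "pure_part D F \<phi> = pure_part D F \<psi>" by (rule pure_part_dep)
  next
    fix i \<phi>
    assume "i \<in> D"
    then show "mean X (\<lambda>v. pure_part D F (\<phi>(i := v))) = 0" by (rule mean_pure_part_upd [OF assms])
  qed
  then show ?thesis by (simp add: power2_eq_square)
qed

text \<open>For \<open>S' \<subseteq> S\<close>: the coordinates in \<open>S'\<close> are frozen at
  \<open>\<phi>\<close>, those in \<open>S - S'\<close> are averaged out, those outside
  \<open>S\<close> stay free.\<close>

definition pin :: "'i set \<Rightarrow> 'i set \<Rightarrow> ('i \<Rightarrow> 'x) \<Rightarrow> (('i \<Rightarrow> 'x) \<Rightarrow> real) \<Rightarrow> ('i \<Rightarrow> 'x) \<Rightarrow> real" where
  "pin S S' \<phi> F w = mean Om (\<lambda>u. F (mix S' \<phi> (mix S u w)))"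

lemma cavg_pin:
  assumes "S' \<subseteq> S"
  shows "cavg T (pin S S' \<phi> F) w = cavg (S' \<union> (T - S)) F (mix S' \<phi> w)"
proof -
  have "mix S' \<phi> (mix S u (mix T w w')) = mix (S' \<union> (T - S)) (mix S' \<phi> w) (mix S u w')" for u w'
    by (rule ext) (use assms in \<open>auto simp: mix_def\<close>)
  then have "cavg T (pin S S' \<phi> F) w =
      mean Om (\<lambda>w'. mean Om (\<lambda>u. F (mix (S' \<union> (T - S)) (mix S' \<phi> w) (mix S u w'))))"
    by (simp add: cavg_def pin_def)
  also have "\<dots> = mean Om (\<lambda>u. F (mix (S' \<union> (T - S)) (mix S' \<phi> w) u))"
    by (subst mean_swap) (rule mean_mix [of "\<lambda>u. F (mix (S' \<union> (T - S)) (mix S' \<phi> w) u)"])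
  finally show ?thesis by (simp add: cavg_def)
qed

text \<open>The alternating sum over subsets of \<open>S \<union> T\<close> factors. Freezing
  \<open>S\<close> thus leaves components of lower degree of pinned functions, which makes induction
  on the degree possible.\<close>

lemma pure_part_mix:
  assumes S: "S \<subseteq> I" and T: "T \<subseteq> I - S"
  shows "pure_part (S \<union> T) F (mix (I - S) w \<phi>) = (\<Sum>S'\<in>Pow S. (- 1) ^ card (S - S') * pure_part T (pin S S' \<phi> F) w)"
proof -
  have fin: "finite S" "finite T" using S T finite_I by (meson finite_subset finite_Diff)+
  have *: "cavg (S' \<union> T') F (mix (I - S) w \<phi>) = cavg T' (pin S S' \<phi> F) w" if "S' \<in> Pow S" "T' \<in> Pow T" for S' T'
  proof -
    have "T' - S = T'" using that T by auto
    moreover have "cavg (S' \<union> T') F (mix (I - S) w \<phi>) = cavg (S' \<union> T') F (mix S' \<phi> w)"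
      by (rule cavg_dep) (use that S T in \<open>auto simp: mix_def\<close>)
    ultimately show ?thesis using that by (simp add: cavg_pin)
  qed
  have "S \<inter> T = {}" using T by auto
  from sum_Pow_signs_Un [OF fin this, of "\<lambda>D. cavg D F (mix (I - S) w \<phi>)"]
  show ?thesis by (simp add: pure_part_def * cong: sum.cong_simp)
qed

end

section \<open>The level inequality on a finite product space\<close>

lemma power_ratio_le: "(real (k + s) / real k) ^ k \<le> 3 ^ s"
proof (cases "k = 0")
  case False
  have "(real (k + s) / real k) ^ k = (1 + real s / real k) ^ k"
    using False by (simp add: field_simps)
  also have "\<dots> \<le> exp (real s)"
    using False by (intro exp_ge_one_plus_x_over_n_power_n) auto
  also have "\<dots> = exp 1 ^ s" by (simp add: exp_of_nat_mult [symmetric])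
  also have "\<dots> \<le> 3 ^ s" by (intro power_mono exp_le) auto
  finally show ?thesis .
qed simp

text \<open>The numerical part of the induction, with l = L / d and p about l: for each s = |S| the
  coefficient coming from the moment inequality and the induction hypothesis is compared with Z^(2 p
  - 1), where Z = (A l)^d. \<open>part1\<close> pays for the \<open>d - s\<close> averaged
  coordinates and \<open>part2\<close> for the \<open>s\<close> frozen ones. In \<open>A\<close>,
  the summand \<open>12 * R\<^sup>2\<close> serves the globalness factor, 6000 the constants of the
  moment inequality.\<close>

lemma level_numeric:
  fixes A R l :: real
  assumes A: "12 * R\<^sup>2 + 6000 \<le> A" and l: "1 \<le> l" "l \<le> real p" "real p \<le> 2 * l" and p: "0 < p" and s: "s \<le> d" "0 < d"
  shows "(6 * real p) ^ (2 * p * s) * (8 * real p) ^ ((d - s) * p) *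
      ((4 * R\<^sup>2) ^ s * (A * (l * real d) / real (d - s)) ^ (d - s)) ^ (p - 1) * (2 * 3 ^ (d * p) * 2 ^ d)
      \<le> (A * l) ^ (d * (2 * p - 1))"
proof -
  define a where "a = A * l"
  define k where "k = d - s"
  have d: "d = k + s" using s by (simp add: k_def)
  have A6: "6000 \<le> A" "12 * R\<^sup>2 \<le> A" using A zero_le_power2 [of R] by linarith+
  have a6: "6000 * l \<le> a" unfolding a_def using A6 l by (intro mult_right_mono) auto
  have a3: "3000 * real p \<le> a" using a6 l by linarith
  have a0: "0 \<le> a" using a3 by (smt (verit) of_nat_0_le_iff)
  have b: "(4 * R\<^sup>2) ^ s * (A * (l * real d) / real k) ^ k \<le> (12 * R\<^sup>2) ^ s * a ^ k"
  proof -
    have "(A * (l * real d) / real k) ^ k = a ^ k * (real (k + s) / real k) ^ k"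
      by (simp add: a_def d power_mult_distrib power_divide)
    also have "\<dots> \<le> a ^ k * 3 ^ s"
      using a0 by (intro mult_left_mono power_ratio_le) auto
    finally have "(4 * R\<^sup>2) ^ s * (A * (l * real d) / real k) ^ k \<le> (4 * R\<^sup>2) ^ s * (a ^ k * 3 ^ s)"
      by (intro mult_left_mono) auto
    also have "\<dots> = (4 * R\<^sup>2 * 3) ^ s * a ^ k" by (simp only: power_mult_distrib mult_ac)
    finally show ?thesis by simp
  qed
  have nn: "0 \<le> A * (l * real d) / real k" using A6 l by auto
  have two: "2 * 3 ^ (d * p) * 2 ^ d \<le> (12::real) ^ (d * p)"
  proof -
    have "2 ^ 1 \<le> (2::real) ^ (d * p)" "2 ^ d \<le> (2::real) ^ (d * p)"
      using p s by (intro power_increasing; simp)+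
    then have "2 * 3 ^ (d * p) * 2 ^ d \<le> (2::real) ^ (d * p) * 3 ^ (d * p) * 2 ^ (d * p)"
      by (intro mult_mono) auto
    then show ?thesis by (simp add: power_mult_distrib [symmetric])
  qed
  have part1: "(12 * (8 * real p)) ^ (k * p) \<le> a ^ (k * p)"
    using a3 by (intro power_mono) auto
  have part2: "((12 * (6 * real p)\<^sup>2) ^ p * (12 * R\<^sup>2) ^ (p - 1)) ^ s \<le> (a ^ (2 * p - 1)) ^ s"
  proof (intro power_mono)
    have q: "(1500 * (real p)\<^sup>2) ^ p \<le> (6000 * l\<^sup>2) ^ p"
    proof (intro power_mono)
      have "(real p)\<^sup>2 \<le> (2 * l)\<^sup>2" using l by (intro power_mono) auto
      then show "1500 * (real p)\<^sup>2 \<le> 6000 * l\<^sup>2" by (simp add: power_mult_distrib)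
    qed simp
    \<comment> \<open>The target exponent is 2 p - 1 rather than 2 p, so one factor \<open>l\<close>
      has to be gained; \<open>l \<le> 3 ^ p\<close> provides it.\<close>
    have "l * (12 * (6 * real p)\<^sup>2) ^ p \<le> 3 ^ p * (12 * (6 * real p)\<^sup>2) ^ p"
    proof (intro mult_right_mono)
      have "real p < 2 ^ p" by (rule of_nat_less_two_power)
      also have "(2::real) ^ p \<le> 3 ^ p" by (intro power_mono) auto
      finally show "l \<le> 3 ^ p" using l by linarith
    qed simp
    also have "\<dots> = (3 * (12 * (6 * real p)\<^sup>2)) ^ p"
      by (simp only: power_mult_distrib)
    also have "\<dots> = (1296 * (real p)\<^sup>2) ^ p"
      by (rule arg_cong [where f = "\<lambda>x. x ^ p"]) (simp add: power2_eq_square)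
    also have "\<dots> \<le> (1500 * (real p)\<^sup>2) ^ p"
      by (intro power_mono mult_right_mono) auto
    also note q
    also have "(6000 * l\<^sup>2) ^ p = (6000 * l) ^ p * l ^ p"
      by (simp add: power_mult_distrib power2_eq_square)
    also have "\<dots> \<le> a ^ p * l ^ p"
      using a6 l by (intro mult_right_mono power_mono) auto
    finally have 1: "l * (12 * (6 * real p)\<^sup>2) ^ p \<le> a ^ p * l ^ p" .
    have "l * (12 * (6 * real p)\<^sup>2) ^ p * (12 * R\<^sup>2) ^ (p - 1) \<le> a ^ p * l ^ p * (12 * R\<^sup>2) ^ (p - 1)"
      using 1 by (intro mult_right_mono) auto
    also have "\<dots> = l * (a ^ p * (12 * R\<^sup>2 * l) ^ (p - 1))"
      using p by (cases p) (auto simp: power_mult_distrib)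
    also have "\<dots> \<le> l * (a ^ p * a ^ (p - 1))"
      unfolding a_def using A6 l by (intro mult_left_mono power_mono mult_right_mono) auto
    also have "a ^ p * a ^ (p - 1) = a ^ (2 * p - 1)"
      using p by (simp add: power_add [symmetric] mult_2)
    finally have "l * ((12 * (6 * real p)\<^sup>2) ^ p * (12 * R\<^sup>2) ^ (p - 1)) \<le> l * a ^ (2 * p - 1)"
      by (simp only: mult.assoc)
    then show "(12 * (6 * real p)\<^sup>2) ^ p * (12 * R\<^sup>2) ^ (p - 1) \<le> a ^ (2 * p - 1)"
      using l by simp
  qed simp
  have V: "((4 * R\<^sup>2) ^ s * (A * (l * real d) / real k) ^ k) ^ (p - 1) \<le> ((12 * R\<^sup>2) ^ s * a ^ k) ^ (p - 1)"
    by (rule power_mono [OF b]) (rule mult_nonneg_nonneg, simp, rule zero_le_power [OF nn])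
  have "(6 * real p) ^ (2 * p * s) * (8 * real p) ^ (k * p) *
      ((4 * R\<^sup>2) ^ s * (A * (l * real d) / real k) ^ k) ^ (p - 1) * (2 * 3 ^ (d * p) * 2 ^ d)
    \<le> (6 * real p) ^ (2 * p * s) * (8 * real p) ^ (k * p) * ((12 * R\<^sup>2) ^ s * a ^ k) ^ (p - 1) * 12 ^ (d * p)"
    by (rule mult_mono [OF mult_left_mono [OF V] two]) (use a0 in auto)
  also have "\<dots> = (12 * (8 * real p)) ^ (k * p) * ((12 * (6 * real p)\<^sup>2) ^ p * (12 * R\<^sup>2) ^ (p - 1)) ^ s * a ^ (k * (p - 1))"
  proof -
    have "(12::real) ^ (d * p) = 12 ^ (k * p) * (12 ^ p) ^ s"
      by (simp only: power_mult [symmetric] power_add [symmetric]) (simp add: d algebra_simps)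
    moreover have "(6 * real p) ^ (2 * p * s) = (((6 * real p)\<^sup>2) ^ p) ^ s"
      by (simp only: power_mult)
    moreover have "((12 * R\<^sup>2) ^ s * a ^ k) ^ (p - 1) = ((12 * R\<^sup>2) ^ (p - 1)) ^ s * a ^ (k * (p - 1))"
    proof -
      have "((12 * R\<^sup>2) ^ s) ^ (p - 1) = ((12 * R\<^sup>2) ^ (p - 1)) ^ s"
        by (simp only: power_mult [symmetric] mult.commute)
      then show ?thesis by (subst power_mult_distrib) (simp only: power_mult)
    qed
    ultimately show ?thesis
      by (simp only: power_mult_distrib mult_ac)
  qed
  also have "\<dots> \<le> a ^ (k * p) * (a ^ (2 * p - 1)) ^ s * a ^ (k * (p - 1))"
    by (rule mult_right_mono [OF mult_mono [OF part1 part2]]) (use a0 in auto)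
  also have "\<dots> = a ^ (d * (2 * p - 1))"
  proof -
    have "k * p + (2 * p - 1) * s + k * (p - 1) = d * (2 * p - 1)"
      using p by (cases p) (auto simp: d algebra_simps)
    then show ?thesis by (simp add: power_add [symmetric] power_mult [symmetric])
  qed
  finally show ?thesis by (simp add: k_def a_def)
qed

context finite_product
begin

lemma finite_subset_I: "A \<subseteq> I \<Longrightarrow> finite A"
  using finite_I rev_finite_subset by blast

lemma sum_subset_pairs:
  "(\<Sum>S\<in>Pow I. \<Sum>T\<in>{T. T \<subseteq> I - S \<and> card S + card T = d}. h S (S \<union> T))
    = (\<Sum>D\<in>{D. D \<subseteq> I \<and> card D = d}. \<Sum>S\<in>Pow D. h S D)"
proof -
  have "bij_betw (\<lambda>(S, T). (S \<union> T, S)) (SIGMA S:Pow I. {T. T \<subseteq> I - S \<and> card S + card T = d})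
      (SIGMA D:{D. D \<subseteq> I \<and> card D = d}. Pow D)"
  proof (rule bij_betw_byWitness [where f' = "\<lambda>(D, S). (S, D - S)"])
    show "(\<lambda>(S, T). (S \<union> T, S)) ` (SIGMA S:Pow I. {T. T \<subseteq> I - S \<and> card S + card T = d})
        \<subseteq> (SIGMA D:{D. D \<subseteq> I \<and> card D = d}. Pow D)"
    proof clarsimp
      fix S T assume "S \<subseteq> I" "T \<subseteq> I - S"
      then have "card (S \<union> T) = card S + card T"
        by (intro card_Un_disjoint finite_subset_I) auto
      with \<open>T \<subseteq> I - S\<close> show "T \<subseteq> I \<and> card (S \<union> T) = card S + card T" by auto
    qed
    show "(\<lambda>(D, S). (S, D - S)) ` (SIGMA D:{D. D \<subseteq> I \<and> card D = d}. Pow D)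
        \<subseteq> (SIGMA S:Pow I. {T. T \<subseteq> I - S \<and> card S + card T = d})"
    proof clarsimp
      fix D S assume D: "D \<subseteq> I" and S: "S \<subseteq> D"
      then have "finite D" by (intro finite_subset_I)
      with S have "card S + card (D - S) = card D"
        using card_mono [OF \<open>finite D\<close> S] by (simp add: card_Diff_subset finite_subset [OF S])
      with D S show "S \<subseteq> I \<and> D - S \<subseteq> I - S \<and> card S + card (D - S) = card D" by auto
    qed
  qed auto
  from sum.reindex_bij_betw [OF this, of "\<lambda>(D, S). h S D"]
  show ?thesis
    using finite_I by (subst (1 2) sum.Sigma) (auto simp: case_prod_beta intro: finite_subset_I)
qed

text \<open>Let \<open>g\<close> be the degree \<open>d\<close> part of \<open>F\<close>. Since \<open>0 \<le> F \<le> 1\<close>, Hoelder's inequality bounds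
  the weight \<open>W = \<langle>F, g\<rangle>\<close> by \<open>W ^ (2 p) \<le> M ^ (2 p - 1) * \<parallel>g\<parallel>\<^sub>2\<^sub>p ^ (2 p)\<close>, and \<open>M ^ (- 1 / p)\<close>
  stays bounded for \<open>p \<approx> L / d\<close>. Rosenthal's inequality reduces the moment of \<open>g\<close> to
  lower levels of \<open>F\<close> with some coordinates pinned, where the induction hypothesis applies.\<close>

theorem level_inequality:
  assumes R: "1 \<le> R" and M: "exp (- L) \<le> M" and dL: "real d \<le> L"
    and F: "\<And>\<phi>. \<phi> \<in> Om \<Longrightarrow> 0 \<le> F \<phi>" "\<And>\<phi>. \<phi> \<in> Om \<Longrightarrow> F \<phi> \<le> 1"
    and glob: "\<And>T \<phi>. T \<subseteq> I \<Longrightarrow> card T \<le> d \<Longrightarrow> \<phi> \<in> Om \<Longrightarrow> cavg T F \<phi> \<le> R ^ card T * M"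
  shows "level_weight d F \<le> M\<^sup>2 * ((12 * R\<^sup>2 + 6000) * L / real d) ^ d"
  using M dL F glob
proof (induction d arbitrary: F M rule: less_induct)
  case (less d)
  note M = less.prems(1) and dL = less.prems(2) and F = less.prems(3,4) and glob = less.prems(5)
  define A where "A = 12 * R\<^sup>2 + 6000"
  have M0: "0 < M" using M by (meson exp_gt_zero less_le_trans)
  have mF: "mean Om F \<le> M" and mF0: "0 \<le> mean Om F"
  proof -
    obtain \<phi> where "\<phi> \<in> Om" using Om_nonempty by blast
    from glob [of "{}", OF _ _ this] show "mean Om F \<le> M" by (simp add: cavg_def)
    show "0 \<le> mean Om F" using F by (intro mean_nonneg)
  qed
  define W where "W = level_weight d F"
  show ?case
  proof (cases "d = 0")
    case True
    have "{D. D \<subseteq> I \<and> card D = 0} = {{}}"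
      using finite_subset_I by (auto simp: card_eq_0_iff)
    moreover have "pure_part {} F \<phi> = mean Om F" for \<phi>
      by (simp add: pure_part_def cavg_def)
    ultimately have "level_weight 0 F = (mean Om F)\<^sup>2"
      by (simp add: level_weight_def)
    also have "\<dots> \<le> M\<^sup>2" using mF mF0 by (intro power_mono) auto
    finally show ?thesis using True by simp
  next
    case False
    define l where "l = L / real d"
    have d0: "0 < real d" "0 < d" using False by auto
    have l1: "1 \<le> l" and L: "L = l * real d" using dL d0 by (auto simp: l_def)
    \<comment> \<open>\<open>real d \<le> L\<close> means l >= 1, hence p <= 2 l: rounding up costs
      only a constant factor.\<close>
    define p where "p = nat \<lceil>l\<rceil>"
    have pl: "l \<le> real p" "real p \<le> 2 * l" "0 < p"
      using l1 by (auto simp: p_def) linarith+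
    define Ds where "Ds = {D. D \<subseteq> I \<and> card D = d}"
    define f where "f D = (if card D = d then pure_part D F else (\<lambda>_. 0))" for D
    \<comment> \<open>The squared norm, over the coordinates outside \<open>S\<close>, of the degree
      \<open>d\<close> components whose set contains \<open>S\<close>, with the coordinates in
      \<open>S\<close> frozen at \<open>\<phi>\<close>.\<close>
    define q where "q S \<phi> = (\<Sum>T\<in>{T. T \<subseteq> I - S \<and> card S + card T = d}.
        mean Om (\<lambda>w. (pure_part (S \<union> T) F (mix (I - S) w \<phi>))\<^sup>2))" for S \<phi>
    have q0: "0 \<le> q S \<phi>" for S \<phi>
      unfolding q_def by (intro sum_nonneg mean_nonneg) auto
    define Z where "Z = (A * l) ^ d"
    define B where "B s = (4 * R\<^sup>2) ^ s * (A * L / real (d - s)) ^ (d - s)" for s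
    have A0: "0 < A" using zero_le_power2 [of R] unfolding A_def by linarith
    have Z0: "0 < Z" unfolding Z_def using A0 l1 by simp
    have Q: "(\<Sum>T\<in>Pow (I - S). (8 * real p) ^ card T * mean Om (\<lambda>w. (f (S \<union> T) (mix (I - S) w \<phi>))\<^sup>2))
        = (8 * real p) ^ (d - card S) * q S \<phi>" if S: "S \<in> Pow I" for S \<phi>
    proof -
      have "card (S \<union> T) = card S + card T" if "T \<in> Pow (I - S)" for T
        using S that by (intro card_Un_disjoint finite_subset_I) auto
      then have "(\<Sum>T\<in>Pow (I - S). (8 * real p) ^ card T * mean Om (\<lambda>w. (f (S \<union> T) (mix (I - S) w \<phi>))\<^sup>2))
        = (\<Sum>T\<in>Pow (I - S). if card S + card T = d then (8 * real p) ^ (d - card S) *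
            mean Om (\<lambda>w. (pure_part (S \<union> T) F (mix (I - S) w \<phi>))\<^sup>2) else 0)"
        by (intro sum.cong refl) (auto simp: f_def)
      also have "\<dots> = (\<Sum>T\<in>{T \<in> Pow (I - S). card S + card T = d}. (8 * real p) ^ (d - card S) *
            mean Om (\<lambda>w. (pure_part (S \<union> T) F (mix (I - S) w \<phi>))\<^sup>2))"
        using finite_I by (subst sum.inter_filter) auto
      finally show ?thesis
        by (simp add: q_def sum_distrib_left)
    qed
    have sum_q: "(\<Sum>S\<in>Pow I. mean Om (q S)) = 2 ^ d * W"
    proof -
      have "mean Om (q S) = (\<Sum>T\<in>{T. T \<subseteq> I - S \<and> card S + card T = d}. mean Om (\<lambda>\<phi>. (pure_part (S \<union> T) F \<phi>)\<^sup>2))" for S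
        unfolding q_def mean_sum
        by (subst mean_swap) (simp only: mean_mix [of "\<lambda>\<phi>. (pure_part (S \<union> _) F \<phi>)\<^sup>2"])
      then have "(\<Sum>S\<in>Pow I. mean Om (q S)) =
          (\<Sum>D\<in>Ds. \<Sum>S\<in>Pow D. mean Om (\<lambda>\<phi>. (pure_part D F \<phi>)\<^sup>2))"
        using sum_subset_pairs [of "\<lambda>S D. mean Om (\<lambda>\<phi>. (pure_part D F \<phi>)\<^sup>2)" d] by (simp add: Ds_def)
      also have "\<dots> = (\<Sum>D\<in>Ds. 2 ^ d * mean Om (\<lambda>\<phi>. (pure_part D F \<phi>)\<^sup>2))"
      proof (rule sum.cong [OF refl])
        fix D assume "D \<in> Ds"
        then have "finite D" "card D = d" using finite_subset_I by (auto simp: Ds_def)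
        then show "(\<Sum>S\<in>Pow D. mean Om (\<lambda>\<phi>. (pure_part D F \<phi>)\<^sup>2)) = 2 ^ d * mean Om (\<lambda>\<phi>. (pure_part D F \<phi>)\<^sup>2)"
          by (simp add: card_Pow)
      qed
      finally show ?thesis by (simp add: W_def level_weight_def Ds_def sum_distrib_left)
    qed
    have q_empty: "q {} \<phi> = W" if "\<phi> \<in> Om" for \<phi>
    proof -
      have "pure_part T F (mix I w \<phi>) = pure_part T F w" if "T \<subseteq> I" for T w
        by (rule pure_part_dep) (use that in \<open>auto simp: mix_def\<close>)
      then show ?thesis by (simp add: q_def W_def level_weight_def cong: sum.cong_simp)
    qed
    \<comment> \<open>Pinning \<open>s\<close> coordinates lowers the degree by \<open>s\<close> and
      replaces \<open>M\<close> with \<open>R ^ s * M\<close> in the globalness hypothesis, so the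
      induction hypothesis bounds \<open>q\<close> at every point.\<close>
    have q_le: "q S \<phi> \<le> B (card S) * M\<^sup>2" if S: "S \<in> Pow I" "S \<noteq> {}" and \<phi>: "\<phi> \<in> Om" for S \<phi>
    proof (cases "card S \<le> d")
      case False
      then have "q S \<phi> = 0" unfolding q_def by (intro sum.neutral) auto
      then show ?thesis using A0 l1 by (simp add: B_def L zero_le_mult_iff)
    next
      case True
      define s where "s = card S"
      have finS: "finite S" using S finite_subset_I by blast
      have s0: "0 < s" using S finS by (simp add: s_def card_gt_0_iff)
      have sd: "s \<le> d" using True by (simp add: s_def)
      define Ts where "Ts = {T. T \<subseteq> I - S \<and> card S + card T = d}"
      have IH: "level_weight (d - s) (pin S S' \<phi> F) \<le> (R ^ s * M)\<^sup>2 * (A * L / real (d - s)) ^ (d - s)"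
        if S': "S' \<in> Pow S" for S'
        unfolding A_def
      proof (rule less.IH)
        show "d - s < d" using s0 d0 by simp
        have "1 * M \<le> R ^ s * M" using M0 R by (intro mult_right_mono one_le_power) auto
        with M show "exp (- L) \<le> R ^ s * M" by simp
        show "real (d - s) \<le> L" using dL by simp
        fix w assume w: "w \<in> Om"
        show "0 \<le> pin S S' \<phi> F w"
          unfolding pin_def using w \<phi> F by (intro mean_nonneg) (auto intro!: mix_in_Om)
        show "pin S S' \<phi> F w \<le> 1"
          unfolding pin_def using w \<phi> F by (intro mean_le_const) (auto intro!: mix_in_Om)
        fix T assume T: "T \<subseteq> I" "card T \<le> d - s"
        have finT: "finite T" using T finite_subset_I by blast
        have c1: "card S' \<le> s" using S' finS by (auto simp: s_def intro: card_mono)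
        have "card (T - S) \<le> card T" using finT by (intro card_mono) auto
        moreover have "card (S' \<union> (T - S)) \<le> card S' + card (T - S)" by (rule card_Un_le)
        ultimately have c2: "card (S' \<union> (T - S)) \<le> s + card T" using c1 by linarith
        have "cavg T (pin S S' \<phi> F) w = cavg (S' \<union> (T - S)) F (mix S' \<phi> w)"
          using S' by (intro cavg_pin) auto
        also have "\<dots> \<le> R ^ card (S' \<union> (T - S)) * M"
          using S' S T w \<phi> c2 sd by (intro glob) (auto intro!: mix_in_Om)
        also have "\<dots> \<le> R ^ (s + card T) * M"
          using c2 R M0 by (intro mult_right_mono power_increasing) auto
        finally show "cavg T (pin S S' \<phi> F) w \<le> R ^ card T * (R ^ s * M)"
          by (simp add: power_add mult_ac)
      qed
      have pt: "(pure_part (S \<union> T) F (mix (I - S) w \<phi>))\<^sup>2 \<le> 2 ^ s * (\<Sum>S'\<in>Pow S. (pure_part T (pin S S' \<phi> F) w)\<^sup>2)"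
        if "T \<in> Ts" for T w
      proof -
        have "pure_part (S \<union> T) F (mix (I - S) w \<phi>) = (\<Sum>S'\<in>Pow S. (- 1) ^ card (S - S') * pure_part T (pin S S' \<phi> F) w)"
          using S that by (intro pure_part_mix) (auto simp: Ts_def)
        also have "\<dots>\<^sup>2 \<le> (\<Sum>S'\<in>Pow S. ((- 1) ^ card (S - S'))\<^sup>2) * (\<Sum>S'\<in>Pow S. (pure_part T (pin S S' \<phi> F) w)\<^sup>2)"
          by (rule Cauchy_Schwarz_ineq_sum)
        also have "(\<Sum>S'\<in>Pow S. ((- 1) ^ card (S - S'))\<^sup>2) = (2::real) ^ s"
          using finS by (simp add: card_Pow s_def power_mult [symmetric] mult.commute [of _ 2])
        finally show ?thesis .
      qed
      have "q S \<phi> \<le> (\<Sum>T\<in>Ts. mean Om (\<lambda>w. 2 ^ s * (\<Sum>S'\<in>Pow S. (pure_part T (pin S S' \<phi> F) w)\<^sup>2)))"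
        unfolding q_def Ts_def [symmetric] by (intro sum_mono mean_mono pt)
      also have "\<dots> = 2 ^ s * (\<Sum>S'\<in>Pow S. \<Sum>T\<in>Ts. mean Om (\<lambda>w. (pure_part T (pin S S' \<phi> F) w)\<^sup>2))"
        by (simp add: mean_cmult mean_sum sum_distrib_left [symmetric] sum.swap [of _ Ts])
      also have "\<dots> \<le> 2 ^ s * (\<Sum>S'\<in>Pow S. level_weight (d - s) (pin S S' \<phi> F))"
      proof (intro mult_left_mono sum_mono)
        fix S'
        show "(\<Sum>T\<in>Ts. mean Om (\<lambda>w. (pure_part T (pin S S' \<phi> F) w)\<^sup>2)) \<le> level_weight (d - s) (pin S S' \<phi> F)"
          unfolding level_weight_def
          by (rule sum_mono2) (use finite_I in \<open>auto simp: Ts_def s_def intro!: mean_nonneg\<close>)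
      qed simp
      also have "\<dots> \<le> 2 ^ s * (\<Sum>S'\<in>Pow S. (R ^ s * M)\<^sup>2 * (A * L / real (d - s)) ^ (d - s))"
        using IH by (intro mult_left_mono sum_mono) auto
      also have "\<dots> = 2 ^ s * (2 ^ s * ((R ^ s * M)\<^sup>2 * (A * L / real (d - s)) ^ (d - s)))"
        using finS by (simp add: card_Pow s_def)
      also have "\<dots> = B s * M\<^sup>2"
      proof -
        have "(2::real) ^ s * 2 ^ s * (R ^ s)\<^sup>2 = (4 * R\<^sup>2) ^ s"
        proof -
          have "(2::real) ^ s * 2 ^ s * (R ^ s)\<^sup>2 = (2 * 2 * (R * R)) ^ s"
            by (simp only: power_mult_distrib power2_eq_square)
          then show ?thesis by (simp add: power2_eq_square)
        qed
        then show ?thesis by (simp add: B_def power_mult_distrib mult.assoc [symmetric])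
      qed
      finally show ?thesis by (simp add: s_def)
    qed
    have W_eq: "W = mean Om (\<lambda>\<phi>. F \<phi> * (\<Sum>D\<in>Pow I. f D \<phi>))"
    proof -
      have "(\<Sum>D\<in>Pow I. f D \<phi>) = (\<Sum>D\<in>Ds. pure_part D F \<phi>)" for \<phi>
      proof -
        have "(\<Sum>D\<in>Pow I. f D \<phi>) = (\<Sum>D\<in>Pow I. if card D = d then pure_part D F \<phi> else 0)"
          by (intro sum.cong) (auto simp: f_def)
        also have "\<dots> = (\<Sum>D\<in>{D \<in> Pow I. card D = d}. pure_part D F \<phi>)"
          using finite_I by (subst sum.inter_filter) auto
        finally show ?thesis by (simp add: Ds_def)
      qed
      then have "mean Om (\<lambda>\<phi>. F \<phi> * (\<Sum>D\<in>Pow I. f D \<phi>)) = (\<Sum>D\<in>Ds. mean Om (\<lambda>\<phi>. F \<phi> * pure_part D F \<phi>))"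
        by (simp add: sum_distrib_left mean_sum)
      also have "\<dots> = W"
        unfolding W_def level_weight_def Ds_def
        by (intro sum.cong refl mean_pure_part_square [symmetric]) auto
      finally show ?thesis by simp
    qed
    have Ros: "mean Om (\<lambda>\<phi>. (\<Sum>D\<in>Pow I. f D \<phi>) ^ (2 * p)) \<le>
        (\<Sum>S\<in>Pow I. (6 * real p) ^ (2 * p * card S) * mean Om (\<lambda>\<phi>. ((8 * real p) ^ (d - card S) * q S \<phi>) ^ p))"
    proof -
      have dep: "f D \<phi> = f D \<psi>" if "\<And>i. i \<in> D \<Longrightarrow> \<phi> i = \<psi> i" for D \<phi> \<psi>
        using pure_part_dep [where F = F, OF that] by (simp add: f_def)
      have cent: "mean X (\<lambda>v. f D (\<phi>(i := v))) = 0" if "D \<subseteq> I" "i \<in> D" for D i \<phi>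
        using mean_pure_part_upd [OF that] by (simp add: f_def)
      have "mean Om (\<lambda>\<phi>. (\<Sum>D\<in>Pow I. f D \<phi>) ^ (2 * p)) \<le>
        (\<Sum>S\<in>Pow I. (6 * real p) ^ (2 * p * card S) * mean Om (\<lambda>\<phi>.
          (\<Sum>T\<in>Pow (I - S). (8 * real p) ^ card T *
            mean Om (\<lambda>w. (f (S \<union> T) (mix (I - S) w \<phi>))\<^sup>2)) ^ p))"
        by (rule product_Rosenthal; (rule dep cent pl(3))?)
      also have "\<dots> = (\<Sum>S\<in>Pow I. (6 * real p) ^ (2 * p * card S) * mean Om (\<lambda>\<phi>. ((8 * real p) ^ (d - card S) * q S \<phi>) ^ p))"
        by (intro sum.cong refl) (simp only: Q)
      finally show ?thesis .
    qed
    show ?thesis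
    proof (rule ccontr)
      assume "\<not> ?thesis"
      then have big: "M\<^sup>2 * Z < W"
        by (simp add: W_def Z_def A_def l_def mult.assoc)
      \<comment> \<open>The term of the empty \<open>S\<close> returns \<open>W\<close> itself, so
        the estimate is self-referential. With W = x M^2 and x > Z it bounds x^(2 p) by two terms,
        each of which turns out to be smaller than x^(2 p) / 2.\<close>
      define x where "x = W / M\<^sup>2"
      have xZ: "Z < x" using big M0 by (simp add: x_def field_simps)
      have x0: "0 < x" using xZ Z0 by linarith
      have Wx: "W = x * M\<^sup>2" using M0 by (simp add: x_def)
      define K where "K = Z ^ (2 * p - 1) / (2 * 3 ^ (d * p) * 2 ^ d)"
      have K0: "0 \<le> K" unfolding K_def using Z0 by simp
      have coef: "(6 * real p) ^ (2 * p * s) * (8 * real p) ^ ((d - s) * p) * B s ^ (p - 1) \<le> K" if "s \<le> d" for s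
      proof -
        have "(A * l) ^ (d * (2 * p - 1)) = Z ^ (2 * p - 1)" by (simp add: Z_def power_mult)
        with level_numeric [of R A l p s d] l1 pl that d0
        show ?thesis by (simp add: K_def B_def L A_def pos_le_divide_eq)
      qed
      have summand: "(6 * real p) ^ (2 * p * card S) * mean Om (\<lambda>\<phi>. ((8 * real p) ^ (d - card S) * q S \<phi>) ^ p)
          \<le> K * (M\<^sup>2) ^ (p - 1) * mean Om (q S)" if S: "S \<in> Pow I" "S \<noteq> {}" for S
      proof (cases "card S \<le> d")
        case False
        then have "q S \<phi> = 0" for \<phi> unfolding q_def by (intro sum.neutral) auto
        then show ?thesis using pl(3) by (simp add: zero_power)
      next
        case True
        define s where "s = card S"
        have "mean Om (\<lambda>\<phi>. ((8 * real p) ^ (d - s) * q S \<phi>) ^ p)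
            \<le> mean Om (\<lambda>\<phi>. (8 * real p) ^ ((d - s) * p) * (B s * M\<^sup>2) ^ (p - 1) * q S \<phi>)"
        proof (rule mean_mono)
          fix \<phi> assume \<phi>: "\<phi> \<in> Om"
          have "q S \<phi> ^ p = q S \<phi> ^ (p - 1) * q S \<phi>" using pl(3) by (cases p) auto
          also have "\<dots> \<le> (B s * M\<^sup>2) ^ (p - 1) * q S \<phi>"
            using q_le [OF S \<phi>] q0 unfolding s_def by (intro mult_right_mono power_mono) auto
          finally have "(8 * real p) ^ ((d - s) * p) * q S \<phi> ^ p \<le> (8 * real p) ^ ((d - s) * p) * ((B s * M\<^sup>2) ^ (p - 1) * q S \<phi>)"
            by (intro mult_left_mono) auto
          then show "((8 * real p) ^ (d - s) * q S \<phi>) ^ p \<le> (8 * real p) ^ ((d - s) * p) * (B s * M\<^sup>2) ^ (p - 1) * q S \<phi>"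
            by (simp only: power_mult_distrib [of _ "q S \<phi>"] power_mult mult.assoc)
        qed
        then have "(6 * real p) ^ (2 * p * s) * mean Om (\<lambda>\<phi>. ((8 * real p) ^ (d - s) * q S \<phi>) ^ p)
            \<le> (6 * real p) ^ (2 * p * s) * ((8 * real p) ^ ((d - s) * p) * (B s * M\<^sup>2) ^ (p - 1) * mean Om (q S))"
          by (intro mult_left_mono) (auto simp: mean_cmult)
        also have "\<dots> = ((6 * real p) ^ (2 * p * s) * (8 * real p) ^ ((d - s) * p) * B s ^ (p - 1)) * ((M\<^sup>2) ^ (p - 1) * mean Om (q S))"
          by (simp only: power_mult_distrib [of "B s"] mult_ac)
        also have "\<dots> \<le> K * ((M\<^sup>2) ^ (p - 1) * mean Om (q S))"
          using coef [of s] True q0 unfolding s_def by (intro mult_right_mono mult_nonneg_nonneg mean_nonneg) auto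
        finally show ?thesis by (simp only: s_def mult.assoc)
      qed
      have "(\<Sum>S\<in>Pow I. (6 * real p) ^ (2 * p * card S) * mean Om (\<lambda>\<phi>. ((8 * real p) ^ (d - card S) * q S \<phi>) ^ p))
          \<le> ((8 * real p) ^ d * W) ^ p + K * (M\<^sup>2) ^ (p - 1) * (2 ^ d * W)"
      proof -
        have "mean Om (\<lambda>\<phi>. ((8 * real p) ^ d * q {} \<phi>) ^ p) = ((8 * real p) ^ d * W) ^ p"
          using q_empty by simp
        moreover have "(\<Sum>S\<in>Pow I - {{}}. (6 * real p) ^ (2 * p * card S) * mean Om (\<lambda>\<phi>. ((8 * real p) ^ (d - card S) * q S \<phi>) ^ p))
            \<le> (\<Sum>S\<in>Pow I - {{}}. K * (M\<^sup>2) ^ (p - 1) * mean Om (q S))"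
          by (rule sum_mono) (use summand in auto)
        moreover have "\<dots> \<le> (\<Sum>S\<in>Pow I. K * (M\<^sup>2) ^ (p - 1) * mean Om (q S))"
          using finite_I K0 q0 by (intro sum_mono2) (auto intro!: mult_nonneg_nonneg mean_nonneg)
        moreover have "\<dots> = K * (M\<^sup>2) ^ (p - 1) * (2 ^ d * W)"
          by (simp only: sum_distrib_left [symmetric] sum_q)
        ultimately show ?thesis
          using finite_I by (subst sum.remove [of _ "{}"]) auto
      qed
      with Ros have G: "mean Om (\<lambda>\<phi>. (\<Sum>D\<in>Pow I. f D \<phi>) ^ (2 * p)) \<le> ((8 * real p) ^ d * W) ^ p + K * (M\<^sup>2) ^ (p - 1) * (2 ^ d * W)"
        (is "?G \<le> ?rhs") by linarith
      have G0: "0 \<le> ?G" by (intro mean_nonneg) simp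
      have "W ^ (2 * p) \<le> mean Om F ^ (2 * p - 1) * mean Om (\<lambda>\<phi>. F \<phi> * (\<Sum>D\<in>Pow I. f D \<phi>) ^ (2 * p))"
        unfolding W_eq using pl(3) F by (intro mean_weighted_power_le finite_Om) auto
      also have "\<dots> \<le> M ^ (2 * p - 1) * ?G"
      proof (intro mult_mono power_mono mean_mono mF mF0)
        fix \<phi> assume "\<phi> \<in> Om"
        then show "F \<phi> * (\<Sum>D\<in>Pow I. f D \<phi>) ^ (2 * p) \<le> (\<Sum>D\<in>Pow I. f D \<phi>) ^ (2 * p)"
          using F(2) mult_right_mono [of "F \<phi>" 1 "(\<Sum>D\<in>Pow I. f D \<phi>) ^ (2 * p)"] by simp
      qed (use M0 F in \<open>auto intro!: mean_nonneg\<close>)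
      also have "\<dots> \<le> M ^ (2 * p - 1) * ?rhs" using G M0 by (intro mult_left_mono) auto
      \<comment> \<open>The missing factor \<open>M\<close> is restored at the price 1 / M <= exp L
        <= 3^(d p), where the lower bound on \<open>p\<close> enters.\<close>
      also have "M ^ (2 * p - 1) \<le> 3 ^ (d * p) * M ^ (2 * p)"
      proof -
        have "L \<le> real (d * p)" using pl(1) d0 by (simp add: L mult.commute [of l])
        then have "exp L \<le> exp (real (d * p))" by simp
        also have "\<dots> = exp 1 ^ (d * p)" by (simp add: exp_of_nat_mult [symmetric])
        also have "\<dots> \<le> 3 ^ (d * p)" by (intro power_mono exp_le) auto
        finally have "1 \<le> 3 ^ (d * p) * exp (- L)" by (simp add: exp_minus field_simps)
        also have "\<dots> \<le> 3 ^ (d * p) * M" using M by (intro mult_left_mono) auto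
        finally have "1 * M ^ (2 * p - 1) \<le> 3 ^ (d * p) * M * M ^ (2 * p - 1)"
          using M0 by (intro mult_right_mono) auto
        also have "\<dots> = 3 ^ (d * p) * M ^ (2 * p)" using pl(3) by (cases p) auto
        finally show ?thesis by simp
      qed
      then have "M ^ (2 * p - 1) * ?rhs \<le> 3 ^ (d * p) * M ^ (2 * p) * ?rhs"
        using G G0 by (intro mult_right_mono) auto
      finally have main: "W ^ (2 * p) \<le> 3 ^ (d * p) * M ^ (2 * p) * ?rhs" .
      have "3 ^ (d * p) * M ^ (2 * p) * ?rhs = (M\<^sup>2) ^ (2 * p) * (3 ^ (d * p) * ((8 * real p) ^ d * x) ^ p + 3 ^ (d * p) * 2 ^ d * K * x)"
      proof -
        have "M ^ (2 * p) = (M\<^sup>2) ^ p" "(M\<^sup>2) ^ (2 * p) = (M\<^sup>2) ^ p * (M\<^sup>2) ^ p"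
          by (simp_all add: power_mult [symmetric] power_add [symmetric] mult_2)
        moreover have "(M\<^sup>2) ^ p = (M\<^sup>2) ^ (p - 1) * M\<^sup>2" using pl(3) by (cases p) auto
        ultimately show ?thesis
          by (simp only: Wx power_mult_distrib distrib_left mult_ac)
      qed
      with main have "(M\<^sup>2) ^ (2 * p) * x ^ (2 * p) \<le> (M\<^sup>2) ^ (2 * p) * (3 ^ (d * p) * ((8 * real p) ^ d * x) ^ p + 3 ^ (d * p) * 2 ^ d * K * x)"
        by (simp add: Wx power_mult_distrib mult.commute)
      then have "x ^ (2 * p) \<le> 3 ^ (d * p) * ((8 * real p) ^ d * x) ^ p + 3 ^ (d * p) * 2 ^ d * K * x"
        using M0 by (subst (asm) mult_le_cancel_left_pos) auto
      moreover have "3 ^ (d * p) * ((8 * real p) ^ d * x) ^ p < x ^ (2 * p) / 2"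
      proof -
        have "2 * 3 ^ (d * p) * ((8 * real p) ^ d) ^ p \<le> (48 * real p) ^ (d * p)"
        proof -
          have "2 ^ 1 \<le> (2::real) ^ (d * p)" using pl(3) d0 by (intro power_increasing) auto
          then have "2 * 3 ^ (d * p) * ((8 * real p) ^ d) ^ p \<le> 2 ^ (d * p) * 3 ^ (d * p) * (8 * real p) ^ (d * p)"
            unfolding power_mult [symmetric] by (intro mult_right_mono) auto
          also have "\<dots> = (2 * 3 * (8 * real p)) ^ (d * p)" by (simp only: power_mult_distrib)
          finally show ?thesis by simp
        qed
        also have "\<dots> \<le> (A * l) ^ (d * p)"
        proof (intro power_mono)
          have "6000 * l \<le> A * l"
            using l1 zero_le_power2 [of R] by (intro mult_right_mono) (auto simp: A_def)
          then show "48 * real p \<le> A * l" using pl(2) l1 by linarith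
        qed simp
        also have "\<dots> = Z ^ p" by (simp add: Z_def power_mult)
        also have "\<dots> < x ^ p" using xZ Z0 pl(3) by (intro power_strict_mono) auto
        finally have "2 * 3 ^ (d * p) * ((8 * real p) ^ d) ^ p * x ^ p < x ^ p * x ^ p"
          using x0 by simp
        moreover have "x ^ (2 * p) = x ^ p * x ^ p" by (simp only: mult_2 power_add)
        moreover have "3 ^ (d * p) * ((8 * real p) ^ d * x) ^ p = 3 ^ (d * p) * ((8 * real p) ^ d) ^ p * x ^ p"
          by (simp only: power_mult_distrib mult.assoc)
        ultimately show ?thesis by linarith
      qed
      moreover have "3 ^ (d * p) * 2 ^ d * K * x < x ^ (2 * p) / 2"
      proof -
        have "2 * (3 ^ (d * p) * 2 ^ d * K) = Z ^ (2 * p - 1)" by (simp add: K_def)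
        also have "\<dots> < x ^ (2 * p - 1)" using xZ Z0 pl(3) by (intro power_strict_mono) auto
        finally have "2 * (3 ^ (d * p) * 2 ^ d * K) * x < x ^ (2 * p - 1) * x" using x0 by simp
        also have "\<dots> = x ^ (2 * p)" using pl(3) by (cases p) auto
        finally show ?thesis by simp
      qed
      ultimately show False by linarith
    qed
  qed
qed

end

section \<open>Distinct lists and partial injections\<close>

definition dlists :: "nat \<Rightarrow> 'a set \<Rightarrow> 'a list set" where
  "dlists k Z = {l. length l = k \<and> distinct l \<and> set l \<subseteq> Z}"

lemma finite_dlists: "finite Z \<Longrightarrow> finite (dlists k Z)"
  by (rule finite_subset [OF _ finite_lists_length_eq [of Z k]]) (auto simp: dlists_def)

lemma dlists_0 [simp]: "dlists 0 Z = {[]}"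
  by (auto simp: dlists_def)

lemma dlists_empty: "finite Z \<Longrightarrow> card Z < k \<Longrightarrow> dlists k Z = {}"
  using card_mono [of Z] by (auto simp: dlists_def distinct_card [symmetric] not_le [symmetric])

lemma dlists_Suc: "dlists (Suc k) Z = (\<lambda>(x, l). x # l) ` (SIGMA x:Z. dlists k (Z - {x}))"
proof (rule Set.set_eqI)
  fix l
  show "l \<in> dlists (Suc k) Z \<longleftrightarrow> l \<in> (\<lambda>(x, l). x # l) ` (SIGMA x:Z. dlists k (Z - {x}))"
    by (cases l) (auto simp: dlists_def image_iff)
qed

lemma sum_dlists_Suc:
  assumes "finite Z"
  shows "(\<Sum>l\<in>dlists (Suc k) Z. f l) = (\<Sum>x\<in>Z. \<Sum>l\<in>dlists k (Z - {x}). f (x # l))"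
proof -
  have "inj_on (\<lambda>(x, l). x # l) (SIGMA x:Z. dlists k (Z - {x}))" by (auto simp: inj_on_def)
  then have "(\<Sum>l\<in>dlists (Suc k) Z. f l) = (\<Sum>(x, l)\<in>(SIGMA x:Z. dlists k (Z - {x})). f (x # l))"
    unfolding dlists_Suc by (subst sum.reindex) (auto simp: case_prod_beta intro!: sum.cong)
  also have "\<dots> = (\<Sum>x\<in>Z. \<Sum>l\<in>dlists k (Z - {x}). f (x # l))"
    using assms by (simp add: sum.Sigma finite_dlists)
  finally show ?thesis .
qed

lemma sum_dlists_Suc':
  assumes "finite Z"
  shows "(\<Sum>l\<in>dlists (Suc k) Z. f l) = (\<Sum>l\<in>dlists k Z. \<Sum>x\<in>Z - set l. f (x # l))"
proof -
  have "dlists (Suc k) Z = (\<lambda>(l, x). x # l) ` (SIGMA l:dlists k Z. Z - set l)"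
  proof (rule Set.set_eqI)
    fix l
    show "l \<in> dlists (Suc k) Z \<longleftrightarrow> l \<in> (\<lambda>(l, x). x # l) ` (SIGMA l:dlists k Z. Z - set l)"
      by (cases l) (auto simp: dlists_def image_iff)
  qed
  moreover have "inj_on (\<lambda>(l, x). x # l) (SIGMA l:dlists k Z. Z - set l)" by (auto simp: inj_on_def)
  ultimately have "(\<Sum>l\<in>dlists (Suc k) Z. f l) = (\<Sum>(l, x)\<in>(SIGMA l:dlists k Z. Z - set l). f (x # l))"
    by (simp only:, subst sum.reindex) (auto simp: case_prod_beta intro!: sum.cong)
  then show ?thesis
    using assms by (simp add: sum.Sigma finite_dlists)
qed

lemma card_dlists_Suc:
  assumes "finite Z"
  shows "real (card (dlists (Suc k) Z)) = (\<Sum>x\<in>Z. real (card (dlists k (Z - {x}))))"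
  using sum_dlists_Suc [OF assms, of "\<lambda>_. 1::real" k] by simp

lemma card_dlists_pos: "finite Z \<Longrightarrow> k \<le> card Z \<Longrightarrow> 0 < card (dlists k Z)"
proof -
  assume Z: "finite Z" "k \<le> card Z"
  obtain l where "set l = Z" "distinct l" using finite_distinct_list [OF Z(1)] by blast
  then have "take k l \<in> dlists k Z"
    using Z distinct_card [of l] set_take_subset [of k l] by (auto simp: dlists_def)
  then show ?thesis using finite_dlists [OF Z(1)] card_gt_0_iff by blast
qed

text \<open>The ratio of the falling factorial of r with k factors to r^k increases with r: delete
  one element from each set and use (r - 1) / (N - 1) <= r / N. The case N = 1 is separated because
  of this quotient.\<close>

lemma card_dlists_ratio:
  fixes K Z :: "'a set"
  assumes "finite K" "finite Z" "card K \<le> card Z"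
  shows "real (card (dlists k K)) * real (card Z) ^ k \<le> real (card K) ^ k * real (card (dlists k Z))"
  using assms
proof (induction k arbitrary: K Z)
  case (Suc k)
  show ?case
  proof (cases "card K = 0")
    case True
    then have "dlists (Suc k) K = {}" using Suc.prems by (intro dlists_empty) auto
    then show ?thesis by simp
  next
    case False
    define r where "r = real (card K)"
    define N where "N = real (card Z)"
    have "1 \<le> card K" using False by linarith
    then have r: "1 \<le> r" "r \<le> N" using Suc.prems(3) by (simp_all add: r_def N_def)
    have step: "real (card (dlists k (K - {x}))) * N ^ k \<le> r ^ k * real (card (dlists k (Z - {y})))"
      if "x \<in> K" "y \<in> Z" for x y
    proof (cases "N = 1")
      case True
      then have "r = 1" using r by simp
      with True have e: "K - {x} = {}" "Z - {y} = {}"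
        using that Suc.prems by (auto simp: r_def N_def card_1_singleton_iff)
      show ?thesis unfolding e using True \<open>r = 1\<close> by simp
    next
      case False
      then have N: "1 < N" using r by simp
      have c: "real (card (K - {x})) = r - 1" "real (card (Z - {y})) = N - 1"
        using that Suc.prems r by (auto simp: r_def N_def of_nat_diff)
      have IH: "real (card (dlists k (K - {x}))) * (N - 1) ^ k \<le> (r - 1) ^ k * real (card (dlists k (Z - {y})))"
        using Suc.IH [of "K - {x}" "Z - {y}"] Suc.prems that c by (simp add: r_def N_def)
      have "(r - 1) / (N - 1) \<le> r / N" using N r by (simp add: field_simps)
      then have "((r - 1) / (N - 1)) ^ k \<le> (r / N) ^ k" using N r by (intro power_mono) auto
      then have q: "(r - 1) ^ k * N ^ k \<le> r ^ k * (N - 1) ^ k"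
        using N by (simp add: power_divide field_simps)
      have "real (card (dlists k (K - {x}))) * N ^ k * (N - 1) ^ k
          \<le> (r - 1) ^ k * real (card (dlists k (Z - {y}))) * N ^ k"
        using mult_right_mono [OF IH, of "N ^ k"] N by (simp add: mult_ac)
      also have "\<dots> \<le> r ^ k * real (card (dlists k (Z - {y}))) * (N - 1) ^ k"
        using mult_right_mono [OF q, of "real (card (dlists k (Z - {y})))"] by (simp add: mult_ac)
      finally show ?thesis using N by simp
    qed
    have "real (card (dlists (Suc k) K)) * N ^ Suc k = (\<Sum>x\<in>K. \<Sum>y\<in>Z. real (card (dlists k (K - {x}))) * N ^ k)"
      using Suc.prems by (simp add: card_dlists_Suc N_def sum_distrib_left sum_distrib_right mult_ac)
    also have "\<dots> \<le> (\<Sum>x\<in>K. \<Sum>y\<in>Z. r ^ k * real (card (dlists k (Z - {y}))))"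
      by (intro sum_mono step)
    also have "\<dots> = r ^ Suc k * real (card (dlists (Suc k) Z))"
      using Suc.prems by (simp add: card_dlists_Suc r_def sum_distrib_left mult_ac)
    finally show ?thesis by (simp add: r_def N_def)
  qed
qed simp

section \<open>Partial injections as sets of pairs, and harmonic arrays on them\<close>

definition graph_on :: "('a \<Rightarrow> 'b) \<Rightarrow> 'a set \<Rightarrow> ('a \<times> 'b) set" where
  "graph_on s E = (\<lambda>i. (i, s i)) ` E"

lemma graph_on_Un: "graph_on s (E \<union> F) = graph_on s E \<union> graph_on s F"
  by (auto simp: graph_on_def)

lemma graph_on_set: "graph_on s (set l) = set (zip l (map s l))"
  by (induction l) (auto simp: graph_on_def)

lemma fst_graph_on [simp]: "fst ` graph_on s E = E"
  by (force simp: graph_on_def)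

lemma snd_graph_on [simp]: "snd ` graph_on s E = s ` E"
  by (force simp: graph_on_def)

lemma inj_on_fst_graph_on [simp]: "inj_on fst (graph_on s E)"
  by (auto simp: graph_on_def inj_on_def)

lemma card_graph_on [simp]: "card (graph_on s E) = card E"
  unfolding graph_on_def by (rule card_image) (auto simp: inj_on_def)

definition partials :: "'a set \<Rightarrow> nat \<Rightarrow> ('a \<times> 'a) set set" where
  "partials X d = {m. m \<subseteq> X \<times> X \<and> card m = d \<and> inj_on fst m \<and> inj_on snd m}"

lemma finite_partials: "finite X \<Longrightarrow> finite (partials X d)"
  by (rule finite_subset [of _ "Pow (X \<times> X)"]) (auto simp: partials_def)

lemma graph_on_in_partials:
  assumes "E \<subseteq> X" "s ` E \<subseteq> X" "inj_on s E" "card E = d"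
  shows "graph_on s E \<in> partials X d"
proof -
  have "inj_on snd (graph_on s E)"
    using assms(3) by (auto simp: graph_on_def inj_on_def)
  moreover have "graph_on s E \<subseteq> X \<times> X" using assms by (auto simp: graph_on_def)
  ultimately show ?thesis using assms by (simp add: partials_def)
qed

lemma
  assumes "length js = length l"
  shows fst_set_zip: "fst ` set (zip js l) = set js" and snd_set_zip: "snd ` set (zip js l) = set l"
    and converse_set_zip: "(set (zip js l))\<inverse> = set (zip l js)"
  using assms by (induction js l rule: list_induct2) auto

lemma partials_zip:
  assumes X: "finite X" and m: "m \<in> partials X e" and js: "js \<in> dlists k (X - fst ` m)" and l: "l \<in> dlists k (X - snd ` m)"
  shows "m \<union> set (zip js l) \<in> partials X (e + k)"
    and "fst ` (m \<union> set (zip js l)) = fst ` m \<union> set js"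
    and "snd ` (m \<union> set (zip js l)) = snd ` m \<union> set l"
proof -
  have len: "length js = length l" "length js = k" using js l by (auto simp: dlists_def)
  show f: "fst ` (m \<union> set (zip js l)) = fst ` m \<union> set js" and g: "snd ` (m \<union> set (zip js l)) = snd ` m \<union> set l"
    using fst_set_zip [OF len(1)] snd_set_zip [OF len(1)] by (simp_all add: image_Un)
  have d: "distinct (map fst (zip js l))" "distinct (map snd (zip js l))" "distinct (zip js l)"
    using js l len by (auto simp: dlists_def distinct_zipI1)
  have disj: "m \<inter> set (zip js l) = {}"
    using js fst_set_zip [OF len(1)] by (force simp: dlists_def)
  have "finite m" using m X finite_subset [of m "X \<times> X"] by (auto simp: partials_def)
  then have "card (m \<union> set (zip js l)) = e + k"
    using m disj d(3) len by (simp add: card_Un_disjoint partials_def distinct_card)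
  moreover have "inj_on fst (m \<union> set (zip js l))"
  proof -
    have "inj_on fst m" "inj_on fst (set (zip js l))" using m d(1) by (auto simp: partials_def distinct_map)
    moreover have "fst ` m \<inter> fst ` set (zip js l) = {}" using js fst_set_zip [OF len(1)] by (auto simp: dlists_def)
    ultimately show ?thesis unfolding inj_on_Un by blast
  qed
  moreover have "inj_on snd (m \<union> set (zip js l))"
  proof -
    have "inj_on snd m" "inj_on snd (set (zip js l))" using m d(2) by (auto simp: partials_def distinct_map)
    moreover have "snd ` m \<inter> snd ` set (zip js l) = {}" using l snd_set_zip [OF len(1)] by (auto simp: dlists_def)
    ultimately show ?thesis unfolding inj_on_Un by blast
  qed
  moreover have "set (zip js l) \<subseteq> X \<times> X"
    using js l by (auto simp: dlists_def dest: set_zip_leftD set_zip_rightD)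
  ultimately show "m \<union> set (zip js l) \<in> partials X (e + k)"
    using m by (auto simp: partials_def)
qed

lemma converse_in_partials: "m \<in> partials X d \<Longrightarrow> m\<inverse> \<in> partials X d"
  unfolding partials_def inj_on_def by (auto; metis fst_conv snd_conv)

lemma converse_in_partials_iff: "m\<inverse> \<in> partials X d \<longleftrightarrow> m \<in> partials X d"
  using converse_in_partials [of m X d] converse_in_partials [of "m\<inverse>" X d] by auto

lemma fst_converse: "fst ` (m\<inverse>) = snd ` m" and snd_converse: "snd ` (m\<inverse>) = fst ` m"
  by force+

text \<open>The analogue for partial injections of a matrix with vanishing row and column sums. Such
  arrays stand for functions of pure degree \<open>d\<close>.\<close>

definition harmonic :: "'a set \<Rightarrow> nat \<Rightarrow> (('a \<times> 'a) set \<Rightarrow> real) \<Rightarrow> bool" where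
  "harmonic X d B \<longleftrightarrow> (\<forall>m. m \<notin> partials X d \<longrightarrow> B m = 0) \<and>
    (\<forall>m\<in>partials X (d - 1). (\<forall>i\<in>X - fst ` m. (\<Sum>j\<in>X - snd ` m. B (insert (i, j) m)) = 0) \<and>
      (\<forall>j\<in>X - snd ` m. (\<Sum>i\<in>X - fst ` m. B (insert (i, j) m)) = 0))"

lemma harmonic_converse:
  assumes "harmonic X d B"
  shows "harmonic X d (\<lambda>m. B (m\<inverse>))"
proof -
  have eq: "(insert (i, j) m)\<inverse> = insert (j, i) (m\<inverse>)" for i j and m :: "('a \<times> 'a) set" by auto
  show ?thesis
    unfolding harmonic_def eq
  proof (intro conjI ballI allI impI)
    fix m assume "m \<notin> partials X d"
    then show "B (m\<inverse>) = 0" using assms by (auto simp: harmonic_def converse_in_partials_iff)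
  next
    fix m i assume "m \<in> partials X (d - 1)" "i \<in> X - fst ` m"
    then show "(\<Sum>j\<in>X - snd ` m. B (insert (j, i) (m\<inverse>))) = 0"
      using assms unfolding harmonic_def by (metis converse_in_partials fst_converse snd_converse)
  next
    fix m j assume "m \<in> partials X (d - 1)" "j \<in> X - snd ` m"
    then show "(\<Sum>i\<in>X - fst ` m. B (insert (j, i) (m\<inverse>))) = 0"
      using assms unfolding harmonic_def by (metis converse_in_partials fst_converse snd_converse)
  qed
qed

lemma harmonic_sum_ran:
  assumes X: "finite X" and B: "harmonic X d B"
  shows "m \<in> partials X e \<Longrightarrow> distinct js \<Longrightarrow> set js \<subseteq> X - fst ` m \<Longrightarrow> e + length js = d \<Longrightarrow>
    Y \<union> Z = X - snd ` m \<Longrightarrow> Y \<inter> Z = {} \<Longrightarrow>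
    (\<Sum>l\<in>dlists (length js) Z. B (m \<union> set (zip js l))) = (- 1) ^ length js * (\<Sum>l\<in>dlists (length js) Y. B (m \<union> set (zip js l)))"
proof (induction js arbitrary: m e Z)
  case (Cons j js)
  define k where "k = length js"
  have fin: "finite Z" "finite Y" using X Cons.prems(5) by (metis finite_Diff finite_Un)+
  have js: "js \<in> dlists k (X - fst ` m)" using Cons.prems by (auto simp: dlists_def k_def)
  have "(\<Sum>l\<in>dlists (Suc k) Z. B (m \<union> set (zip (j # js) l)))
      = (\<Sum>x\<in>Z. \<Sum>l\<in>dlists k (Z - {x}). B (insert (j, x) m \<union> set (zip js l)))"
    by (simp add: sum_dlists_Suc [OF fin(1)])
  also have "\<dots> = (\<Sum>x\<in>Z. (- 1) ^ k * (\<Sum>l\<in>dlists k Y. B (insert (j, x) m \<union> set (zip js l))))"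
  proof (rule sum.cong [OF refl])
    fix x assume x: "x \<in> Z"
    have "m \<union> set (zip [j] [x]) \<in> partials X (e + 1)"
      by (rule partials_zip [OF X Cons.prems(1)]) (use Cons.prems x in \<open>auto simp: dlists_def\<close>)
    then have "insert (j, x) m \<in> partials X (Suc e)" by simp
    then show "(\<Sum>l\<in>dlists k (Z - {x}). B (insert (j, x) m \<union> set (zip js l)))
        = (- 1) ^ k * (\<Sum>l\<in>dlists k Y. B (insert (j, x) m \<union> set (zip js l)))"
      unfolding k_def by (rule Cons.IH) (use Cons.prems x in auto)
  qed
  also have "\<dots> = (- 1) ^ k * (\<Sum>l\<in>dlists k Y. \<Sum>x\<in>Z. B (insert (j, x) m \<union> set (zip js l)))"
    by (simp add: sum_distrib_left [symmetric] sum.swap [of _ Z])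
  also have "\<dots> = (- 1) ^ k * (\<Sum>l\<in>dlists k Y. - (\<Sum>x\<in>Y - set l. B (insert (j, x) m \<union> set (zip js l))))"
  proof (intro arg_cong2 [where f = "(*)"] sum.cong refl)
    fix l assume l: "l \<in> dlists k Y"
    define m' where "m' = m \<union> set (zip js l)"
    have l': "l \<in> dlists k (X - snd ` m)" using l Cons.prems(5) by (auto simp: dlists_def)
    note z = partials_zip [OF X Cons.prems(1) js l']
    have "e + k = d - 1" using Cons.prems(4) by (simp add: k_def)
    then have m': "m' \<in> partials X (d - 1)" using z(1) by (simp add: m'_def)
    have fs: "fst ` m' = fst ` m \<union> set js" "snd ` m' = snd ` m \<union> set l"
      using z(2,3) by (simp_all only: m'_def)
    have "j \<in> X - fst ` m'" unfolding fs using Cons.prems(2,3) by auto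
    with B m' have "(\<Sum>x\<in>X - snd ` m'. B (insert (j, x) m')) = 0"
      unfolding harmonic_def by blast
    moreover have "X - snd ` m' = Z \<union> (Y - set l)"
      unfolding fs using Cons.prems(5,6) l by (auto simp: dlists_def)
    moreover have "Z \<inter> (Y - set l) = {}" using Cons.prems(6) by auto
    ultimately have "(\<Sum>x\<in>Z. B (insert (j, x) m')) + (\<Sum>x\<in>Y - set l. B (insert (j, x) m')) = 0"
      using fin by (simp add: sum.union_disjoint)
    then show "(\<Sum>x\<in>Z. B (insert (j, x) m \<union> set (zip js l))) = - (\<Sum>x\<in>Y - set l. B (insert (j, x) m \<union> set (zip js l)))"
      by (simp add: m'_def)
  qed
  also have "\<dots> = (- 1) ^ Suc k * (\<Sum>l\<in>dlists (Suc k) Y. B (m \<union> set (zip (j # js) l)))"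
    by (simp add: sum_dlists_Suc' [OF fin(2)] sum_negf)
  finally show ?case by (simp add: k_def)
qed simp

lemma harmonic_sum_dom:
  assumes X: "finite X" and B: "harmonic X d B"
    and m: "m \<in> partials X e" and l: "distinct l" "set l \<subseteq> X - snd ` m" "e + length l = d"
    and Y: "Y \<union> Z = X - fst ` m" "Y \<inter> Z = {}"
  shows "(\<Sum>a\<in>dlists (length l) Z. B (m \<union> set (zip a l))) = (- 1) ^ length l * (\<Sum>a\<in>dlists (length l) Y. B (m \<union> set (zip a l)))"
proof -
  have eq: "(m\<inverse> \<union> set (zip l a))\<inverse> = m \<union> set (zip a l)" if "a \<in> dlists (length l) V" for a V
    using that by (simp add: converse_Un converse_set_zip dlists_def)
  have "(\<Sum>a\<in>dlists (length l) Z. B ((m\<inverse> \<union> set (zip l a))\<inverse>)) = (- 1) ^ length l * (\<Sum>a\<in>dlists (length l) Y. B ((m\<inverse> \<union> set (zip l a))\<inverse>))"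
    by (rule harmonic_sum_ran [OF X harmonic_converse [OF B] converse_in_partials [OF m]])
       (use l Y in \<open>simp_all add: fst_converse snd_converse\<close>)
  then show ?thesis by (simp add: eq cong: sum.cong_simp)
qed

text \<open>Domain points and values are both moved, and the two signs \<open>(- 1) ^ k\<close>
  cancel.\<close>

lemma harmonic_sum_both:
  assumes X: "finite X" and B: "harmonic X d B" and m: "m \<in> partials X e" and k: "e + k = d"
    and V: "V \<union> V' = X - fst ` m" "V \<inter> V' = {}" and Y: "Y \<union> Y' = X - snd ` m" "Y \<inter> Y' = {}"
  shows "(\<Sum>a\<in>dlists k V'. \<Sum>l\<in>dlists k Y'. B (m \<union> set (zip a l))) = (\<Sum>a\<in>dlists k V. \<Sum>l\<in>dlists k Y. B (m \<union> set (zip a l)))"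
proof -
  have 1: "(\<Sum>l\<in>dlists k Y'. B (m \<union> set (zip a l))) = (- 1) ^ k * (\<Sum>l\<in>dlists k Y. B (m \<union> set (zip a l)))"
    if "a \<in> dlists k V'" for a
  proof -
    have "length a = k" "distinct a" "set a \<subseteq> X - fst ` m" using that V by (auto simp: dlists_def)
    with harmonic_sum_ran [OF X B m, of a Y Y'] k Y show ?thesis by simp
  qed
  have 2: "(\<Sum>a\<in>dlists k V'. B (m \<union> set (zip a l))) = (- 1) ^ k * (\<Sum>a\<in>dlists k V. B (m \<union> set (zip a l)))"
    if "l \<in> dlists k Y" for l
  proof -
    have "length l = k" "distinct l" "set l \<subseteq> X - snd ` m" using that Y by (auto simp: dlists_def)
    with harmonic_sum_dom [OF X B m, of l V V'] k V show ?thesis by simp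
  qed
  have "(\<Sum>a\<in>dlists k V'. \<Sum>l\<in>dlists k Y'. B (m \<union> set (zip a l))) =
      (\<Sum>a\<in>dlists k V'. (- 1) ^ k * (\<Sum>l\<in>dlists k Y. B (m \<union> set (zip a l))))"
    by (intro sum.cong refl 1)
  also have "\<dots> = (- 1) ^ k * (\<Sum>l\<in>dlists k Y. \<Sum>a\<in>dlists k V'. B (m \<union> set (zip a l)))"
    unfolding sum_distrib_left [symmetric] by (subst sum.swap) (rule refl)
  also have "\<dots> = (- 1) ^ k * (\<Sum>l\<in>dlists k Y. (- 1) ^ k * (\<Sum>a\<in>dlists k V. B (m \<union> set (zip a l))))"
    by (intro arg_cong2 [where f = "(*)"] sum.cong refl 2)
  also have "\<dots> = ((- 1) ^ k * (- 1) ^ k) * (\<Sum>l\<in>dlists k Y. \<Sum>a\<in>dlists k V. B (m \<union> set (zip a l)))"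
    unfolding sum_distrib_left [symmetric] mult.assoc ..
  also have "(- 1) ^ k * (- 1) ^ k = (1::real)" by (simp flip: power_mult_distrib)
  finally show ?thesis by (subst (2) sum.swap) simp
qed

section \<open>Functions of low degree on the alternating group\<close>

text \<open>Conditioning on \<open>key\<close>: on each of its fibres the factor
  \<open>u (key s)\<close> is constant.\<close>

lemma mean_conditional:
  assumes "finite A"
  shows "mean A (\<lambda>s. f s * u (key s)) = mean A (\<lambda>s. mean {t \<in> A. key t = key s} f * u (key s))"
proof -
  have grp: "(\<Sum>s\<in>A. h s) = (\<Sum>y\<in>key ` A. \<Sum>s\<in>{s \<in> A. key s = y}. h s)" for h :: "'a \<Rightarrow> real"
    using assms by (intro sum.group [symmetric]) auto
  have "(\<Sum>s\<in>A. f s * u (key s)) = (\<Sum>s\<in>A. mean {t \<in> A. key t = key s} f * u (key s))"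
    unfolding grp
  proof (rule sum.cong [OF refl])
    fix y assume "y \<in> key ` A"
    define F where "F = {s \<in> A. key s = y}"
    have "F \<noteq> {}" "finite F" using \<open>y \<in> key ` A\<close> assms by (auto simp: F_def)
    then have "real (card F) \<noteq> 0" by simp
    have "(\<Sum>s\<in>F. f s * u (key s)) = (\<Sum>s\<in>F. f s) * u y"
      unfolding sum_distrib_right by (rule sum.cong) (auto simp: F_def)
    also have "\<dots> = real (card F) * (mean F f * u y)"
      using \<open>real (card F) \<noteq> 0\<close> by (simp add: mean_def)
    also have "\<dots> = (\<Sum>s\<in>F. mean F f * u y)" by simp
    also have "\<dots> = (\<Sum>s\<in>F. mean {t \<in> A. key t = key s} f * u (key s))"
      by (rule sum.cong) (auto simp: F_def)
    finally show "(\<Sum>s\<in>{s \<in> A. key s = y}. f s * u (key s)) =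
      (\<Sum>s\<in>{s \<in> A. key s = y}. mean {t \<in> A. key t = key s} f * u (key s))"
      by (simp add: F_def)
  qed
  then show ?thesis by (simp add: mean_def)
qed

lemma ex_permutes_map:
  assumes "I \<in> dlists k X" "J \<in> dlists k X"
  shows "\<exists>p. p permutes X \<and> map p I = J"
  using assms
proof (induction k arbitrary: I J)
  case 0
  then show ?case by (auto intro: permutes_id)
next
  case (Suc k)
  obtain a I' where I: "I = a # I'" "I' \<in> dlists k X" "a \<in> X" "a \<notin> set I'"
    using Suc.prems(1) by (cases I) (auto simp: dlists_def)
  obtain b J' where J: "J = b # J'" "J' \<in> dlists k X" "b \<in> X" "b \<notin> set J'"
    using Suc.prems(2) by (cases J) (auto simp: dlists_def)
  obtain p where p: "p permutes X" "map p I' = J'" using Suc.IH I J by blast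
  have "p a \<notin> set J'"
    unfolding p(2) [symmetric] set_map inj_image_mem_iff [OF permutes_inj [OF p(1)]] by (rule I(4))
  define q where "q = Transposition.transpose (p a) b \<circ> p"
  have "q permutes X"
    unfolding q_def using p I J by (intro permutes_compose permutes_swap_id) (auto simp: permutes_in_image)
  moreover have "map q I' = J'"
  proof -
    have "map q I' = map (Transposition.transpose (p a) b) J'"
      using p(2) by (auto simp: q_def)
    also have "\<dots> = J'"
      using \<open>p a \<notin> set J'\<close> J(4) by (intro map_idI) (auto simp: Transposition.transpose_def)
    finally show ?thesis .
  qed
  moreover have "q a = b" by (simp add: q_def)
  ultimately show ?case unfolding I(1) J(1) by (intro exI [of _ q]) simp
qed

section \<open>The alternating group of a finite set and its multiple transitivity\<close>

locale even_permutations =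
  fixes X :: "nat set"
  assumes finite_X: "finite X"
begin

definition G :: "(nat \<Rightarrow> nat) set" where
  "G = {p. p permutes X \<and> evenperm p}"

lemma permutation_G: "s permutes X \<Longrightarrow> permutation s"
  using finite_X permutation_permutes by blast

lemma G_permutes: "s \<in> G \<Longrightarrow> s permutes X"
  by (simp add: G_def)

lemma finite_G: "finite G"
  using finite_permutations [OF finite_X] by (rule rev_finite_subset) (auto simp: G_def)

lemma id_in_G: "id \<in> G"
  by (simp add: G_def permutes_id)

lemma G_nonempty: "G \<noteq> {}"
  using id_in_G by blast

lemma comp_in_G: "s \<in> G \<Longrightarrow> t \<in> G \<Longrightarrow> s \<circ> t \<in> G"
  by (simp add: G_def permutes_compose evenperm_comp permutation_G)

lemma inv_in_G: "s \<in> G \<Longrightarrow> inv' s \<in> G"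
  by (simp add: G_def permutes_inv evenperm_inv permutation_G)

lemma inv_comp_G: "s \<in> G \<Longrightarrow> inv' s \<circ> s = id" and comp_inv_G: "s \<in> G \<Longrightarrow> s \<circ> inv' s = id"
  using permutes_inv_o G_permutes by blast+

lemma inj_G: "s \<in> G \<Longrightarrow> inj s"
  using permutes_inj G_permutes by blast

lemma image_G: "s \<in> G \<Longrightarrow> s ` X = X"
  using permutes_image G_permutes by blast

lemma G_in_X_iff: "s \<in> G \<Longrightarrow> s i \<in> X \<longleftrightarrow> i \<in> X"
  using permutes_in_image G_permutes by metis

lemma map_in_dlists: "s \<in> G \<Longrightarrow> I \<in> dlists k X \<Longrightarrow> map s I \<in> dlists k X"
  using G_in_X_iff inj_on_subset [OF inj_G] by (auto simp: dlists_def distinct_map)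

lemma bij_betw_translate:
  assumes g: "g \<in> G" and h: "h \<in> G" and m: "\<And>s. s \<in> G \<Longrightarrow> s \<in> A \<longleftrightarrow> h \<circ> s \<circ> g \<in> B" and "A \<subseteq> G" "B \<subseteq> G"
  shows "bij_betw (\<lambda>s. h \<circ> s \<circ> g) A B"
proof (rule bij_betw_byWitness [where f' = "\<lambda>s. inv' h \<circ> s \<circ> inv' g"])
  have 1: "inv' h \<circ> (h \<circ> s \<circ> g) \<circ> inv' g = s" for s
  proof -
    have "inv' h \<circ> (h \<circ> s \<circ> g) \<circ> inv' g = (inv' h \<circ> h) \<circ> s \<circ> (g \<circ> inv' g)" by (simp only: o_assoc)
    then show ?thesis by (simp add: inv_comp_G comp_inv_G g h)
  qed
  have 2: "h \<circ> (inv' h \<circ> s \<circ> inv' g) \<circ> g = s" for s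
  proof -
    have "h \<circ> (inv' h \<circ> s \<circ> inv' g) \<circ> g = (h \<circ> inv' h) \<circ> s \<circ> (inv' g \<circ> g)" by (simp only: o_assoc)
    then show ?thesis by (simp add: inv_comp_G comp_inv_G g h)
  qed
  show "\<forall>s\<in>A. inv' h \<circ> (h \<circ> s \<circ> g) \<circ> inv' g = s" using 1 by blast
  show "\<forall>s\<in>B. h \<circ> (inv' h \<circ> s \<circ> inv' g) \<circ> g = s" using 2 by blast
  show "(\<lambda>s. h \<circ> s \<circ> g) ` A \<subseteq> B" using assms by blast
  show "(\<lambda>s. inv' h \<circ> s \<circ> inv' g) ` B \<subseteq> A"
  proof
    fix t assume "t \<in> (\<lambda>s. inv' h \<circ> s \<circ> inv' g) ` B"
    then obtain s where s: "s \<in> B" "t = inv' h \<circ> s \<circ> inv' g" by blast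
    then have "t \<in> G" using assms by (auto intro!: comp_in_G inv_in_G)
    with m s 2 show "t \<in> A" by metis
  qed
qed

lemma mean_G_translate:
  assumes "g \<in> G" "h \<in> G"
  shows "mean G (\<lambda>s. f (h \<circ> s \<circ> g)) = mean G f"
  by (rule mean_bij [OF bij_betw_translate]) (use assms in \<open>auto intro: comp_in_G\<close>)

lemma mean_G_left: "h \<in> G \<Longrightarrow> mean G (\<lambda>s. f (h \<circ> s)) = mean G f"
  using mean_G_translate [OF id_in_G, of h f] by simp

lemma mean_G_right: "g \<in> G \<Longrightarrow> mean G (\<lambda>s. f (s \<circ> g)) = mean G f"
  using mean_G_translate [OF _ id_in_G, of g f] by simp

text \<open>A permutation of the wrong parity is corrected by exchanging two points outside the
  target, which accounts for the two spare points in \<open>k + 2 \<le> card X\<close>.\<close>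

lemma ex_even_map:
  assumes I: "I \<in> dlists k X" and J: "J \<in> dlists k X" and k: "k + 2 \<le> card X"
  shows "\<exists>g\<in>G. map g I = J"
proof -
  obtain p where p: "p permutes X" "map p I = J" using ex_permutes_map [OF I J] by blast
  have "card (set J) = k" "set J \<subseteq> X" using J by (auto simp: dlists_def distinct_card)
  then have "2 \<le> card (X - set J)"
    using k finite_X by (simp add: card_Diff_subset finite_subset)
  then obtain T where "T \<subseteq> X - set J" "card T = 2"
    by (meson obtain_subset_with_card_n)
  then obtain u v where uv: "u \<in> X - set J" "v \<in> X - set J" "u \<noteq> v"
    by (auto simp: card_2_iff)
  define q where "q = (if evenperm p then p else Transposition.transpose u v \<circ> p)"
  have tr: "Transposition.transpose u v permutes X" using uv by (intro permutes_swap_id) auto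
  have "q \<in> G"
    using p tr uv
    by (auto simp: q_def G_def permutes_compose evenperm_comp evenperm_swap permutation_G)
  moreover have "map q I = J"
  proof (cases "evenperm p")
    case False
    have "map (Transposition.transpose u v) J = J"
      using uv by (intro map_idI) (auto simp: Transposition.transpose_def)
    then have "map (Transposition.transpose u v \<circ> p) I = J"
      using p(2) by (metis map_map)
    then show ?thesis using False by (simp add: q_def)
  qed (simp add: q_def p)
  ultimately show ?thesis by blast
qed

lemma card_map_fibre:
  assumes "I \<in> dlists k X" "I' \<in> dlists k X" "J \<in> dlists k X" "J' \<in> dlists k X" "k + 2 \<le> card X"
  shows "card {s \<in> G. map s I = J} = card {s \<in> G. map s I' = J'}"
proof -
  obtain g where g: "g \<in> G" "map g I' = I" using ex_even_map assms by blast
  obtain h where h: "h \<in> G" "map h J = J'" using ex_even_map assms by blast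
  have "bij_betw (\<lambda>s. h \<circ> s \<circ> g) {s \<in> G. map s I = J} {s \<in> G. map s I' = J'}"
  proof (rule bij_betw_translate [OF g(1) h(1)])
    fix s assume s: "s \<in> G"
    have "map (h \<circ> s \<circ> g) I' = map h (map s I)" using g(2) by auto
    moreover have "map h (map s I) = map h J \<longleftrightarrow> map s I = J"
      by (rule inj_map_eq_map [OF inj_G [OF h(1)]])
    ultimately show "s \<in> {s \<in> G. map s I = J} \<longleftrightarrow> h \<circ> s \<circ> g \<in> {s \<in> G. map s I' = J'}"
      using s g h comp_in_G by auto
  qed auto
  then show ?thesis by (rule bij_betw_same_card)
qed

lemma card_map_fibre_pos:
  assumes "I \<in> dlists k X" "J \<in> dlists k X" "k + 2 \<le> card X"
  shows "0 < card {s \<in> G. map s I = J}"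
proof -
  have "{s \<in> G. map s I = J} \<noteq> {}" using ex_even_map [OF assms] by blast
  then show ?thesis using finite_G by (simp add: card_gt_0_iff)
qed

lemma dlists_append:
  "I \<in> dlists d X \<Longrightarrow> a \<in> dlists k (X - set I) \<Longrightarrow> I @ a \<in> dlists (d + k) X"
  by (auto simp: dlists_def)

text \<open>Given \<open>map s I = J\<close>, the values at further points are uniform among the
  lists that avoid \<open>J\<close>, because by transitivity all fibres have the same size.\<close>

lemma mean_fibre_map:
  assumes I: "I \<in> dlists d X" and a: "a \<in> dlists k (X - set I)" and J: "J \<in> dlists d X"
    and dk: "d + k + 2 \<le> card X"
  shows "mean {s \<in> G. map s I = J} (\<lambda>s. f (map s a)) = mean (dlists k (X - set J)) f"
proof (rule mean_fibres)
  have Ia: "I @ a \<in> dlists (d + k) X" by (rule dlists_append [OF I a])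
  have len: "length I = d" "length J = d" using I J by (auto simp: dlists_def)
  show "0 < card {s \<in> G. map s (I @ a) = I @ a}"
    by (rule card_map_fibre_pos [OF Ia Ia dk])
  fix l assume l: "l \<in> dlists k (X - set J)"
  have "{s \<in> {s \<in> G. map s I = J}. map s a = l} = {s \<in> G. map s (I @ a) = J @ l}"
    using len by auto
  then show "card {s \<in> {s \<in> G. map s I = J}. map s a = l} = card {s \<in> G. map s (I @ a) = I @ a}"
    using card_map_fibre [OF Ia Ia dlists_append [OF J l] Ia dk] by simp
next
  fix s assume s: "s \<in> {s \<in> G. map s I = J}"
  have "map s (I @ a) \<in> dlists (d + k) X"
    using s dlists_append [OF I a] by (intro map_in_dlists) auto
  then show "map s a \<in> dlists k (X - set J)"
    using s a by (auto simp: dlists_def)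
qed (use finite_G finite_X in \<open>auto intro: finite_dlists\<close>)

lemma mean_G_map:
  assumes "a \<in> dlists k X" "k + 2 \<le> card X"
  shows "mean G (\<lambda>s. f (map s a)) = mean (dlists k X) f"
  using mean_fibre_map [of "[]" 0 a k "[]" f] assms by simp

section \<open>Umvirates and the filtration by degree\<close>

definition ext :: "(nat \<times> nat) set \<Rightarrow> (nat \<Rightarrow> nat) set" where
  "ext m = {s \<in> G. \<forall>(i, j)\<in>m. s i = j}"

text \<open>The average over the umvirate of \<open>m\<close>, with the value 0 if no even
  permutation extends \<open>m\<close>.\<close>

definition restr :: "((nat \<Rightarrow> nat) \<Rightarrow> real) \<Rightarrow> (nat \<times> nat) set \<Rightarrow> real" where
  "restr f m = mean (ext m) f"

lemma ext_subset_G: "ext m \<subseteq> G"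
  by (auto simp: ext_def)

lemma finite_ext: "finite (ext m)"
  using finite_subset [OF ext_subset_G finite_G] .

lemma ext_graph_on: "ext (graph_on s E) = {t \<in> G. \<forall>i\<in>E. t i = s i}"
  by (auto simp: ext_def graph_on_def)

lemma ext_graph_on_map: "ext (graph_on s (set I)) = {t \<in> G. map t I = map s I}"
  by (auto simp: ext_graph_on)

lemma ext_eq_graph_on: "s \<in> ext m \<Longrightarrow> m = graph_on s (fst ` m)"
  by (force simp: ext_def graph_on_def)

lemma mean_G_restr:
  "mean G (\<lambda>s. f s * u (map s I)) = mean G (\<lambda>s. restr f (graph_on s (set I)) * u (map s I))"
  using mean_conditional [OF finite_G, of f u "\<lambda>s. map s I"]
  by (simp add: restr_def ext_graph_on_map)

lemma ext_translate:
  assumes "g \<in> G" "h \<in> G" "s \<in> G"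
  shows "h \<circ> s \<circ> g \<in> ext m \<longleftrightarrow> s \<in> ext (map_prod g (inv' h) ` m)"
proof -
  have "h (s (g i)) = j \<longleftrightarrow> s (g i) = inv' h j" for i j
    using permutes_inv_eq [OF G_permutes [OF assms(2)]] by metis
  then have "(\<forall>(i, j)\<in>m. (h \<circ> s \<circ> g) i = j) \<longleftrightarrow> (\<forall>(i, j)\<in>m. s (g i) = inv' h j)"
    by simp
  also have "\<dots> \<longleftrightarrow> (\<forall>(i, j)\<in>map_prod g (inv' h) ` m. s i = j)"
    by (auto simp: case_prod_beta)
  finally show ?thesis
    using assms comp_in_G by (simp add: ext_def)
qed

definition graphs_upto :: "nat \<Rightarrow> (nat \<times> nat) set set" where
  "graphs_upto d = {m. m \<subseteq> X \<times> X \<and> card m \<le> d}"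

lemma finite_graphs_upto: "finite (graphs_upto d)"
  by (rule finite_subset [of _ "Pow (X \<times> X)"]) (auto simp: graphs_upto_def finite_X)

lemma graphs_upto_mono: "d \<le> e \<Longrightarrow> graphs_upto d \<subseteq> graphs_upto e"
  by (auto simp: graphs_upto_def)

lemma graphs_upto_map_prod:
  assumes "m \<in> graphs_upto d" "g \<in> G" "h \<in> G"
  shows "map_prod g h ` m \<in> graphs_upto d"
proof -
  have "finite m" using assms(1) finite_X finite_subset [of m "X \<times> X"] by (auto simp: graphs_upto_def)
  then have "card (map_prod g h ` m) \<le> d"
    using assms(1) card_image_le [of m "map_prod g h"] by (auto simp: graphs_upto_def)
  then show ?thesis
    using assms G_in_X_iff by (auto simp: graphs_upto_def)
qed

text \<open>Degree at most \<open>d\<close>: the span of the indicators of umvirates of size at most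
  \<open>d\<close>, with equality tested on \<open>G\<close> only.\<close>

definition low :: "nat \<Rightarrow> ((nat \<Rightarrow> nat) \<Rightarrow> real) \<Rightarrow> bool" where
  "low d f \<longleftrightarrow> (\<exists>c. \<forall>s\<in>G. f s = (\<Sum>m\<in>graphs_upto d. c m * indicator (ext m) s))"

definition orth :: "nat \<Rightarrow> ((nat \<Rightarrow> nat) \<Rightarrow> real) \<Rightarrow> bool" where
  "orth d f \<longleftrightarrow> (\<forall>m\<in>graphs_upto d. (\<Sum>s\<in>ext m. f s) = 0)"

lemma sum_indicator_ext:
  fixes f :: "(nat \<Rightarrow> nat) \<Rightarrow> real"
  shows "(\<Sum>s\<in>G. f s * indicator (ext m) s) = (\<Sum>s\<in>ext m. f s)"
proof -
  have "(\<Sum>s\<in>G. f s * indicator (ext m) s) = (\<Sum>s\<in>G. if s \<in> ext m then f s else 0)"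
    by (intro sum.cong) (auto simp: indicator_def)
  also have "\<dots> = (\<Sum>s\<in>G \<inter> ext m. f s)" using finite_G by (simp add: sum.inter_restrict)
  finally show ?thesis using ext_subset_G by (simp add: Int_absorb1)
qed

lemma low_orth:
  assumes "low d f" "orth d g"
  shows "mean G (\<lambda>s. f s * g s) = 0"
proof -
  obtain c where c: "\<And>s. s \<in> G \<Longrightarrow> f s = (\<Sum>m\<in>graphs_upto d. c m * indicator (ext m) s)"
    using assms(1) by (auto simp: low_def)
  have "(\<Sum>s\<in>G. f s * g s) = (\<Sum>s\<in>G. \<Sum>m\<in>graphs_upto d. c m * (g s * indicator (ext m) s))"
    by (intro sum.cong refl) (simp add: c sum_distrib_left mult_ac)
  also have "\<dots> = (\<Sum>m\<in>graphs_upto d. c m * (\<Sum>s\<in>G. g s * indicator (ext m) s))"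
    by (subst sum.swap) (simp add: sum_distrib_left)
  also have "\<dots> = 0" using assms(2) by (simp add: sum_indicator_ext orth_def)
  finally show ?thesis by (simp add: mean_def)
qed

lemma orth_low: "orth d g \<Longrightarrow> low d f \<Longrightarrow> mean G (\<lambda>s. g s * f s) = 0"
  using low_orth [of d f g] by (simp add: mult.commute)

lemma low_cong: "low d f \<Longrightarrow> (\<And>s. s \<in> G \<Longrightarrow> f s = g s) \<Longrightarrow> low d g"
  by (simp add: low_def)

lemma low_zero: "low d (\<lambda>s. 0)"
  unfolding low_def by (rule exI [of _ "\<lambda>_. 0"]) simp

lemma low_cmult: "low d f \<Longrightarrow> low d (\<lambda>s. a * f s)"
proof -
  assume "low d f"
  then obtain c where "\<And>s. s \<in> G \<Longrightarrow> f s = (\<Sum>m\<in>graphs_upto d. c m * indicator (ext m) s)"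
    by (auto simp: low_def)
  then show ?thesis
    unfolding low_def by (intro exI [of _ "\<lambda>m. a * c m"]) (simp add: sum_distrib_left mult.assoc)
qed

lemma low_add:
  assumes "low d f" "low d g"
  shows "low d (\<lambda>s. f s + g s)"
proof -
  obtain c where "\<And>s. s \<in> G \<Longrightarrow> f s = (\<Sum>m\<in>graphs_upto d. c m * indicator (ext m) s)"
    using assms(1) by (auto simp: low_def)
  moreover obtain e where "\<And>s. s \<in> G \<Longrightarrow> g s = (\<Sum>m\<in>graphs_upto d. e m * indicator (ext m) s)"
    using assms(2) by (auto simp: low_def)
  ultimately show ?thesis
    unfolding low_def by (intro exI [of _ "\<lambda>m. c m + e m"]) (simp add: sum.distrib distrib_right)
qed

lemma low_diff: "low d f \<Longrightarrow> low d g \<Longrightarrow> low d (\<lambda>s. f s - g s)"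
  using low_add [of d f "\<lambda>s. - 1 * g s"] low_cmult [of d g "- 1"] by simp

lemma low_sum: "(\<And>i. i \<in> I \<Longrightarrow> low d (f i)) \<Longrightarrow> low d (\<lambda>s. \<Sum>i\<in>I. f i s)"
  by (induction I rule: infinite_finite_induct) (auto intro: low_zero low_add)

lemma low_indicator:
  assumes "m \<in> graphs_upto d"
  shows "low d (indicator (ext m))"
  unfolding low_def
proof (intro exI [of _ "\<lambda>m'. if m' = m then 1 else 0"] ballI)
  fix s assume "s \<in> G"
  show "indicator (ext m) s = (\<Sum>m'\<in>graphs_upto d. (if m' = m then 1 else 0) * (indicator (ext m') s :: real))"
    using assms finite_graphs_upto [of d]
    by (subst sum.mono_neutral_right [of _ "{m}"]) auto
qed

lemma low_mono:
  assumes "low d f" "d \<le> e"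
  shows "low e f"
proof -
  obtain c where c: "\<And>s. s \<in> G \<Longrightarrow> f s = (\<Sum>m\<in>graphs_upto d. c m * indicator (ext m) s)"
    using assms(1) by (auto simp: low_def)
  have "low e (\<lambda>s. \<Sum>m\<in>graphs_upto d. c m * indicator (ext m) s)"
    using graphs_upto_mono [OF assms(2)] by (intro low_sum low_cmult low_indicator) auto
  then show ?thesis by (rule low_cong) (simp add: c)
qed

lemma orth_mono: "orth e f \<Longrightarrow> d \<le> e \<Longrightarrow> orth d f"
  using graphs_upto_mono by (force simp: orth_def)

lemma orth_add: "orth d f \<Longrightarrow> orth d g \<Longrightarrow> orth d (\<lambda>s. f s + g s)"
  by (simp add: orth_def sum.distrib)

lemma orth_diff: "orth d f \<Longrightarrow> orth d g \<Longrightarrow> orth d (\<lambda>s. f s - g s)"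
  by (simp add: orth_def sum_subtractf)

lemma orth_cmult: "orth d f \<Longrightarrow> orth d (\<lambda>s. a * f s)"
  by (simp add: orth_def sum_distrib_left [symmetric])

lemma orth_zero: "orth d (\<lambda>s. 0)"
  by (simp add: orth_def)

lemma orth_sum: "(\<And>i. i \<in> I \<Longrightarrow> orth d (f i)) \<Longrightarrow> orth d (\<lambda>s. \<Sum>i\<in>I. f i s)"
  by (induction I rule: infinite_finite_induct) (auto intro: orth_zero orth_add)

lemma low_translate:
  assumes f: "low d f" and g: "g \<in> G" and h: "h \<in> G"
  shows "low d (\<lambda>s. f (h \<circ> s \<circ> g))"
proof -
  obtain c where c: "\<And>s. s \<in> G \<Longrightarrow> f s = (\<Sum>m\<in>graphs_upto d. c m * indicator (ext m) s)"
    using f by (auto simp: low_def)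
  have "low d (\<lambda>s. \<Sum>m\<in>graphs_upto d. c m * indicator (ext (map_prod g (inv' h) ` m)) s)"
    using g h inv_in_G by (intro low_sum low_cmult low_indicator graphs_upto_map_prod) auto
  then show ?thesis
    by (rule low_cong) (use c g h comp_in_G ext_translate in \<open>simp add: indicator_def\<close>)
qed

lemma orth_translate:
  assumes f: "orth d f" and g: "g \<in> G" and h: "h \<in> G"
  shows "orth d (\<lambda>s. f (h \<circ> s \<circ> g))"
  unfolding orth_def
proof
  fix m assume m: "m \<in> graphs_upto d"
  define m' where "m' = map_prod (inv' g) h ` m"
  have m': "m' \<in> graphs_upto d" unfolding m'_def using m g h inv_in_G by (intro graphs_upto_map_prod) auto
  have undo: "map_prod g (inv' h) ` m' = m"
  proof -
    have "g (inv' g i) = i" "inv' h (h i) = i" for i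
      using comp_inv_G [OF g] inv_comp_G [OF h] by (metis comp_apply id_apply)+
    then show ?thesis by (simp add: m'_def image_image map_prod_def case_prod_beta)
  qed
  have "bij_betw (\<lambda>s. h \<circ> s \<circ> g) (ext m) (ext m')"
    using bij_betw_translate [OF g h, of "ext m" "ext m'"] ext_translate [OF g h, of _ m'] ext_subset_G
    by (simp add: undo)
  then have "(\<Sum>s\<in>ext m. f (h \<circ> s \<circ> g)) = (\<Sum>s\<in>ext m'. f s)"
    by (rule sum.reindex_bij_betw)
  then show "(\<Sum>s\<in>ext m. f (h \<circ> s \<circ> g)) = 0" using f m' by (simp add: orth_def)
qed

lemma low_orth_zero:
  assumes "low d f" "orth d f" "s \<in> G"
  shows "f s = 0"
proof -
  have "mean G (\<lambda>s. f s * f s) = 0" using low_orth assms by blast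
  then have "(\<Sum>s\<in>G. f s * f s) = 0" using G_nonempty finite_G by (simp add: mean_def)
  then have "\<forall>s\<in>G. f s * f s = 0"
    by (subst (asm) sum_nonneg_eq_0_iff) (auto simp: finite_G)
  then show ?thesis using assms(3) by simp
qed

lemma ex_projection: "\<exists>u. low d u \<and> orth d (\<lambda>s. f s - u s)"
proof -
  obtain c where c: "\<And>m. m \<in> graphs_upto d \<Longrightarrow>
      (\<Sum>s\<in>G. (f s - (\<Sum>m\<in>graphs_upto d. c m * indicator (ext m) s)) * indicator (ext m) s) = 0"
    using sum_projection [OF finite_graphs_upto finite_G, of d f "\<lambda>m. indicator (ext m)"] by auto
  define u where "u s = (\<Sum>m\<in>graphs_upto d. c m * indicator (ext m) s)" for s
  have "low d u" unfolding u_def low_def by blast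
  moreover have "orth d (\<lambda>s. f s - u s)"
    using c by (simp add: orth_def sum_indicator_ext [symmetric] u_def)
  ultimately show ?thesis by blast
qed

text \<open>By \<open>low_orth_zero\<close> the choice is unique on \<open>G\<close>; values
  elsewhere are arbitrary.\<close>

definition proj :: "nat \<Rightarrow> ((nat \<Rightarrow> nat) \<Rightarrow> real) \<Rightarrow> (nat \<Rightarrow> nat) \<Rightarrow> real" where
  "proj d f = (SOME u. low d u \<and> orth d (\<lambda>s. f s - u s))"

lemma low_proj: "low d (proj d f)" and orth_proj: "orth d (\<lambda>s. f s - proj d f s)"
  using someI_ex [OF ex_projection [of d f]] by (simp_all add: proj_def)

text \<open>The pure degree \<open>d\<close> part for \<open>0 < d\<close>. Truncated subtraction
  makes it 0 for d = 0; the constant part is \<open>proj 0 f\<close>.\<close>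

definition layer :: "nat \<Rightarrow> ((nat \<Rightarrow> nat) \<Rightarrow> real) \<Rightarrow> (nat \<Rightarrow> nat) \<Rightarrow> real" where
  "layer d f s = proj d f s - proj (d - 1) f s"

lemma low_layer: "low d (layer d f)"
  unfolding layer_def [abs_def] by (intro low_diff low_proj low_mono [OF low_proj]) simp

lemma orth_layer: "0 < d \<Longrightarrow> orth (d - 1) (layer d f)"
proof -
  have "orth (d - 1) (\<lambda>s. (f s - proj (d - 1) f s) - (f s - proj d f s))"
    by (intro orth_diff orth_proj orth_mono [OF orth_proj [of d f]]) simp
  then show ?thesis by (simp add: layer_def [abs_def])
qed

lemma layer_decomposition: "f s = proj 0 f s + (\<Sum>d\<in>{1..D}. layer d f s) + (f s - proj D f s)"
proof -
  have "proj D f s = proj 0 f s + (\<Sum>d\<in>{1..D}. layer d f s)"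
    by (induction D) (simp_all add: layer_def)
  then show ?thesis by simp
qed

end

section \<open>Harmonic coefficient arrays\<close>

lemma card_dlists_full: "finite K \<Longrightarrow> card K = k \<Longrightarrow> card (dlists k K) = fact k"
proof (induction k arbitrary: K)
  case (Suc k)
  have "real (card (dlists (Suc k) K)) = (\<Sum>x\<in>K. real (card (dlists k (K - {x}))))"
    by (rule card_dlists_Suc [OF Suc.prems(1)])
  also have "\<dots> = (\<Sum>x\<in>K. real (fact k))"
    using Suc by (intro sum.cong refl) simp
  also have "\<dots> = real (fact (Suc k))" using Suc.prems by (simp add: algebra_simps)
  finally show ?case using of_nat_eq_iff by blast
qed simp

lemma sum_dlists_set:
  fixes H :: "'a set \<Rightarrow> real"
  assumes "finite Y"
  shows "(\<Sum>a\<in>dlists k Y. H (set a)) = fact k * (\<Sum>E\<in>{E. E \<subseteq> Y \<and> card E = k}. H E)"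
proof -
  have "(\<Sum>a\<in>dlists k Y. H (set a)) = (\<Sum>E\<in>{E. E \<subseteq> Y \<and> card E = k}. \<Sum>a\<in>{a \<in> dlists k Y. set a = E}. H (set a))"
    using assms by (intro sum.group [symmetric] finite_dlists) (auto simp: dlists_def distinct_card)
  also have "\<dots> = (\<Sum>E\<in>{E. E \<subseteq> Y \<and> card E = k}. fact k * H E)"
  proof (rule sum.cong [OF refl])
    fix E assume E: "E \<in> {E. E \<subseteq> Y \<and> card E = k}"
    then have "finite E" using assms finite_subset by auto
    have "set a = E" if "a \<in> dlists k E" for a
      using that E card_subset_eq [OF \<open>finite E\<close>, of "set a"] by (simp add: dlists_def distinct_card)
    then have "dlists k E \<subseteq> {a \<in> dlists k Y. set a = E}" using E by (auto simp: dlists_def)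
    moreover have "{a \<in> dlists k Y. set a = E} \<subseteq> dlists k E" by (auto simp: dlists_def)
    ultimately have "{a \<in> dlists k Y. set a = E} = dlists k E" by blast
    then have "card {a \<in> dlists k Y. set a = E} = fact k"
      using E \<open>finite E\<close> by (simp add: card_dlists_full)
    then show "(\<Sum>a\<in>{a \<in> dlists k Y. set a = E}. H (set a)) = fact k * H E" by simp
  qed
  finally show ?thesis by (simp add: sum_distrib_left)
qed

lemma sum_Pow_power_card:
  fixes q :: real
  shows "finite E \<Longrightarrow> (\<Sum>S\<in>Pow E. q ^ card (E - S)) = (1 + q) ^ card E"
proof (induction E rule: finite_induct)
  case (insert i E)
  have "q ^ card (insert i E - S) = q * q ^ card (E - S)" "q ^ card (insert i E - insert i S) = q ^ card (E - S)"
    if "S \<in> Pow E" for S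
  proof -
    have "insert i E - S = insert i (E - S)" "insert i E - insert i S = E - S"
      using that insert.hyps by auto
    then show "q ^ card (insert i E - S) = q * q ^ card (E - S)" "q ^ card (insert i E - insert i S) = q ^ card (E - S)"
      using insert.hyps by auto
  qed
  then show ?case
    using insert unfolding sum_Pow_insert [OF insert.hyps]
    by (simp add: sum_distrib_left [symmetric] distrib_right cong: sum.cong_simp)
qed simp

context even_permutations
begin

definition subs :: "nat \<Rightarrow> nat set set" where
  "subs d = {E. E \<subseteq> X \<and> card E = d}"

text \<open>Synthesis of a function from an array, the counterpart of the extraction of averages in
  \<open>coefs\<close>. Comparing the two in \<open>energy\<close> amounts to frame bounds.\<close>

definition gsum :: "nat \<Rightarrow> ((nat \<times> nat) set \<Rightarrow> real) \<Rightarrow> (nat \<Rightarrow> nat) \<Rightarrow> real" where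
  "gsum d B s = (\<Sum>E\<in>subs d. B (graph_on s E))"

definition energy :: "nat \<Rightarrow> ((nat \<times> nat) set \<Rightarrow> real) \<Rightarrow> real" where
  "energy d B = (\<Sum>E\<in>subs d. mean G (\<lambda>s. (B (graph_on s E))\<^sup>2))"

definition coefs :: "nat \<Rightarrow> ((nat \<Rightarrow> nat) \<Rightarrow> real) \<Rightarrow> (nat \<times> nat) set \<Rightarrow> real" where
  "coefs d f m = (if m \<in> partials X d then restr f m else 0)"

lemma finite_subs: "finite (subs d)"
  by (rule finite_subset [of _ "Pow X"]) (auto simp: subs_def finite_X)

lemma subs_finite: "E \<in> subs d \<Longrightarrow> finite E"
  using finite_X finite_subset by (auto simp: subs_def)

lemma energy_nonneg: "0 \<le> energy d B"
  unfolding energy_def by (intro sum_nonneg mean_nonneg) auto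

lemma subs_list: "E \<in> subs d \<Longrightarrow> \<exists>I\<in>dlists d X. set I = E"
proof -
  assume E: "E \<in> subs d"
  obtain I where I: "set I = E" "distinct I" using finite_distinct_list [OF subs_finite [OF E]] by blast
  then have "length I = d" using E distinct_card [OF I(2)] by (simp add: subs_def)
  then have "I \<in> dlists d X" using E I by (simp add: subs_def dlists_def)
  with I show ?thesis by blast
qed

lemma graph_on_partials: "s \<in> G \<Longrightarrow> E \<in> subs d \<Longrightarrow> graph_on s E \<in> partials X d"
  using inj_on_subset [OF inj_G] G_in_X_iff by (intro graph_on_in_partials) (auto simp: subs_def)

lemma coefs_graph_on: "s \<in> G \<Longrightarrow> E \<in> subs d \<Longrightarrow> coefs d f (graph_on s E) = restr f (graph_on s E)"
  by (simp add: coefs_def graph_on_partials)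

text \<open>For a fixed \<open>s\<close>, the relations of size \<open>d\<close> contained in its
  graph correspond to their domains.\<close>

lemma sum_ext_graphs:
  assumes s: "s \<in> G"
  shows "(\<Sum>m\<in>{m. m \<subseteq> X \<times> X \<and> card m = d}. c m * indicator (ext m) s) = gsum d c s"
proof -
  have "bij_betw (graph_on s) (subs d) {m. m \<subseteq> X \<times> X \<and> card m = d \<and> s \<in> ext m}"
  proof (rule bij_betw_byWitness [where f' = "\<lambda>m. fst ` m"])
    show "\<forall>m\<in>{m. m \<subseteq> X \<times> X \<and> card m = d \<and> s \<in> ext m}. graph_on s (fst ` m) = m"
      using ext_eq_graph_on by auto
    show "graph_on s ` subs d \<subseteq> {m. m \<subseteq> X \<times> X \<and> card m = d \<and> s \<in> ext m}"
      using s G_in_X_iff by (auto simp: subs_def ext_graph_on graph_on_def [of s])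
        (auto simp: graph_on_def [symmetric] ext_graph_on)
    show "(\<lambda>m. fst ` m) ` {m. m \<subseteq> X \<times> X \<and> card m = d \<and> s \<in> ext m} \<subseteq> subs d"
    proof clarify
      fix m assume m: "m \<subseteq> X \<times> X" "s \<in> ext m"
      then have "m = graph_on s (fst ` m)" using ext_eq_graph_on by blast
      then have "card m = card (fst ` m)" by (metis card_graph_on)
      with m show "fst ` m \<in> subs (card m)" by (auto simp: subs_def)
    qed
  qed auto
  then have "gsum d c s = (\<Sum>m\<in>{m. m \<subseteq> X \<times> X \<and> card m = d \<and> s \<in> ext m}. c m)"
    unfolding gsum_def by (rule sum.reindex_bij_betw)
  also have "\<dots> = (\<Sum>m\<in>{m. m \<subseteq> X \<times> X \<and> card m = d}. c m * indicator (ext m) s)"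
  proof (rule sum.mono_neutral_cong_left)
    show "finite {m. m \<subseteq> X \<times> X \<and> card m = d}"
      by (rule finite_subset [of _ "Pow (X \<times> X)"]) (auto simp: finite_X)
  qed (auto simp: indicator_def)
  finally show ?thesis ..
qed

lemma partials_list:
  assumes "m \<in> partials X d"
  shows "\<exists>I\<in>dlists d X. \<exists>J\<in>dlists d X. m = set (zip I J) \<and> ext m = {s \<in> G. map s I = J}"
proof -
  have m: "m \<subseteq> X \<times> X" "card m = d" "inj_on fst m" "inj_on snd m" using assms by (auto simp: partials_def)
  obtain l where l: "set l = m" "distinct l"
    using finite_distinct_list [of m] finite_subset [OF m(1)] finite_X by auto
  have len: "length l = d" using l m(2) distinct_card by fastforce
  have IJ: "map fst l \<in> dlists d X" "map snd l \<in> dlists d X"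
    using l m len by (auto simp: dlists_def distinct_map)
  have z: "zip (map fst l) (map snd l) = l" by (simp add: zip_map_fst_snd)
  have "ext m = {s \<in> G. map s (map fst l) = map snd l}"
    using l(1) by (auto simp: ext_def)
  moreover have "m = set (zip (map fst l) (map snd l))" using l(1) z by simp
  ultimately show ?thesis using IJ by blast
qed

lemma card_ext_eq:
  assumes "m \<in> partials X d" "m' \<in> partials X d" "d + 2 \<le> card X"
  shows "card (ext m) = card (ext m')"
proof -
  obtain I J where 1: "I \<in> dlists d X" "J \<in> dlists d X" "ext m = {s \<in> G. map s I = J}"
    using partials_list [OF assms(1)] by blast
  obtain I' J' where 2: "I' \<in> dlists d X" "J' \<in> dlists d X" "ext m' = {s \<in> G. map s I' = J'}"
    using partials_list [OF assms(2)] by blast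
  show ?thesis
    unfolding 1(3) 2(3) by (rule card_map_fibre [OF 1(1) 2(1) 1(2) 2(2) assms(3)])
qed

lemma insert_in_partials:
  assumes "m \<in> partials X (d - 1)" "0 < d" "i \<in> X - fst ` m" "j \<in> X - snd ` m"
  shows "insert (i, j) m \<in> partials X d"
proof -
  have "m \<union> set (zip [i] [j]) \<in> partials X (d - 1 + 1)"
    by (rule partials_zip [OF finite_X assms(1)]) (use assms in \<open>auto simp: dlists_def\<close>)
  then show ?thesis using assms(2) by simp
qed

text \<open>A row or column sum is proportional to the sum of \<open>f\<close> over the umvirate of
  \<open>m\<close>, whose indicator has degree \<open>d - 1\<close>. Proportionality rests on
  umvirates of equal size having equal cardinality, hence \<open>d + 2 \<le> card X\<close>.\<close>

lemma harmonic_coefs: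
  assumes f: "orth (d - 1) f" and d: "0 < d" "d + 2 \<le> card X"
  shows "harmonic X d (coefs d f)"
  unfolding harmonic_def
proof (intro conjI ballI allI impI)
  fix m assume "m \<notin> partials X d"
  then show "coefs d f m = 0" by (simp add: coefs_def)
next
  fix m i assume m: "m \<in> partials X (d - 1)" and i: "i \<in> X - fst ` m"
  have zero: "(\<Sum>s\<in>ext m. f s) = 0"
    using f m by (auto simp: orth_def graphs_upto_def partials_def)
  have ext: "(\<Sum>j\<in>X - snd ` m. \<Sum>s\<in>ext (insert (i, j) m). f s) = (\<Sum>s\<in>ext m. f s)"
  proof -
    have "(\<Sum>s\<in>ext m. f s) = (\<Sum>j\<in>X - snd ` m. \<Sum>s\<in>{s \<in> ext m. s i = j}. f s)"
    proof (rule sum.group [symmetric])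
      show "(\<lambda>s. s i) ` ext m \<subseteq> X - snd ` m"
      proof clarify
        fix s assume s: "s \<in> ext m"
        then have sG: "s \<in> G" using ext_subset_G by blast
        have "s i \<notin> snd ` m"
        proof
          assume "s i \<in> snd ` m"
          then obtain i' where "(i', s i) \<in> m" by force
          then have "s i' = s i" using s by (auto simp: ext_def)
          then have "i' = i" using inj_G [OF sG] by (simp add: inj_eq)
          with \<open>(i', s i) \<in> m\<close> i show False by force
        qed
        then show "s i \<in> X - snd ` m" using i sG by (simp add: G_in_X_iff)
      qed
    qed (use finite_ext finite_X in auto)
    moreover have "{s \<in> ext m. s i = j} = ext (insert (i, j) m)" for j by (auto simp: ext_def)
    ultimately show ?thesis by simp
  qed
  show "(\<Sum>j\<in>X - snd ` m. coefs d f (insert (i, j) m)) = 0"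
  proof (cases "X - snd ` m = {}")
    case False
    then obtain j0 where j0: "j0 \<in> X - snd ` m" by blast
    define N where "N = real (card (ext (insert (i, j0) m)))"
    have "coefs d f (insert (i, j) m) = (\<Sum>s\<in>ext (insert (i, j) m). f s) / N" if "j \<in> X - snd ` m" for j
      using card_ext_eq [OF insert_in_partials [OF m d(1) i that] insert_in_partials [OF m d(1) i j0] d(2)]
        insert_in_partials [OF m d(1) i that] by (simp add: coefs_def restr_def mean_def N_def)
    then have "(\<Sum>j\<in>X - snd ` m. coefs d f (insert (i, j) m)) = (\<Sum>j\<in>X - snd ` m. (\<Sum>s\<in>ext (insert (i, j) m). f s) / N)"
      by (rule sum.cong [OF refl])
    also have "\<dots> = 0" by (simp only: sum_divide_distrib [symmetric] ext zero)
    finally show ?thesis .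
  next
    case True
    then show ?thesis by (simp only: sum.empty)
  qed
next
  fix m j assume m: "m \<in> partials X (d - 1)" and j: "j \<in> X - snd ` m"
  have zero: "(\<Sum>s\<in>ext m. f s) = 0"
    using f m by (auto simp: orth_def graphs_upto_def partials_def)
  have ext: "(\<Sum>i\<in>X - fst ` m. \<Sum>s\<in>ext (insert (i, j) m). f s) = (\<Sum>s\<in>ext m. f s)"
  proof -
    have "(\<Sum>s\<in>ext m. f s) = (\<Sum>i\<in>X - fst ` m. \<Sum>s\<in>{s \<in> ext m. inv' s j = i}. f s)"
    proof (rule sum.group [symmetric])
      show "(\<lambda>s. inv' s j) ` ext m \<subseteq> X - fst ` m"
      proof clarify
        fix s assume s: "s \<in> ext m"
        then have sG: "s \<in> G" using ext_subset_G by blast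
        have sj: "s (inv' s j) = j" using comp_inv_G [OF sG] by (metis comp_apply id_apply)
        have "inv' s j \<notin> fst ` m"
        proof
          assume "inv' s j \<in> fst ` m"
          then obtain j' where j': "(inv' s j, j') \<in> m" by force
          then have "j' = j" using s sj by (auto simp: ext_def)
          with j' j show False by force
        qed
        then show "inv' s j \<in> X - fst ` m" using j sG inv_in_G by (simp add: G_in_X_iff)
      qed
    qed (use finite_ext finite_X in auto)
    moreover have "{s \<in> ext m. inv' s j = i} = ext (insert (i, j) m)" for i
      using permutes_inv_eq [OF G_permutes] by (auto simp: ext_def)
    ultimately show ?thesis by simp
  qed
  show "(\<Sum>i\<in>X - fst ` m. coefs d f (insert (i, j) m)) = 0"
  proof (cases "X - fst ` m = {}")
    case False
    then obtain i0 where i0: "i0 \<in> X - fst ` m" by blast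
    define N where "N = real (card (ext (insert (i0, j) m)))"
    have "coefs d f (insert (i, j) m) = (\<Sum>s\<in>ext (insert (i, j) m). f s) / N" if "i \<in> X - fst ` m" for i
      using card_ext_eq [OF insert_in_partials [OF m d(1) that j] insert_in_partials [OF m d(1) i0 j] d(2)]
        insert_in_partials [OF m d(1) that j] by (simp add: coefs_def restr_def mean_def N_def)
    then have "(\<Sum>i\<in>X - fst ` m. coefs d f (insert (i, j) m)) = (\<Sum>i\<in>X - fst ` m. (\<Sum>s\<in>ext (insert (i, j) m). f s) / N)"
      by (rule sum.cong [OF refl])
    also have "\<dots> = 0" by (simp only: sum_divide_distrib [symmetric] ext zero)
    finally show ?thesis .
  next
    case True
    then show ?thesis by (simp only: sum.empty)
  qed
qed

text \<open>The lower arrays: all the ways to extend a partial injection \<open>m\<close> by a pair with prescribed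
  first (\<open>b\<close>) or second (\<open>\<not> b\<close>) component \<open>x\<close>. Under \<open>gsum d\<close> each becomes the indicator
  of \<open>ext m\<close>, a function of degree \<open>d - 1\<close>.\<close>

definition lower_array :: "(nat \<times> nat) set \<times> bool \<times> nat \<Rightarrow> (nat \<times> nat) set \<Rightarrow> real" where
  "lower_array = (\<lambda>(m, b, x) m'. of_bool (if b then \<exists>j\<in>X - snd ` m. m' = insert (x, j) m
      else \<exists>i\<in>X - fst ` m. m' = insert (i, x) m))"

definition lower_indices :: "nat \<Rightarrow> ((nat \<times> nat) set \<times> bool \<times> nat) set" where
  "lower_indices d = {(m, b, x). m \<in> partials X (d - 1) \<and> x \<in> X \<and> (if b then x \<notin> fst ` m else x \<notin> snd ` m)}"

lemma gsum_lower_array: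
  assumes idx: "(m, b, x) \<in> lower_indices d" and d: "0 < d" and s: "s \<in> G"
  shows "gsum d (lower_array (m, b, x)) s = indicator (ext m) s"
proof -
  have m: "m \<in> partials X (d - 1)" "x \<in> X" using idx by (auto simp: lower_indices_def)
  define i where "i = (if b then x else inv' s x)"
  have i_eq: "s i = x" if "\<not> b" using that permutes_inv_eq [OF G_permutes [OF s]] by (auto simp: i_def)
  have iX: "i \<in> X" using m(2) s inv_in_G by (simp add: i_def G_in_X_iff)
  have *: "lower_array (m, b, x) (graph_on s E) = of_bool (s \<in> ext m \<and> E = insert i (fst ` m))" if E: "E \<in> subs d" for E
  proof -
    have f1: "s \<in> ext m \<and> E = insert i (fst ` m)"
      if "graph_on s E = insert (i', j) m" "if b then i' = x else j = x" for i' j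
    proof -
      have "m \<subseteq> graph_on s E" "(i', j) \<in> graph_on s E" using that by auto
      then have "s \<in> ext m" "s i' = j" using s by (auto simp: ext_def graph_on_def)
      moreover have "i' = i"
      proof (cases b)
        case False
        then have "s i' = s i" using \<open>s i' = j\<close> i_eq that by simp
        then show ?thesis using inj_G [OF s] by (simp add: inj_eq)
      qed (use that in \<open>simp add: i_def\<close>)
      moreover have "E = fst ` graph_on s E" by simp
      ultimately show ?thesis using that(1) by simp
    qed
    have f2: "lower_array (m, b, x) (graph_on s E) = 1" if e: "s \<in> ext m" "E = insert i (fst ` m)"
    proof -
      have gm: "graph_on s (fst ` m) = m" using ext_eq_graph_on [OF e(1)] by simp
      have "i \<notin> fst ` m"
      proof
        assume "i \<in> fst ` m"
        then have "E = fst ` m" using e(2) by auto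
        then have "card E = card (fst ` m)" by simp
        also have "\<dots> = d - 1" using m(1) by (simp add: partials_def card_image)
        finally have "d = d - 1" using E by (simp add: subs_def)
        then show False using d by linarith
      qed
      then have "s i \<notin> s ` fst ` m" using inj_G [OF s] by (simp add: inj_image_mem_iff)
      then have "s i \<notin> snd ` m" by (subst gm [symmetric]) simp
      moreover have "graph_on s E = insert (i, s i) m"
        using gm by (simp add: e(2) graph_on_def)
      ultimately show ?thesis
        using iX s i_eq \<open>i \<notin> fst ` m\<close> by (cases b) (auto simp: lower_array_def G_in_X_iff i_def)
    qed
    show ?thesis
    proof (cases "s \<in> ext m \<and> E = insert i (fst ` m)")
      case True
      then show ?thesis using f2 by simp
    next
      case False
      then have "\<not> (if b then \<exists>j\<in>X - snd ` m. graph_on s E = insert (x, j) m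
          else \<exists>i\<in>X - fst ` m. graph_on s E = insert (i, x) m)" (is "\<not> ?ex")
      proof (rule contrapos_nn)
        assume ex: ?ex
        show "s \<in> ext m \<and> E = insert i (fst ` m)"
        proof (cases b)
          case True
          with ex obtain j where "graph_on s E = insert (x, j) m" by auto
          then show ?thesis by (rule f1) (simp add: True)
        next
          case False
          with ex obtain i' where "graph_on s E = insert (i', x) m" by auto
          then show ?thesis by (rule f1) (simp add: False)
        qed
      qed
      with False show ?thesis by (simp only: lower_array_def split_conv of_bool_eq)
    qed
  qed
  show ?thesis
  proof (cases "s \<in> ext m")
    case True
    have "i \<notin> fst ` m"
    proof
      assume "i \<in> fst ` m"
      then obtain j where j: "(i, j) \<in> m" by force
      then have "s i = j" using True by (auto simp: ext_def)
      with j idx i_eq show False by (cases b) (force simp: lower_indices_def i_def)+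
    qed
    moreover have "finite m" using m(1) finite_X finite_subset [of m "X \<times> X"] by (auto simp: partials_def)
    ultimately have "card (insert i (fst ` m)) = d"
      using m(1) d by (simp add: partials_def card_image)
    then have E: "insert i (fst ` m) \<in> subs d"
      using m(1) iX by (auto simp: subs_def partials_def)
    have "gsum d (lower_array (m, b, x)) s = (\<Sum>E\<in>subs d. of_bool (E = insert i (fst ` m)))"
      unfolding gsum_def using True by (intro sum.cong refl) (simp add: *)
    also have "\<dots> = (\<Sum>E\<in>{insert i (fst ` m)}. 1)"
      using E finite_subs by (intro sum.mono_neutral_cong_right) auto
    finally show ?thesis using True by simp
  next
    case False
    then have "gsum d (lower_array (m, b, x)) s = (\<Sum>E\<in>subs d. 0)"
      unfolding gsum_def by (intro sum.cong refl) (simp add: *)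
    then show ?thesis using False by simp
  qed
qed

text \<open>From the coefficients of \<open>f\<close> subtract their projection onto the lower
  arrays. Orthogonality to these is exactly the vanishing of row and column sums, and by
  \<open>gsum_lower_array\<close> the subtracted part synthesises a function of degree
  \<open>d - 1\<close>.\<close>

lemma harmonic_representative:
  assumes f: "low d f" and d: "0 < d"
  shows "\<exists>B. harmonic X d B \<and> low (d - 1) (\<lambda>s. f s - gsum d B s)"
proof -
  obtain c where c: "\<And>s. s \<in> G \<Longrightarrow> f s = (\<Sum>m\<in>graphs_upto d. c m * indicator (ext m) s)"
    using f by (auto simp: low_def)
  define K where "K = lower_indices d"
  have finK: "finite K"
  proof (rule finite_subset)
    show "K \<subseteq> partials X (d - 1) \<times> UNIV \<times> X" by (auto simp: K_def lower_indices_def)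
  qed (simp add: finite_partials finite_X)
  obtain e where e: "\<And>k. k \<in> K \<Longrightarrow>
      (\<Sum>m\<in>partials X d. (c m - (\<Sum>k\<in>K. e k * lower_array k m)) * lower_array k m) = 0"
    using sum_projection [where f = c and v = lower_array, OF finK finite_partials [OF finite_X, of d]] by blast
  define B where "B m = (if m \<in> partials X d then c m - (\<Sum>k\<in>K. e k * lower_array k m) else 0)" for m
  have B: "(\<Sum>m\<in>partials X d. B m * lower_array k m) = 0" if "k \<in> K" for k
    using e [OF that] by (simp add: B_def)
  have "harmonic X d B"
    unfolding harmonic_def
  proof (intro conjI ballI allI impI)
    fix m i assume m: "m \<in> partials X (d - 1)" and i: "i \<in> X - fst ` m"
    have "(m, True, i) \<in> K" using m i by (auto simp: K_def lower_indices_def)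
    then have "0 = (\<Sum>m'\<in>partials X d. B m' * lower_array (m, True, i) m')" using B by simp
    also have "\<dots> = (\<Sum>m'\<in>(\<lambda>j. insert (i, j) m) ` (X - snd ` m). B m')"
      using insert_in_partials [OF m d i] finite_partials [OF finite_X]
      by (intro sum.mono_neutral_cong_right) (auto simp: lower_array_def)
    also have "\<dots> = (\<Sum>j\<in>X - snd ` m. B (insert (i, j) m))"
    proof (subst sum.reindex)
      show "inj_on (\<lambda>j. insert (i, j) m) (X - snd ` m)"
      proof (rule inj_onI)
        fix j j' assume j: "j \<in> X - snd ` m" "insert (i, j) m = insert (i, j') m"
        then have "(i, j) \<in> insert (i, j') m" by auto
        with j(1) show "j = j'" by force
      qed
    qed simp
    finally show "(\<Sum>j\<in>X - snd ` m. B (insert (i, j) m)) = 0" by simp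
  next
    fix m j assume m: "m \<in> partials X (d - 1)" and j: "j \<in> X - snd ` m"
    have "(m, False, j) \<in> K" using m j by (auto simp: K_def lower_indices_def)
    then have "0 = (\<Sum>m'\<in>partials X d. B m' * lower_array (m, False, j) m')" using B by simp
    also have "\<dots> = (\<Sum>m'\<in>(\<lambda>i. insert (i, j) m) ` (X - fst ` m). B m')"
      using insert_in_partials [OF m d _ j] finite_partials [OF finite_X]
      by (intro sum.mono_neutral_cong_right) (auto simp: lower_array_def)
    also have "\<dots> = (\<Sum>i\<in>X - fst ` m. B (insert (i, j) m))"
    proof (subst sum.reindex)
      show "inj_on (\<lambda>i. insert (i, j) m) (X - fst ` m)"
      proof (rule inj_onI)
        fix i i' assume i: "i \<in> X - fst ` m" "insert (i, j) m = insert (i', j) m"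
        then have "(i, j) \<in> insert (i', j) m" by auto
        with i(1) show "i = i'" by force
      qed
    qed simp
    finally show "(\<Sum>i\<in>X - fst ` m. B (insert (i, j) m)) = 0" by simp
  qed (simp add: B_def)
  moreover have "low (d - 1) (\<lambda>s. f s - gsum d B s)"
  proof -
    have split: "graphs_upto d = graphs_upto (d - 1) \<union> {m. m \<subseteq> X \<times> X \<and> card m = d}"
      "graphs_upto (d - 1) \<inter> {m. m \<subseteq> X \<times> X \<and> card m = d} = {}"
      using d by (auto simp: graphs_upto_def)
    have fin: "finite {m. m \<subseteq> X \<times> X \<and> card m = d}"
      by (rule finite_subset [of _ "Pow (X \<times> X)"]) (auto simp: finite_X)
    have eq: "f s - gsum d B s = (\<Sum>m\<in>graphs_upto (d - 1). c m * indicator (ext m) s) + (\<Sum>k\<in>K. e k * indicator (ext (fst k)) s)"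
      if s: "s \<in> G" for s
    proof -
      have "f s = (\<Sum>m\<in>graphs_upto (d - 1). c m * indicator (ext m) s) + gsum d c s"
        by (simp only: c [OF s] split(1) sum.union_disjoint [OF finite_graphs_upto fin split(2)] sum_ext_graphs [OF s])
      moreover have "gsum d B s = gsum d c s - (\<Sum>k\<in>K. e k * gsum d (lower_array k) s)"
      proof -
        have "gsum d B s = (\<Sum>E\<in>subs d. c (graph_on s E) - (\<Sum>k\<in>K. e k * lower_array k (graph_on s E)))"
          unfolding gsum_def by (intro sum.cong refl) (simp add: B_def graph_on_partials [OF s])
        also have "\<dots> = gsum d c s - (\<Sum>k\<in>K. \<Sum>E\<in>subs d. e k * lower_array k (graph_on s E))"
          by (simp add: sum_subtractf gsum_def sum.swap [of _ K])
        finally show ?thesis by (simp add: gsum_def sum_distrib_left)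
      qed
      moreover have "(\<Sum>k\<in>K. e k * gsum d (lower_array k) s) = (\<Sum>k\<in>K. e k * indicator (ext (fst k)) s)"
        by (intro sum.cong refl) (use gsum_lower_array [OF _ d s] in \<open>auto simp: K_def\<close>)
      ultimately show ?thesis by simp
    qed
    have "low (d - 1) (\<lambda>s. (\<Sum>m\<in>graphs_upto (d - 1). c m * indicator (ext m) s) + (\<Sum>k\<in>K. e k * indicator (ext (fst k)) s))"
    proof (intro low_add low_sum low_cmult low_indicator)
      fix k assume "k \<in> K"
      then show "fst k \<in> graphs_upto (d - 1)" by (auto simp: K_def lower_indices_def graphs_upto_def partials_def)
    qed
    then show ?thesis by (rule low_cong) (simp add: eq)
  qed
  ultimately show ?thesis by blast
qed

end

section \<open>Near-orthogonality of harmonic arrays and the frame inequality\<close>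

lemma degree_bounds:
  fixes d n :: nat
  assumes "0 < d" "10 * d\<^sup>2 \<le> n"
  shows "2 * d + 2 \<le> n" "9 * d\<^sup>2 \<le> n - d"
proof -
  have "d \<le> d\<^sup>2" by (simp add: power2_nat_le_imp_le)
  then show "2 * d + 2 \<le> n" "9 * d\<^sup>2 \<le> n - d" using assms by linarith+
qed

lemma dlists_image:
  assumes "inj s"
  shows "dlists k (s ` Z) = map s ` dlists k Z"
proof
  show "map s ` dlists k Z \<subseteq> dlists k (s ` Z)"
  proof
    fix l assume "l \<in> map s ` dlists k Z"
    then obtain b where b: "l = map s b" "b \<in> dlists k Z" by blast
    have "inj_on s (set b)" using assms inj_on_subset by blast
    with b show "l \<in> dlists k (s ` Z)" by (simp add: dlists_def distinct_map image_mono)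
  qed
  show "dlists k (s ` Z) \<subseteq> map s ` dlists k Z"
  proof
    fix l assume l: "l \<in> dlists k (s ` Z)"
    define b where "b = map (inv_into Z s) l"
    have "map s b = l"
      unfolding b_def map_map
      by (rule map_idI) (use l in \<open>auto simp: dlists_def f_inv_into_f\<close>)
    moreover have "set b \<subseteq> Z"
      using l by (auto simp: b_def dlists_def inv_into_into)
    moreover have "distinct b" using \<open>map s b = l\<close> l by (auto simp: dlists_def distinct_map)
    moreover have "length b = k" using l by (simp add: b_def dlists_def)
    ultimately show "l \<in> map s ` dlists k Z" by (force simp: dlists_def)
  qed
qed

lemma sum_dlists_image:
  assumes "inj s"
  shows "(\<Sum>l\<in>dlists k (s ` Z). f l) = (\<Sum>b\<in>dlists k Z. f (map s b))"
proof -
  have "inj_on (map s) (dlists k Z)" using assms by (simp add: inj_on_def inj_map_eq_map)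
  then show ?thesis by (simp add: dlists_image [OF assms] sum.reindex)
qed

text \<open>By the binomial theorem the sum is (1 + q)^d - 1, and exp (1 / 9) < 3 / 2.\<close>

lemma sum_proper_subsets_le:
  fixes q :: real
  assumes E: "finite E" "card E = d" and q: "0 \<le> q" "real d * q \<le> 1 / 9"
  shows "(\<Sum>S\<in>Pow E - {E}. q ^ card (E - S)) \<le> 1 / 2"
proof -
  have "(\<Sum>S\<in>Pow E. q ^ card (E - S)) = (1 + q) ^ d"
    using sum_Pow_power_card [OF E(1)] E(2) by simp
  moreover have "(\<Sum>S\<in>Pow E. q ^ card (E - S)) = 1 + (\<Sum>S\<in>Pow E - {E}. q ^ card (E - S))"
    using E(1) by (subst sum.remove [of _ E]) auto
  moreover have "(1 + q) ^ d \<le> exp (1 / 9)"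
  proof -
    have "(1 + q) ^ d \<le> exp q ^ d" using q by (intro power_mono exp_ge_add_one_self) auto
    also have "\<dots> = exp (real d * q)" by (simp add: exp_of_nat_mult)
    finally show ?thesis using q(2) by (meson exp_le_cancel_iff order_trans)
  qed
  moreover have "exp (1 / 9) \<le> 1 + 1 / 9 + (1 / 9 :: real)\<^sup>2" by (rule exp_bound) auto
  ultimately show ?thesis by (simp add: power2_eq_square)
qed

context even_permutations
begin

text \<open>Condition on an umvirate of fewer than \<open>d\<close> pairs. The points of
  \<open>E\<close> whose values are still free take uniform values off the fixed ones; harmonicity
  turns this into a sum over lists of fixed values not yet used, and there are too few of them. The
  relabelling \<open>\<psi>\<close> prepares the coupling with idempotents.\<close>

lemma orth_single:
  assumes B: "harmonic X d B" and E: "E \<in> subs d" and psi: "inj_on \<psi> E" "\<psi> ` E \<subseteq> X"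
    and d: "0 < d" "2 * d + 1 \<le> card X"
  shows "orth (d - 1) (\<lambda>s. B (graph_on (s \<circ> \<psi>) E))"
  unfolding orth_def
proof
  fix m assume m: "m \<in> graphs_upto (d - 1)"
  show "(\<Sum>s\<in>ext m. B (graph_on (s \<circ> \<psi>) E)) = 0"
  proof (cases "ext m = {}")
    case False
    then obtain t where t: "t \<in> ext m" by blast
    have tG: "t \<in> G" using t ext_subset_G by blast
    have injt: "inj t" by (rule inj_G [OF tG])
    define K where "K = fst ` m"
    have m_eq: "m = graph_on t K" using ext_eq_graph_on [OF t] by (simp add: K_def)
    have "card K = card m" using card_graph_on m_eq by metis
    then have K: "K \<subseteq> X" "card K \<le> d - 1"
      using m by (auto simp: graphs_upto_def K_def)
    have finK: "finite K" using K finite_X finite_subset by blast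
    obtain Kl where Kl: "set Kl = K" "distinct Kl" using finite_distinct_list [OF finK] by blast
    have Kl': "Kl \<in> dlists (card K) X" using Kl K distinct_card [OF Kl(2)] by (simp add: dlists_def)
    have finE: "finite E" and EX: "E \<subseteq> X" and cE: "card E = d"
      using E subs_finite [OF E] by (auto simp: subs_def)
    define E0 where "E0 = {i \<in> E. \<psi> i \<in> K}"
    have E0: "E0 \<subseteq> E" "finite E0" using finE by (auto simp: E0_def)
    obtain js where js: "set js = E - E0" "distinct js" using finite_distinct_list [of "E - E0"] finE by auto
    define k where "k = length js"
    have k: "card E0 + k = d"
    proof -
      have "k = card (E - E0)" unfolding k_def using js distinct_card by metis
      then show ?thesis using E0 finE cE card_mono [OF finE E0(1)] by (simp add: card_Diff_subset)
    qed
    define a where "a = map \<psi> js"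
    have "inj_on \<psi> (set js)" using js(1) inj_on_subset [OF psi(1)] by blast
    then have a: "a \<in> dlists k (X - set Kl)"
      using js psi(2) by (auto simp: dlists_def a_def k_def distinct_map Kl E0_def)
    define m0 where "m0 = graph_on (t \<circ> \<psi>) E0"
    define F where "F l = B (m0 \<union> set (zip js l))" for l
    have injE0: "inj_on \<psi> E0" using inj_on_subset [OF psi(1) E0(1)] .
    have psiE0: "\<psi> ` E0 \<subseteq> K" by (auto simp: E0_def)
    have tX: "t ` A \<subseteq> X" if "A \<subseteq> X" for A using that G_in_X_iff [OF tG] by blast
    have m0: "m0 \<in> partials X (card E0)"
      unfolding m0_def
    proof (rule graph_on_in_partials)
      show "E0 \<subseteq> X" using E0 EX by blast
      show "(t \<circ> \<psi>) ` E0 \<subseteq> X" using psiE0 K(1) tX [of "\<psi> ` E0"] by (simp add: image_comp)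
      show "inj_on (t \<circ> \<psi>) E0" using injE0 injt by (intro comp_inj_on) (auto intro: inj_on_subset)
    qed simp
    have snd0: "snd ` m0 = t ` \<psi> ` E0" by (simp add: m0_def image_comp)
    have "(\<Sum>s\<in>ext m. B (graph_on (s \<circ> \<psi>) E)) = (\<Sum>s\<in>ext m. F (map s a))"
    proof (rule sum.cong [OF refl])
      fix s assume s: "s \<in> ext m"
      have "E = E0 \<union> set js" using js E0 by blast
      then have "graph_on (s \<circ> \<psi>) E = graph_on (s \<circ> \<psi>) E0 \<union> set (zip js (map (s \<circ> \<psi>) js))"
        by (metis graph_on_Un graph_on_set)
      moreover have "graph_on (s \<circ> \<psi>) E0 = m0"
      proof -
        have "s i = t i" if "i \<in> K" for i using s that unfolding m_eq ext_graph_on by blast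
        then show ?thesis by (auto simp: m0_def graph_on_def E0_def)
      qed
      ultimately show "B (graph_on (s \<circ> \<psi>) E) = F (map s a)" by (simp add: F_def a_def)
    qed
    also have "\<dots> = real (card (ext m)) * mean (ext m) (\<lambda>s. F (map s a))"
      using False finite_ext by (simp add: mean_def)
    also have "mean (ext m) (\<lambda>s. F (map s a)) = mean (dlists k (X - t ` K)) F"
    proof -
      have "ext m = {s \<in> G. map s Kl = map t Kl}"
        unfolding m_eq Kl(1) [symmetric] by (rule ext_graph_on_map)
      moreover have "card K + k + 2 \<le> card X" using K(2) k d by linarith
      ultimately show ?thesis
        using mean_fibre_map [OF Kl' a map_in_dlists [OF tG Kl'], of F] by (simp add: Kl(1))
    qed
    also have "mean (dlists k (X - t ` K)) F = 0"
    proof -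
      \<comment> \<open>The fixed values not taken on \<open>E0\<close>: at most
        \<open>d - 1 - card E0\<close> of them, fewer than \<open>k = d - card E0\<close>.\<close>
      define Y where "Y = t ` K - t ` \<psi> ` E0"
      have "(\<Sum>l\<in>dlists (length js) (X - t ` K). B (m0 \<union> set (zip js l))) =
          (- 1) ^ length js * (\<Sum>l\<in>dlists (length js) Y. B (m0 \<union> set (zip js l)))"
      proof (rule harmonic_sum_ran [OF finite_X B m0 js(2)])
        show "set js \<subseteq> X - fst ` m0" using js EX by (auto simp: m0_def)
        show "card E0 + length js = d" using k by (simp add: k_def)
        show "Y \<union> (X - t ` K) = X - snd ` m0" using psiE0 tX [OF K(1)] by (auto simp: snd0 Y_def)
      qed (auto simp: Y_def)
      moreover have "dlists k Y = {}"
      proof (rule dlists_empty)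
        show "finite Y" using finK by (simp add: Y_def)
        have "card (t ` \<psi> ` E0) = card E0" "card (t ` K) = card K"
          using injE0 inj_on_subset [OF injt] by (simp_all add: card_image)
        moreover have "card Y = card (t ` K) - card (t ` \<psi> ` E0)"
          unfolding Y_def using psiE0 finK E0 by (intro card_Diff_subset) auto
        moreover have "card E0 \<le> card K"
          using card_mono [OF finK psiE0] injE0 by (simp add: card_image)
        ultimately show "card Y < k" using K(2) k d(1) by linarith
      qed
      ultimately show ?thesis by (simp add: mean_def F_def k_def)
    qed
    finally show ?thesis by (simp only: mult_zero_right)
  qed simp
qed

lemma orth_gsum:
  assumes "harmonic X d B" "0 < d" "2 * d + 1 \<le> card X"
  shows "orth (d - 1) (gsum d B)"
proof -
  have "orth (d - 1) (\<lambda>s. \<Sum>E\<in>subs d. B (graph_on (s \<circ> id) E))"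
    using assms by (intro orth_sum orth_single) (auto simp: subs_def)
  then show ?thesis by (simp add: gsum_def [abs_def])
qed

lemma sum_subs_split:
  assumes E: "E \<in> subs d"
  shows "(\<Sum>E'\<in>subs d. h E') = (\<Sum>E0\<in>Pow E. \<Sum>E2\<in>{E2. E2 \<subseteq> X - E \<and> card E2 = card (E - E0)}. h (E0 \<union> E2))"
proof -
  have finE: "finite E" and EX: "E \<subseteq> X" and cE: "card E = d" using E subs_finite [OF E] by (auto simp: subs_def)
  have cD: "card (E - E0) + card E0 = d" if "E0 \<subseteq> E" for E0
    using that finE cE card_mono [OF finE that] finite_subset [OF that finE] by (simp add: card_Diff_subset)
  have "bij_betw (\<lambda>(E0, E2). E0 \<union> E2) (SIGMA E0:Pow E. {E2. E2 \<subseteq> X - E \<and> card E2 = card (E - E0)}) (subs d)"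
  proof (rule bij_betw_byWitness [where f' = "\<lambda>E'. (E' \<inter> E, E' - E)"])
    show "(\<lambda>(E0, E2). E0 \<union> E2) ` (SIGMA E0:Pow E. {E2. E2 \<subseteq> X - E \<and> card E2 = card (E - E0)}) \<subseteq> subs d"
    proof clarsimp
      fix E0 E2 assume *: "E0 \<subseteq> E" "E2 \<subseteq> X - E" "card E2 = card (E - E0)"
      have "finite E0" "finite E2" using * finE finite_X finite_subset by (metis finite_Diff)+
      then have "card (E0 \<union> E2) = card E0 + card E2" using * by (intro card_Un_disjoint) auto
      then show "E0 \<union> E2 \<in> subs d" using * EX cD [OF *(1)] by (auto simp: subs_def)
    qed
    show "(\<lambda>E'. (E' \<inter> E, E' - E)) ` subs d \<subseteq> (SIGMA E0:Pow E. {E2. E2 \<subseteq> X - E \<and> card E2 = card (E - E0)})"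
    proof clarsimp
      fix E' assume E': "E' \<in> subs d"
      then have finE': "finite E'" "E' \<subseteq> X" "card E' = d" using subs_finite [OF E'] by (auto simp: subs_def)
      have "card E' = card (E' \<inter> E) + card (E' - E)"
        using finE' card_Un_disjoint [of "E' \<inter> E" "E' - E"] by (simp add: Int_Diff_Un Int_Diff_disjoint)
      then show "E' - E \<subseteq> X - E \<and> card (E' - E) = card (E - E' \<inter> E)"
        using finE' cD [of "E' \<inter> E"] by auto
    qed
  qed auto
  from sum.reindex_bij_betw [OF this, of h, symmetric] show ?thesis
    using finE finite_X by (subst sum.Sigma) (auto simp: case_prod_beta)
qed

text \<open>The second factor is the first one translated by an even permutation that carries
  \<open>e0 @ a\<close> to \<open>e0 @ b\<close>, so both have the same L2 norm.\<close>

lemma abs_mean_twist_le: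
  assumes E: "E \<in> subs d" and E0: "E0 \<subseteq> E" and k: "card (E - E0) = k"
    and a: "a \<in> dlists k (E - E0)" and b: "b \<in> dlists k (E - E0)" and d: "d + 2 \<le> card X"
  shows "\<bar>mean G (\<lambda>s. B (graph_on s E) * B (graph_on s E0 \<union> set (zip a (map s b))))\<bar> \<le> mean G (\<lambda>s. (B (graph_on s E))\<^sup>2)"
proof -
  have finE: "finite E" and EX: "E \<subseteq> X" and cE: "card E = d" using E subs_finite [OF E] by (auto simp: subs_def)
  have finE0: "finite E0" using E0 finE finite_subset by blast
  obtain e0 where e0: "set e0 = E0" "distinct e0" using finite_distinct_list [OF finE0] by blast
  have len: "length e0 + k = d"
    using distinct_card [OF e0(2)] e0(1) k E0 finE finE0 cE card_mono [OF finE E0] by (simp add: card_Diff_subset)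
  have ab: "e0 @ a \<in> dlists d X" "e0 @ b \<in> dlists d X"
    using a b e0 len E0 EX by (auto simp: dlists_def)
  obtain g where g: "g \<in> G" "map g (e0 @ a) = e0 @ b" using ex_even_map [OF ab d] by blast
  have set_a: "set a = E - E0"
    using a k finE card_subset_eq [of "E - E0" "set a"] by (simp add: dlists_def distinct_card)
  have eq: "graph_on (s \<circ> g) E = graph_on s E0 \<union> set (zip a (map s b))" for s
  proof -
    have ge0: "map g e0 = e0" and ga: "map g a = b" using g(2) by auto
    have "E = E0 \<union> set a" using set_a E0 by blast
    then have "graph_on (s \<circ> g) E = graph_on (s \<circ> g) (set e0) \<union> graph_on (s \<circ> g) (set a)"
      by (simp add: graph_on_Un e0)
    also have "\<dots> = set (zip e0 (map s (map g e0))) \<union> set (zip a (map s (map g a)))"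
      by (simp add: graph_on_set)
    also have "\<dots> = graph_on s E0 \<union> set (zip a (map s b))"
      unfolding ge0 ga by (simp add: graph_on_set e0(1) [symmetric])
    finally show ?thesis .
  qed
  have inv: "mean G (\<lambda>s. (B (graph_on (s \<circ> g) E))\<^sup>2) = mean G (\<lambda>s. (B (graph_on s E))\<^sup>2)"
    by (rule mean_G_right [OF g(1), of "\<lambda>s. (B (graph_on s E))\<^sup>2"])
  have amgm: "\<bar>x * y\<bar> \<le> x\<^sup>2 / 2 + y\<^sup>2 / 2" for x y :: real
    using sum_squares_bound [of "\<bar>x\<bar>" "\<bar>y\<bar>"] by (simp add: abs_mult)
  have "\<bar>mean G (\<lambda>s. B (graph_on s E) * B (graph_on (s \<circ> g) E))\<bar>
      \<le> mean G (\<lambda>s. \<bar>B (graph_on s E) * B (graph_on (s \<circ> g) E)\<bar>)" by (rule abs_mean_le)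
  also have "\<dots> \<le> mean G (\<lambda>s. (B (graph_on s E))\<^sup>2 / 2 + (B (graph_on (s \<circ> g) E))\<^sup>2 / 2)"
    by (intro mean_mono amgm)
  also have "\<dots> = mean G (\<lambda>s. (B (graph_on s E))\<^sup>2)"
    by (simp only: mean_add mean_divide inv field_sum_of_halves)
  finally show ?thesis by (simp only: eq)
qed

text \<open>Group the sets in \<open>gsum\<close> by their intersection \<open>E0\<close> with
  \<open>E\<close>. Given the values on \<open>E\<close>, the remaining points and their values
  range over complements, and \<open>harmonic_sum_both\<close> pulls them back into \<open>E\<close>
  and its image. The term \<open>E0 = E\<close> is the array itself; the others carry a large
  denominator.\<close>

lemma restr_gsum:
  assumes B: "harmonic X d B" and E: "E \<in> subs d" and s: "s \<in> G" and d: "2 * d + 2 \<le> card X"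
  shows "restr (gsum d B) (graph_on s E) = (\<Sum>E0\<in>Pow E.
    (\<Sum>a\<in>dlists (card (E - E0)) (E - E0). \<Sum>b\<in>dlists (card (E - E0)) (E - E0).
      B (graph_on s E0 \<union> set (zip a (map s b)))) / (fact (card (E - E0)) * real (card (dlists (card (E - E0)) (X - E)))))"
proof -
  have finE: "finite E" and EX: "E \<subseteq> X" and cE: "card E = d" using E subs_finite [OF E] by (auto simp: subs_def)
  obtain I where I: "I \<in> dlists d X" "set I = E" using subs_list [OF E] by blast
  have injs: "inj s" by (rule inj_G [OF s])
  have imX: "X - s ` E = s ` (X - E)" using image_G [OF s] injs EX by (simp add: image_set_diff)
  have part: "mean (ext (graph_on s E)) (\<lambda>t. \<Sum>E2\<in>{E2. E2 \<subseteq> X - E \<and> card E2 = card (E - E0)}. B (graph_on t (E0 \<union> E2)))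
    = (\<Sum>a\<in>dlists (card (E - E0)) (E - E0). \<Sum>b\<in>dlists (card (E - E0)) (E - E0).
      B (graph_on s E0 \<union> set (zip a (map s b)))) / (fact (card (E - E0)) * real (card (dlists (card (E - E0)) (X - E))))"
    if E0: "E0 \<in> Pow E" for E0
  proof -
    define k where "k = card (E - E0)"
    define N where "N = real (card (dlists k (X - E)))"
    have finE0: "finite E0" using E0 finE finite_subset by blast
    have k: "card E0 + k = d"
      using E0 finE cE card_mono [OF finE, of E0] finE0 by (simp add: k_def card_Diff_subset)
    define m0 where "m0 = graph_on s E0"
    have m0: "m0 \<in> partials X (card E0)"
      unfolding m0_def using s E0 EX by (intro graph_on_partials) (auto simp: subs_def)
    have "fact k * mean (ext (graph_on s E)) (\<lambda>t. \<Sum>E2\<in>{E2. E2 \<subseteq> X - E \<and> card E2 = k}. B (graph_on t (E0 \<union> E2)))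
        = mean (ext (graph_on s E)) (\<lambda>t. \<Sum>a\<in>dlists k (X - E). B (graph_on t (E0 \<union> set a)))"
      using finite_X by (simp add: mean_cmult [symmetric] sum_dlists_set [of "X - E" "\<lambda>E2. B (graph_on _ (E0 \<union> E2))"])
    also have "\<dots> = (\<Sum>a\<in>dlists k (X - E). mean (ext (graph_on s E)) (\<lambda>t. B (m0 \<union> set (zip a (map t a)))))"
    proof -
      have "graph_on t (E0 \<union> set a) = m0 \<union> set (zip a (map t a))" if "t \<in> ext (graph_on s E)" for t a
      proof -
        have "t i = s i" if "i \<in> E0" for i
          using that E0 \<open>t \<in> ext (graph_on s E)\<close> unfolding ext_graph_on by blast
        then have "graph_on t E0 = m0" by (auto simp: m0_def graph_on_def)
        then show ?thesis by (simp add: graph_on_Un graph_on_set)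
      qed
      then show ?thesis by (simp add: mean_sum cong: mean_cong)
    qed
    also have "\<dots> = (\<Sum>a\<in>dlists k (X - E). mean (dlists k (X - s ` E)) (\<lambda>l. B (m0 \<union> set (zip a l))))"
    proof (rule sum.cong [OF refl])
      fix a assume a: "a \<in> dlists k (X - E)"
      have "ext (graph_on s E) = {t \<in> G. map t I = map s I}"
        using ext_graph_on_map [of s I] I(2) by simp
      moreover have "d + k + 2 \<le> card X" using k d by linarith
      ultimately show "mean (ext (graph_on s E)) (\<lambda>t. B (m0 \<union> set (zip a (map t a)))) =
          mean (dlists k (X - s ` E)) (\<lambda>l. B (m0 \<union> set (zip a l)))"
        using mean_fibre_map [OF I(1) _ map_in_dlists [OF s I(1)], of a k "\<lambda>l. B (m0 \<union> set (zip a l))"] a I(2) by simp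
    qed
    also have "\<dots> = (\<Sum>a\<in>dlists k (X - E). \<Sum>l\<in>dlists k (X - s ` E). B (m0 \<union> set (zip a l))) / N"
    proof -
      have "card (dlists k (X - s ` E)) = card (dlists k (X - E))"
        using sum_dlists_image [OF injs, of "\<lambda>_. 1::nat" k "X - E"] imX by simp
      then show ?thesis by (simp add: mean_def sum_divide_distrib N_def)
    qed
    also have "(\<Sum>a\<in>dlists k (X - E). \<Sum>l\<in>dlists k (X - s ` E). B (m0 \<union> set (zip a l)))
        = (\<Sum>a\<in>dlists k (E - E0). \<Sum>l\<in>dlists k (s ` E - s ` E0). B (m0 \<union> set (zip a l)))"
    proof (rule harmonic_sum_both [OF finite_X B m0 k])
      show "E - E0 \<union> (X - E) = X - fst ` m0" using E0 EX by (auto simp: m0_def)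
      have "s ` E \<subseteq> X" using EX image_G [OF s] by blast
      then show "s ` E - s ` E0 \<union> (X - s ` E) = X - snd ` m0" using E0 by (auto simp: m0_def)
    qed auto
    also have "s ` E - s ` E0 = s ` (E - E0)" using injs by (simp add: image_set_diff)
    finally have "fact k * mean (ext (graph_on s E)) (\<lambda>t. \<Sum>E2\<in>{E2. E2 \<subseteq> X - E \<and> card E2 = k}. B (graph_on t (E0 \<union> E2)))
        = (\<Sum>a\<in>dlists k (E - E0). \<Sum>b\<in>dlists k (E - E0). B (m0 \<union> set (zip a (map s b)))) / N"
      by (simp add: sum_dlists_image [OF injs])
    moreover have "x = S / (c * N')" if "c * x = S / N'" "c \<noteq> 0" for c x S N' :: real
      using that by (metis (no_types) divide_divide_eq_left mult.commute nonzero_mult_div_cancel_left)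
    ultimately show ?thesis
      unfolding k_def [symmetric] N_def [symmetric] m0_def [symmetric] by simp
  qed
  have "restr (gsum d B) (graph_on s E) =
      (\<Sum>E0\<in>Pow E. mean (ext (graph_on s E)) (\<lambda>t. \<Sum>E2\<in>{E2. E2 \<subseteq> X - E \<and> card E2 = card (E - E0)}. B (graph_on t (E0 \<union> E2))))"
    by (simp add: restr_def gsum_def sum_subs_split [OF E] mean_sum)
  also note sum.cong [OF refl part]
  finally show ?thesis .
qed

text \<open>Paired with the array on a fixed \<open>E\<close>, the diagonal term yields the full
  energy of \<open>E\<close>. A term with k points of \<open>E\<close> missing carries at most q^k,
  where q = d / (n - d), and \<open>10 * d\<^sup>2 \<le> card X\<close> gives d q <= 1 / 9, so these
  terms cancel at most half.\<close>

lemma energy_le_gsum: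
  assumes B: "harmonic X d B" and d: "0 < d" "10 * d\<^sup>2 \<le> card X"
  shows "energy d B \<le> 2 * mean G (\<lambda>s. (gsum d B s)\<^sup>2)"
proof -
  note db = degree_bounds [OF d]
  define q where "q = real d / real (card X - d)"
  have nd: "9 * (real d)\<^sup>2 \<le> real (card X - d)"
    using db(2) by (metis of_nat_le_iff of_nat_mult of_nat_numeral of_nat_power)
  have nd0: "0 < real (card X - d)" using db by simp
  have q: "0 \<le> q" "real d * q \<le> 1 / 9"
    using nd nd0 by (auto simp: q_def power2_eq_square field_simps)
  have one: "mean G (\<lambda>s. (B (graph_on s E))\<^sup>2) / 2 \<le> mean G (\<lambda>s. gsum d B s * B (graph_on s E))" if E: "E \<in> subs d" for E
  proof -
    have finE: "finite E" and EX: "E \<subseteq> X" and cE: "card E = d" using E subs_finite [OF E] by (auto simp: subs_def)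
    define M where "M = mean G (\<lambda>s. (B (graph_on s E))\<^sup>2)"
    have M0: "0 \<le> M" unfolding M_def by (intro mean_nonneg) simp
    define T where "T E0 = mean G (\<lambda>s. ((\<Sum>a\<in>dlists (card (E - E0)) (E - E0). \<Sum>b\<in>dlists (card (E - E0)) (E - E0).
      B (graph_on s E0 \<union> set (zip a (map s b)))) / (fact (card (E - E0)) * real (card (dlists (card (E - E0)) (X - E)))))
      * B (graph_on s E))" for E0
    obtain I where I: "I \<in> dlists d X" "set I = E" using subs_list [OF E] by blast
    have "mean G (\<lambda>s. gsum d B s * B (graph_on s E)) = mean G (\<lambda>s. restr (gsum d B) (graph_on s E) * B (graph_on s E))"
      using mean_G_restr [of "gsum d B" "\<lambda>l. B (set (zip I l))" I] by (simp add: graph_on_set [symmetric] I(2))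
    also have "\<dots> = (\<Sum>E0\<in>Pow E. T E0)"
      by (simp add: T_def restr_gsum [OF B E _ db(1)] sum_distrib_right mean_sum)
    also have "\<dots> = T E + (\<Sum>E0\<in>Pow E - {E}. T E0)"
      using finE by (subst sum.remove [of _ E]) auto
    also have "T E = M" by (simp add: T_def M_def power2_eq_square)
    finally have eq: "mean G (\<lambda>s. gsum d B s * B (graph_on s E)) = M + (\<Sum>E0\<in>Pow E - {E}. T E0)" .
    have "\<bar>T E0\<bar> \<le> q ^ card (E - E0) * M" if E0: "E0 \<in> Pow E - {E}" for E0
    proof -
      define k where "k = card (E - E0)"
      define N where "N = real (card (dlists k (X - E)))"
      have kd: "k \<le> d" unfolding k_def using cE finE card_mono [of E "E - E0"] by auto
      have cX: "card (X - E) = card X - d" using EX cE finE by (simp add: card_Diff_subset)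
      have kX: "k \<le> card (X - E)" using kd db cX by linarith
      have N0: "0 < N" unfolding N_def using kX finite_X card_dlists_pos [of "X - E" k] by simp
      have tw: "\<bar>mean G (\<lambda>s. B (graph_on s E) * B (graph_on s E0 \<union> set (zip a (map s b))))\<bar> \<le> M"
        if "a \<in> dlists k (E - E0)" "b \<in> dlists k (E - E0)" for a b
        unfolding M_def using E0 db(1) by (intro abs_mean_twist_le [OF E _ k_def [symmetric] that]) auto
      have "T E0 = (\<Sum>a\<in>dlists k (E - E0). \<Sum>b\<in>dlists k (E - E0).
          mean G (\<lambda>s. B (graph_on s E) * B (graph_on s E0 \<union> set (zip a (map s b))))) / (fact k * N)"
        by (simp add: T_def k_def [symmetric] N_def [symmetric] mean_divide mean_sum sum_distrib_right mult.commute [of "B (graph_on _ E)"])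
      then have "\<bar>T E0\<bar> = \<bar>\<Sum>a\<in>dlists k (E - E0). \<Sum>b\<in>dlists k (E - E0).
          mean G (\<lambda>s. B (graph_on s E) * B (graph_on s E0 \<union> set (zip a (map s b))))\<bar> / (fact k * N)"
        using N0 by simp
      also have "\<dots> \<le> (\<Sum>a\<in>dlists k (E - E0). \<Sum>b\<in>dlists k (E - E0). M) / (fact k * N)"
        using N0 by (intro divide_right_mono order_trans [OF sum_abs sum_mono] tw) auto
      also have "\<dots> = fact k * fact k * M / (fact k * N)"
        using finE by (simp add: card_dlists_full k_def)
      also have "\<dots> = fact k / N * M" by simp
      also have "fact k / N \<le> q ^ k"
      proof -
        have "real (card (dlists k (E - E0))) * real (card (X - E)) ^ k \<le> real (card (E - E0)) ^ k * N"
          unfolding N_def using finE finite_X kX by (intro card_dlists_ratio) (auto simp: k_def)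
        then have "fact k * real (card X - d) ^ k \<le> real k ^ k * N"
          using finE by (simp add: card_dlists_full cX k_def)
        also have "\<dots> \<le> real d ^ k * N"
          using kd N0 by (intro mult_right_mono power_mono) auto
        finally show ?thesis
          using N0 nd0 by (simp add: q_def power_divide field_simps)
      qed
      finally show ?thesis using M0 by (simp add: k_def mult_right_mono)
    qed
    then have "\<bar>\<Sum>E0\<in>Pow E - {E}. T E0\<bar> \<le> (\<Sum>E0\<in>Pow E - {E}. q ^ card (E - E0) * M)"
      by (intro order_trans [OF sum_abs sum_mono])
    also have "\<dots> = (\<Sum>E0\<in>Pow E - {E}. q ^ card (E - E0)) * M"
      by (simp add: sum_distrib_right)
    also have "\<dots> \<le> 1 / 2 * M"
      using M0 by (intro mult_right_mono sum_proper_subsets_le [OF finE cE q]) auto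
    finally show ?thesis using eq by (simp add: M_def)
  qed
  have "energy d B / 2 = (\<Sum>E\<in>subs d. mean G (\<lambda>s. (B (graph_on s E))\<^sup>2) / 2)"
    by (simp add: energy_def sum_divide_distrib)
  also have "\<dots> \<le> (\<Sum>E\<in>subs d. mean G (\<lambda>s. gsum d B s * B (graph_on s E)))"
    by (intro sum_mono one)
  also have "\<dots> = mean G (\<lambda>s. gsum d B s * gsum d B s)"
    by (simp add: mean_sum [symmetric] sum_distrib_left [symmetric] gsum_def [of d B, symmetric])
  finally show ?thesis by (simp add: power2_eq_square)
qed

text \<open>On \<open>G\<close> the function equals \<open>gsum d B\<close> for a harmonic
  \<open>B\<close>, since the difference has degree \<open>d - 1\<close> and is orthogonal to that
  degree. Its squared norm is then a pairing of \<open>restr f\<close> with \<open>B\<close>, half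
  of which is absorbed by means of \<open>energy_le_gsum\<close>.\<close>

lemma frame_inequality:
  assumes f: "low d f" "orth (d - 1) f" and d: "0 < d" "10 * d\<^sup>2 \<le> card X"
  shows "mean G (\<lambda>s. (f s)\<^sup>2) \<le> 2 * energy d (restr f)"
proof -
  obtain B where B: "harmonic X d B" "low (d - 1) (\<lambda>s. f s - gsum d B s)"
    using harmonic_representative [OF f(1) d(1)] by blast
  have "orth (d - 1) (gsum d B)"
    using degree_bounds(1) [OF d] by (intro orth_gsum [OF B(1) d(1)]) linarith
  then have "orth (d - 1) (\<lambda>s. f s - gsum d B s)" by (rule orth_diff [OF f(2)])
  then have eq: "f s = gsum d B s" if "s \<in> G" for s
    using low_orth_zero [OF B(2) _ that] by simp
  define F where "F = mean G (\<lambda>s. (f s)\<^sup>2)"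
  have "energy d B \<le> 2 * mean G (\<lambda>s. (gsum d B s)\<^sup>2)" by (rule energy_le_gsum [OF B(1) d])
  also have "mean G (\<lambda>s. (gsum d B s)\<^sup>2) = F" by (simp add: F_def eq)
  finally have EB: "energy d B \<le> 2 * F" .
  have amgm: "x * y \<le> x\<^sup>2 + y\<^sup>2 / 4" for x y :: real
    using zero_le_power2 [of "x - y / 2"] by (simp add: power2_eq_square algebra_simps)
  have "F = mean G (\<lambda>s. f s * gsum d B s)" by (simp add: F_def eq power2_eq_square)
  also have "\<dots> = (\<Sum>E\<in>subs d. mean G (\<lambda>s. f s * B (graph_on s E)))"
    by (simp add: gsum_def sum_distrib_left mean_sum)
  also have "\<dots> = (\<Sum>E\<in>subs d. mean G (\<lambda>s. restr f (graph_on s E) * B (graph_on s E)))"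
  proof (rule sum.cong [OF refl])
    fix E assume "E \<in> subs d"
    then obtain I where I: "I \<in> dlists d X" "set I = E" using subs_list by blast
    show "mean G (\<lambda>s. f s * B (graph_on s E)) = mean G (\<lambda>s. restr f (graph_on s E) * B (graph_on s E))"
      using mean_G_restr [of f "\<lambda>l. B (set (zip I l))" I] by (simp add: graph_on_set [symmetric] I(2))
  qed
  also have "\<dots> \<le> (\<Sum>E\<in>subs d. mean G (\<lambda>s. (restr f (graph_on s E))\<^sup>2 + (B (graph_on s E))\<^sup>2 / 4))"
    by (intro sum_mono mean_mono amgm)
  also have "\<dots> = energy d (restr f) + energy d B / 4"
    by (simp add: energy_def mean_add mean_divide sum.distrib sum_divide_distrib)
  finally show ?thesis using EB by (simp add: F_def [symmetric])
qed

end

section \<open>Convolution on the alternating group\<close>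

lemma mean_fibrewise:
  assumes "finite A" "finite B" "\<And>x. x \<in> A \<Longrightarrow> key x \<in> B"
    and fib: "\<And>y. y \<in> B \<Longrightarrow> card {x \<in> A. key x = y} = N" and "0 < N"
  shows "mean A f = mean B (\<lambda>y. mean {x \<in> A. key x = y} f)"
proof -
  have grp: "(\<Sum>x\<in>A. g x) = (\<Sum>y\<in>B. \<Sum>x\<in>{x \<in> A. key x = y}. g x)" for g :: "'a \<Rightarrow> real"
    using assms(1-3) by (intro sum.group [symmetric]) auto
  have "real (card A) = real N * real (card B)"
    using grp [of "\<lambda>_. 1"] fib by simp
  moreover have "mean B (\<lambda>y. mean {x \<in> A. key x = y} f) = (\<Sum>y\<in>B. (\<Sum>x\<in>{x \<in> A. key x = y}. f x) / real N) / real (card B)"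
    unfolding mean_def by (intro arg_cong2 [where f = "(/)"] sum.cong refl) (simp add: fib)
  ultimately show ?thesis
    by (simp add: mean_def grp [of f] sum_divide_distrib [symmetric])
qed

context even_permutations
begin

text \<open>Ordered such that the mean of \<open>f x * conv g h x\<close>, for the indicators of A,
  B and C, is the probability that x is in A, y in B and their product in C. As an operator on
  \<open>h\<close> it commutes with left translations.\<close>

definition conv :: "((nat \<Rightarrow> nat) \<Rightarrow> real) \<Rightarrow> ((nat \<Rightarrow> nat) \<Rightarrow> real) \<Rightarrow> (nat \<Rightarrow> nat) \<Rightarrow> real" where
  "conv g h x = mean G (\<lambda>y. g y * h (x \<circ> y))"

lemma conv_sum: "conv g h = (\<lambda>x. \<Sum>y\<in>G. (g y / real (card G)) * h (id \<circ> x \<circ> y))"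
  by (simp add: conv_def [abs_def] mean_def sum_divide_distrib)

lemma low_conv: "low d h \<Longrightarrow> low d (conv g h)"
  unfolding conv_sum by (intro low_sum low_cmult low_translate id_in_G)

lemma orth_conv: "orth d h \<Longrightarrow> orth d (conv g h)"
  unfolding conv_sum by (intro orth_sum orth_cmult orth_translate id_in_G)

lemma conv_diff_left: "conv (\<lambda>y. g y - g' y) h x = conv g h x - conv g' h x"
  by (simp add: conv_def left_diff_distrib mean_diff)

lemma conv_diff_right: "conv g (\<lambda>y. h y - h' y) x = conv g h x - conv g h' x"
  by (simp add: conv_def right_diff_distrib mean_diff)

lemma conv_add_right: "conv g (\<lambda>y. h y + h' y) x = conv g h x + conv g h' x"
  by (simp add: conv_def distrib_left mean_add)

lemma conv_sum_right: "conv g (\<lambda>y. \<Sum>i\<in>I. h i y) x = (\<Sum>i\<in>I. conv g (h i) x)"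
  by (simp add: conv_def sum_distrib_left mean_sum)

lemma conv_orth_low: "orth d g \<Longrightarrow> low d h \<Longrightarrow> x \<in> G \<Longrightarrow> conv g h x = 0"
  unfolding conv_def using low_translate [OF _ id_in_G, of d h x] by (intro orth_low) auto

lemma conv_low_orth: "low d g \<Longrightarrow> orth d h \<Longrightarrow> x \<in> G \<Longrightarrow> conv g h x = 0"
  unfolding conv_def using orth_translate [OF _ id_in_G, of d h x] by (intro low_orth) auto

lemma ext_zip: "length I = length J \<Longrightarrow> ext (set (zip I J)) = {s \<in> G. map s I = J}"
  by (induction I J rule: list_induct2) (auto simp: ext_def)

text \<open>Umvirate averages of a convolution multiply like matrices indexed by tuples: condition
  on the tuple \<open>K\<close> that \<open>y\<close> carries to \<open>I\<close>.\<close>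

lemma restr_conv:
  assumes I: "I \<in> dlists d X" and J: "J \<in> dlists d X" and d: "d + 2 \<le> card X"
  shows "restr (conv g h) (set (zip I J)) =
    mean (dlists d X) (\<lambda>K. restr g (set (zip K I)) * restr h (set (zip K J)))"
proof -
  define F where "F I J = {s \<in> G. map s I = J}" for I J
  have F: "restr f (set (zip I J)) = mean (F I J) f" if "I \<in> dlists d X" "J \<in> dlists d X" for f I J
    using that by (simp add: restr_def F_def ext_zip dlists_def)
  have inv_map: "map (inv' y) I = K \<longleftrightarrow> map y K = I" if y: "y \<in> G" for y K
  proof -
    have "map (inv' y) (map y K) = K" "map y (map (inv' y) I) = I"
      using inv_comp_G [OF y] comp_inv_G [OF y] by simp_all
    then show ?thesis by metis
  qed
  have transl: "mean (F I J) (\<lambda>x. h (x \<circ> y)) = mean (F (map (inv' y) I) J) h" if y: "y \<in> G" for y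
  proof -
    have "bij_betw (\<lambda>x. id \<circ> x \<circ> y) (F I J) (F (map (inv' y) I) J)"
    proof (rule bij_betw_translate [OF y id_in_G])
      fix s assume s: "s \<in> G"
      have "map y (map (inv' y) I) = I" using comp_inv_G [OF y] by simp
      then have eq: "map (id \<circ> s \<circ> y) (map (inv' y) I) = map s I" by (metis id_o map_map)
      then show "s \<in> F I J \<longleftrightarrow> id \<circ> s \<circ> y \<in> F (map (inv' y) I) J"
        unfolding F_def mem_Collect_eq eq using s comp_in_G [OF s y] by simp
    qed (auto simp: F_def)
    from mean_bij [OF this, of h] show ?thesis by simp
  qed
  have "restr (conv g h) (set (zip I J)) = mean G (\<lambda>y. g y * mean (F I J) (\<lambda>x. h (x \<circ> y)))"
    unfolding F [OF I J] conv_def by (subst mean_swap) (simp add: mean_cmult)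
  also have "\<dots> = mean G (\<lambda>y. g y * mean (F (map (inv' y) I) J) h)"
    by (simp add: transl)
  also have "\<dots> = mean (dlists d X) (\<lambda>K. mean {y \<in> G. map (inv' y) I = K} (\<lambda>y. g y * mean (F (map (inv' y) I) J) h))"
  proof (rule mean_fibrewise [OF finite_G finite_dlists [OF finite_X]])
    show "0 < card (F I I)" unfolding F_def by (rule card_map_fibre_pos [OF I I d])
    show "map (inv' y) I \<in> dlists d X" if "y \<in> G" for y by (rule map_in_dlists [OF inv_in_G [OF that] I])
    fix K assume K: "K \<in> dlists d X"
    have "{y \<in> G. map (inv' y) I = K} = F K I" using inv_map by (auto simp: F_def)
    then show "card {y \<in> G. map (inv' y) I = K} = card (F I I)"
      using card_map_fibre [OF K I I I d] by (simp add: F_def)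
  qed
  also have "\<dots> = mean (dlists d X) (\<lambda>K. restr g (set (zip K I)) * restr h (set (zip K J)))"
  proof (rule mean_cong [OF refl], unfold simp_implies_def)
    fix K assume K: "K \<in> dlists d X"
    have FK: "{y \<in> G. map (inv' y) I = K} = F K I" using inv_map by (auto simp: F_def)
    have "mean {y \<in> G. map (inv' y) I = K} (\<lambda>y. g y * mean (F (map (inv' y) I) J) h)
        = mean {y \<in> G. map (inv' y) I = K} (\<lambda>y. g y * mean (F K J) h)"
      by (rule mean_cong) (auto simp: simp_implies_def)
    then show "mean {y \<in> G. map (inv' y) I = K} (\<lambda>y. g y * mean (F (map (inv' y) I) J) h)
        = restr g (set (zip K I)) * restr h (set (zip K J))"
      by (simp add: FK mean_multc F [OF K I] F [OF K J])
  qed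
  finally show ?thesis .
qed

text \<open>Up to normalisation the energy is a squared Hilbert-Schmidt norm over pairs of tuples;
  each set of domain points is counted d! times.\<close>

lemma energy_dlists:
  assumes "d + 2 \<le> card X"
  shows "fact d * energy d B = real (card (dlists d X)) * mean (dlists d X) (\<lambda>I. mean (dlists d X) (\<lambda>J. (B (set (zip I J)))\<^sup>2))"
proof -
  have "fact d * energy d B = (\<Sum>I\<in>dlists d X. mean G (\<lambda>s. (B (graph_on s (set I)))\<^sup>2))"
    by (simp add: energy_def subs_def sum_dlists_set [OF finite_X, of "\<lambda>E. mean G (\<lambda>s. (B (graph_on s E))\<^sup>2)"])
  also have "\<dots> = (\<Sum>I\<in>dlists d X. mean (dlists d X) (\<lambda>J. (B (set (zip I J)))\<^sup>2))"
    using mean_G_map [OF _ assms, of _ "\<lambda>J. (B (set (zip _ J)))\<^sup>2"]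
    by (intro sum.cong refl) (simp add: graph_on_set)
  also have "\<dots> = real (card (dlists d X)) * mean (dlists d X) (\<lambda>I. mean (dlists d X) (\<lambda>J. (B (set (zip I J)))\<^sup>2))"
  proof -
    have "0 < card (dlists d X)" using assms finite_X by (intro card_dlists_pos) auto
    then show ?thesis by (simp add: mean_def [of "dlists d X" "\<lambda>I. mean (dlists d X) (\<lambda>J. (B (set (zip I J)))\<^sup>2)"])
  qed
  finally show ?thesis .
qed

text \<open>Submultiplicativity of the Hilbert-Schmidt norm. The gain is d! divided by the number of
  d-tuples, at most (d / n)^d.\<close>

lemma energy_conv_le:
  assumes d: "0 < d" "d + 2 \<le> card X"
  shows "energy d (restr (conv g h)) \<le> (real d / real (card X)) ^ d * (energy d (restr g) * energy d (restr h))"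
proof -
  define D where "D = dlists d X"
  define N where "N = real (card D)"
  define S where "S B = mean D (\<lambda>I. mean D (\<lambda>J. (B (set (zip I J)))\<^sup>2))" for B :: "(nat \<times> nat) set \<Rightarrow> real"
  have N0: "0 < N" unfolding N_def D_def using d finite_X card_dlists_pos [of X d] by simp
  have S_eq: "S B = fact d * energy d B / N" for B
    using energy_dlists [OF d(2), of B] N0 by (simp add: S_def D_def N_def)
  have "S (restr (conv g h)) \<le> mean D (\<lambda>I. mean D (\<lambda>J.
      mean D (\<lambda>K. (restr g (set (zip K I)))\<^sup>2) * mean D (\<lambda>K. (restr h (set (zip K J)))\<^sup>2)))"
    unfolding S_def
    by (intro mean_mono) (simp only: D_def restr_conv [OF _ _ d(2)] mean_Cauchy_Schwarz)
  also have "\<dots> = mean D (\<lambda>I. mean D (\<lambda>K. (restr g (set (zip K I)))\<^sup>2)) * mean D (\<lambda>J. mean D (\<lambda>K. (restr h (set (zip K J)))\<^sup>2))"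
    by (simp only: mean_cmult mean_multc)
  also have "\<dots> = S (restr g) * S (restr h)"
    unfolding S_def mean_swap [of D D "\<lambda>K I. (restr g (set (zip K I)))\<^sup>2"] mean_swap [of D D "\<lambda>K I. (restr h (set (zip K I)))\<^sup>2"] ..
  finally have "fact d * energy d (restr (conv g h)) / N \<le> (fact d * energy d (restr g) / N) * (fact d * energy d (restr h) / N)"
    by (simp only: S_eq)
  then have "energy d (restr (conv g h)) \<le> fact d / N * (energy d (restr g) * energy d (restr h))"
    using N0 by (simp add: field_simps)
  also have "fact d / N \<le> (real d / real (card X)) ^ d"
  proof -
    obtain K where K: "K \<subseteq> X" "card K = d" using d(2) by (meson add_leD1 obtain_subset_with_card_n)
    have finK: "finite K" using K finite_X finite_subset by blast
    have "real (card (dlists d K)) * real (card X) ^ d \<le> real (card K) ^ d * N"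
      unfolding N_def D_def using finK finite_X K d by (intro card_dlists_ratio) auto
    then have "fact d * real (card X) ^ d \<le> real d ^ d * N"
      using finK K by (simp add: card_dlists_full)
    then show ?thesis using N0 d by (simp add: power_divide field_simps)
  qed
  finally show ?thesis by (simp add: mult_right_mono energy_nonneg)
qed

lemma trilinear_level_le:
  assumes f: "low d f" "orth (d - 1) f" and h: "low d h" "orth (d - 1) h" and d: "0 < d" "10 * d\<^sup>2 \<le> card X"
  shows "\<bar>mean G (\<lambda>x. f x * conv g h x)\<bar>
    \<le> 2 * sqrt ((real d / real (card X)) ^ d * energy d (restr f) * energy d (restr g) * energy d (restr h))"
proof -
  have d2: "d + 2 \<le> card X" using degree_bounds(1) [OF d] by linarith
  have "\<bar>mean G (\<lambda>x. f x * conv g h x)\<bar> \<le> sqrt (mean G (\<lambda>x. (f x)\<^sup>2)) * sqrt (mean G (\<lambda>x. (conv g h x)\<^sup>2))"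
    by (rule abs_mean_mult_le)
  also have "\<dots> \<le> sqrt (2 * energy d (restr f)) * sqrt (2 * energy d (restr (conv g h)))"
    using frame_inequality [OF f d] frame_inequality [OF low_conv [OF h(1)] orth_conv [OF h(2)] d]
    by (intro mult_mono real_sqrt_le_mono) (auto intro: mean_nonneg energy_nonneg)
  also have "\<dots> = 2 * sqrt (energy d (restr f) * energy d (restr (conv g h)))"
    by (simp add: real_sqrt_mult)
  also have "\<dots> \<le> 2 * sqrt (energy d (restr f) * ((real d / real (card X)) ^ d * (energy d (restr g) * energy d (restr h))))"
    by (intro mult_left_mono real_sqrt_le_mono energy_conv_le d d2 energy_nonneg) simp
  finally show ?thesis by (simp only: mult_ac)
qed

lemma mean_mult_layer:
  assumes "low d k" "orth (d - 1) k"
  shows "mean G (\<lambda>s. f s * k s) = mean G (\<lambda>s. layer d f s * k s)"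
proof -
  have f: "f x = layer d f x + proj (d - 1) f x + (f x - proj d f x)" for x
    by (simp add: layer_def)
  have "mean G (\<lambda>x. f x * k x) = mean G (\<lambda>x. layer d f x * k x) + mean G (\<lambda>x. proj (d - 1) f x * k x)
      + mean G (\<lambda>x. (f x - proj d f x) * k x)"
    by (subst f) (simp only: distrib_right mean_add)
  also have "mean G (\<lambda>x. proj (d - 1) f x * k x) = 0" by (rule low_orth [OF low_proj assms(2)])
  also have "mean G (\<lambda>x. (f x - proj d f x) * k x) = 0" by (rule orth_low [OF orth_proj assms(1)])
  finally show ?thesis by simp
qed

text \<open>Degrees do not interact: convolution by \<open>g\<close> keeps the pure degree of its
  second argument, so the other two factors may be replaced with their own degree \<open>d\<close>
  parts.\<close>

lemma trilinear_layer:
  assumes d: "0 < d"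
  shows "mean G (\<lambda>x. f x * conv g (layer d h) x) = mean G (\<lambda>x. layer d f x * conv (layer d g) (layer d h) x)"
proof -
  define k where "k = conv g (layer d h)"
  have k: "low d k" "orth (d - 1) k"
    unfolding k_def by (intro low_conv low_layer orth_conv orth_layer d)+
  have "mean G (\<lambda>x. f x * k x) = mean G (\<lambda>x. layer d f x * k x)" by (rule mean_mult_layer [OF k])
  also have "\<dots> = mean G (\<lambda>x. layer d f x * conv (layer d g) (layer d h) x)"
  proof (rule mean_cong [OF refl], unfold simp_implies_def)
    fix x assume x: "x \<in> G"
    have "conv (\<lambda>y. (g y - proj d g y) + proj (d - 1) g y) (layer d h) x = 0"
    proof -
      have "conv (\<lambda>y. g y - proj d g y) (layer d h) x = 0"
        by (rule conv_orth_low [OF orth_proj low_layer x])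
      moreover have "conv (proj (d - 1) g) (layer d h) x = 0"
        by (rule conv_low_orth [OF low_proj orth_layer [OF d] x])
      ultimately show ?thesis by (simp add: conv_def distrib_right mean_add)
    qed
    moreover have "(\<lambda>y. (g y - proj d g y) + proj (d - 1) g y) = (\<lambda>y. g y - layer d g y)"
      by (simp add: layer_def fun_eq_iff)
    ultimately have "k x = conv (layer d g) (layer d h) x"
      by (simp add: k_def conv_diff_left)
    then show "layer d f x * k x = layer d f x * conv (layer d g) (layer d h) x" by simp
  qed
  finally show ?thesis by (simp add: k_def)
qed

lemma proj_0: "s \<in> G \<Longrightarrow> proj 0 h s = mean G h"
proof -
  have g0: "graphs_upto 0 = {{}}"
    using finite_X finite_subset [of _ "X \<times> X"] by (auto simp: graphs_upto_def)
  have e0: "ext {} = G" by (auto simp: ext_def)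
  obtain c where c: "\<And>s. s \<in> G \<Longrightarrow> proj 0 h s = c"
    using low_proj [of 0 h] by (auto simp: low_def g0 e0)
  have "(\<Sum>s\<in>G. h s - proj 0 h s) = 0"
    using orth_proj [of 0 h] by (simp add: orth_def g0 e0)
  then have "(\<Sum>s\<in>G. h s) = real (card G) * c" by (simp add: sum_subtractf c)
  then have "mean G h = c" using finite_G G_nonempty by (simp add: mean_def)
  then show "s \<in> G \<Longrightarrow> proj 0 h s = mean G h" using c by simp
qed

lemma trilinear_decomposition:
  "mean G (\<lambda>x. f x * conv g h x) = mean G f * mean G g * mean G h
    + (\<Sum>d\<in>{1..D}. mean G (\<lambda>x. layer d f x * conv (layer d g) (layer d h) x))
    + mean G (\<lambda>x. f x * conv g (\<lambda>y. h y - proj D h y) x)"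
proof -
  have "conv g h x = conv g (\<lambda>y. proj 0 h y + (\<Sum>d\<in>{1..D}. layer d h y) + (h y - proj D h y)) x" for x
    by (rule arg_cong [where f = "\<lambda>h. conv g h x"]) (rule ext, rule layer_decomposition)
  then have "conv g h x = conv g (proj 0 h) x + (\<Sum>d\<in>{1..D}. conv g (layer d h) x) + conv g (\<lambda>y. h y - proj D h y) x" for x
    by (simp only: conv_add_right conv_sum_right)
  then have "mean G (\<lambda>x. f x * conv g h x) = mean G (\<lambda>x. f x * conv g (proj 0 h) x)
      + (\<Sum>d\<in>{1..D}. mean G (\<lambda>x. f x * conv g (layer d h) x)) + mean G (\<lambda>x. f x * conv g (\<lambda>y. h y - proj D h y) x)"
    by (simp only: distrib_left sum_distrib_left mean_add mean_sum)
  moreover have "mean G (\<lambda>x. f x * conv g (proj 0 h) x) = mean G f * mean G g * mean G h"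
  proof -
    have "conv g (proj 0 h) x = mean G g * mean G h" if "x \<in> G" for x
      using that by (simp add: conv_def proj_0 comp_in_G mean_multc)
    then show ?thesis by (simp add: mean_multc mult.assoc)
  qed
  moreover have "(\<Sum>d\<in>{1..D}. mean G (\<lambda>x. f x * conv g (layer d h) x))
      = (\<Sum>d\<in>{1..D}. mean G (\<lambda>x. layer d f x * conv (layer d g) (layer d h) x))"
    by (intro sum.cong refl trilinear_layer) auto
  ultimately show ?thesis by linarith
qed

end

section \<open>Convolution contracts functions of high degree\<close>

lemma tendsto_mean:
  "(\<And>x. x \<in> A \<Longrightarrow> (\<lambda>n. f n x) \<longlonglongrightarrow> l x) \<Longrightarrow> (\<lambda>n. mean A (f n)) \<longlonglongrightarrow> mean A l"
  unfolding mean_def divide_inverse by (intro tendsto_mult_right tendsto_sum)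

text \<open>Bolzano-Weierstrass, one coordinate at a time.\<close>

lemma convergent_subsequence_on_finite:
  fixes f :: "nat \<Rightarrow> 'a \<Rightarrow> real"
  assumes "finite A" "\<And>n a. a \<in> A \<Longrightarrow> \<bar>f n a\<bar> \<le> C"
  shows "\<exists>r l. strict_mono r \<and> (\<forall>a\<in>A. (\<lambda>n. f (r n) a) \<longlonglongrightarrow> l a)"
  using assms
proof (induction A rule: finite_induct)
  case empty
  have "strict_mono (id :: nat \<Rightarrow> nat)" by (simp add: strict_mono_def)
  then show ?case by blast
next
  case (insert a A)
  obtain r l where r: "strict_mono r" "\<And>b. b \<in> A \<Longrightarrow> (\<lambda>n. f (r n) b) \<longlonglongrightarrow> l b"
    using insert by blast
  have "bounded (range (\<lambda>n. f (r n) a))"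
    using insert.prems unfolding bounded_iff by (intro exI [of _ C]) auto
  then obtain x r' where r': "strict_mono r'" "((\<lambda>n. f (r n) a) \<circ> r') \<longlonglongrightarrow> x"
    using bounded_imp_convergent_subsequence by blast
  have lim: "(\<lambda>n. f ((r \<circ> r') n) b) \<longlonglongrightarrow> (if b = a then x else l b)" if "b \<in> insert a A" for b
  proof (cases "b = a")
    case True
    then show ?thesis using r'(2) by (simp add: o_def)
  next
    case False
    then have "(\<lambda>n. f (r n) b) \<longlonglongrightarrow> l b" using that r(2) by simp
    from LIMSEQ_subseq_LIMSEQ [OF this r'(1)] False show ?thesis by (simp add: o_def)
  qed
  show ?case
    by (rule exI [of _ "r \<circ> r'"], rule exI [of _ "\<lambda>b. if b = a then x else l b"], rule conjI,
        rule strict_mono_o [OF r(1) r'(1)], rule ballI, rule lim)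
qed

section \<open>Many orthogonal translates from disjoint double swaps\<close>

abbreviation swap2 :: "nat \<Rightarrow> nat \<Rightarrow> nat \<Rightarrow> nat \<Rightarrow> nat \<Rightarrow> nat" where
  "swap2 a b c d \<equiv> Transposition.transpose a b \<circ> Transposition.transpose c d"

context even_permutations
begin

lemma swap2_in_G:
  assumes "a \<in> X" "b \<in> X" "c \<in> X" "d \<in> X" "a \<noteq> b" "c \<noteq> d"
  shows "swap2 a b c d \<in> G"
proof -
  have "Transposition.transpose a b permutes X" "Transposition.transpose c d permutes X"
    using assms by (auto intro: permutes_swap_id)
  then show ?thesis
    using assms by (simp add: G_def permutes_compose evenperm_comp evenperm_swap permutation_G)
qed

text \<open>Invariance under double swaps off \<open>Y\<close> gives invariance under all even
  permutations of \<open>X - Y\<close>. Then \<open>v x\<close> depends only on the preimages under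
  \<open>x\<close> of the points of \<open>Y\<close>, which makes it a combination of umvirates of
  size \<open>card Y\<close>.\<close>

lemma low_if_swap_invariant:
  assumes Y: "Y \<subseteq> X" "5 \<le> card (X - Y)"
    and v: "\<And>a b c d x. {a, b, c, d} \<subseteq> X - Y \<Longrightarrow> distinct [a, b, c, d] \<Longrightarrow> x \<in> G \<Longrightarrow> v (swap2 a b c d \<circ> x) = v x"
  shows "low (card Y) v"
proof -
  \<comment> \<open>If the transpositions overlap, a transposition of two further points is inserted
    between them. The overlap leaves at most three points in use, hence the requirement of
    five.\<close>
  have pair: "v (swap2 p q a b \<circ> x) = v x"
    if pq: "p \<in> X - Y" "q \<in> X - Y" "p \<noteq> q" and ab: "a \<in> X - Y" "b \<in> X - Y" "a \<noteq> b" and x: "x \<in> G" for p q a b x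
  proof (cases "{p, q} \<inter> {a, b} = {}")
    case True
    then show ?thesis using that by (intro v) auto
  next
    case False
    then have "card {p, q, a, b} \<le> 3"
      using pq(3) ab(3) by (auto simp: card_insert_if)
    moreover have "card (X - Y - {p, q, a, b}) = card (X - Y) - card {p, q, a, b}"
      using pq ab by (intro card_Diff_subset) auto
    ultimately have "2 \<le> card (X - Y - {p, q, a, b})" using Y(2) by linarith
    then obtain T where "T \<subseteq> X - Y - {p, q, a, b}" "card T = 2" by (meson obtain_subset_with_card_n)
    then obtain d e where de: "d \<in> X - Y - {p, q, a, b}" "e \<in> X - Y - {p, q, a, b}" "d \<noteq> e"
      by (auto simp: card_2_iff)
    have "swap2 d e a b \<circ> x \<in> G"
      using de ab x by (intro comp_in_G swap2_in_G) auto
    then have "v (swap2 p q d e \<circ> (swap2 d e a b \<circ> x)) = v (swap2 d e a b \<circ> x)"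
      using pq de by (intro v) auto
    also have "\<dots> = v x" using ab de x by (intro v) auto
    also have "swap2 p q d e \<circ> (swap2 d e a b \<circ> x) = swap2 p q a b \<circ> x"
      by (simp add: fun_eq_iff)
    finally show ?thesis .
  qed
  have inv: "v (\<sigma> \<circ> x) = v x" if s: "\<sigma> permutes (X - Y)" "evenperm \<sigma>" and x: "x \<in> G" for \<sigma> x
  proof -
    \<comment> \<open>Transpositions are added one at a time, so odd permutations need a companion
      statement: one more transposition makes them act trivially.\<close>
    have "(evenperm \<sigma> \<longrightarrow> (\<forall>x\<in>G. v (\<sigma> \<circ> x) = v x)) \<and>
        (\<not> evenperm \<sigma> \<longrightarrow> (\<forall>p\<in>X - Y. \<forall>q\<in>X - Y. p \<noteq> q \<longrightarrow> (\<forall>x\<in>G. v (Transposition.transpose p q \<circ> \<sigma> \<circ> x) = v x)))"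
      using s(1) finite_Diff [OF finite_X, of Y]
    proof (induction rule: permutes_induct)
      case id
      then show ?case by simp
    next
      case (swap a b \<tau>)
      have tau: "\<tau> permutes X" using permutes_subset [OF swap.hyps(4)] by blast
      have ev: "evenperm (Transposition.transpose a b \<circ> \<tau>) \<longleftrightarrow> \<not> evenperm \<tau>"
        using swap.hyps(1-3) permutation_G [OF tau] by (simp add: evenperm_comp evenperm_swap permutation_swap_id)
      show ?case
      proof (intro conjI impI ballI)
        fix x assume "evenperm (Transposition.transpose a b \<circ> \<tau>)" and x: "x \<in> G"
        then have "\<not> evenperm \<tau>" using ev by blast
        then show "v (Transposition.transpose a b \<circ> \<tau> \<circ> x) = v x" using swap x by blast
      next
        fix p q x assume odd: "\<not> evenperm (Transposition.transpose a b \<circ> \<tau>)" and pq: "p \<in> X - Y" "q \<in> X - Y" "p \<noteq> q"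
          and x: "x \<in> G"
        then have e: "evenperm \<tau>" using ev by blast
        then have "\<tau> \<in> G" using tau by (simp add: G_def)
        then have "v (swap2 p q a b \<circ> (\<tau> \<circ> x)) = v (\<tau> \<circ> x)"
          using pq swap.hyps(1-3) x by (intro pair comp_in_G) auto
        also have "\<dots> = v x" using swap.IH e x by blast
        finally show "v (Transposition.transpose p q \<circ> (Transposition.transpose a b \<circ> \<tau>) \<circ> x) = v x"
          by (simp only: o_assoc)
      qed
    qed
    then show ?thesis using s(2) x by blast
  qed
  \<comment> \<open>\<open>m x\<close> records the preimages of \<open>Y\<close> under
    \<open>x\<close>. The umvirates \<open>ext (m x)\<close> partition \<open>G\<close>, and
    \<open>v\<close> is constant on each of them.\<close>
  define m where "m x = graph_on x (inv' x ` Y)" for x :: "nat \<Rightarrow> nat"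
  have mem: "x' \<in> ext (m x) \<longleftrightarrow> (\<forall>i\<in>Y. x' (inv' x i) = i)" if "x \<in> G" "x' \<in> G" for x x'
  proof -
    have "x (inv' x i) = i" for i using comp_inv_G [OF that(1)] by (metis comp_apply id_apply)
    then show ?thesis using that by (auto simp: m_def ext_graph_on)
  qed
  have self: "x \<in> ext (m x)" if "x \<in> G" for x
    using that comp_inv_G [OF that] by (auto simp: mem fun_eq_iff)
  have same: "v x' = v x" if x: "x \<in> G" "x' \<in> G" and e: "x' \<in> ext (m x)" for x x'
  proof -
    define \<sigma> where "\<sigma> = x' \<circ> inv' x"
    have sG: "\<sigma> \<in> G" unfolding \<sigma>_def using x by (intro comp_in_G inv_in_G)
    have fixY: "\<sigma> i = i" if "i \<in> Y" for i using e mem [OF x] that by (simp add: \<sigma>_def)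
    have "\<sigma> permutes (X - Y)"
    proof (rule permutes_superset [OF G_permutes [OF sG]])
      fix i assume "i \<in> X - (X - Y)"
      then show "\<sigma> i = i" using fixY by blast
    qed
    moreover have "evenperm \<sigma>" using sG by (simp add: G_def)
    ultimately have "v (\<sigma> \<circ> x) = v x" using x(1) by (intro inv)
    moreover have "\<sigma> \<circ> x = x'" unfolding \<sigma>_def using inv_comp_G [OF x(1)] by (simp add: o_assoc [symmetric])
    ultimately show ?thesis by simp
  qed
  define M where "M = m ` G"
  define c where "c \<mu> = v (SOME x. x \<in> G \<and> m x = \<mu>)" for \<mu>
  have c: "c (m x) = v x" if x: "x \<in> G" for x
  proof -
    have "\<exists>z. z \<in> G \<and> m z = m x" using x by blast
    from someI_ex [OF this] have z: "(SOME z. z \<in> G \<and> m z = m x) \<in> G" "m (SOME z. z \<in> G \<and> m z = m x) = m x" by auto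
    then show ?thesis unfolding c_def using same [OF z(1) x] self [OF x] by metis
  qed
  have eqm: "m x' = m x" if x: "x \<in> G" "x' \<in> G" and e: "x' \<in> ext (m x)" for x x'
  proof -
    have "inv' x' i = inv' x i" if "i \<in> Y" for i
      using e mem [OF x] that permutes_inv_eq [OF G_permutes [OF x(2)]] by blast
    then have "inv' x' ` Y = inv' x ` Y" by auto
    moreover have "x' j = x j" if "j \<in> inv' x ` Y" for j
      using e that mem [OF x] comp_inv_G [OF x(1)] by (auto simp: fun_eq_iff)
    ultimately show ?thesis by (auto simp: m_def graph_on_def)
  qed
  have finM: "finite M" using finite_G by (simp add: M_def)
  have "low (card Y) (\<lambda>x. \<Sum>\<mu>\<in>M. c \<mu> * indicator (ext \<mu>) x)"
  proof (intro low_sum low_cmult low_indicator)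
    fix \<mu> assume "\<mu> \<in> M"
    then obtain x where x: "x \<in> G" "\<mu> = m x" by (auto simp: M_def)
    have "card (inv' x ` Y) = card Y"
      using inj_on_subset [OF inj_G [OF inv_in_G [OF x(1)]]] by (intro card_image) auto
    moreover have "graph_on x (inv' x ` Y) \<subseteq> X \<times> X"
      using Y(1) x(1) G_in_X_iff [OF inv_in_G [OF x(1)]] G_in_X_iff [OF x(1)] by (auto simp: graph_on_def)
    ultimately show "\<mu> \<in> graphs_upto (card Y)" by (simp add: x(2) m_def graphs_upto_def)
  qed
  then show ?thesis
  proof (rule low_cong)
    fix x assume x: "x \<in> G"
    have "(\<Sum>\<mu>\<in>M. c \<mu> * indicator (ext \<mu>) x) = (\<Sum>\<mu>\<in>{m x}. c \<mu> * indicator (ext \<mu>) x)"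
    proof (rule sum.mono_neutral_right [OF finM])
      show "{m x} \<subseteq> M" using x by (auto simp: M_def)
      show "\<forall>\<mu>\<in>M - {m x}. c \<mu> * indicator (ext \<mu>) x = 0"
      proof
        fix \<mu> assume \<mu>: "\<mu> \<in> M - {m x}"
        then obtain z where z: "z \<in> G" "\<mu> = m z" by (auto simp: M_def)
        have "x \<notin> ext \<mu>" using eqm [OF z(1) x] \<mu> z(2) by auto
        then show "c \<mu> * indicator (ext \<mu>) x = 0" by simp
      qed
    qed
    also have "\<dots> = v x" using c [OF x] self [OF x] by simp
    finally show "(\<Sum>\<mu>\<in>M. c \<mu> * indicator (ext \<mu>) x) = v x" .
  qed
qed

definition stab :: "nat set \<Rightarrow> (nat \<Rightarrow> nat) set" where
  "stab Y = {a \<in> G. \<forall>i\<in>Y. a i = i}"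

definition left_closed :: "nat set \<Rightarrow> ((nat \<Rightarrow> nat) \<Rightarrow> real) set \<Rightarrow> bool" where
  "left_closed Y S \<longleftrightarrow> (\<forall>u\<in>S. \<forall>v\<in>S. (\<lambda>x. u x + v x) \<in> S) \<and> (\<forall>c. \<forall>u\<in>S. (\<lambda>x. c * u x) \<in> S) \<and>
    (\<forall>a\<in>stab Y. \<forall>u\<in>S. (\<lambda>x. u (a \<circ> x)) \<in> S)"

text \<open>Relations of the Klein four-group on the points a, b, c, d; the last one says that the
  3-cycle \<open>swap2 b c c d\<close> conjugates one double swap into another.\<close>

lemma swap2_eqs:
  assumes "distinct [a, b, c, d]"
  shows "swap2 a b c d \<circ> swap2 a b c d = id"
    and "swap2 a c b d \<circ> swap2 a c b d = id"
    and "swap2 a b c d \<circ> swap2 a c b d = swap2 a d b c"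
    and "swap2 a c b d \<circ> swap2 a b c d = swap2 a d b c"
    and "swap2 a b d c = swap2 a b c d"
    and "swap2 a c b d \<circ> swap2 b c c d = swap2 b c c d \<circ> swap2 a b c d"
proof -
  have *: "f = g" if "f a = g a" "f b = g b" "f c = g c" "f d = g d"
      "\<And>x. x \<noteq> a \<Longrightarrow> x \<noteq> b \<Longrightarrow> x \<noteq> c \<Longrightarrow> x \<noteq> d \<Longrightarrow> f x = g x" for f g :: "nat \<Rightarrow> nat"
    using that by (metis ext)
  have ne: "a \<noteq> b" "a \<noteq> c" "a \<noteq> d" "b \<noteq> c" "b \<noteq> d" "c \<noteq> d"
    "b \<noteq> a" "c \<noteq> a" "d \<noteq> a" "c \<noteq> b" "d \<noteq> b" "d \<noteq> c" using assms by auto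
  show "swap2 a b c d \<circ> swap2 a b c d = id" "swap2 a c b d \<circ> swap2 a c b d = id"
    "swap2 a b c d \<circ> swap2 a c b d = swap2 a d b c" "swap2 a c b d \<circ> swap2 a b c d = swap2 a d b c"
    "swap2 a b d c = swap2 a b c d" "swap2 a c b d \<circ> swap2 b c c d = swap2 b c c d \<circ> swap2 a b c d"
    by (rule *; simp add: Transposition.transpose_def ne)+
qed

text \<open>If all double swaps off \<open>Y\<close> fixed \<open>u0\<close>, it would have degree
  at most \<open>D\<close> and vanish. So some double swap moves it, and antisymmetrising gives the
  sign -1. The Klein four-group is commutative, so the result can then be projected onto an
  eigenspace of a second double swap.\<close>

lemma ex_swap_eigenvector:
  assumes S: "left_closed Y S" and orth: "\<And>u. u \<in> S \<Longrightarrow> orth D u" and ne: "u0 \<in> S" "x0 \<in> G" "u0 x0 \<noteq> 0"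
    and Y: "Y \<subseteq> X" "5 \<le> card (X - Y)" "card Y \<le> D"
  obtains a b c d u x where "{a, b, c, d} \<subseteq> X - Y" "distinct [a, b, c, d]" "u \<in> S" "x \<in> G" "u x \<noteq> 0"
    "\<And>x. u (swap2 a b c d \<circ> x) = - u x" "\<And>x. u (swap2 a c b d \<circ> x) = u x"
proof -
  have "\<exists>a b c d x. {a, b, c, d} \<subseteq> X - Y \<and> distinct [a, b, c, d] \<and> x \<in> G \<and> u0 (swap2 a b c d \<circ> x) \<noteq> u0 x"
  proof (rule ccontr)
    assume "\<not> ?thesis"
    then have "low (card Y) u0" using Y by (intro low_if_swap_invariant) blast+
    then have "low D u0" by (rule low_mono) (rule Y(3))
    then have "u0 x0 = 0" using orth [OF ne(1)] ne(2) by (rule low_orth_zero)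
    with ne(3) show False ..
  qed
  then obtain a b c d x1 where abcd: "{a, b, c, d} \<subseteq> X - Y" "distinct [a, b, c, d]" and x1: "x1 \<in> G" "u0 (swap2 a b c d \<circ> x1) \<noteq> u0 x1"
    by blast
  define t where "t = swap2 a b c d"
  define t' where "t' = swap2 a c b d"
  note eqs = swap2_eqs [OF abcd(2)]
  have tG: "t \<in> G" "t' \<in> G" unfolding t_def t'_def using abcd by (auto intro!: swap2_in_G)
  have tstab: "t \<in> stab Y" "t' \<in> stab Y"
    using tG abcd(1) by (auto simp: stab_def t_def t'_def Transposition.transpose_def)
  have tt: "t \<circ> (t \<circ> x) = x" "t' \<circ> (t' \<circ> x) = x" "t \<circ> (t' \<circ> x) = t' \<circ> (t \<circ> x)" for x
    using eqs(1-4) by (metis o_assoc id_o t_def t'_def)+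
  have sub: "(\<lambda>x. u x + r * w x) \<in> S" if "u \<in> S" "w \<in> S" for u w r
    using S that by (simp add: left_closed_def)
  have trans: "(\<lambda>x. u (s \<circ> x)) \<in> S" if "u \<in> S" "s \<in> stab Y" for u s
    using S that by (simp add: left_closed_def)
  define v where "v x = u0 x + (- 1) * u0 (t \<circ> x)" for x
  have v: "v \<in> S" unfolding v_def by (rule sub [OF ne(1) trans [OF ne(1) tstab(1)]])
  have vx1: "v x1 \<noteq> 0" using x1(2) by (simp add: v_def t_def)
  have vt: "v (t \<circ> x) = - v x" for x by (simp add: v_def tt)
  define w where "w r x = v x + r * v (t' \<circ> x)" for r x
  have w: "w r \<in> S" for r unfolding w_def by (rule sub [OF v trans [OF v tstab(2)]])
  have wt: "w r (t \<circ> x) = - w r x" for r x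
    by (simp add: w_def tt(3) [symmetric] vt algebra_simps)
  have wt': "w 1 (t' \<circ> x) = w 1 x" "w (- 1) (t' \<circ> x) = - w (- 1) x" for x
    by (simp_all add: w_def tt)
  show ?thesis
  proof (cases "w 1 x1 = 0")
    case False
    show ?thesis
      by (rule that [of a b c d "w 1" x1, OF abcd w x1(1) False wt [unfolded t_def] wt'(1) [unfolded t'_def]])
  next
    \<comment> \<open>Only the sign -1 is available for the second double swap. The product of the
      two then acts trivially, and exchanging the roles of \<open>c\<close> and \<open>d\<close>
      gives the required signs.\<close>
    case True
    then have ne1: "w (- 1) x1 \<noteq> 0" using vx1 by (simp add: w_def)
    have inv: "w (- 1) (swap2 a d b c \<circ> x) = w (- 1) x" for x
    proof -
      have "swap2 a d b c \<circ> x = t \<circ> (t' \<circ> x)"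
        unfolding t_def t'_def o_assoc eqs(3) [unfolded o_assoc] ..
      then show ?thesis by (simp only: wt wt'(2) minus_minus)
    qed
    have neg: "w (- 1) (swap2 a b d c \<circ> x) = - w (- 1) x" for x
      unfolding eqs(5) by (rule wt [unfolded t_def])
    have "{a, b, d, c} \<subseteq> X - Y" "distinct [a, b, d, c]" using abcd by auto
    then show ?thesis by (rule that [of a b d c "w (- 1)" x1, OF _ _ w x1(1) ne1 neg inv])
  qed
qed

lemma stab_mono: "Y \<subseteq> Y' \<Longrightarrow> stab Y' \<subseteq> stab Y"
  by (auto simp: stab_def)

lemma swap2_commute_stab:
  assumes "s \<in> stab Y" "{a, b, c, d} \<subseteq> Y"
  shows "s \<circ> swap2 a b c d = swap2 a b c d \<circ> s"
proof -
  have inj: "inj s" using assms inj_G by (auto simp: stab_def)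
  have fx: "s a = a" "s b = b" "s c = c" "s d = d" using assms by (auto simp: stab_def)
  have "s \<circ> Transposition.transpose i j = Transposition.transpose i j \<circ> s" if "s i = i" "s j = j" for i j
  proof
    fix k
    show "(s \<circ> Transposition.transpose i j) k = (Transposition.transpose i j \<circ> s) k"
      using that inj by (auto simp: Transposition.transpose_def inj_eq)
  qed
  then show ?thesis using fx by (metis o_assoc)
qed

text \<open>Each step spends four points. On the eigenspace with sign -1 under \<open>t\<close> and
  +1 under \<open>t'\<close>, the conjugating element \<open>z\<close> exchanges the roles of the
  two: translates with and without \<open>z\<close> have opposite signs under \<open>t\<close>, so
  they are orthogonal and their number doubles. The induction hypothesis is applied inside this
  eigenspace, with the four points added to \<open>Y\<close>, which makes all later translations
  commute with \<open>t\<close> and \<open>t'\<close>.\<close>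

lemma ex_orthogonal_translates:
  assumes "left_closed Y S" and "\<And>u. u \<in> S \<Longrightarrow> orth D u" and "u0 \<in> S" "x0 \<in> G" "u0 x0 \<noteq> 0"
    and "Y \<subseteq> X" "card Y + 4 * w \<le> D" "card Y + 4 * w + 5 \<le> card X"
  shows "\<exists>u\<in>S. \<exists>x\<in>G. u x \<noteq> 0 \<and> (\<exists>\<Theta>\<subseteq>stab Y. card \<Theta> = 2 ^ w \<and>
    (\<forall>\<theta>\<in>\<Theta>. \<forall>\<eta>\<in>\<Theta>. \<theta> \<noteq> \<eta> \<longrightarrow> mean G (\<lambda>x. u (\<theta> \<circ> x) * u (\<eta> \<circ> x)) = 0))"
  using assms
proof (induction w arbitrary: Y S u0 x0)
  case 0
  have "id \<in> stab Y" by (simp add: stab_def id_in_G)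
  with 0 show ?case by (intro bexI [of _ u0] bexI [of _ x0] conjI exI [of _ "{id}"]) auto
next
  case (Suc w)
  have finY: "finite Y" using Suc.prems(6) finite_X finite_subset by blast
  have cXY: "card (X - Y) = card X - card Y" using Suc.prems(6) finY by (simp add: card_Diff_subset)
  have a5: "5 \<le> card (X - Y)" and aD: "card Y \<le> D" using Suc.prems(7,8) cXY by linarith+
  obtain a b c d u1 x1 where abcd: "{a, b, c, d} \<subseteq> X - Y" "distinct [a, b, c, d]" and u1: "u1 \<in> S" "x1 \<in> G" "u1 x1 \<noteq> 0"
    and eig: "\<And>x. u1 (swap2 a b c d \<circ> x) = - u1 x" "\<And>x. u1 (swap2 a c b d \<circ> x) = u1 x"
    using ex_swap_eigenvector [OF Suc.prems(1-6) a5 aD] by metis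
  define t where "t = swap2 a b c d"
  define t' where "t' = swap2 a c b d"
  define z where "z = swap2 b c c d"
  have tG: "t \<in> G" "t' \<in> G" "z \<in> G" unfolding t_def t'_def z_def using abcd by (auto intro!: swap2_in_G)
  define Y' where "Y' = Y \<union> {a, b, c, d}"
  have Y': "Y' \<subseteq> X" "card Y' = card Y + 4" "Y \<subseteq> Y'"
    using abcd Suc.prems(6) finY by (auto simp: Y'_def card_Un_disjoint)
  define S' where "S' = {u \<in> S. \<forall>x\<in>G. u (t \<circ> x) = - u x \<and> u (t' \<circ> x) = u x}"
  have comm: "s \<circ> t = t \<circ> s" "s \<circ> t' = t' \<circ> s" if "s \<in> stab Y'" for s
    unfolding t_def t'_def using that by (auto intro!: swap2_commute_stab simp: Y'_def)
  have "left_closed Y' S'"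
    unfolding left_closed_def
  proof (intro conjI ballI allI)
    fix u v assume "u \<in> S'" "v \<in> S'"
    then show "(\<lambda>x. u x + v x) \<in> S'" using Suc.prems(1) by (simp add: S'_def left_closed_def)
  next
    fix r u assume "u \<in> S'"
    then show "(\<lambda>x. r * u x) \<in> S'" using Suc.prems(1) by (simp add: S'_def left_closed_def)
  next
    fix s u assume s: "s \<in> stab Y'" and u: "u \<in> S'"
    have "s \<in> stab Y" "s \<in> G" using s stab_mono [OF Y'(3)] by (auto simp: stab_def)
    then have "(\<lambda>x. u (s \<circ> x)) \<in> S" using Suc.prems(1) u by (simp add: S'_def left_closed_def)
    moreover have "u (s \<circ> (t \<circ> x)) = - u (s \<circ> x) \<and> u (s \<circ> (t' \<circ> x)) = u (s \<circ> x)" if "x \<in> G" for x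
    proof -
      have "s \<circ> (t \<circ> x) = t \<circ> (s \<circ> x)" "s \<circ> (t' \<circ> x) = t' \<circ> (s \<circ> x)"
        using comm [OF s] by (simp_all only: o_assoc)
      then show ?thesis using u comp_in_G [OF \<open>s \<in> G\<close> that] by (simp add: S'_def)
    qed
    ultimately show "(\<lambda>x. u (s \<circ> x)) \<in> S'" by (simp add: S'_def)
  qed
  moreover have "u1 \<in> S'" using u1 eig by (simp add: S'_def t_def t'_def)
  moreover have "card Y' + 4 * w \<le> D" "card Y' + 4 * w + 5 \<le> card X" using Suc.prems(7,8) Y'(2) by simp_all
  moreover have "orth D u" if "u \<in> S'" for u using that Suc.prems(2) by (simp add: S'_def)
  ultimately have "\<exists>u\<in>S'. \<exists>x\<in>G. u x \<noteq> 0 \<and> (\<exists>\<Theta>\<subseteq>stab Y'. card \<Theta> = 2 ^ w \<and>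
      (\<forall>\<theta>\<in>\<Theta>. \<forall>\<eta>\<in>\<Theta>. \<theta> \<noteq> \<eta> \<longrightarrow> mean G (\<lambda>x. u (\<theta> \<circ> x) * u (\<eta> \<circ> x)) = 0))"
    using u1(2,3) Y'(1) by (intro Suc.IH)
  then obtain u x \<Theta> where u: "u \<in> S'" "x \<in> G" "u x \<noteq> 0" and Th: "\<Theta> \<subseteq> stab Y'" "card \<Theta> = 2 ^ w"
    and ort: "\<And>\<theta> \<eta>. \<theta> \<in> \<Theta> \<Longrightarrow> \<eta> \<in> \<Theta> \<Longrightarrow> \<theta> \<noteq> \<eta> \<Longrightarrow> mean G (\<lambda>x. u (\<theta> \<circ> x) * u (\<eta> \<circ> x)) = 0"
    by blast
  have ThG: "\<theta> \<in> G" if "\<theta> \<in> \<Theta>" for \<theta> using that Th(1) by (auto simp: stab_def)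
  have zc: "t' \<circ> z = z \<circ> t" using swap2_eqs(6) [OF abcd(2)] by (simp add: t'_def z_def t_def)
  have zinj: "\<theta> \<circ> z = \<eta> \<circ> z \<Longrightarrow> \<theta> = \<eta>" for \<theta> \<eta> :: "nat \<Rightarrow> nat"
    using comp_inv_G [OF tG(3)] by (metis o_assoc o_id)
  have disj: "\<Theta> \<inter> (\<lambda>\<theta>. \<theta> \<circ> z) ` \<Theta> = {}"
  proof -
    have "\<theta> b = b" "(\<theta> \<circ> z) b = c" if "\<theta> \<in> \<Theta>" for \<theta>
    proof -
      have "\<theta> \<in> stab Y'" using that Th by blast
      then have "\<theta> b = b" "\<theta> c = c" by (auto simp: stab_def Y'_def)
      then show "\<theta> b = b" "(\<theta> \<circ> z) b = c" using abcd(2) by (auto simp: z_def Transposition.transpose_def)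
    qed
    moreover have "b \<noteq> c" using abcd(2) by simp
    ultimately show ?thesis by fastforce
  qed
  have finTh: "finite \<Theta>" using finite_G ThG by (meson finite_subset subsetI)
  define \<Theta>' where "\<Theta>' = \<Theta> \<union> (\<lambda>\<theta>. \<theta> \<circ> z) ` \<Theta>"
  have "card \<Theta>' = 2 ^ Suc w"
  proof -
    have "card ((\<lambda>\<theta>. \<theta> \<circ> z) ` \<Theta>) = 2 ^ w" using Th(2) zinj by (subst card_image) (auto simp: inj_on_def)
    then show ?thesis using Th(2) finTh disj by (simp add: \<Theta>'_def card_Un_disjoint)
  qed
  moreover have "\<Theta>' \<subseteq> stab Y"
  proof -
    have "z \<in> stab Y" using tG(3) abcd(1) by (auto simp: stab_def z_def Transposition.transpose_def)
    moreover have "\<Theta> \<subseteq> stab Y" using Th(1) stab_mono [OF Y'(3)] by blast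
    ultimately show ?thesis using comp_in_G by (auto simp: \<Theta>'_def stab_def subset_iff)
  qed
  moreover have "mean G (\<lambda>x. u (\<theta> \<circ> x) * u (\<eta> \<circ> x)) = 0" if th: "\<theta> \<in> \<Theta>'" "\<eta> \<in> \<Theta>'" "\<theta> \<noteq> \<eta>" for \<theta> \<eta>
  proof -
    have neg: "u (\<theta> \<circ> (t \<circ> x)) = - u (\<theta> \<circ> x)" if "\<theta> \<in> \<Theta>" "x \<in> G" for \<theta> x
    proof -
      have "\<theta> \<circ> (t \<circ> x) = t \<circ> (\<theta> \<circ> x)" using comm(1) that Th(1) by (metis o_assoc subsetD)
      then show ?thesis using u(1) comp_in_G [OF ThG that(2)] that by (simp add: S'_def)
    qed
    have pos: "u (\<theta> \<circ> z \<circ> (t \<circ> x)) = u (\<theta> \<circ> z \<circ> x)" if "\<theta> \<in> \<Theta>" "x \<in> G" for \<theta> x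
    proof -
      have "\<theta> \<circ> z \<circ> (t \<circ> x) = \<theta> \<circ> (z \<circ> t) \<circ> x" by (simp only: o_assoc)
      also have "\<dots> = (\<theta> \<circ> t') \<circ> z \<circ> x" by (simp only: zc [symmetric] o_assoc)
      also have "\<dots> = t' \<circ> (\<theta> \<circ> z \<circ> x)" using comm(2) that Th(1) by (metis o_assoc subsetD)
      finally have *: "\<theta> \<circ> z \<circ> (t \<circ> x) = t' \<circ> (\<theta> \<circ> z \<circ> x)" .
      have "\<theta> \<circ> z \<circ> x \<in> G" using ThG tG(3) that comp_in_G by blast
      then show ?thesis unfolding * using u(1) by (simp add: S'_def)
    qed
    have mixed: "mean G (\<lambda>x. u (\<theta> \<circ> x) * u (\<eta> \<circ> z \<circ> x)) = 0" if "\<theta> \<in> \<Theta>" "\<eta> \<in> \<Theta>" for \<theta> \<eta>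
    proof -
      have "mean G (\<lambda>x. u (\<theta> \<circ> x) * u (\<eta> \<circ> z \<circ> x)) = mean G (\<lambda>x. u (\<theta> \<circ> (t \<circ> x)) * u (\<eta> \<circ> z \<circ> (t \<circ> x)))"
        by (rule mean_G_left [OF tG(1), of "\<lambda>x. u (\<theta> \<circ> x) * u (\<eta> \<circ> z \<circ> x)", symmetric])
      also have "\<dots> = mean G (\<lambda>x. - (u (\<theta> \<circ> x) * u (\<eta> \<circ> z \<circ> x)))"
        by (rule mean_cong) (auto simp: simp_implies_def neg [OF that(1)] pos [OF that(2)])
      finally show ?thesis by (simp add: mean_minus)
    qed
    have both: "mean G (\<lambda>x. u (\<theta> \<circ> z \<circ> x) * u (\<eta> \<circ> z \<circ> x)) = 0" if "\<theta> \<in> \<Theta>" "\<eta> \<in> \<Theta>" "\<theta> \<noteq> \<eta>" for \<theta> \<eta>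
      using mean_G_left [OF tG(3), of "\<lambda>x. u (\<theta> \<circ> x) * u (\<eta> \<circ> x)"] ort [OF that] by (simp add: o_assoc)
    consider "\<theta> \<in> \<Theta>" "\<eta> \<in> \<Theta>" | "\<theta> \<in> \<Theta>" "\<exists>\<eta>'\<in>\<Theta>. \<eta> = \<eta>' \<circ> z" | "\<exists>\<theta>'\<in>\<Theta>. \<theta> = \<theta>' \<circ> z" "\<eta> \<in> \<Theta>"
      | "\<exists>\<theta>'\<in>\<Theta>. \<theta> = \<theta>' \<circ> z" "\<exists>\<eta>'\<in>\<Theta>. \<eta> = \<eta>' \<circ> z"
      using th(1,2) by (auto simp: \<Theta>'_def)
    then show ?thesis
    proof cases
      case 1
      then show ?thesis using ort th(3) by blast
    next
      case 2
      then show ?thesis using mixed by blast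
    next
      case 3
      then obtain \<theta>' where "\<theta>' \<in> \<Theta>" "\<theta> = \<theta>' \<circ> z" by blast
      then show ?thesis using mixed [OF 3(2)] by (simp add: mult.commute)
    next
      case 4
      then show ?thesis using both th(3) by blast
    qed
  qed
  moreover have "u \<in> S" using u(1) by (simp add: S'_def)
  ultimately show ?case using u(2,3) by blast
qed

section \<open>The operator norm of convolution on functions orthogonal to low degree\<close>

lemma conv_translate_left: "conv g (\<lambda>x. v (a \<circ> x)) x = conv g v (a \<circ> x)"
  by (simp add: conv_def o_assoc)

lemma mean_conv_square_le: "mean G (\<lambda>x. (conv g h x)\<^sup>2) \<le> mean G (\<lambda>x. (g x)\<^sup>2) * mean G (\<lambda>x. (h x)\<^sup>2)"
proof -
  have "mean G (\<lambda>x. (conv g h x)\<^sup>2) \<le> mean G (\<lambda>x. mean G (\<lambda>x. (g x)\<^sup>2) * mean G (\<lambda>x. (h x)\<^sup>2))"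
  proof (rule mean_mono)
    fix x assume x: "x \<in> G"
    have "(conv g h x)\<^sup>2 \<le> mean G (\<lambda>y. (g y)\<^sup>2) * mean G (\<lambda>y. (h (x \<circ> y))\<^sup>2)"
      unfolding conv_def by (rule mean_Cauchy_Schwarz)
    also have "mean G (\<lambda>y. (h (x \<circ> y))\<^sup>2) = mean G (\<lambda>y. (h y)\<^sup>2)"
      by (rule mean_G_left [OF x])
    finally show "(conv g h x)\<^sup>2 \<le> mean G (\<lambda>x. (g x)\<^sup>2) * mean G (\<lambda>x. (h x)\<^sup>2)" .
  qed
  then show ?thesis by (simp add: mean_const finite_G G_nonempty)
qed

text \<open>Since \<open>G\<close> is finite, the unit sphere of the functions orthogonal to low
  degree is compact, so the operator norm is attained; \<open>\<kappa>\<close> is its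
  square.\<close>

lemma ex_conv_maximizer:
  assumes "orth D h" "s \<in> G" "h s \<noteq> 0"
  shows "\<exists>\<kappa> u. (\<forall>v. orth D v \<longrightarrow> mean G (\<lambda>x. (conv g v x)\<^sup>2) \<le> \<kappa> * mean G (\<lambda>x. (v x)\<^sup>2)) \<and>
    orth D u \<and> mean G (\<lambda>x. (u x)\<^sup>2) = 1 \<and> mean G (\<lambda>x. (conv g u x)\<^sup>2) = \<kappa>"
proof -
  define Q where "Q v = mean G (\<lambda>x. (conv g v x)\<^sup>2)" for v
  define N where "N v = mean G (\<lambda>x. (v x)\<^sup>2)" for v :: "(nat \<Rightarrow> nat) \<Rightarrow> real"
  define U where "U = {v. orth D v \<and> N v = 1}"
  have N0: "0 \<le> N v" for v unfolding N_def by (intro mean_nonneg) simp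
  have scale: "N (\<lambda>x. c * v x) = c\<^sup>2 * N v" "Q (\<lambda>x. c * v x) = c\<^sup>2 * Q v" for c v
    by (simp_all add: N_def Q_def conv_def power_mult_distrib mean_cmult mult.left_commute)
  have sphere: "(\<lambda>x. inverse (sqrt (N v)) * v x) \<in> U" if "orth D v" "N v \<noteq> 0" for v
  proof -
    have "(inverse (sqrt (N v)))\<^sup>2 * N v = 1"
      using that(2) N0 [of v] by (simp add: power_inverse)
    then show ?thesis using that by (simp add: U_def scale orth_cmult)
  qed
  have Nz: "v x = 0" if "N v = 0" "x \<in> G" for v x
  proof -
    have "(\<Sum>x\<in>G. (v x)\<^sup>2) = 0" using that(1) finite_G G_nonempty by (simp add: N_def mean_def)
    then show ?thesis using that(2) finite_G by (simp add: sum_nonneg_eq_0_iff)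
  qed
  have "N h \<noteq> 0" using Nz assms by blast
  then have Une: "U \<noteq> {}" using sphere [OF assms(1)] by blast
  have "Q v \<le> N g" if "v \<in> U" for v
    using mean_conv_square_le [of g v] that by (simp add: Q_def N_def U_def)
  then have bdd: "bdd_above (Q ` U)" by (intro bdd_aboveI2)
  define \<kappa> where "\<kappa> = (SUP v\<in>U. Q v)"
  have up: "Q v \<le> \<kappa>" if "v \<in> U" for v unfolding \<kappa>_def by (rule cSUP_upper [OF that bdd])
  have "\<exists>v\<in>U. \<kappa> - inverse (real (Suc n)) < Q v" for n
    using less_cSUP_iff [OF Une bdd, of "\<kappa> - inverse (real (Suc n))"] by (simp add: \<kappa>_def)
  then obtain v where v: "\<And>n. v n \<in> U" "\<And>n. \<kappa> - inverse (real (Suc n)) < Q (v n)" by metis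
  have vb: "\<bar>v n x\<bar> \<le> sqrt (real (card G))" if "x \<in> G" for n x
  proof -
    have "(v n x)\<^sup>2 \<le> (\<Sum>x\<in>G. (v n x)\<^sup>2)"
      using that finite_G by (intro member_le_sum) auto
    also have "\<dots> = real (card G)"
      using v(1) [of n] finite_G G_nonempty by (simp add: U_def N_def mean_def field_simps)
    finally show ?thesis by (metis real_sqrt_abs real_sqrt_le_iff)
  qed
  obtain r l where r: "strict_mono r" and l: "\<And>x. x \<in> G \<Longrightarrow> (\<lambda>n. v (r n) x) \<longlonglongrightarrow> l x"
    using convergent_subsequence_on_finite [OF finite_G, of v "sqrt (real (card G))"] vb by blast
  have orl: "orth D l"
    unfolding orth_def
  proof
    fix m assume m: "m \<in> graphs_upto D"
    have "(\<lambda>n. \<Sum>x\<in>ext m. v (r n) x) \<longlonglongrightarrow> (\<Sum>x\<in>ext m. l x)"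
      using l ext_subset_G by (intro tendsto_sum) blast
    moreover have "(\<Sum>x\<in>ext m. v (r n) x) = 0" for n using v(1) [of "r n"] m by (simp add: U_def orth_def)
    ultimately show "(\<Sum>x\<in>ext m. l x) = 0" by (simp add: LIMSEQ_const_iff)
  qed
  have "(\<lambda>n. N (v (r n))) \<longlonglongrightarrow> N l"
    unfolding N_def by (intro tendsto_mean tendsto_power l)
  moreover have "N (v (r n)) = 1" for n using v(1) by (simp add: U_def)
  ultimately have Nl: "N l = 1" by (simp add: LIMSEQ_const_iff)
  have L1: "(\<lambda>n. Q (v (r n))) \<longlonglongrightarrow> Q l"
    unfolding Q_def conv_def by (intro tendsto_mean tendsto_power tendsto_mult tendsto_const l comp_in_G)
  have L2: "(\<lambda>n. \<kappa> - inverse (real (Suc n))) \<longlonglongrightarrow> \<kappa> - 0"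
    by (intro tendsto_diff tendsto_const LIMSEQ_inverse_real_of_nat)
  have le: "\<kappa> - inverse (real (Suc n)) \<le> Q (v (r n))" for n
  proof -
    have "n \<le> r n" by (rule seq_suble [OF r])
    then have "inverse (real (Suc (r n))) \<le> inverse (real (Suc n))" by (intro le_imp_inverse_le) auto
    then show ?thesis using v(2) [of "r n"] by linarith
  qed
  have "\<kappa> - 0 \<le> Q l" by (rule LIMSEQ_le [OF L2 L1]) (use le in blast)
  moreover have "Q l \<le> \<kappa>" using up orl Nl by (simp add: U_def)
  ultimately have Ql: "Q l = \<kappa>" by simp
  have "Q u \<le> \<kappa> * N u" if "orth D u" for u
  proof (cases "N u = 0")
    case True
    then have "u x = 0" if "x \<in> G" for x by (rule Nz [OF _ that])
    then have "Q u = 0" by (simp add: Q_def conv_def comp_in_G)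
    then show ?thesis using True by simp
  next
    case False
    have "(inverse (sqrt (N u)))\<^sup>2 * Q u \<le> \<kappa>"
      using up [OF sphere [OF that False]] by (simp add: scale)
    then have "Q u / N u \<le> \<kappa>" using N0 [of u] by (simp add: power_inverse divide_inverse mult.commute)
    then show ?thesis using False N0 [of u] by (simp add: divide_le_eq)
  qed
  then show ?thesis using orl Nl Ql unfolding Q_def N_def by blast
qed

text \<open>The maximizers of \<open>h \<mapsto> \<parallel>conv g h\<parallel> / \<parallel>h\<parallel>\<close> form an eigenspace invariant under left translations,
  and an eigenspace that is orthogonal to the low degree functions contains many orthogonal
  translates of a single vector. Bessel's inequality then bounds the eigenvalue.\<close>

lemma mean_conv_high_le:
  assumes h: "orth D h" and w: "4 * w \<le> D" "4 * w + 5 \<le> card X"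
  shows "2 ^ w * mean G (\<lambda>x. (conv g h x)\<^sup>2) \<le> mean G (\<lambda>x. (g x)\<^sup>2) * mean G (\<lambda>x. (h x)\<^sup>2)"
proof (cases "\<exists>s\<in>G. h s \<noteq> 0")
  case False
  then have "conv g h x = 0" if "x \<in> G" for x using that comp_in_G by (simp add: conv_def)
  then show ?thesis by (simp add: mean_nonneg)
next
  case True
  define Q where "Q v = mean G (\<lambda>x. (conv g v x)\<^sup>2)" for v
  define N where "N v = mean G (\<lambda>x. (v x)\<^sup>2)" for v :: "(nat \<Rightarrow> nat) \<Rightarrow> real"
  obtain \<kappa> u0 where \<kappa>: "\<And>v. orth D v \<Longrightarrow> Q v \<le> \<kappa> * N v" and u0: "orth D u0" "N u0 = 1" "Q u0 = \<kappa>"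
    using ex_conv_maximizer [OF h, of _ g] True unfolding Q_def N_def by blast
  \<comment> \<open>Closure of the maximizers under addition follows from the parallelogram law: if
    the sum of two upper bounds is attained, each of them is.\<close>
  define S where "S = {u. orth D u \<and> Q u = \<kappa> * N u}"
  have par: "N (\<lambda>x. u x + v x) + N (\<lambda>x. u x - v x) = 2 * N u + 2 * N v" for u v
    unfolding N_def by (simp add: mean_add [symmetric] mean_cmult [symmetric] power2_eq_square algebra_simps)
  have parQ: "Q (\<lambda>x. u x + v x) + Q (\<lambda>x. u x - v x) = 2 * Q u + 2 * Q v" for u v
    unfolding Q_def conv_add_right conv_diff_right
    by (simp add: mean_add [symmetric] mean_cmult [symmetric] power2_eq_square algebra_simps)
  have scale: "N (\<lambda>x. c * v x) = c\<^sup>2 * N v" "Q (\<lambda>x. c * v x) = c\<^sup>2 * Q v" for c v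
    by (simp_all add: N_def Q_def conv_def power_mult_distrib mean_cmult mult.left_commute)
  have shift: "N (\<lambda>x. v (a \<circ> x)) = N v" "Q (\<lambda>x. v (a \<circ> x)) = Q v" if "a \<in> G" for a v
    unfolding N_def Q_def conv_translate_left
    using mean_G_left [OF that, of "\<lambda>x. (v x)\<^sup>2"] mean_G_left [OF that, of "\<lambda>x. (conv g v x)\<^sup>2"] by auto
  have lc: "left_closed {} S"
    unfolding left_closed_def
  proof (intro conjI ballI allI)
    fix u v assume uv: "u \<in> S" "v \<in> S"
    have o: "orth D (\<lambda>x. u x + v x)" "orth D (\<lambda>x. u x - v x)" using uv by (auto simp: S_def intro: orth_add orth_diff)
    have "Q (\<lambda>x. u x + v x) + Q (\<lambda>x. u x - v x) = \<kappa> * (N (\<lambda>x. u x + v x) + N (\<lambda>x. u x - v x))"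
      unfolding par parQ using uv by (simp add: S_def algebra_simps)
    then have "Q (\<lambda>x. u x + v x) = \<kappa> * N (\<lambda>x. u x + v x)"
      using \<kappa> [OF o(1)] \<kappa> [OF o(2)] unfolding distrib_left by linarith
    then show "(\<lambda>x. u x + v x) \<in> S" using o by (simp add: S_def)
  next
    fix c u assume "u \<in> S"
    then show "(\<lambda>x. c * u x) \<in> S" by (simp add: S_def scale orth_cmult)
  next
    fix a u assume "a \<in> stab {}" "u \<in> S"
    then have "a \<in> G" "orth D u" "Q u = \<kappa> * N u" by (auto simp: stab_def S_def)
    then show "(\<lambda>x. u (a \<circ> x)) \<in> S" using orth_translate [of D u id a] id_in_G by (simp add: S_def shift)
  qed
  have u0S: "u0 \<in> S" using u0 by (simp add: S_def)
  have "\<exists>x0\<in>G. u0 x0 \<noteq> 0"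
  proof (rule ccontr)
    assume "\<not> ?thesis"
    then have "N u0 = 0" by (simp add: N_def)
    with u0 show False by simp
  qed
  then obtain x0 where x0: "x0 \<in> G" "u0 x0 \<noteq> 0" by blast
  have "\<exists>u\<in>S. \<exists>x\<in>G. u x \<noteq> 0 \<and> (\<exists>\<Theta>\<subseteq>stab {}. card \<Theta> = 2 ^ w \<and>
      (\<forall>\<theta>\<in>\<Theta>. \<forall>\<eta>\<in>\<Theta>. \<theta> \<noteq> \<eta> \<longrightarrow> mean G (\<lambda>x. u (\<theta> \<circ> x) * u (\<eta> \<circ> x)) = 0))"
    by (rule ex_orthogonal_translates [where D = D, OF lc _ u0S x0]) (use w in \<open>simp_all add: S_def\<close>)
  then obtain u x \<Theta> where u: "u \<in> S" "x \<in> G" "u x \<noteq> 0" and Th: "\<Theta> \<subseteq> stab {}" "card \<Theta> = 2 ^ w"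
    and ort: "\<And>\<theta> \<eta>. \<theta> \<in> \<Theta> \<Longrightarrow> \<eta> \<in> \<Theta> \<Longrightarrow> \<theta> \<noteq> \<eta> \<Longrightarrow> mean G (\<lambda>x. u (\<theta> \<circ> x) * u (\<eta> \<circ> x)) = 0"
    by blast
  have ThG: "\<theta> \<in> G" if "\<theta> \<in> \<Theta>" for \<theta> using that Th(1) by (auto simp: stab_def)
  have finTh: "finite \<Theta>" using finite_G ThG by (meson finite_subset subsetI)
  have Nu: "0 < N u"
  proof -
    have "0 < (\<Sum>y\<in>G. (u y)\<^sup>2)" using u finite_G by (intro sum_pos2 [of _ x]) auto
    then show ?thesis using finite_G G_nonempty by (simp add: N_def mean_def card_gt_0_iff)
  qed
  \<comment> \<open>For fixed \<open>y\<close> these convolutions are the inner products of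
    \<open>g\<close> with pairwise orthogonal functions of \<open>z\<close>, the values
    \<open>u (\<theta> \<circ> (y \<circ> z))\<close>; \<open>P\<close> is the projection of
    \<open>g\<close> onto their span.\<close>
  have bessel: "(\<Sum>\<theta>\<in>\<Theta>. (conv g (\<lambda>x. u (\<theta> \<circ> x)) y)\<^sup>2) \<le> N g * N u" if y: "y \<in> G" for y
  proof -
    define c where "c \<theta> = conv g (\<lambda>x. u (\<theta> \<circ> x)) y / N u" for \<theta>
    define P where "P z = (\<Sum>\<theta>\<in>\<Theta>. c \<theta> * u (\<theta> \<circ> (y \<circ> z)))" for z
    have orty: "mean G (\<lambda>z. u (\<theta> \<circ> (y \<circ> z)) * u (\<eta> \<circ> (y \<circ> z))) = (if \<theta> = \<eta> then N u else 0)"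
      if "\<theta> \<in> \<Theta>" "\<eta> \<in> \<Theta>" for \<theta> \<eta>
    proof -
      have "mean G (\<lambda>z. u (\<theta> \<circ> (y \<circ> z)) * u (\<eta> \<circ> (y \<circ> z))) = mean G (\<lambda>z. u (\<theta> \<circ> z) * u (\<eta> \<circ> z))"
        by (rule mean_G_left [OF y, of "\<lambda>z. u (\<theta> \<circ> z) * u (\<eta> \<circ> z)"])
      then show ?thesis
        using ort [OF that] shift(1) [OF ThG [OF that(1)], of u] by (auto simp: N_def power2_eq_square)
    qed
    have gP: "mean G (\<lambda>z. g z * P z) = (\<Sum>\<theta>\<in>\<Theta>. (c \<theta>)\<^sup>2) * N u"
    proof -
      have "mean G (\<lambda>z. g z * P z) = (\<Sum>\<theta>\<in>\<Theta>. c \<theta> * conv g (\<lambda>x. u (\<theta> \<circ> x)) y)"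
        by (simp add: P_def conv_def sum_distrib_left mean_sum mult.left_commute mean_cmult)
      also have "\<dots> = (\<Sum>\<theta>\<in>\<Theta>. (c \<theta>)\<^sup>2 * N u)"
        using Nu by (intro sum.cong refl) (simp add: c_def power2_eq_square)
      finally show ?thesis by (simp add: sum_distrib_right)
    qed
    have PP: "mean G (\<lambda>z. P z * P z) = (\<Sum>\<theta>\<in>\<Theta>. (c \<theta>)\<^sup>2) * N u"
    proof -
      have "mean G (\<lambda>z. P z * P z) = (\<Sum>\<theta>\<in>\<Theta>. \<Sum>\<eta>\<in>\<Theta>. c \<theta> * c \<eta> * mean G (\<lambda>z. u (\<theta> \<circ> (y \<circ> z)) * u (\<eta> \<circ> (y \<circ> z))))"
        by (simp add: P_def sum_product mean_sum mean_cmult [symmetric] mult_ac)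
      also have "\<dots> = (\<Sum>\<theta>\<in>\<Theta>. \<Sum>\<eta>\<in>\<Theta>. if \<eta> = \<theta> then (c \<theta>)\<^sup>2 * N u else 0)"
        by (intro sum.cong refl) (simp add: orty power2_eq_square)
      also have "\<dots> = (\<Sum>\<theta>\<in>\<Theta>. (c \<theta>)\<^sup>2 * N u)" using finTh by simp
      finally show ?thesis by (simp add: sum_distrib_right)
    qed
    have "0 \<le> mean G (\<lambda>z. (g z - P z)\<^sup>2)" by (intro mean_nonneg) simp
    also have "\<dots> = N g + mean G (\<lambda>z. P z * P z) - 2 * mean G (\<lambda>z. g z * P z)"
      by (simp only: N_def power2_diff mean_add mean_diff) (simp only: power2_eq_square mean_cmult mult.assoc)
    finally have "(\<Sum>\<theta>\<in>\<Theta>. (c \<theta>)\<^sup>2) * N u \<le> N g" unfolding gP PP by linarith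
    then have "(\<Sum>\<theta>\<in>\<Theta>. (c \<theta>)\<^sup>2) * N u * N u \<le> N g * N u"
      using Nu by (intro mult_right_mono) auto
    moreover have "(\<Sum>\<theta>\<in>\<Theta>. (c \<theta>)\<^sup>2) * N u * N u = (\<Sum>\<theta>\<in>\<Theta>. (conv g (\<lambda>x. u (\<theta> \<circ> x)) y)\<^sup>2)"
      unfolding sum_distrib_right using Nu by (intro sum.cong refl) (simp add: c_def power2_eq_square)
    ultimately show ?thesis by simp
  qed
  \<comment> \<open>A left translation changes neither norm, so each of the 2^w translates
    contributes \<open>\<kappa> * N u\<close>.\<close>
  have "2 ^ w * (\<kappa> * N u) = (\<Sum>\<theta>\<in>\<Theta>. Q (\<lambda>x. u (\<theta> \<circ> x)))"
    using u(1) ThG Th(2) by (simp add: S_def shift)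
  also have "\<dots> = mean G (\<lambda>y. \<Sum>\<theta>\<in>\<Theta>. (conv g (\<lambda>x. u (\<theta> \<circ> x)) y)\<^sup>2)"
    by (simp add: Q_def mean_sum)
  also have "\<dots> \<le> N g * N u"
    using bessel Nu by (intro mean_le_const mult_nonneg_nonneg) (auto simp: N_def intro: mean_nonneg)
  finally have "2 ^ w * \<kappa> \<le> N g" using Nu by (simp add: mult.assoc [symmetric])
  have "0 \<le> N h" unfolding N_def by (intro mean_nonneg) simp
  have "2 ^ w * Q h \<le> 2 ^ w * (\<kappa> * N h)" using \<kappa> [OF h] by (intro mult_left_mono) auto
  also have "\<dots> \<le> N g * N h"
    using mult_right_mono [OF \<open>2 ^ w * \<kappa> \<le> N g\<close> \<open>0 \<le> N h\<close>] by (simp add: mult.assoc)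
  finally show ?thesis by (simp add: Q_def N_def)
qed

end

section \<open>Random idempotents\<close>

text \<open>A uniform point \<open>\<phi>\<close> of \<open>X ^ X\<close> and a uniform permutation \<open>\<tau>\<close> determine the idempotent map
  \<open>rep \<phi> \<tau>\<close>, which sends \<open>i\<close> to the \<open>\<tau>\<close>-least element of its \<open>\<phi>\<close>-fibre. Composing it with an
  independent uniform permutation gives a uniform point of \<open>X ^ X\<close>, so it couples
  the symmetric group with a product space.\<close>

locale permutation_transfer = even_permutations X + finite_product X X for X
begin

definition SS :: "(nat \<Rightarrow> nat) set" where
  "SS = {p. p permutes X}"

lemma finite_SS: "finite SS"
  unfolding SS_def by (rule finite_permutations [OF finite_X])

lemma SS_nonempty: "SS \<noteq> {}"
  using permutes_id [of X] unfolding SS_def by blast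

lemma mean_SS_const [simp]: "mean SS (\<lambda>_. c) = c"
  by (simp add: mean_const finite_SS SS_nonempty)

lemma G_subset_SS: "G \<subseteq> SS"
  by (auto simp: G_def SS_def)

lemma SS_in_X_iff: "s \<in> SS \<Longrightarrow> s i \<in> X \<longleftrightarrow> i \<in> X"
  unfolding SS_def mem_Collect_eq by (rule permutes_in_image)

lemma inj_SS: "s \<in> SS \<Longrightarrow> inj s"
  by (simp add: SS_def permutes_inj)

lemma mean_SS_right:
  assumes "g \<in> SS"
  shows "mean SS (\<lambda>s. f (s \<circ> g)) = mean SS f"
proof (rule mean_bij, rule bij_betw_byWitness [where f' = "\<lambda>s. s \<circ> inv' g"])
  have g: "g \<circ> inv' g = id" "inv' g \<circ> g = id" "inv' g \<in> SS"
    using assms permutes_inv_o permutes_inv by (auto simp: SS_def)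
  show "\<forall>s\<in>SS. s \<circ> g \<circ> inv' g = s" "\<forall>s\<in>SS. s \<circ> inv' g \<circ> g = s"
    using g by (simp_all add: o_assoc [symmetric])
  show "(\<lambda>s. s \<circ> g) ` SS \<subseteq> SS" "(\<lambda>s. s \<circ> inv' g) ` SS \<subseteq> SS"
    using assms g(3) by (auto simp: SS_def permutes_compose)
qed

lemma mean_SS_map:
  assumes a: "a \<in> dlists k X"
  shows "mean SS (\<lambda>s. f (map s a)) = mean (dlists k X) f"
proof (rule mean_fibres [OF finite_SS finite_dlists [OF finite_X]])
  show "map s a \<in> dlists k X" if "s \<in> SS" for s
    using that a SS_in_X_iff inj_on_subset [OF inj_SS [OF that]] by (auto simp: dlists_def distinct_map)
  show "0 < card {s \<in> SS. map s a = a}"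
  proof -
    have "id \<in> {s \<in> SS. map s a = a}" by (simp add: SS_def permutes_id)
    then show ?thesis using finite_SS card_gt_0_iff by fastforce
  qed
  fix l assume l: "l \<in> dlists k X"
  obtain h where h: "h permutes X" "map h a = l" using ex_permutes_map [OF a l] by blast
  have hh: "h \<circ> inv' h = id" "inv' h \<circ> h = id" "inv' h permutes X"
    using h(1) permutes_inv_o permutes_inv by auto
  have back_map: "map (inv' h) l = a"
    unfolding h(2) [symmetric] map_map hh(2) by simp
  have "bij_betw (\<lambda>s. inv' h \<circ> s) {s \<in> SS. map s a = l} {s \<in> SS. map s a = a}"
  proof (rule bij_betw_byWitness [where f' = "\<lambda>s. h \<circ> s"])
    show "\<forall>s\<in>{s \<in> SS. map s a = l}. h \<circ> (inv' h \<circ> s) = s" "\<forall>s\<in>{s \<in> SS. map s a = a}. inv' h \<circ> (h \<circ> s) = s"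
      by (simp_all add: o_assoc hh)
    show "(\<lambda>s. inv' h \<circ> s) ` {s \<in> SS. map s a = l} \<subseteq> {s \<in> SS. map s a = a}"
    proof clarify
      fix s assume s: "s \<in> SS" "l = map s a"
      have "map (inv' h \<circ> s) a = map (inv' h) (map s a)" by simp
      also have "\<dots> = a" unfolding s(2) [symmetric] by (rule back_map)
      finally have "map (inv' h \<circ> s) a = a" .
      moreover have "inv' h \<circ> s \<in> SS" using s(1) hh(3) by (simp add: SS_def permutes_compose)
      ultimately show "inv' h \<circ> s \<in> SS \<and> map (inv' h \<circ> s) a = a" by (rule conjI [rotated])
    qed
    show "(\<lambda>s. h \<circ> s) ` {s \<in> SS. map s a = a} \<subseteq> {s \<in> SS. map s a = l}"
    proof clarify
      fix s assume s: "s \<in> SS" "map s a = a"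
      have "map (h \<circ> s) a = map h (map s a)" by simp
      also have "\<dots> = l" unfolding s(2) by (rule h(2))
      finally have "map (h \<circ> s) a = l" .
      moreover have "h \<circ> s \<in> SS" using s(1) h(1) by (simp add: SS_def permutes_compose)
      ultimately show "h \<circ> s \<in> SS \<and> map (h \<circ> s) a = l" by (rule conjI [rotated])
    qed
  qed
  then show "card {s \<in> SS. map s a = l} = card {s \<in> SS. map s a = a}" by (rule bij_betw_same_card)
qed

text \<open>The identity outside \<open>X\<close>, so that \<open>rep_conj\<close> is an identity
  between functions.\<close>

definition rep :: "(nat \<Rightarrow> nat) \<Rightarrow> (nat \<Rightarrow> nat) \<Rightarrow> nat \<Rightarrow> nat" where
  "rep \<phi> \<tau> i = (if i \<in> X then arg_min \<tau> (\<lambda>j. j \<in> X \<and> \<phi> j = \<phi> i) else i)"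

lemma
  assumes "i \<in> X"
  shows rep_in_X: "rep \<phi> \<tau> i \<in> X" and rep_fibre: "\<phi> (rep \<phi> \<tau> i) = \<phi> i"
  using arg_min_natI [of "\<lambda>j. j \<in> X \<and> \<phi> j = \<phi> i" i \<tau>] assms by (simp_all add: rep_def)

lemma rep_least: "i \<in> X \<Longrightarrow> j \<in> X \<Longrightarrow> \<phi> j = \<phi> i \<Longrightarrow> \<tau> (rep \<phi> \<tau> i) \<le> \<tau> j"
  using arg_min_nat_le [of "\<lambda>j. j \<in> X \<and> \<phi> j = \<phi> i" j \<tau>] by (simp add: rep_def)

lemma rep_cong: "i \<in> X \<Longrightarrow> j \<in> X \<Longrightarrow> \<phi> i = \<phi> j \<Longrightarrow> rep \<phi> \<tau> i = rep \<phi> \<tau> j"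
  by (simp add: rep_def)

lemma rep_eqI:
  assumes "\<tau> \<in> SS" "i \<in> X" "j \<in> X" "\<phi> j = \<phi> i" "\<And>k. k \<in> X \<Longrightarrow> \<phi> k = \<phi> i \<Longrightarrow> \<tau> j \<le> \<tau> k"
  shows "rep \<phi> \<tau> i = j"
proof -
  have "\<tau> (rep \<phi> \<tau> i) = \<tau> j"
    using assms rep_least [of i j \<phi> \<tau>] rep_in_X [of i \<phi> \<tau>] rep_fibre [of i \<phi> \<tau>] by (intro antisym) auto
  then show ?thesis using inj_SS [OF assms(1)] by (simp add: inj_eq)
qed

lemma rep_idem: "i \<in> X \<Longrightarrow> rep \<phi> \<tau> (rep \<phi> \<tau> i) = rep \<phi> \<tau> i"
  by (rule rep_cong) (auto simp: rep_in_X rep_fibre)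

lemma comp_perm_in_Om:
  assumes "\<phi> \<in> Om" "\<pi> permutes X"
  shows "\<phi> \<circ> \<pi> \<in> Om"
  using assms permutes_in_image [OF assms(2)] permutes_not_in [OF assms(2)]
  by (auto simp: Om_def PiE_iff extensional_def)

lemma mean_Om_right:
  assumes "\<pi> permutes X"
  shows "mean Om (\<lambda>\<phi>. f (\<phi> \<circ> \<pi>)) = mean Om f"
proof (rule mean_bij, rule bij_betw_byWitness [where f' = "\<lambda>\<phi>. \<phi> \<circ> inv' \<pi>"])
  have g: "\<pi> \<circ> inv' \<pi> = id" "inv' \<pi> \<circ> \<pi> = id" "inv' \<pi> permutes X"
    using assms permutes_inv_o permutes_inv by auto
  show "\<forall>\<phi>\<in>Om. \<phi> \<circ> \<pi> \<circ> inv' \<pi> = \<phi>" "\<forall>\<phi>\<in>Om. \<phi> \<circ> inv' \<pi> \<circ> \<pi> = \<phi>"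
    using g by (simp_all add: o_assoc [symmetric])
  show "(\<lambda>\<phi>. \<phi> \<circ> \<pi>) ` Om \<subseteq> Om" "(\<lambda>\<phi>. \<phi> \<circ> inv' \<pi>) ` Om \<subseteq> Om"
    using assms g(3) by (auto intro: comp_perm_in_Om)
qed

text \<open>Relabelling \<open>X\<close> relabels fibres and priorities together. Hence the law of
  the random idempotent is invariant under conjugation, the source of the symmetry arguments that
  follow.\<close>

lemma rep_conj:
  assumes tau: "\<tau> \<in> SS" and pi: "\<pi> permutes X"
  shows "rep (\<phi> \<circ> \<pi>) (\<tau> \<circ> \<pi>) = inv' \<pi> \<circ> rep \<phi> \<tau> \<circ> \<pi>"
proof
  fix i
  have inv: "\<pi> (inv' \<pi> j) = j" "inv' \<pi> (\<pi> j) = j" for j using permutes_inverses [OF pi] by auto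
  have inX: "\<pi> j \<in> X \<longleftrightarrow> j \<in> X" "inv' \<pi> j \<in> X \<longleftrightarrow> j \<in> X" for j
    using permutes_in_image [OF pi] permutes_in_image [OF permutes_inv [OF pi]] by auto
  show "rep (\<phi> \<circ> \<pi>) (\<tau> \<circ> \<pi>) i = (inv' \<pi> \<circ> rep \<phi> \<tau> \<circ> \<pi>) i"
  proof (cases "i \<in> X")
    case True
    have "rep (\<phi> \<circ> \<pi>) (\<tau> \<circ> \<pi>) i = inv' \<pi> (rep \<phi> \<tau> (\<pi> i))"
    proof (rule rep_eqI)
      show "\<tau> \<circ> \<pi> \<in> SS" using tau pi by (simp add: SS_def permutes_compose)
      show "i \<in> X" by fact
      show "inv' \<pi> (rep \<phi> \<tau> (\<pi> i)) \<in> X" using True by (simp add: inX rep_in_X)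
      show "(\<phi> \<circ> \<pi>) (inv' \<pi> (rep \<phi> \<tau> (\<pi> i))) = (\<phi> \<circ> \<pi>) i" using True by (simp add: inv inX rep_fibre)
      fix k assume "k \<in> X" "(\<phi> \<circ> \<pi>) k = (\<phi> \<circ> \<pi>) i"
      then show "(\<tau> \<circ> \<pi>) (inv' \<pi> (rep \<phi> \<tau> (\<pi> i))) \<le> (\<tau> \<circ> \<pi>) k"
        using True by (simp add: inv inX rep_least)
    qed
    then show ?thesis by simp
  next
    case False
    then show ?thesis by (simp add: rep_def inX inv)
  qed
qed

definition seed_mean :: "((nat \<Rightarrow> nat) \<Rightarrow> real) \<Rightarrow> real" where
  "seed_mean H = mean Om (\<lambda>\<phi>. mean SS (\<lambda>\<tau>. H (rep \<phi> \<tau>)))"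

lemma seed_mean_conj:
  assumes "\<pi> permutes X"
  shows "seed_mean (\<lambda>\<psi>. H (inv' \<pi> \<circ> \<psi> \<circ> \<pi>)) = seed_mean H"
proof -
  have pi: "\<pi> \<in> SS" using assms by (simp add: SS_def)
  have "seed_mean (\<lambda>\<psi>. H (inv' \<pi> \<circ> \<psi> \<circ> \<pi>)) = mean Om (\<lambda>\<phi>. mean SS (\<lambda>\<tau>. H (rep (\<phi> \<circ> \<pi>) (\<tau> \<circ> \<pi>))))"
    by (simp add: seed_mean_def rep_conj assms)
  also have "\<dots> = mean Om (\<lambda>\<phi>. mean SS (\<lambda>\<tau>. H (rep (\<phi> \<circ> \<pi>) \<tau>)))"
    using mean_SS_right [OF pi, of "\<lambda>\<tau>. H (rep (_ \<circ> \<pi>) \<tau>)"] by simp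
  also have "\<dots> = seed_mean H"
    unfolding seed_mean_def by (rule mean_Om_right [OF assms, of "\<lambda>\<phi>. mean SS (\<lambda>\<tau>. H (rep \<phi> \<tau>))"])
  finally show ?thesis .
qed

lemma seed_mean_cong:
  assumes "\<And>\<phi> \<tau>. \<phi> \<in> Om \<Longrightarrow> \<tau> \<in> SS \<Longrightarrow> H (rep \<phi> \<tau>) = H' (rep \<phi> \<tau>)"
  shows "seed_mean H = seed_mean H'"
  unfolding seed_mean_def using assms by (simp add: mean_def)

lemma seed_mean_mono:
  assumes "\<And>\<phi> \<tau>. \<phi> \<in> Om \<Longrightarrow> \<tau> \<in> SS \<Longrightarrow> H (rep \<phi> \<tau>) \<le> H' (rep \<phi> \<tau>)"
  shows "seed_mean H \<le> seed_mean H'"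
  unfolding seed_mean_def using assms by (intro mean_mono)

lemma seed_mean_sum: "seed_mean (\<lambda>\<psi>. \<Sum>i\<in>I. H i \<psi>) = (\<Sum>i\<in>I. seed_mean (H i))"
  by (simp add: seed_mean_def mean_sum)

lemma seed_mean_multc: "seed_mean (\<lambda>\<psi>. H \<psi> * c) = seed_mean H * c"
  by (simp add: seed_mean_def mean_multc)

lemma seed_mean_cmult: "seed_mean (\<lambda>\<psi>. c * H \<psi>) = c * seed_mean H"
  by (simp add: seed_mean_def mean_cmult)

lemma seed_mean_const [simp]: "seed_mean (\<lambda>\<psi>. c) = c"
  by (simp add: seed_mean_def)

lemma seed_mean_nonneg: "(\<And>\<psi>. 0 \<le> H \<psi>) \<Longrightarrow> 0 \<le> seed_mean H"
  unfolding seed_mean_def by (intro mean_nonneg)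

lemma seed_mean_swap: "seed_mean (\<lambda>\<psi>. mean A (\<lambda>s. H s \<psi>)) = mean A (\<lambda>s. seed_mean (H s))"
  by (simp add: seed_mean_def mean_swap [of _ A])

lemma restrict_in_Om: "s \<in> SS \<Longrightarrow> (\<And>i. i \<in> X \<Longrightarrow> \<psi> i \<in> X) \<Longrightarrow> restrict (s \<circ> \<psi>) X \<in> Om"
  by (auto simp: Om_def SS_in_X_iff)

text \<open>For a fixed seed the idempotent is \<open>\<phi>\<close> followed by a map that is
  injective on its image. Extended to a permutation, that map is absorbed by the uniform
  \<open>s\<close>, so \<open>s \<circ> \<psi>\<close> has the law of
  \<open>s \<circ> \<phi>\<close>, which is uniform. The restriction to \<open>X\<close> serves to
  land among the extensional functions of \<open>Om\<close>.\<close>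

lemma seed_mean_uniform: "seed_mean (\<lambda>\<psi>. mean SS (\<lambda>s. H (restrict (s \<circ> \<psi>) X))) = mean Om H"
proof -
  have one: "mean SS (\<lambda>s. H (restrict (s \<circ> rep \<phi> \<tau>) X)) = mean SS (\<lambda>s. H (restrict (s \<circ> \<phi>) X))"
    if phi: "\<phi> \<in> Om" for \<phi> \<tau>
  proof -
    define \<rho> where "\<rho> v = rep \<phi> \<tau> (SOME i. i \<in> X \<and> \<phi> i = v)" for v
    have \<rho>: "rep \<phi> \<tau> i = \<rho> (\<phi> i)" if "i \<in> X" for i
    proof -
      have "\<exists>k. k \<in> X \<and> \<phi> k = \<phi> i" using that by blast
      from someI_ex [OF this] show ?thesis unfolding \<rho>_def using that by (intro rep_cong) auto
    qed
    have img: "\<phi> ` X \<subseteq> X" using phi by (auto simp: Om_def)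
    obtain L where L: "set L = \<phi> ` X" "distinct L"
      using finite_distinct_list [of "\<phi> ` X"] finite_X by blast
    have "inj_on \<rho> (\<phi> ` X)"
    proof (rule inj_onI)
      fix u v assume "u \<in> \<phi> ` X" "v \<in> \<phi> ` X" "\<rho> u = \<rho> v"
      then obtain i j where "i \<in> X" "j \<in> X" "u = \<phi> i" "v = \<phi> j" "rep \<phi> \<tau> i = rep \<phi> \<tau> j" using \<rho> by auto
      then show "u = v" using rep_fibre by metis
    qed
    moreover have "\<rho> ` \<phi> ` X \<subseteq> X" using \<rho> rep_in_X by (auto simp: image_subset_iff) (metis rep_in_X)
    ultimately have "map \<rho> L \<in> dlists (length L) X"
      using L by (simp add: dlists_def distinct_map)
    moreover have "L \<in> dlists (length L) X" using L img by (simp add: dlists_def)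
    ultimately obtain \<kappa> where \<kappa>: "\<kappa> permutes X" "map \<kappa> L = map \<rho> L" using ex_permutes_map by blast
    have "\<kappa> (\<phi> i) = rep \<phi> \<tau> i" if "i \<in> X" for i
      using \<kappa>(2) L(1) \<rho> [OF that] that by auto
    then have eq: "restrict (s \<circ> rep \<phi> \<tau>) X = restrict (s \<circ> \<kappa> \<circ> \<phi>) X" for s
      by (auto simp: restrict_def)
    have "\<kappa> \<in> SS" using \<kappa>(1) by (simp add: SS_def)
    then show ?thesis
      unfolding eq by (rule mean_SS_right [of \<kappa> "\<lambda>s. H (restrict (s \<circ> \<phi>) X)"])
  qed
  have two: "mean Om (\<lambda>\<phi>. H (restrict (s \<circ> \<phi>) X)) = mean Om H" if s: "s \<in> SS" for s
  proof (rule mean_bij, rule bij_betw_byWitness [where f' = "\<lambda>\<phi>. restrict (inv' s \<circ> \<phi>) X"])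
    have ss: "s (inv' s i) = i" "inv' s (s i) = i" for i using s permutes_inverses by (auto simp: SS_def)
    have s': "inv' s \<in> SS" using s permutes_inv by (auto simp: SS_def)
    have ext: "undefined = \<phi> i" if "\<phi> \<in> Om" "i \<notin> X" for \<phi> i
      using that by (auto simp: Om_def PiE_iff extensional_def)
    show "\<forall>\<phi>\<in>Om. restrict (inv' s \<circ> restrict (s \<circ> \<phi>) X) X = \<phi>" "\<forall>\<phi>\<in>Om. restrict (s \<circ> restrict (inv' s \<circ> \<phi>) X) X = \<phi>"
      using ss ext by (auto simp: fun_eq_iff restrict_def)
    have "\<phi> i \<in> X" if "\<phi> \<in> Om" "i \<in> X" for \<phi> i using that by (auto simp: Om_def)
    then show "(\<lambda>\<phi>. restrict (s \<circ> \<phi>) X) ` Om \<subseteq> Om" "(\<lambda>\<phi>. restrict (inv' s \<circ> \<phi>) X) ` Om \<subseteq> Om"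
      using restrict_in_Om [OF s] restrict_in_Om [OF s'] by auto
  qed
  have "seed_mean (\<lambda>\<psi>. mean SS (\<lambda>s. H (restrict (s \<circ> \<psi>) X))) = mean Om (\<lambda>\<phi>. mean SS (\<lambda>s. H (restrict (s \<circ> \<phi>) X)))"
    by (simp add: seed_mean_def one)
  also have "\<dots> = mean SS (\<lambda>s. mean Om (\<lambda>\<phi>. H (restrict (s \<circ> \<phi>) X)))" by (rule mean_swap)
  also have "\<dots> = mean Om H" by (simp add: two)
  finally show ?thesis .
qed

section \<open>How likely the random idempotent is to fix or to move given points\<close>

definition fixes_map :: "nat set \<Rightarrow> nat list \<Rightarrow> nat list \<Rightarrow> (nat \<Rightarrow> nat) \<Rightarrow> bool" where
  "fixes_map E0 js l \<psi> \<longleftrightarrow> (\<forall>i\<in>E0. \<psi> i = i) \<and> map \<psi> js = l"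

definition fixes_prob :: "nat set \<Rightarrow> nat list \<Rightarrow> nat list \<Rightarrow> real" where
  "fixes_prob E0 js l = seed_mean (\<lambda>\<psi>. of_bool (fixes_map E0 js l \<psi>))"

lemma fixes_prob_conj:
  assumes pi: "\<pi> permutes X"
  shows "fixes_prob (\<pi> ` E0) (map \<pi> js) (map \<pi> l) = fixes_prob E0 js l"
proof -
  have inv: "\<pi> (inv' \<pi> j) = j" "inv' \<pi> (\<pi> j) = j" for j using permutes_inverses [OF pi] by auto
  have "fixes_map E0 js l (inv' \<pi> \<circ> \<psi> \<circ> \<pi>) \<longleftrightarrow> fixes_map (\<pi> ` E0) (map \<pi> js) (map \<pi> l) \<psi>" for \<psi>
  proof -
    have a: "inv' \<pi> (\<psi> (\<pi> i)) = k \<longleftrightarrow> \<psi> (\<pi> i) = \<pi> k" for i k using inv by metis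
    have "map (inv' \<pi> \<circ> \<psi> \<circ> \<pi>) js = l \<longleftrightarrow> map \<psi> (map \<pi> js) = map \<pi> l"
    proof
      assume "map (inv' \<pi> \<circ> \<psi> \<circ> \<pi>) js = l"
      then have "map \<pi> l = map \<pi> (map (inv' \<pi> \<circ> \<psi> \<circ> \<pi>) js)" by simp
      also have "\<dots> = map \<psi> (map \<pi> js)" by (simp add: inv)
      finally show "map \<psi> (map \<pi> js) = map \<pi> l" ..
    next
      assume *: "map \<psi> (map \<pi> js) = map \<pi> l"
      have "map (inv' \<pi> \<circ> \<psi> \<circ> \<pi>) js = map (inv' \<pi>) (map \<psi> (map \<pi> js))" by simp
      also have "\<dots> = l" unfolding * by (simp add: inv o_def)
      finally show "map (inv' \<pi> \<circ> \<psi> \<circ> \<pi>) js = l" .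
    qed
    then show ?thesis by (simp add: fixes_map_def a)
  qed
  then show ?thesis
    using seed_mean_conj [OF pi, of "\<lambda>\<psi>. of_bool (fixes_map E0 js l \<psi>)"] by (simp add: fixes_prob_def)
qed

text \<open>Conjugate by a permutation that fixes \<open>E\<close> pointwise and carries
  \<open>l\<close> to \<open>l'\<close>.\<close>

lemma fixes_prob_target_eq:
  assumes E: "E \<in> subs d" "E0 \<subseteq> E" and js: "set js \<subseteq> E" and l: "l \<in> dlists k (X - E)" "l' \<in> dlists k (X - E)"
  shows "fixes_prob E0 js l = fixes_prob E0 js l'"
proof -
  obtain e where e: "e \<in> dlists d X" "set e = E" using subs_list [OF E(1)] by blast
  have "e @ l \<in> dlists (d + k) X" "e @ l' \<in> dlists (d + k) X"
    using e l by (auto intro!: dlists_append)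
  then obtain \<pi> where pi: "\<pi> permutes X" "map \<pi> (e @ l) = e @ l'" using ex_permutes_map by blast
  then have "map \<pi> e = e" "map \<pi> l = l'" by auto
  then have fx: "\<pi> i = i" if "i \<in> E" for i using e(2) that map_idI by (metis in_set_conv_nth nth_map)
  have "\<pi> ` E0 = E0" using fx E(2) by force
  moreover have "map \<pi> js = js" using fx js by (intro map_idI) auto
  ultimately show ?thesis using fixes_prob_conj [OF pi(1), of E0 js l] \<open>map \<pi> l = l'\<close> by simp
qed

lemma fixes_prob_domain_eq:
  assumes "E \<in> subs d" "E' \<in> subs d"
  shows "fixes_prob E [] [] = fixes_prob E' [] []"
proof -
  obtain e where e: "e \<in> dlists d X" "set e = E" using subs_list [OF assms(1)] by blast
  obtain e' where e': "e' \<in> dlists d X" "set e' = E'" using subs_list [OF assms(2)] by blast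
  obtain \<pi> where pi: "\<pi> permutes X" "map \<pi> e = e'" using ex_permutes_map [OF e(1) e'(1)] by blast
  then have "\<pi> ` E = E'" using e(2) e'(2) by auto
  then show ?thesis using fixes_prob_conj [OF pi(1), of E "[]" "[]"] by simp
qed

text \<open>Moving the points of \<open>js\<close> out of the fibres of \<open>E0 \<union> set l\<close> costs nothing and is possible in at
  least \<open>(n - d) ^ k\<close> ways.\<close>

lemma fixes_prob_moving_le:
  assumes E: "E \<in> subs d" and E0: "E0 \<subseteq> E" and js: "set js = E - E0" "distinct js" "length js = k"
    and l: "l \<in> dlists k (X - E)"
  shows "fixes_prob E0 js l * real (card X - d) ^ k \<le> fixes_prob E [] []"
proof -
  have finE: "finite E" and EX: "E \<subseteq> X" and cE: "card E = d" using E subs_finite [OF E] by (auto simp: subs_def)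
  define E' where "E' = E0 \<union> set l"
  have cl: "card (set l) = k" "set l \<subseteq> X - E" "length l = k" using l by (auto simp: dlists_def distinct_card)
  have ck: "card (E - E0) = k" using js distinct_card by metis
  have finE0: "finite E0" using E0 finE finite_subset by blast
  have cE': "card E' = d"
  proof -
    have "card E0 + k = d"
      using ck E0 finE finE0 cE card_mono [OF finE E0] by (simp add: card_Diff_subset)
    moreover have "card E' = card E0 + card (set l)"
      unfolding E'_def using finE0 E0 cl(2) by (intro card_Un_disjoint) auto
    ultimately show ?thesis using cl by simp
  qed
  have E'X: "E' \<subseteq> X" using E0 EX cl(2) by (auto simp: E'_def)
  have E': "E' \<in> subs d" using E'X cE' by (simp add: subs_def)
  have disj: "E' \<inter> set js = {}" using js(1) cl(2) E0 by (auto simp: E'_def)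
  define V where "V = {(\<phi>, \<tau>) \<in> Om \<times> SS. fixes_map E0 js l (rep \<phi> \<tau>)}"
  define W where "W = {(\<phi>, \<tau>) \<in> Om \<times> SS. fixes_map E' [] [] (rep \<phi> \<tau>)}"
  \<comment> \<open>New values for the points of \<open>js\<close>, off the values of
    \<open>\<phi>\<close> on \<open>E'\<close>. The fibres of the points of \<open>E'\<close> can
    only lose points, so their \<open>\<tau>\<close>-least elements stay least.\<close>
  define C where "C \<xi> = (\<Pi>\<^sub>E i\<in>set js. X - fst \<xi> ` E')" for \<xi> :: "(nat \<Rightarrow> nat) \<times> (nat \<Rightarrow> nat)"
  have finV: "finite V" "finite W"
    unfolding V_def W_def using finite_Om finite_SS by (auto intro: finite_subset [of _ "Om \<times> SS"])
  have finC: "finite (C \<xi>)" for \<xi> unfolding C_def using finite_X by (intro finite_PiE) auto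
  have cardC: "(card X - d) ^ k \<le> card (C \<xi>)" for \<xi>
  proof -
    have "card (fst \<xi> ` E') \<le> d" using card_image_le [of E' "fst \<xi>"] E'X finite_X finite_subset cE' by metis
    moreover have "card X - card (fst \<xi> ` E') \<le> card (X - fst \<xi> ` E')" by (rule diff_card_le_card_Diff) (use E'X finite_X finite_subset in blast)
    ultimately have "card X - d \<le> card (X - fst \<xi> ` E')" by linarith
    then have "(card X - d) ^ k \<le> card (X - fst \<xi> ` E') ^ k" by (rule power_mono) simp
    moreover have "card (C \<xi>) = card (X - fst \<xi> ` E') ^ card (set js)" by (simp add: C_def card_PiE)
    ultimately show ?thesis using js(3) distinct_card [OF js(2)] by simp
  qed
  define h where "h = (\<lambda>((\<phi>, \<tau>), c). (mix (set js) c \<phi> :: nat \<Rightarrow> nat, \<tau> :: nat \<Rightarrow> nat))"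
  have fibre: "\<phi> (js ! i) = \<phi> (l ! i)" if "(\<phi>, \<tau>) \<in> V" "i < k" for \<phi> \<tau> i
  proof -
    have "map (rep \<phi> \<tau>) js = l" using that(1) by (simp add: V_def fixes_map_def)
    then have "rep \<phi> \<tau> (js ! i) = l ! i" using that(2) js(3) by (metis nth_map)
    moreover have "js ! i \<in> X" using that(2) js EX nth_mem by blast
    ultimately show ?thesis using rep_fibre by metis
  qed
  have agree: "mix (set js) c \<phi> i = \<phi> i" if "i \<notin> set js" for c \<phi> i using that by (simp add: mix_def)
  \<comment> \<open>The old value at \<open>js ! i\<close> is not lost: it equals the value at
    \<open>l ! i\<close>, which is left alone.\<close>
  have "inj_on h (SIGMA \<xi>:V. C \<xi>)"
  proof (rule inj_onI, clarsimp simp: h_def)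
    fix \<phi> \<tau> c \<phi>' c'
    assume V: "(\<phi>, \<tau>) \<in> V" "(\<phi>', \<tau>) \<in> V" and c: "c \<in> C (\<phi>, \<tau>)" "c' \<in> C (\<phi>', \<tau>)"
      and eq: "mix (set js) c \<phi> = mix (set js) c' \<phi>'"
    have off: "\<phi> i = \<phi>' i" if "i \<notin> set js" for i using fun_cong [OF eq, of i] that by (simp add: mix_def)
    have "\<phi> i = \<phi>' i" for i
    proof (cases "i \<in> set js")
      case True
      then obtain r where r: "r < k" "i = js ! r" using js(3) in_set_conv_nth by metis
      have "l ! r \<in> set l" using r(1) cl(3) by simp
      then have "l ! r \<notin> set js" using disj by (auto simp: E'_def)
      then show ?thesis using fibre [OF V(1) r(1)] fibre [OF V(2) r(1)] off r(2) by metis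
    qed (rule off)
    moreover have "c i = c' i" for i
    proof (cases "i \<in> set js")
      case True
      then show ?thesis using fun_cong [OF eq, of i] by (simp add: mix_def)
    next
      case False
      then show ?thesis using c by (simp add: C_def PiE_iff extensional_def)
    qed
    ultimately show "\<phi> = \<phi>' \<and> c = c'" by (simp add: fun_eq_iff)
  qed
  moreover have "h ` (SIGMA \<xi>:V. C \<xi>) \<subseteq> W"
  proof (clarsimp simp: h_def)
    fix \<phi> \<tau> c assume V: "(\<phi>, \<tau>) \<in> V" and c: "c \<in> C (\<phi>, \<tau>)"
    have phi: "\<phi> \<in> Om" "\<tau> \<in> SS" using V by (auto simp: V_def)
    have cv: "c i \<in> X - \<phi> ` E'" if "i \<in> set js" for i using c that by (auto simp: C_def)
    have "mix (set js) c \<phi> \<in> Om"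
      using phi cv js(1) EX by (auto simp: Om_def mix_def PiE_iff extensional_def)
    moreover have "rep (mix (set js) c \<phi>) \<tau> e = e" if e: "e \<in> E'" for e
    proof (rule rep_eqI [OF phi(2)])
      show "e \<in> X" "e \<in> X" using e E'X by auto
      have ee: "rep \<phi> \<tau> e = e"
      proof (cases "e \<in> E0")
        case True
        then show ?thesis using V by (auto simp: V_def fixes_map_def)
      next
        case False
        then have "e \<in> set (map (rep \<phi> \<tau>) js)" using e V by (auto simp: E'_def V_def fixes_map_def)
        then obtain j where "j \<in> set js" "e = rep \<phi> \<tau> j" by auto
        then show ?thesis using js(1) EX rep_idem by auto
      qed
      fix i assume i: "i \<in> X" "mix (set js) c \<phi> i = mix (set js) c \<phi> e"
      have "mix (set js) c \<phi> e = \<phi> e" using e disj by (intro agree) auto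
      moreover have "i \<notin> set js"
      proof
        assume "i \<in> set js"
        then have "c i = \<phi> e" using i(2) \<open>mix (set js) c \<phi> e = \<phi> e\<close> by (simp add: mix_def)
        then show False using cv [OF \<open>i \<in> set js\<close>] e by auto
      qed
      ultimately have "\<phi> i = \<phi> e" using i(2) agree by metis
      then show "\<tau> e \<le> \<tau> i" using rep_least [of e i \<phi> \<tau>] ee i(1) e E'X by auto
    qed simp
    ultimately show "(mix (set js) c \<phi>, \<tau>) \<in> W" using phi by (simp add: W_def fixes_map_def)
  qed
  ultimately have "card (SIGMA \<xi>:V. C \<xi>) \<le> card W"
    using finV by (metis card_inj_on_le)
  moreover have "card V * (card X - d) ^ k \<le> card (SIGMA \<xi>:V. C \<xi>)"
  proof -
    have "(\<Sum>\<xi>\<in>V. (card X - d) ^ k) \<le> (\<Sum>\<xi>\<in>V. card (C \<xi>))" by (intro sum_mono cardC)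
    then show ?thesis using finV finC by (simp add: card_SigmaI)
  qed
  ultimately have "card V * (card X - d) ^ k \<le> card W" by linarith
  then have "real (card V) * real (card X - d) ^ k \<le> real (card W)"
    by (metis of_nat_le_iff of_nat_mult of_nat_power)
  moreover have cnt: "seed_mean (\<lambda>\<psi>. of_bool (P \<psi>)) = real (card {(\<phi>, \<tau>) \<in> Om \<times> SS. P (rep \<phi> \<tau>)}) / real (card (Om \<times> SS))" for P
  proof -
    have "seed_mean (\<lambda>\<psi>. of_bool (P \<psi>)) = mean (Om \<times> SS) (\<lambda>p. of_bool (P (rep (fst p) (snd p))))"
      by (simp add: seed_mean_def mean_Times)
    also have "(\<Sum>p\<in>Om \<times> SS. of_bool (P (rep (fst p) (snd p))) :: real) = real (card {p \<in> Om \<times> SS. P (rep (fst p) (snd p))})"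
      using finite_Om finite_SS by (simp add: of_bool_def sum.If_cases Int_def)
    then have "mean (Om \<times> SS) (\<lambda>p. of_bool (P (rep (fst p) (snd p)))) = real (card {p \<in> Om \<times> SS. P (rep (fst p) (snd p))}) / real (card (Om \<times> SS))"
      by (simp add: mean_def)
    also have "{p \<in> Om \<times> SS. P (rep (fst p) (snd p))} = {(\<phi>, \<tau>) \<in> Om \<times> SS. P (rep \<phi> \<tau>)}" by auto
    finally show ?thesis .
  qed
  ultimately have "fixes_prob E0 js l * real (card X - d) ^ k \<le> fixes_prob E' [] []"
    unfolding fixes_prob_def cnt V_def [symmetric] W_def [symmetric] by (simp add: divide_right_mono)
  then show ?thesis using fixes_prob_domain_eq [OF E E'] by simp
qed

end

section \<open>Transfer to the product space\<close>

lemma card_dlists_ge: "finite Z \<Longrightarrow> (card Z - k) ^ k \<le> card (dlists k Z)"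
proof (induction k arbitrary: Z)
  case (Suc k)
  have "real ((card Z - Suc k) ^ Suc k) \<le> (\<Sum>x\<in>Z. real ((card Z - Suc k) ^ k))"
    by (simp add: mult_right_mono)
  also have "\<dots> \<le> (\<Sum>x\<in>Z. real (card (dlists k (Z - {x}))))"
  proof (rule sum_mono)
    fix x assume x: "x \<in> Z"
    have "card (Z - {x}) - k = card Z - Suc k" using Suc.prems x by simp
    moreover have "(card (Z - {x}) - k) ^ k \<le> card (dlists k (Z - {x}))" using Suc.IH Suc.prems by simp
    ultimately have "(card Z - Suc k) ^ k \<le> card (dlists k (Z - {x}))" by metis
    then show "real ((card Z - Suc k) ^ k) \<le> real (card (dlists k (Z - {x})))" using of_nat_le_iff by blast
  qed
  also have "\<dots> = real (card (dlists (Suc k) Z))" by (rule card_dlists_Suc [OF Suc.prems, symmetric])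
  finally show ?case using of_nat_le_iff by blast
qed simp

text \<open>Since n <= 2 (n - d), the n-th power of n / (n - d) is at most exp (2 d) <= 9^d.\<close>

lemma power_self_le:
  assumes "2 * d \<le> n" "0 < n"
  shows "real n ^ n \<le> 9 ^ d * real (n - d) ^ n"
proof -
  define r where "r = real (n - d)"
  have r: "0 < r" "real n = r + real d" "real n \<le> 2 * r" using assms by (auto simp: r_def of_nat_diff)
  have "(real n / r) ^ n = (1 + real d / r) ^ n" using r(1) by (simp add: r(2) add_divide_distrib)
  also have "\<dots> \<le> exp (real d / r) ^ n"
    using r(1) by (intro power_mono exp_ge_add_one_self) auto
  also have "\<dots> = exp (real n * (real d / r))" by (simp only: exp_of_nat_mult)
  also have "\<dots> \<le> exp (2 * real d)"
  proof -
    have "real n * real d \<le> 2 * r * real d" using r(3) by (intro mult_right_mono) auto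
    then show ?thesis using r(1) by (simp add: pos_divide_le_eq mult_ac)
  qed
  also have "\<dots> = (exp 1 * exp 1) ^ d"
    by (simp add: exp_of_nat_mult [symmetric] exp_add [symmetric] mult.commute)
  also have "\<dots> \<le> (3 * 3) ^ d" by (intro power_mono mult_mono exp_le) auto
  finally have "(real n / r) ^ n \<le> 9 ^ d" by simp
  then have "real n ^ n / r ^ n \<le> 9 ^ d" by (simp add: power_divide)
  then show ?thesis using r(1) by (simp add: pos_divide_le_eq r_def)
qed

context permutation_transfer
begin

text \<open>A point that is alone in its fibre is fixed. So it suffices that \<open>\<phi>\<close>
  is injective on \<open>E\<close> and shares no value between \<open>E\<close> and its complement,
  which holds for at least (n - d)^n maps.\<close>

lemma fixes_prob_ge:
  assumes E: "E \<in> subs d" and d: "2 * d \<le> card X"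
  shows "(1 / 9) ^ d \<le> fixes_prob E [] []"
proof -
  define n where "n = card X"
  have n0: "0 < n" using finite_X X_nonempty by (simp add: n_def card_gt_0_iff)
  have finE: "finite E" and EX: "E \<subseteq> X" and cE: "card E = d" using E subs_finite [OF E] by (auto simp: subs_def)
  obtain e where e: "e \<in> dlists d X" "set e = E" using subs_list [OF E] by blast
  define P where "P J = {\<phi> \<in> Om. map \<phi> e = J \<and> (\<forall>i\<in>X - E. \<phi> i \<in> X - set J)}" for J
  have finP: "finite (P J)" for J unfolding P_def using finite_Om by simp
  have cardP: "(n - d) ^ (n - d) \<le> card (P J)" if J: "J \<in> dlists d X" for J
  proof -
    obtain \<pi> where pi: "\<pi> permutes X" "map \<pi> e = J" using ex_permutes_map [OF e(1) J] by blast
    define C where "C = (\<Pi>\<^sub>E i\<in>X - E. X - set J)"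
    have "inj_on (mix E \<pi>) C"
    proof (rule inj_onI)
      fix c c' assume c: "c \<in> C" "c' \<in> C" "mix E \<pi> c = mix E \<pi> c'"
      have "c i = c' i" for i
      proof (cases "i \<in> X - E")
        case True
        then show ?thesis using fun_cong [OF c(3), of i] by (simp add: mix_def)
      next
        case False
        then show ?thesis using c(1,2) by (auto simp: C_def PiE_iff extensional_def)
      qed
      then show "c = c'" by (simp add: fun_eq_iff)
    qed
    moreover have "mix E \<pi> ` C \<subseteq> P J"
    proof clarify
      fix c assume c: "c \<in> C"
      have "mix E \<pi> c \<in> Om"
        using c EX permutes_in_image [OF pi(1)] by (auto simp: Om_def mix_def C_def PiE_iff extensional_def)
      moreover have "map (mix E \<pi> c) e = J" unfolding pi(2) [symmetric] using e(2) by (simp add: mix_def)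
      ultimately show "mix E \<pi> c \<in> P J" using c by (auto simp: P_def mix_def C_def)
    qed
    ultimately have "card C \<le> card (P J)" using finP by (metis card_inj_on_le)
    moreover have "card C = (n - d) ^ (n - d)"
    proof -
      have "card (set J) = d" "set J \<subseteq> X" using J by (auto simp: dlists_def distinct_card)
      then have "card (X - set J) = n - d" using finite_X by (simp add: n_def card_Diff_subset)
      moreover have "card (X - E) = n - d" using EX finE cE by (simp add: n_def card_Diff_subset)
      ultimately show ?thesis using finite_X by (simp add: C_def card_PiE)
    qed
    ultimately show ?thesis by simp
  qed
  define Good where "Good = (\<Union>J\<in>dlists d X. P J)"
  have "(n - d) ^ n \<le> card Good"
  proof -
    have "(n - d) ^ n = (n - d) ^ d * (n - d) ^ (n - d)"
      using d by (simp add: n_def power_add [symmetric])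
    also have "\<dots> \<le> card (dlists d X) * (n - d) ^ (n - d)"
      using card_dlists_ge [OF finite_X, of d] by (intro mult_right_mono) (auto simp: n_def)
    also have "\<dots> = (\<Sum>J\<in>dlists d X. (n - d) ^ (n - d))" by simp
    also have "\<dots> \<le> (\<Sum>J\<in>dlists d X. card (P J))" by (intro sum_mono cardP)
    also have "\<dots> = card Good"
      unfolding Good_def using finite_dlists [OF finite_X] finP
      by (intro card_UN_disjoint [symmetric]) (auto simp: P_def)
    finally show ?thesis .
  qed
  then have "real (n - d) ^ n \<le> real (card Good)" by (metis of_nat_le_iff of_nat_power)
  have fixed: "fixes_map E [] [] (rep \<phi> \<tau>)" if phi: "\<phi> \<in> Good" and tau: "\<tau> \<in> SS" for \<phi> \<tau>
  proof -
    obtain J where J: "J \<in> dlists d X" "map \<phi> e = J" "\<And>i. i \<in> X - E \<Longrightarrow> \<phi> i \<in> X - set J"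
      using phi by (auto simp: Good_def P_def)
    have inj: "inj_on \<phi> E" using J(1) unfolding J(2) [symmetric] by (simp add: dlists_def distinct_map e(2))
    have "rep \<phi> \<tau> i = i" if i: "i \<in> E" for i
    proof (rule rep_eqI [OF tau])
      show "i \<in> X" "i \<in> X" using i EX by auto
      fix k assume k: "k \<in> X" "\<phi> k = \<phi> i"
      have "\<phi> i \<in> set J" using i e(2) J(2) by auto
      then have "k \<in> E" using J(3) [of k] k by auto
      then have "k = i" using inj i k(2) by (simp add: inj_on_eq_iff)
      then show "\<tau> i \<le> \<tau> k" by simp
    qed simp
    then show ?thesis by (simp add: fixes_map_def)
  qed
  have GO: "Good \<subseteq> Om" by (auto simp: Good_def P_def)
  have cOm: "real (card Om) = real n ^ n"
    using finite_X by (simp add: Om_def card_PiE n_def)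
  have "(1 / 9) ^ d \<le> real (n - d) ^ n / real n ^ n"
  proof -
    have "real n ^ n \<le> 9 ^ d * real (n - d) ^ n"
      using d n0 by (intro power_self_le) (simp_all add: n_def)
    then show ?thesis using n0 by (simp add: power_divide field_simps)
  qed
  also have "\<dots> \<le> real (card Good) / real (card Om)"
    unfolding cOm using \<open>real (n - d) ^ n \<le> real (card Good)\<close> by (intro divide_right_mono) auto
  also have "\<dots> = mean Om (\<lambda>\<phi>. of_bool (\<phi> \<in> Good))"
    using GO finite_Om by (simp add: mean_def of_bool_def sum.If_cases Int_absorb1)
  also have "\<dots> \<le> fixes_prob E [] []"
    unfolding fixes_prob_def seed_mean_def
  proof (rule mean_mono)
    fix \<phi>
    have "of_bool (\<phi> \<in> Good) = mean SS (\<lambda>\<tau>. of_bool (\<phi> \<in> Good))" by simp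
    also have "\<dots> \<le> mean SS (\<lambda>\<tau>. of_bool (fixes_map E [] [] (rep \<phi> \<tau>)))"
      using fixed by (intro mean_mono) auto
    finally show "of_bool (\<phi> \<in> Good) \<le> mean SS (\<lambda>\<tau>. of_bool (fixes_map E [] [] (rep \<phi> \<tau>)))" .
  qed
  finally show ?thesis .
qed

definition moved :: "nat set \<Rightarrow> nat set \<Rightarrow> nat list" where
  "moved E E0 = sorted_list_of_set (E - E0)"

lemma moved:
  assumes "E \<in> subs d"
  shows "set (moved E E0) = E - E0" "distinct (moved E E0)" "length (moved E E0) = card (E - E0)"
  using subs_finite [OF assms] by (simp_all add: moved_def)

text \<open>If \<open>\<psi>\<close> is injective on \<open>E\<close>, idempotence forces each point
  of \<open>E\<close> to be fixed or to leave \<open>E\<close>, so exactly one pair of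
  \<open>E0\<close> and \<open>l\<close> matches. Otherwise no pair matches, and the left-hand side
  vanishes because the graph is not a partial injection.\<close>

lemma graph_on_rep_expansion:
  assumes B: "harmonic X d B" and E: "E \<in> subs d" and s: "s \<in> G" and psi: "\<psi> = rep \<phi> \<tau>"
  shows "B (graph_on (s \<circ> \<psi>) E) = (\<Sum>E0\<in>Pow E. \<Sum>l\<in>dlists (card (E - E0)) (X - E).
    of_bool (fixes_map E0 (moved E E0) l \<psi>) * B (graph_on s E0 \<union> set (zip (moved E E0) (map s l))))"
proof -
  have finE: "finite E" and EX: "E \<subseteq> X" and cE: "card E = d" using E subs_finite [OF E] by (auto simp: subs_def)
  define t where "t E0 l = of_bool (fixes_map E0 (moved E E0) l \<psi>) * B (graph_on s E0 \<union> set (zip (moved E E0) (map s l)))" for E0 l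
  have out: "\<psi> i \<in> X - E" if "fixes_map E0 (moved E E0) l \<psi>" "l \<in> dlists k (X - E)" "i \<in> E - E0" for E0 l k i
  proof -
    have "\<psi> i \<in> set l" using that(1,3) moved(1) [OF E, of E0] by (auto simp: fixes_map_def)
    then show ?thesis using that(2) by (auto simp: dlists_def)
  qed
  show ?thesis
  proof (cases "inj_on \<psi> E")
    case True
    define E1 where "E1 = {i \<in> E. \<psi> i = i}"
    define l1 where "l1 = map \<psi> (moved E E1)"
    have E1: "E1 \<in> Pow E" by (auto simp: E1_def)
    have "\<psi> i \<notin> E" if i: "i \<in> E - E1" for i
    proof
      assume "\<psi> i \<in> E"
      moreover have "\<psi> (\<psi> i) = \<psi> i" unfolding psi using i EX by (intro rep_idem) auto
      ultimately have "\<psi> i = i" using True i by (simp add: inj_on_eq_iff)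
      then show False using i by (simp add: E1_def)
    qed
    moreover have "\<psi> i \<in> X" if "i \<in> E" for i unfolding psi using that EX by (intro rep_in_X) auto
    moreover have "inj_on \<psi> (E - E1)" using True by (rule inj_on_subset) auto
    ultimately have l1: "l1 \<in> dlists (card (E - E1)) (X - E)"
      using moved [OF E, of E1] by (auto simp: l1_def dlists_def distinct_map)
    have E1_only: "E0 = E1" "l = l1" if "E0 \<in> Pow E" "fixes_map E0 (moved E E0) l \<psi>" "l \<in> dlists k (X - E)" for E0 l k
    proof -
      have "E0 \<subseteq> E1" using that(1,2) by (auto simp: fixes_map_def E1_def)
      moreover have "E1 \<subseteq> E0" using out [OF that(2,3)] by (force simp: E1_def)
      ultimately show "E0 = E1" by blast
      then show "l = l1" using that(2) by (simp add: fixes_map_def l1_def)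
    qed
    have "(\<Sum>E0\<in>Pow E. \<Sum>l\<in>dlists (card (E - E0)) (X - E). t E0 l) = (\<Sum>E0\<in>{E1}. \<Sum>l\<in>dlists (card (E - E0)) (X - E). t E0 l)"
    proof (rule sum.mono_neutral_right)
      show "\<forall>E0\<in>Pow E - {E1}. (\<Sum>l\<in>dlists (card (E - E0)) (X - E). t E0 l) = 0"
      proof (intro ballI sum.neutral)
        fix E0 l assume "E0 \<in> Pow E - {E1}" "l \<in> dlists (card (E - E0)) (X - E)"
        then have "\<not> fixes_map E0 (moved E E0) l \<psi>" using E1_only(1) by blast
        then show "t E0 l = 0" by (simp add: t_def)
      qed
    qed (use finE E1 in auto)
    also have "\<dots> = (\<Sum>l\<in>{l1}. t E1 l)"
    proof -
      have "(\<Sum>l\<in>dlists (card (E - E1)) (X - E). t E1 l) = (\<Sum>l\<in>{l1}. t E1 l)"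
      proof (rule sum.mono_neutral_right)
        show "\<forall>l\<in>dlists (card (E - E1)) (X - E) - {l1}. t E1 l = 0"
        proof
          fix l assume "l \<in> dlists (card (E - E1)) (X - E) - {l1}"
          then have "\<not> fixes_map E1 (moved E E1) l \<psi>" using E1_only(2) [OF E1] by blast
          then show "t E1 l = 0" by (simp add: t_def)
        qed
      qed (use l1 finite_X in \<open>auto intro: finite_dlists\<close>)
      then show ?thesis by simp
    qed
    also have "\<dots> = B (graph_on s E1 \<union> set (zip (moved E E1) (map s l1)))"
      by (simp add: t_def fixes_map_def l1_def) (simp add: E1_def)
    also have "graph_on s E1 \<union> set (zip (moved E E1) (map s l1)) = graph_on (s \<circ> \<psi>) E"
    proof -
      have "E = E1 \<union> set (moved E E1)" using moved(1) [OF E, of E1] E1 by auto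
      then have "graph_on (s \<circ> \<psi>) E = graph_on (s \<circ> \<psi>) E1 \<union> graph_on (s \<circ> \<psi>) (set (moved E E1))"
        by (metis graph_on_Un)
      moreover have "graph_on (s \<circ> \<psi>) E1 = graph_on s E1" by (auto simp: graph_on_def E1_def)
      moreover have "graph_on (s \<circ> \<psi>) (set (moved E E1)) = set (zip (moved E E1) (map s l1))"
        unfolding graph_on_set l1_def by simp
      ultimately show ?thesis by simp
    qed
    finally show ?thesis by (simp add: t_def)
  next
    case False
    have "\<not> inj_on snd (graph_on (s \<circ> \<psi>) E)"
    proof
      assume *: "inj_on snd (graph_on (s \<circ> \<psi>) E)"
      have "inj_on \<psi> E"
      proof (rule inj_onI)
        fix i j assume ij: "i \<in> E" "j \<in> E" "\<psi> i = \<psi> j"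
        then have "(i, s (\<psi> i)) \<in> graph_on (s \<circ> \<psi>) E" "(j, s (\<psi> i)) \<in> graph_on (s \<circ> \<psi>) E"
          by (auto simp: graph_on_def)
        from inj_onD [OF * _ this] show "i = j" by simp
      qed
      with False show False ..
    qed
    then have "B (graph_on (s \<circ> \<psi>) E) = 0" using B by (simp add: harmonic_def partials_def)
    moreover have "t E0 l = 0" if E0: "E0 \<in> Pow E" and l: "l \<in> dlists (card (E - E0)) (X - E)" for E0 l
    proof -
      have "\<not> fixes_map E0 (moved E E0) l \<psi>"
      proof
        assume fm: "fixes_map E0 (moved E E0) l \<psi>"
        have fx: "\<psi> i = i" if "i \<in> E0" for i using fm that by (simp add: fixes_map_def)
        have "inj_on \<psi> (set (moved E E0))"
          using fm l by (auto simp: fixes_map_def dlists_def distinct_map)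
        then have "inj_on \<psi> (E - E0)" using moved(1) [OF E] by simp
        moreover have "inj_on \<psi> E0" using fx by (simp add: inj_on_def)
        moreover have "\<psi> ` E0 \<inter> \<psi> ` (E - E0) = {}" using fx out [OF fm l] E0 by force
        ultimately have "inj_on \<psi> (E0 \<union> (E - E0))" unfolding inj_on_Un by blast
        moreover have "E0 \<union> (E - E0) = E" using E0 by blast
        ultimately show False using False by simp
      qed
      then show ?thesis by (simp add: t_def)
    qed
    ultimately show ?thesis unfolding t_def [symmetric] by (simp add: sum.neutral)
  qed
qed

text \<open>By symmetry the probability is the same for all target lists outside \<open>E\<close>;
  the choice picks one of them.\<close>

definition moving_prob :: "nat set \<Rightarrow> nat set \<Rightarrow> real" where
  "moving_prob E E0 = fixes_prob E0 (moved E E0) (SOME l. l \<in> dlists (card (E - E0)) (X - E))"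

lemma moving_prob:
  assumes E: "E \<in> subs d" and E0: "E0 \<in> Pow E" and d: "2 * d \<le> card X"
  shows "l \<in> dlists (card (E - E0)) (X - E) \<Longrightarrow> fixes_prob E0 (moved E E0) l = moving_prob E E0"
    and "moving_prob E E0 * real (card X - d) ^ card (E - E0) \<le> fixes_prob E [] []"
    and "0 \<le> moving_prob E E0"
proof -
  have finE: "finite E" and EX: "E \<subseteq> X" and cE: "card E = d" using E subs_finite [OF E] by (auto simp: subs_def)
  define k where "k = card (E - E0)"
  have "k \<le> d" unfolding k_def using cE finE card_mono [of E "E - E0"] by auto
  then have "k \<le> card (X - E)" using d EX finE cE by (simp add: card_Diff_subset)
  then have "dlists k (X - E) \<noteq> {}" using card_dlists_pos [of "X - E" k] finite_X by auto
  then have l0: "(SOME l. l \<in> dlists k (X - E)) \<in> dlists k (X - E)" by (simp add: some_in_eq)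
  show "fixes_prob E0 (moved E E0) l = moving_prob E E0" if "l \<in> dlists (card (E - E0)) (X - E)"
    unfolding moving_prob_def
    by (rule fixes_prob_target_eq [OF E _ _ that l0 [unfolded k_def]]) (use E0 moved(1) [OF E] in auto)
  show "moving_prob E E0 * real (card X - d) ^ card (E - E0) \<le> fixes_prob E [] []"
    unfolding moving_prob_def
    by (rule fixes_prob_moving_le [OF E _ moved [OF E] l0 [unfolded k_def]]) (use E0 in auto)
  show "0 \<le> moving_prob E E0" unfolding moving_prob_def fixes_prob_def by (intro seed_mean_nonneg) simp
qed

text \<open>As the probability is constant over the target lists, a plain sum over lists outside the
  image of \<open>E\<close> remains, and \<open>harmonic_sum_ran\<close> turns it into a short sum
  inside.\<close>

lemma seed_mean_graph_on:
  assumes B: "harmonic X d B" and E: "E \<in> subs d" and s: "s \<in> G" and d: "2 * d \<le> card X"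
  shows "seed_mean (\<lambda>\<psi>. B (graph_on (s \<circ> \<psi>) E)) = (\<Sum>E0\<in>Pow E. moving_prob E E0 * ((- 1) ^ card (E - E0) *
    (\<Sum>b\<in>dlists (card (E - E0)) (E - E0). B (graph_on s E0 \<union> set (zip (moved E E0) (map s b))))))"
proof -
  have finE: "finite E" and EX: "E \<subseteq> X" and cE: "card E = d" using E subs_finite [OF E] by (auto simp: subs_def)
  have injs: "inj s" by (rule inj_G [OF s])
  have "seed_mean (\<lambda>\<psi>. B (graph_on (s \<circ> \<psi>) E)) = seed_mean (\<lambda>\<psi>. \<Sum>E0\<in>Pow E. \<Sum>l\<in>dlists (card (E - E0)) (X - E).
    of_bool (fixes_map E0 (moved E E0) l \<psi>) * B (graph_on s E0 \<union> set (zip (moved E E0) (map s l))))"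
    by (rule seed_mean_cong) (rule graph_on_rep_expansion [OF B E s refl])
  also have "\<dots> = (\<Sum>E0\<in>Pow E. \<Sum>l\<in>dlists (card (E - E0)) (X - E).
      fixes_prob E0 (moved E E0) l * B (graph_on s E0 \<union> set (zip (moved E E0) (map s l))))"
    by (simp add: seed_mean_sum seed_mean_multc fixes_prob_def)
  also have "\<dots> = (\<Sum>E0\<in>Pow E. moving_prob E E0 * ((- 1) ^ card (E - E0) *
    (\<Sum>b\<in>dlists (card (E - E0)) (E - E0). B (graph_on s E0 \<union> set (zip (moved E E0) (map s b))))))"
  proof (rule sum.cong [OF refl])
    fix E0 assume E0: "E0 \<in> Pow E"
    define k where "k = card (E - E0)"
    define m0 where "m0 = graph_on s E0"
    define js where "js = moved E E0"
    note js = moved [OF E, of E0, folded js_def k_def]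
    have m0: "m0 \<in> partials X (card E0)"
      unfolding m0_def using s E0 EX by (intro graph_on_partials) (auto simp: subs_def)
    have "card E0 + k = d"
      using E0 finE cE card_mono [OF finE, of E0] finite_subset [of E0 E] by (simp add: k_def card_Diff_subset)
    have imX: "s ` (X - E) = X - s ` E" using image_G [OF s] injs by (simp add: image_set_diff)
    have "(\<Sum>l\<in>dlists k (X - E). fixes_prob E0 js l * B (m0 \<union> set (zip js (map s l))))
        = (\<Sum>l\<in>dlists k (X - E). moving_prob E E0 * B (m0 \<union> set (zip js (map s l))))"
      using moving_prob(1) [OF E E0 d] by (intro sum.cong refl) (simp add: js_def k_def)
    also have "\<dots> = moving_prob E E0 * (\<Sum>l\<in>dlists k (X - s ` E). B (m0 \<union> set (zip js l)))"
      using sum_dlists_image [OF injs, of "\<lambda>l. B (m0 \<union> set (zip js l))" k "X - E"] by (simp add: sum_distrib_left imX)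
    also have "(\<Sum>l\<in>dlists k (X - s ` E). B (m0 \<union> set (zip js l))) = (- 1) ^ k * (\<Sum>l\<in>dlists k (s ` E - s ` E0). B (m0 \<union> set (zip js l)))"
      unfolding js(3) [symmetric]
    proof (rule harmonic_sum_ran [OF finite_X B m0 js(2)])
      show "set js \<subseteq> X - fst ` m0" using js(1) EX by (auto simp: m0_def)
      show "card E0 + length js = d" using \<open>card E0 + k = d\<close> js(3) by simp
      have "s ` E \<subseteq> X" using EX image_G [OF s] by blast
      then show "s ` E - s ` E0 \<union> (X - s ` E) = X - snd ` m0" using E0 by (auto simp: m0_def)
    qed auto
    also have "s ` E - s ` E0 = s ` (E - E0)" using injs by (simp add: image_set_diff)
    finally show "(\<Sum>l\<in>dlists (card (E - E0)) (X - E).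
        fixes_prob E0 (moved E E0) l * B (graph_on s E0 \<union> set (zip (moved E E0) (map s l)))) =
      moving_prob E E0 * ((- 1) ^ card (E - E0) *
        (\<Sum>b\<in>dlists (card (E - E0)) (E - E0). B (graph_on s E0 \<union> set (zip (moved E E0) (map s b)))))"
      by (simp add: k_def js_def m0_def sum_dlists_image [OF injs])
  qed
  finally show ?thesis .
qed

text \<open>The second factor depends only on the values of \<open>s\<close> on \<open>E\<close>, so
  \<open>f\<close> may be replaced with its conditional expectation.\<close>

lemma mean_twisted:
  assumes E: "E \<in> subs d" and E0: "E0 \<subseteq> E" and a: "a \<in> dlists (card (E - E0)) (E - E0)" and b: "b \<in> dlists (card (E - E0)) (E - E0)"
  shows "mean G (\<lambda>s. f s * B (graph_on s E0 \<union> set (zip a (map s b))))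
    = mean G (\<lambda>s. coefs d f (graph_on s E) * B (graph_on s E0 \<union> set (zip a (map s b))))"
proof -
  have finE: "finite E" using subs_finite [OF E] .
  obtain e0 where e0: "set e0 = E0" "distinct e0" using finite_distinct_list [of E0] finite_subset [OF E0 finE] by blast
  have "set b = E - E0"
    using b finE card_subset_eq [of "E - E0" "set b"] by (simp add: dlists_def distinct_card)
  then have setI: "set (e0 @ b) = E" using e0 E0 by auto
  have eq: "graph_on s E0 \<union> set (zip a (map s b)) = set (zip (e0 @ a) (map s (e0 @ b)))" for s
    by (simp add: e0(1) [symmetric] graph_on_set)
  have "mean G (\<lambda>s. restr f (graph_on s E) * B (set (zip (e0 @ a) (map s (e0 @ b)))))
    = mean G (\<lambda>s. coefs d f (graph_on s E) * B (set (zip (e0 @ a) (map s (e0 @ b)))))"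
    by (rule mean_cong) (simp_all add: simp_implies_def coefs_graph_on [OF _ E])
  then show ?thesis
    unfolding eq using mean_G_restr [of f "\<lambda>l. B (set (zip (e0 @ a) l))" "e0 @ b"] unfolding setI by simp
qed

text \<open>Expand over the set \<open>E0\<close> of points of \<open>E\<close> that \<open>\<psi>\<close> fixes: the term \<open>E0 = E\<close> dominates, because by
  harmonicity the points outside \<open>E0\<close> cost a factor of order \<open>1 / card X\<close> each.\<close>

lemma coupled_lower_bound:
  assumes f: "orth (d - 1) f" and B: "B = coefs d f" and E: "E \<in> subs d" and d: "0 < d" "10 * d\<^sup>2 \<le> card X"
  shows "fixes_prob E [] [] / 2 * mean G (\<lambda>s. (B (graph_on s E))\<^sup>2)
    \<le> seed_mean (\<lambda>\<psi>. mean G (\<lambda>s. f s * B (graph_on (s \<circ> \<psi>) E)))"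
proof -
  note db = degree_bounds [OF d]
  have d2: "2 * d \<le> card X" "d + 2 \<le> card X" using db(1) by linarith+
  have harm: "harmonic X d B" unfolding B by (rule harmonic_coefs [OF f d(1) d2(2)])
  have finE: "finite E" and EX: "E \<subseteq> X" and cE: "card E = d" using E subs_finite [OF E] by (auto simp: subs_def)
  define M where "M = mean G (\<lambda>s. (B (graph_on s E))\<^sup>2)"
  define p where "p = fixes_prob E [] []"
  define q where "q = real d / real (card X - d)"
  define r where "r = real (card X - d)"
  have nd: "9 * (real d)\<^sup>2 \<le> r"
    unfolding r_def using db(2) by (metis of_nat_le_iff of_nat_mult of_nat_numeral of_nat_power)
  have r0: "0 < r" using db by (simp add: r_def)
  have q: "0 \<le> q" "real d * q \<le> 1 / 9"
    using nd r0 by (auto simp: q_def r_def [symmetric] power2_eq_square field_simps)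
  have M0: "0 \<le> M" unfolding M_def by (intro mean_nonneg) simp
  have p0: "0 \<le> p" unfolding p_def fixes_prob_def by (intro seed_mean_nonneg) simp
  define T where "T E0 = moving_prob E E0 * ((- 1) ^ card (E - E0) *
    (\<Sum>b\<in>dlists (card (E - E0)) (E - E0). mean G (\<lambda>s. B (graph_on s E) * B (graph_on s E0 \<union> set (zip (moved E E0) (map s b))))))" for E0
  have mov: "moved E E0 \<in> dlists (card (E - E0)) (E - E0)" for E0 using moved [OF E, of E0] by (simp add: dlists_def)
  have "seed_mean (\<lambda>\<psi>. mean G (\<lambda>s. f s * B (graph_on (s \<circ> \<psi>) E))) = mean G (\<lambda>s. f s * seed_mean (\<lambda>\<psi>. B (graph_on (s \<circ> \<psi>) E)))"
    by (simp add: seed_mean_swap seed_mean_cmult)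
  also have "\<dots> = mean G (\<lambda>s. \<Sum>E0\<in>Pow E. \<Sum>b\<in>dlists (card (E - E0)) (E - E0). (moving_prob E E0 * (- 1) ^ card (E - E0)) *
    (f s * B (graph_on s E0 \<union> set (zip (moved E E0) (map s b)))))"
    by (rule mean_cong) (simp_all add: simp_implies_def seed_mean_graph_on [OF harm E _ d2(1)] sum_distrib_left mult_ac)
  also have "\<dots> = (\<Sum>E0\<in>Pow E. \<Sum>b\<in>dlists (card (E - E0)) (E - E0). (moving_prob E E0 * (- 1) ^ card (E - E0)) *
    mean G (\<lambda>s. f s * B (graph_on s E0 \<union> set (zip (moved E E0) (map s b)))))"
    by (simp only: mean_sum mean_cmult)
  also have "\<dots> = (\<Sum>E0\<in>Pow E. \<Sum>b\<in>dlists (card (E - E0)) (E - E0). (moving_prob E E0 * (- 1) ^ card (E - E0)) *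
    mean G (\<lambda>s. B (graph_on s E) * B (graph_on s E0 \<union> set (zip (moved E E0) (map s b)))))"
  proof (intro sum.cong refl arg_cong2 [where f = "(*)"])
    fix E0 b assume "E0 \<in> Pow E" "b \<in> dlists (card (E - E0)) (E - E0)"
    then show "mean G (\<lambda>s. f s * B (graph_on s E0 \<union> set (zip (moved E E0) (map s b)))) =
        mean G (\<lambda>s. B (graph_on s E) * B (graph_on s E0 \<union> set (zip (moved E E0) (map s b))))"
      using mean_twisted [OF E _ mov, of E0 b f B] B by simp
  qed
  also have "\<dots> = (\<Sum>E0\<in>Pow E. T E0)"
    by (simp add: T_def sum_distrib_left mult.assoc)
  also have "\<dots> = T E + (\<Sum>E0\<in>Pow E - {E}. T E0)" using finE by (subst sum.remove [of _ E]) auto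
  also have "T E = p * M"
  proof -
    have "moving_prob E E = p"
      using moving_prob(1) [OF E _ d2(1), of E "[]"] by (simp add: p_def moved_def)
    then show ?thesis by (simp add: T_def M_def moved_def power2_eq_square)
  qed
  finally have eq: "seed_mean (\<lambda>\<psi>. mean G (\<lambda>s. f s * B (graph_on (s \<circ> \<psi>) E))) = p * M + (\<Sum>E0\<in>Pow E - {E}. T E0)" .
  have "\<bar>T E0\<bar> \<le> q ^ card (E - E0) * (p * M)" if E0: "E0 \<in> Pow E - {E}" for E0
  proof -
    define k where "k = card (E - E0)"
    have kd: "k \<le> d" unfolding k_def using cE finE card_mono [of E "E - E0"] by auto
    note mp = moving_prob(2,3) [OF E _ d2(1), of E0]
    have E0': "E0 \<in> Pow E" "E0 \<subseteq> E" using E0 by auto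
    have "\<bar>T E0\<bar> = moving_prob E E0 * \<bar>\<Sum>b\<in>dlists k (E - E0). mean G (\<lambda>s. B (graph_on s E) * B (graph_on s E0 \<union> set (zip (moved E E0) (map s b))))\<bar>"
      using mp(2) E0' by (simp add: T_def k_def abs_mult power_abs)
    \<comment> \<open>The short sum has k! <= d^k terms, while moving k points costs a factor (n -
      d)^(-k) in probability: together q^k.\<close>
    also have "\<dots> \<le> moving_prob E E0 * (\<Sum>b\<in>dlists k (E - E0). M)"
    proof (intro mult_left_mono order_trans [OF sum_abs sum_mono])
      fix b assume "b \<in> dlists k (E - E0)"
      then show "\<bar>mean G (\<lambda>s. B (graph_on s E) * B (graph_on s E0 \<union> set (zip (moved E E0) (map s b))))\<bar> \<le> M"
        unfolding M_def by (intro abs_mean_twist_le [OF E E0'(2) k_def [symmetric] _ _ d2(2)]) (use mov in \<open>simp_all add: k_def\<close>)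
    qed (use mp(2) E0' in auto)
    also have "\<dots> = moving_prob E E0 * fact k * M"
      using finE by (simp add: card_dlists_full k_def)
    also have "\<dots> \<le> moving_prob E E0 * real d ^ k * M"
    proof (intro mult_right_mono mult_left_mono M0)
      have "(fact k :: real) \<le> real (k ^ k)" by (rule fact_le_power)
      also have "\<dots> \<le> real (d ^ k)" unfolding of_nat_le_iff using kd by (rule power_mono) simp
      finally show "fact k \<le> real d ^ k" by simp
    qed (use mp(2) E0' in auto)
    also have "\<dots> = (moving_prob E E0 * r ^ k) * q ^ k * M"
      using r0 by (simp add: q_def r_def [symmetric] power_divide)
    also have "\<dots> \<le> p * q ^ k * M"
      using mp(1) E0' q(1) M0 by (intro mult_right_mono) (auto simp: r_def k_def p_def)
    finally show ?thesis by (simp add: k_def mult_ac)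
  qed
  then have "\<bar>\<Sum>E0\<in>Pow E - {E}. T E0\<bar> \<le> (\<Sum>E0\<in>Pow E - {E}. q ^ card (E - E0) * (p * M))"
    by (intro order_trans [OF sum_abs sum_mono])
  also have "\<dots> = (\<Sum>E0\<in>Pow E - {E}. q ^ card (E - E0)) * (p * M)" by (simp add: sum_distrib_right)
  also have "\<dots> \<le> 1 / 2 * (p * M)"
    using M0 p0 by (intro mult_right_mono sum_proper_subsets_le [OF finE cE q]) auto
  finally show ?thesis using eq by (simp add: M_def p_def)
qed

text \<open>The conditional probability that the uniform permutation \<open>s\<close> lies in
  \<open>A\<close>, given that \<open>s \<circ> \<psi>\<close> equals \<open>\<phi>\<close> on
  \<open>X\<close>. By \<open>seed_mean_uniform\<close> the condition has probability 1 /
  \<open>card Om\<close>, whence the factor. So the values lie in [0, 1], as the level inequality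
  demands.\<close>

definition transfer :: "(nat \<Rightarrow> nat) set \<Rightarrow> (nat \<Rightarrow> nat) \<Rightarrow> real" where
  "transfer A \<phi> = real (card Om) * seed_mean (\<lambda>\<psi>. mean SS (\<lambda>s. indicator A s * of_bool (restrict (s \<circ> \<psi>) X = \<phi>)))"

lemma mean_transfer:
  "mean Om (\<lambda>\<phi>. transfer A \<phi> * H \<phi>) = seed_mean (\<lambda>\<psi>. mean SS (\<lambda>s. indicator A s * H (restrict (s \<circ> \<psi>) X)))"
proof -
  have "0 < real (card Om)" using finite_Om Om_nonempty by (simp add: card_gt_0_iff)
  then have "mean Om (\<lambda>\<phi>. transfer A \<phi> * H \<phi>)
      = (\<Sum>\<phi>\<in>Om. seed_mean (\<lambda>\<psi>. mean SS (\<lambda>s. indicator A s * of_bool (restrict (s \<circ> \<psi>) X = \<phi>))) * H \<phi>)"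
    by (simp add: mean_def transfer_def mult.assoc sum_distrib_left [symmetric])
  also have "\<dots> = seed_mean (\<lambda>\<psi>. \<Sum>\<phi>\<in>Om. mean SS (\<lambda>s. indicator A s * of_bool (restrict (s \<circ> \<psi>) X = \<phi>)) * H \<phi>)"
    by (simp only: seed_mean_sum seed_mean_multc)
  also have "\<dots> = seed_mean (\<lambda>\<psi>. mean SS (\<lambda>s. indicator A s * H (restrict (s \<circ> \<psi>) X)))"
  proof (rule seed_mean_cong)
    fix \<phi>0 \<tau>
    define \<psi> where "\<psi> = rep \<phi>0 \<tau>"
    have "(\<Sum>\<phi>\<in>Om. mean SS (\<lambda>s. indicator A s * of_bool (restrict (s \<circ> \<psi>) X = \<phi>)) * H \<phi>)
        = mean SS (\<lambda>s. \<Sum>\<phi>\<in>Om. indicator A s * of_bool (restrict (s \<circ> \<psi>) X = \<phi>) * H \<phi>)"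
      by (simp only: mean_sum mean_multc)
    also have "\<dots> = mean SS (\<lambda>s. indicator A s * H (restrict (s \<circ> \<psi>) X))"
    proof (rule mean_cong [OF refl], unfold simp_implies_def)
      fix s assume s: "s \<in> SS"
      define z where "z = restrict (s \<circ> \<psi>) X"
      have z: "z \<in> Om" unfolding z_def by (rule restrict_in_Om [OF s]) (simp add: \<psi>_def rep_in_X)
      have "(\<Sum>\<phi>\<in>Om. indicator A s * of_bool (z = \<phi>) * H \<phi>) = (\<Sum>\<phi>\<in>Om. if z = \<phi> then indicator A s * H \<phi> else 0)"
        by (intro sum.cong refl) (simp only: of_bool_def split: if_splits, simp)
      also have "\<dots> = indicator A s * H z" unfolding sum.delta' [OF finite_Om] using z by (simp only: if_True)
      finally have "(\<Sum>\<phi>\<in>Om. indicator A s * of_bool (z = \<phi>) * H \<phi>) = indicator A s * H z" .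
      then show "(\<Sum>\<phi>\<in>Om. indicator A s * of_bool (restrict (s \<circ> \<psi>) X = \<phi>) * H \<phi>) = indicator A s * H (restrict (s \<circ> \<psi>) X)"
        by (simp only: z_def)
    qed
    finally show "(\<Sum>\<phi>\<in>Om. mean SS (\<lambda>s. indicator A s * of_bool (restrict (s \<circ> rep \<phi>0 \<tau>) X = \<phi>)) * H \<phi>)
        = mean SS (\<lambda>s. indicator A s * H (restrict (s \<circ> rep \<phi>0 \<tau>) X))"
      by (simp only: \<psi>_def)
  qed
  finally show ?thesis .
qed

lemma transfer_nonneg: "0 \<le> transfer A \<phi>"
  unfolding transfer_def by (intro mult_nonneg_nonneg seed_mean_nonneg mean_nonneg) auto

lemma transfer_le_1:
  assumes "\<phi> \<in> Om"
  shows "transfer A \<phi> \<le> 1"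
proof -
  have "seed_mean (\<lambda>\<psi>. mean SS (\<lambda>s. indicator A s * of_bool (restrict (s \<circ> \<psi>) X = \<phi>)))
      \<le> seed_mean (\<lambda>\<psi>. mean SS (\<lambda>s. of_bool (restrict (s \<circ> \<psi>) X = \<phi>)))"
    by (intro seed_mean_mono mean_mono) (auto simp: indicator_def)
  also have "\<dots> = mean Om (\<lambda>z. of_bool (z = \<phi>))"
    by (rule seed_mean_uniform)
  also have "\<dots> = 1 / real (card Om)"
    using finite_Om assms by (simp add: mean_def of_bool_def sum.delta)
  finally have "transfer A \<phi> \<le> real (card Om) * (1 / real (card Om))"
    unfolding transfer_def by (intro mult_left_mono) auto
  then show ?thesis by (simp split: if_splits)
qed

text \<open>Prescribing \<open>s \<circ> \<psi>\<close> on \<open>T\<close> prescribes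
  \<open>s\<close> on the image of \<open>T\<close>, which has at most \<open>card T\<close> points,
  so globalness applies for each seed; averaging over the seeds restores the uniform law. If the
  prescribed values are inconsistent, both sides vanish.\<close>

lemma cavg_transfer_le:
  assumes glob: "\<And>k I J. I \<in> dlists k X \<Longrightarrow> J \<in> dlists k X \<Longrightarrow>
      mean SS (\<lambda>s. indicator A s * of_bool (map s I = J)) \<le> R ^ k * M * mean SS (\<lambda>s. of_bool (map s I = J))"
    and R: "1 \<le> R" and M: "0 \<le> M" and T: "T \<subseteq> X" and phi: "\<phi> \<in> Om"
  shows "cavg T (transfer A) \<phi> \<le> R ^ card T * M"
proof -
  define g where "g z = (of_bool (\<forall>i\<in>T. z i = \<phi> i) :: real)" for z :: "nat \<Rightarrow> nat"
  have g_restr: "g (restrict z X) = g z" for z using T by (auto simp: g_def subset_iff)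
  have finT: "finite T" using T finite_X finite_subset by blast
  have pt: "mean SS (\<lambda>s. indicator A s * g (s \<circ> rep \<phi>0 \<tau>)) \<le> R ^ card T * M * mean SS (\<lambda>s. g (s \<circ> rep \<phi>0 \<tau>))" for \<phi>0 \<tau>
  proof (cases "\<exists>s0\<in>SS. \<forall>i\<in>T. s0 (rep \<phi>0 \<tau> i) = \<phi> i")
    case False
    then have "g (s \<circ> rep \<phi>0 \<tau>) = 0" if "s \<in> SS" for s using that by (simp add: g_def)
    then show ?thesis by simp
  next
    case True
    then obtain s0 where s0: "s0 \<in> SS" "\<And>i. i \<in> T \<Longrightarrow> s0 (rep \<phi>0 \<tau> i) = \<phi> i" by blast
    have fin: "finite (rep \<phi>0 \<tau> ` T)" using finT by simp
    obtain I where I: "set I = rep \<phi>0 \<tau> ` T" "distinct I" using finite_distinct_list [OF fin] by blast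
    have setI: "set I \<subseteq> X" using I T rep_in_X by auto
    define k where "k = length I"
    have k: "k \<le> card T" unfolding k_def using distinct_card [OF I(2)] I(1) card_image_le [OF finT] by metis
    have Id: "I \<in> dlists k X" using I setI by (simp add: dlists_def k_def)
    have Jd: "map s0 I \<in> dlists k X"
      using Id SS_in_X_iff [OF s0(1)] inj_on_subset [OF inj_SS [OF s0(1)]] by (auto simp: dlists_def distinct_map)
    have eq: "g (s \<circ> rep \<phi>0 \<tau>) = of_bool (map s I = map s0 I)" for s
      using s0(2) I(1) by (auto simp: g_def)
    have "mean SS (\<lambda>s. indicator A s * g (s \<circ> rep \<phi>0 \<tau>)) \<le> R ^ k * M * mean SS (\<lambda>s. g (s \<circ> rep \<phi>0 \<tau>))"
      unfolding eq by (rule glob [OF Id Jd])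
    also have "\<dots> \<le> R ^ card T * M * mean SS (\<lambda>s. g (s \<circ> rep \<phi>0 \<tau>))"
      using k R M by (intro mult_right_mono power_increasing mean_nonneg) (auto simp: g_def)
    finally show ?thesis .
  qed
  have cg: "cavg T g z = g z" if "z \<in> Om" for z
  proof -
    have "g (mix T z w) = g z" for w by (simp add: g_def mix_def)
    then show ?thesis by (simp add: cavg_def)
  qed
  have mg: "0 < mean Om g"
  proof -
    have "0 < (\<Sum>z\<in>Om. g z)" using phi finite_Om by (intro sum_pos2 [of _ \<phi>]) (auto simp: g_def)
    then show ?thesis using finite_Om Om_nonempty by (simp add: mean_def card_gt_0_iff)
  qed
  \<comment> \<open>The conditional expectation is read off as a quotient, by testing against the
    indicator \<open>g\<close> of agreement with \<open>\<phi>\<close> on \<open>T\<close>.\<close>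
  have "cavg T (transfer A) \<phi> * mean Om g = mean Om (\<lambda>z. cavg T (transfer A) z * g z)"
  proof -
    have eq: "cavg T (transfer A) \<phi> * g z = cavg T (transfer A) z * g z" for z
    proof (cases "\<forall>i\<in>T. z i = \<phi> i")
      case True
      then have "cavg T (transfer A) \<phi> = cavg T (transfer A) z" by (intro cavg_dep) auto
      then show ?thesis by simp
    next
      case False
      then have "g z = 0" by (simp only: g_def of_bool_eq)
      then show ?thesis by simp
    qed
    show ?thesis unfolding mean_cmult [symmetric] eq ..
  qed
  also have "\<dots> = mean Om (\<lambda>z. transfer A z * cavg T g z)" by (rule mean_cavg_mult)
  also have "\<dots> = mean Om (\<lambda>z. transfer A z * g z)" by (simp add: cg)
  also have "\<dots> = seed_mean (\<lambda>\<psi>. mean SS (\<lambda>s. indicator A s * g (s \<circ> \<psi>)))"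
    by (simp add: mean_transfer g_restr)
  also have "\<dots> \<le> seed_mean (\<lambda>\<psi>. R ^ card T * M * mean SS (\<lambda>s. g (s \<circ> \<psi>)))"
    by (rule seed_mean_mono) (rule pt)
  also have "\<dots> = R ^ card T * M * mean Om g"
    using seed_mean_uniform [of g] by (simp only: seed_mean_cmult g_restr)
  finally show ?thesis using mg by simp
qed

lemma low_map:
  assumes I: "I \<in> dlists d X"
  shows "low d (\<lambda>s. u (map s I))"
proof -
  have "low d (\<lambda>s. \<Sum>J\<in>dlists d X. u J * indicator (ext (set (zip I J))) s)"
  proof (intro low_sum low_cmult low_indicator)
    fix J assume J: "J \<in> dlists d X"
    have "card (set (zip I J)) \<le> d" using card_length [of "zip I J"] I J by (simp add: dlists_def)
    then show "set (zip I J) \<in> graphs_upto d"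
      using I J by (auto simp: graphs_upto_def dlists_def dest: set_zip_leftD set_zip_rightD)
  qed
  then show ?thesis
  proof (rule low_cong)
    fix s assume s: "s \<in> G"
    have "(\<Sum>J\<in>dlists d X. u J * indicator (ext (set (zip I J))) s) = (\<Sum>J\<in>{map s I}. u J * indicator (ext (set (zip I J))) s)"
    proof (rule sum.mono_neutral_right [OF finite_dlists [OF finite_X]])
      show "{map s I} \<subseteq> dlists d X" using map_in_dlists [OF s I] by simp
      show "\<forall>J\<in>dlists d X - {map s I}. u J * indicator (ext (set (zip I J))) s = 0"
      proof
        fix J assume J: "J \<in> dlists d X - {map s I}"
        then have "length I = length J" using I by (simp add: dlists_def)
        then show "u J * indicator (ext (set (zip I J))) s = 0" using J by (auto simp: ext_zip)
      qed
    qed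
    also have "\<dots> = u (map s I)" using s by (simp add: ext_zip)
    finally show "(\<Sum>J\<in>dlists d X. u J * indicator (ext (set (zip I J))) s) = u (map s I)" .
  qed
qed

text \<open>Seed by seed: if \<open>\<psi>\<close> is injective on \<open>E\<close>, the values on
  \<open>E\<close> form a uniform tuple, exactly as for an even permutation; otherwise the array
  vanishes, which is why only an inequality results.\<close>

lemma mean_Om_graph_square_le:
  assumes B: "harmonic X d B" and E: "E \<in> subs d" and d: "d + 2 \<le> card X"
  shows "mean Om (\<lambda>\<phi>. (B (graph_on \<phi> E))\<^sup>2) \<le> mean G (\<lambda>s. (B (graph_on s E))\<^sup>2)"
proof -
  define M where "M = mean G (\<lambda>s. (B (graph_on s E))\<^sup>2)"
  have M0: "0 \<le> M" unfolding M_def by (intro mean_nonneg) simp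
  have EX: "E \<subseteq> X" using E by (simp add: subs_def)
  obtain e where e: "e \<in> dlists d X" "set e = E" using subs_list [OF E] by blast
  have gr: "graph_on (restrict z X) E = graph_on z E" for z
    unfolding graph_on_def by (rule image_cong) (use EX in auto)
  have "mean Om (\<lambda>\<phi>. (B (graph_on \<phi> E))\<^sup>2) = seed_mean (\<lambda>\<psi>. mean SS (\<lambda>s. (B (graph_on (s \<circ> \<psi>) E))\<^sup>2))"
    using seed_mean_uniform [of "\<lambda>\<phi>. (B (graph_on \<phi> E))\<^sup>2"] by (simp add: gr)
  also have "\<dots> \<le> seed_mean (\<lambda>\<psi>. M)"
  proof (rule seed_mean_mono)
    fix \<phi> \<tau>
    define \<psi> where "\<psi> = rep \<phi> \<tau>"
    have eq: "(B (graph_on (s \<circ> \<psi>) E))\<^sup>2 = (B (set (zip e (map s (map \<psi> e)))))\<^sup>2" for s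
      by (simp add: e(2) [symmetric] graph_on_set)
    have "mean SS (\<lambda>s. (B (graph_on (s \<circ> \<psi>) E))\<^sup>2) \<le> M"
    proof (cases "inj_on \<psi> E")
      case True
      have "\<psi> i \<in> X" if "i \<in> E" for i unfolding \<psi>_def using that EX by (intro rep_in_X) auto
      then have pe: "map \<psi> e \<in> dlists d X" using e True by (auto simp: dlists_def distinct_map)
      have "mean SS (\<lambda>s. (B (graph_on (s \<circ> \<psi>) E))\<^sup>2) = mean (dlists d X) (\<lambda>l. (B (set (zip e l)))\<^sup>2)"
        unfolding eq by (rule mean_SS_map [OF pe])
      also have "\<dots> = mean G (\<lambda>s. (B (set (zip e (map s e))))\<^sup>2)"
        by (rule mean_G_map [OF e(1) d, symmetric])
      also have "\<dots> = M" by (simp add: M_def e(2) [symmetric] graph_on_set)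
      finally show ?thesis by simp
    next
      case False
      have "B (graph_on (s \<circ> \<psi>) E) = 0" for s
      proof -
        have "\<not> inj_on snd (graph_on (s \<circ> \<psi>) E)"
        proof
          assume *: "inj_on snd (graph_on (s \<circ> \<psi>) E)"
          have "inj_on \<psi> E"
          proof (rule inj_onI)
            fix i j assume ij: "i \<in> E" "j \<in> E" "\<psi> i = \<psi> j"
            then have "(i, s (\<psi> i)) \<in> graph_on (s \<circ> \<psi>) E" "(j, s (\<psi> i)) \<in> graph_on (s \<circ> \<psi>) E"
              by (auto simp: graph_on_def)
            from inj_onD [OF * _ this] show "i = j" by simp
          qed
          with False show False ..
        qed
        then show ?thesis using B by (simp add: harmonic_def partials_def)
      qed
      then show ?thesis using M0 by simp
    qed
    then show "mean SS (\<lambda>s. (B (graph_on (s \<circ> rep \<phi> \<tau>) E))\<^sup>2) \<le> M" by (simp only: \<psi>_def)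
  qed
  finally show ?thesis by (simp add: M_def)
qed

text \<open>On the product space a harmonic array is centred in each coordinate of \<open>E\<close>:
  values that collide give 0 and the others form a row sum. By \<open>mean_mult_pure\<close> it
  therefore pairs only with the pure part on \<open>E\<close>.\<close>

lemma harmonic_mean_upd:
  assumes B: "harmonic X d B" and E: "E \<in> subs d" and i: "i \<in> E"
  shows "mean X (\<lambda>v. B (graph_on (\<phi>(i := v)) E)) = 0"
proof -
  define m where "m = graph_on \<phi> (E - {i})"
  have EX: "E \<subseteq> X" and cE: "card E = d" and finE: "finite E" using E subs_finite [OF E] by (auto simp: subs_def)
  have g: "graph_on (\<phi>(i := v)) E = insert (i, v) m" for v
    using i by (auto simp: graph_on_def m_def)
  have im: "i \<notin> fst ` m" by (simp add: m_def)
  have "(\<Sum>v\<in>X. B (insert (i, v) m)) = 0"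
  proof (cases "m \<in> partials X (d - 1)")
    case True
    have "(\<Sum>v\<in>X. B (insert (i, v) m)) = (\<Sum>v\<in>X - snd ` m. B (insert (i, v) m))"
    proof (rule sum.mono_neutral_right [OF finite_X])
      show "\<forall>v\<in>X - (X - snd ` m). B (insert (i, v) m) = 0"
      proof
        fix v assume "v \<in> X - (X - snd ` m)"
        then obtain j where j: "(j, v) \<in> m" by force
        then have "j \<noteq> i" using im by force
        have "\<not> inj_on snd (insert (i, v) m)"
        proof
          assume "inj_on snd (insert (i, v) m)"
          then have "(i, v) = (j, v)" by (rule inj_onD) (use j in auto)
          then show False using \<open>j \<noteq> i\<close> by simp
        qed
        then show "B (insert (i, v) m) = 0" using B by (simp add: harmonic_def partials_def)
      qed
    qed auto
    also have "\<dots> = 0" using B True im i EX by (auto simp: harmonic_def)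
    finally show ?thesis .
  next
    case False
    have "insert (i, v) m \<notin> partials X d" for v
    proof
      assume "insert (i, v) m \<in> partials X d"
      then have "m \<subseteq> X \<times> X" "inj_on fst m" "inj_on snd m" by (auto simp: partials_def)
      moreover have "card m = d - 1" using i cE finE by (simp add: m_def)
      ultimately show False using False by (simp add: partials_def)
    qed
    then show ?thesis using B by (simp add: harmonic_def)
  qed
  then show ?thesis by (simp add: mean_def g)
qed

text \<open>Globalness refers to the symmetric group, the analysis to the alternating group; for
  subsets of the latter the passage costs the factor 1/2.\<close>

lemma mean_SS_indicator:
  assumes "A \<subseteq> G" "card SS = 2 * card G"
  shows "mean SS (\<lambda>s. indicator A s * h s) = mean G (\<lambda>s. indicator A s * h s) / 2"
proof -
  have "(\<Sum>s\<in>SS. indicator A s * h s) = (\<Sum>s\<in>G. indicator A s * h s)"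
    by (rule sum.mono_neutral_right [OF finite_SS G_subset_SS]) (use assms(1) in \<open>auto simp: indicator_def\<close>)
  then show ?thesis by (simp add: mean_def assms(2))
qed

text \<open>The transferred function is paired with the coefficient array of the layer. The coupling
  bounds the pairing below by 9^(-d) / 4 times the energy; on the product space it sees only the
  pure parts, which gives an upper bound by the arithmetic-geometric mean inequality.\<close>

theorem energy_layer_le_level_weight:
  assumes A: "A \<subseteq> G" and d: "0 < d" "10 * d\<^sup>2 \<le> card X" and half: "card SS = 2 * card G"
  shows "energy d (restr (layer d (indicator A))) \<le> 16 * 81 ^ d * level_weight d (transfer A)"
proof -
  note db = degree_bounds [OF d]
  have d2: "2 * d \<le> card X" "d + 2 \<le> card X" "2 * d + 1 \<le> card X" using db(1) by linarith+
  define f where "f = layer d (indicator A)"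
  define B where "B = coefs d f"
  have fo: "orth (d - 1) f" unfolding f_def by (rule orth_layer [OF d(1)])
  have harm: "harmonic X d B" unfolding B_def by (rule harmonic_coefs [OF fo d(1) d2(2)])
  define \<eta> where "\<eta> = energy d (restr f)"
  have \<eta>: "\<eta> = (\<Sum>E\<in>subs d. mean G (\<lambda>s. (B (graph_on s E))\<^sup>2))"
    unfolding \<eta>_def energy_def B_def
    by (intro sum.cong refl mean_cong) (simp_all add: simp_implies_def coefs_graph_on)
  \<comment> \<open>Chosen such that the energy on the right-hand side has half the coefficient of
    the one on the left.\<close>
  define \<alpha> where "\<alpha> = 4 * (9::real) ^ d"
  have \<alpha>0: "0 < \<alpha>" by (simp add: \<alpha>_def)
  define K where "K E = mean Om (\<lambda>\<phi>. transfer A \<phi> * B (graph_on \<phi> E))" for E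
  have lower: "(1 / 9) ^ d / 4 * mean G (\<lambda>s. (B (graph_on s E))\<^sup>2) \<le> K E" if E: "E \<in> subs d" for E
  proof -
    have EX: "E \<subseteq> X" using E by (simp add: subs_def)
    have gr: "graph_on (restrict z X) E = graph_on z E" for z
    unfolding graph_on_def by (rule image_cong) (use EX in auto)
    obtain e where e: "e \<in> dlists d X" "set e = E" using subs_list [OF E] by blast
    have lay: "mean G (\<lambda>s. indicator A s * B (graph_on (s \<circ> \<psi>) E)) = mean G (\<lambda>s. f s * B (graph_on (s \<circ> \<psi>) E))"
      if psi: "\<psi> = rep \<phi> \<tau>" for \<psi> \<phi> \<tau>
    proof (cases "inj_on \<psi> E")
      case True
      have im: "\<psi> ` E \<subseteq> X" unfolding psi using EX rep_in_X by auto
      then have pe: "map \<psi> e \<in> dlists d X" using e True by (auto simp: dlists_def distinct_map)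
      have "low d (\<lambda>s. B (graph_on (s \<circ> \<psi>) E))"
        using low_map [OF pe, of "\<lambda>l. B (set (zip e l))"] by (simp add: e(2) [symmetric] graph_on_set)
      moreover have "orth (d - 1) (\<lambda>s. B (graph_on (s \<circ> \<psi>) E))"
        by (rule orth_single [OF harm E True im d(1) d2(3)])
      ultimately show ?thesis unfolding f_def by (rule mean_mult_layer)
    next
      case False
      have "B (graph_on (s \<circ> \<psi>) E) = 0" for s
      proof -
        have "\<not> inj_on snd (graph_on (s \<circ> \<psi>) E)"
        proof
          assume *: "inj_on snd (graph_on (s \<circ> \<psi>) E)"
          have "inj_on \<psi> E"
          proof (rule inj_onI)
            fix i j assume ij: "i \<in> E" "j \<in> E" "\<psi> i = \<psi> j"
            then have "(i, s (\<psi> i)) \<in> graph_on (s \<circ> \<psi>) E" "(j, s (\<psi> i)) \<in> graph_on (s \<circ> \<psi>) E"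
              by (auto simp: graph_on_def)
            from inj_onD [OF * _ this] show "i = j" by simp
          qed
          with False show False ..
        qed
        then show ?thesis using harm by (simp add: harmonic_def partials_def)
      qed
      then show ?thesis by simp
    qed
    have "K E = seed_mean (\<lambda>\<psi>. mean SS (\<lambda>s. indicator A s * B (graph_on (s \<circ> \<psi>) E)))"
      by (simp add: K_def mean_transfer gr)
    also have "\<dots> = seed_mean (\<lambda>\<psi>. 1 / 2 * mean G (\<lambda>s. f s * B (graph_on (s \<circ> \<psi>) E)))"
      by (rule seed_mean_cong) (simp add: mean_SS_indicator [OF A half] lay [OF refl])
    also have "\<dots> = 1 / 2 * seed_mean (\<lambda>\<psi>. mean G (\<lambda>s. f s * B (graph_on (s \<circ> \<psi>) E)))"
      by (rule seed_mean_cmult)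
    finally have "fixes_prob E [] [] / 4 * mean G (\<lambda>s. (B (graph_on s E))\<^sup>2) \<le> K E"
      using coupled_lower_bound [OF fo B_def E d] by simp
    moreover have "(1 / 9) ^ d / 4 * mean G (\<lambda>s. (B (graph_on s E))\<^sup>2) \<le> fixes_prob E [] [] / 4 * mean G (\<lambda>s. (B (graph_on s E))\<^sup>2)"
      using fixes_prob_ge [OF E d2(1)] by (intro mult_right_mono divide_right_mono mean_nonneg) auto
    ultimately show ?thesis by linarith
  qed
  have upper: "K E \<le> \<alpha> / 2 * mean Om (\<lambda>\<phi>. (pure_part E (transfer A) \<phi>)\<^sup>2) + 1 / (2 * \<alpha>) * mean G (\<lambda>s. (B (graph_on s E))\<^sup>2)"
    if E: "E \<in> subs d" for E
  proof -
    have EX: "E \<subseteq> X" using E by (simp add: subs_def)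
    have amgm: "x * y \<le> \<alpha> / 2 * x\<^sup>2 + 1 / (2 * \<alpha>) * y\<^sup>2" for x y :: real
    proof -
      have "0 \<le> (\<alpha> * x - y)\<^sup>2 / (2 * \<alpha>)" using \<alpha>0 by simp
      also have "\<dots> = \<alpha> / 2 * x\<^sup>2 + 1 / (2 * \<alpha>) * y\<^sup>2 - x * y"
        using \<alpha>0 by (simp add: power2_eq_square field_simps)
      finally show ?thesis by simp
    qed
    have "K E = mean Om (\<lambda>\<phi>. pure_part E (transfer A) \<phi> * B (graph_on \<phi> E))"
      unfolding K_def
    proof (rule mean_mult_pure [OF EX])
      fix \<phi> \<psi> :: "nat \<Rightarrow> nat" assume "\<And>i. i \<in> E \<Longrightarrow> \<phi> i = \<psi> i"
      then have "graph_on \<phi> E = graph_on \<psi> E" by (auto simp: graph_on_def)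
      then show "B (graph_on \<phi> E) = B (graph_on \<psi> E)" by simp
    next
      fix i \<phi> assume "i \<in> E"
      then show "mean X (\<lambda>v. B (graph_on (\<phi>(i := v)) E)) = 0" by (rule harmonic_mean_upd [OF harm E])
    qed
    also have "\<dots> \<le> mean Om (\<lambda>\<phi>. \<alpha> / 2 * (pure_part E (transfer A) \<phi>)\<^sup>2 + 1 / (2 * \<alpha>) * (B (graph_on \<phi> E))\<^sup>2)"
      by (intro mean_mono amgm)
    also have "\<dots> = \<alpha> / 2 * mean Om (\<lambda>\<phi>. (pure_part E (transfer A) \<phi>)\<^sup>2) + 1 / (2 * \<alpha>) * mean Om (\<lambda>\<phi>. (B (graph_on \<phi> E))\<^sup>2)"
      by (simp only: mean_add mean_cmult)
    also have "\<dots> \<le> \<alpha> / 2 * mean Om (\<lambda>\<phi>. (pure_part E (transfer A) \<phi>)\<^sup>2) + 1 / (2 * \<alpha>) * mean G (\<lambda>s. (B (graph_on s E))\<^sup>2)"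
      using mean_Om_graph_square_le [OF harm E d2(2)] \<alpha>0 by (intro add_left_mono mult_left_mono) auto
    finally show ?thesis .
  qed
  have "(1 / 9) ^ d / 4 * \<eta> = (\<Sum>E\<in>subs d. (1 / 9) ^ d / 4 * mean G (\<lambda>s. (B (graph_on s E))\<^sup>2))"
    unfolding \<eta> by (rule sum_distrib_left)
  also have "\<dots> \<le> (\<Sum>E\<in>subs d. \<alpha> / 2 * mean Om (\<lambda>\<phi>. (pure_part E (transfer A) \<phi>)\<^sup>2) + 1 / (2 * \<alpha>) * mean G (\<lambda>s. (B (graph_on s E))\<^sup>2))"
    by (intro sum_mono order_trans [OF lower upper])
  also have "\<dots> = \<alpha> / 2 * level_weight d (transfer A) + 1 / (2 * \<alpha>) * \<eta>"
    by (simp only: sum.distrib sum_distrib_left [symmetric] level_weight_def subs_def \<eta>)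
  finally have main: "(1 / 9) ^ d / 4 * \<eta> \<le> \<alpha> / 2 * level_weight d (transfer A) + 1 / (2 * \<alpha>) * \<eta>" .
  have p9: "(1 / 9) ^ d = 1 / (9::real) ^ d" by (simp add: power_divide)
  have "\<eta> / (8 * 9 ^ d) \<le> 2 * 9 ^ d * level_weight d (transfer A)"
    using main unfolding \<alpha>_def p9 by simp
  then have "\<eta> \<le> 2 * 9 ^ d * level_weight d (transfer A) * (8 * 9 ^ d)"
    by (simp add: pos_divide_le_eq)
  also have "\<dots> = 16 * ((9 * 9) ^ d) * level_weight d (transfer A)"
    by (simp only: power_mult_distrib) simp
  finally show ?thesis by (simp add: \<eta>_def f_def)
qed

end

section \<open>Mixing for global sets\<close>

text \<open>The origin of the cube root: three factors (y / d)^d against one (d / N)^d leave (y^3 /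
  (N d^2))^d under the square root.\<close>

lemma level_product_le:
  fixes \<epsilon> N y :: real
  assumes E: "\<And>i. i \<in> {0, 1, 2 :: nat} \<Longrightarrow> 0 \<le> E i \<and> E i \<le> 4 * (m i)\<^sup>2 * (y / real d) ^ d"
    and m: "\<And>i. 0 \<le> m i" and y: "0 \<le> y" "y ^ 3 \<le> \<epsilon>\<^sup>2 * N" and d: "0 < d" and N: "0 < N" and eps: "0 \<le> \<epsilon>"
  shows "2 * sqrt ((real d / N) ^ d * E 0 * E 1 * E 2) \<le> 16 * (m 0 * m 1 * m 2) * \<epsilon> ^ d"
proof -
  define z where "z = (y / real d) ^ d"
  have z: "0 \<le> z" using y by (simp add: z_def)
  have base: "real d / N * (y / real d) ^ 3 \<le> \<epsilon>\<^sup>2"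
  proof -
    have "real d / N * (y / real d) ^ 3 = y ^ 3 / (N * (real d)\<^sup>2)"
      using d by (simp add: power_divide power2_eq_square power3_eq_cube)
    also have "\<dots> \<le> \<epsilon>\<^sup>2 * N / (N * (real d)\<^sup>2)"
      using y N by (intro divide_right_mono) auto
    also have "\<dots> = \<epsilon>\<^sup>2 / (real d)\<^sup>2" using N by simp
    also have "\<dots> \<le> \<epsilon>\<^sup>2 / 1" using d by (intro divide_left_mono) auto
    finally show ?thesis by simp
  qed
  have "E 0 * E 1 * E 2 \<le> (4 * (m 0)\<^sup>2 * z) * (4 * (m 1)\<^sup>2 * z) * (4 * (m 2)\<^sup>2 * z)"
    using E z by (intro mult_mono) (auto simp: z_def)
  also have "\<dots> = 64 * (m 0 * m 1 * m 2)\<^sup>2 * z ^ 3"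
    by (simp add: power2_eq_square power3_eq_cube)
  finally have "(real d / N) ^ d * (E 0 * E 1 * E 2) \<le> (real d / N) ^ d * (64 * (m 0 * m 1 * m 2)\<^sup>2 * z ^ 3)"
    using N by (intro mult_left_mono) auto
  also have "\<dots> = 64 * (m 0 * m 1 * m 2)\<^sup>2 * (real d / N * (y / real d) ^ 3) ^ d"
    by (simp only: z_def power_mult_distrib mult_ac flip: power_mult)
  also have "\<dots> \<le> 64 * (m 0 * m 1 * m 2)\<^sup>2 * (\<epsilon>\<^sup>2) ^ d"
    using base y N by (intro mult_left_mono power_mono) auto
  also have "\<dots> = (8 * (m 0 * m 1 * m 2) * \<epsilon> ^ d)\<^sup>2"
    by (simp add: power_mult_distrib mult.commute flip: power_mult)
  finally have "sqrt ((real d / N) ^ d * (E 0 * E 1 * E 2)) \<le> 8 * (m 0 * m 1 * m 2) * \<epsilon> ^ d"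
    using m eps by (intro real_le_lsqrt) (auto simp: mult.assoc)
  then show ?thesis by (simp add: mult_ac)
qed

lemma geometric_tail_le:
  fixes \<epsilon> :: real
  assumes "0 \<le> \<epsilon>" "\<epsilon> \<le> 1 / 2"
  shows "(\<Sum>d\<in>{1..D}. \<epsilon> ^ d) \<le> 2 * \<epsilon>"
proof -
  have "(\<Sum>d\<in>{1..D}. \<epsilon> ^ d) \<le> 2 * \<epsilon> - 2 * \<epsilon> ^ Suc D"
  proof (induction D)
    case 0
    then show ?case using assms by simp
  next
    case (Suc D)
    have "2 * \<epsilon> ^ Suc (Suc D) \<le> \<epsilon> ^ Suc D"
      using mult_right_mono [OF assms(2), of "2 * \<epsilon> ^ Suc D"] assms by simp
    with Suc show ?case by simp
  qed
  moreover have "0 \<le> \<epsilon> ^ Suc D" using assms by simp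
  ultimately show ?thesis by linarith
qed

context even_permutations
begin

text \<open>Cauchy-Schwarz followed by \<open>mean_conv_high_le\<close>; discarding the low degree
  part does not increase the norm of \<open>h\<close>.\<close>

lemma trilinear_high_le:
  assumes w: "4 * w \<le> D" "4 * w + 5 \<le> card X"
  shows "2 ^ w * (mean G (\<lambda>x. f x * conv g (\<lambda>y. h y - proj D h y) x))\<^sup>2
    \<le> mean G (\<lambda>x. (f x)\<^sup>2) * (mean G (\<lambda>x. (g x)\<^sup>2) * mean G (\<lambda>x. (h x)\<^sup>2))"
proof -
  define k where "k = (\<lambda>y. h y - proj D h y)"
  have kh: "mean G (\<lambda>x. (k x)\<^sup>2) \<le> mean G (\<lambda>x. (h x)\<^sup>2)"
  proof -
    have "mean G (\<lambda>x. k x * proj D h x) = 0"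
      unfolding k_def by (rule orth_low [OF orth_proj low_proj])
    moreover have "(h x)\<^sup>2 = (k x)\<^sup>2 + 2 * (k x * proj D h x) + (proj D h x)\<^sup>2" for x
      by (simp add: k_def power2_eq_square algebra_simps)
    ultimately have "mean G (\<lambda>x. (h x)\<^sup>2) = mean G (\<lambda>x. (k x)\<^sup>2) + mean G (\<lambda>x. (proj D h x)\<^sup>2)"
      by (simp only: mean_add mean_cmult)
    then show ?thesis by (simp add: mean_nonneg)
  qed
  have "2 ^ w * (mean G (\<lambda>x. f x * conv g k x))\<^sup>2
      \<le> 2 ^ w * (mean G (\<lambda>x. (f x)\<^sup>2) * mean G (\<lambda>x. (conv g k x)\<^sup>2))"
    by (intro mult_left_mono mean_Cauchy_Schwarz) simp
  also have "\<dots> = mean G (\<lambda>x. (f x)\<^sup>2) * (2 ^ w * mean G (\<lambda>x. (conv g k x)\<^sup>2))" by simp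
  also have "\<dots> \<le> mean G (\<lambda>x. (f x)\<^sup>2) * (mean G (\<lambda>x. (g x)\<^sup>2) * mean G (\<lambda>x. (k x)\<^sup>2))"
    unfolding k_def by (intro mult_left_mono mean_conv_high_le [OF orth_proj w] mean_nonneg) simp
  also have "\<dots> \<le> mean G (\<lambda>x. (f x)\<^sup>2) * (mean G (\<lambda>x. (g x)\<^sup>2) * mean G (\<lambda>x. (h x)\<^sup>2))"
    by (intro mult_left_mono kh mean_nonneg) simp_all
  finally show ?thesis by (simp only: k_def)
qed

end

context permutation_transfer
begin

text \<open>Globalness with squared norms and multiplied out by the measure of the umvirate, which
  avoids quotients; \<open>R\<close> is the square of the constant for norms.\<close>

definition global_in :: "real \<Rightarrow> (nat \<Rightarrow> nat) set \<Rightarrow> bool" where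
  "global_in R A \<longleftrightarrow> (\<forall>k. \<forall>I\<in>dlists k X. \<forall>J\<in>dlists k X.
     mean SS (\<lambda>s. indicator A s * of_bool (map s I = J))
       \<le> R ^ k * mean SS (indicator A) * mean SS (\<lambda>s. of_bool (map s I = J)))"

lemma energy_layer_global_le:
  assumes A: "A \<subseteq> G" "global_in R A" "exp (- L) \<le> mean G (indicator A) / 2" and R: "1 \<le> R"
    and half: "card SS = 2 * card G" and d: "0 < d" "10 * d\<^sup>2 \<le> card X" "real d \<le> L"
  shows "energy d (restr (layer d (indicator A)))
    \<le> 4 * (mean G (indicator A))\<^sup>2 * (81 * (12 * R\<^sup>2 + 6000) * L / real d) ^ d"
proof -
  define M where "M = mean SS (indicator A)"
  have M: "M = mean G (indicator A) / 2" using mean_SS_indicator [OF A(1) half, of "\<lambda>_. 1"] by (simp add: M_def)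
  have M0: "0 \<le> M" unfolding M_def by (intro mean_nonneg) simp
  have lw: "level_weight d (transfer A) \<le> M\<^sup>2 * ((12 * R\<^sup>2 + 6000) * L / real d) ^ d"
  proof (rule level_inequality [OF R])
    show "cavg T (transfer A) \<phi> \<le> R ^ card T * M" if "T \<subseteq> X" "\<phi> \<in> Om" for T \<phi>
      by (rule cavg_transfer_le [OF _ R M0 that]) (use A(2) in \<open>auto simp: global_in_def M_def\<close>)
  qed (use A(3) M d transfer_nonneg transfer_le_1 in auto)
  have "energy d (restr (layer d (indicator A))) \<le> 16 * 81 ^ d * level_weight d (transfer A)"
    by (rule energy_layer_le_level_weight [OF A(1) d(1,2) half])
  also have "\<dots> \<le> 16 * 81 ^ d * (M\<^sup>2 * ((12 * R\<^sup>2 + 6000) * L / real d) ^ d)"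
    by (intro mult_left_mono lw) simp
  also have "\<dots> = 4 * (mean G (indicator A))\<^sup>2 * (81 ^ d * ((12 * R\<^sup>2 + 6000) * L / real d) ^ d)"
    by (simp add: M power_divide)
  also have "81 ^ d * ((12 * R\<^sup>2 + 6000) * L / real d) ^ d = (81 * (12 * R\<^sup>2 + 6000) * L / real d) ^ d"
    by (simp only: mult.assoc times_divide_eq_right flip: power_mult_distrib)
  finally show ?thesis .
qed

text \<open>The degrees from 1 to \<open>D\<close> contribute at most 32 / 10^4 of the product of
  the densities and the high part at most 1 / 1000, together less than 1 / 100.\<close>

theorem mixing:
  fixes A B C and L R :: real and D w :: nat
  defines "\<mu> \<equiv> \<lambda>A. mean G (indicator A)"
  assumes sets: "\<And>F. F \<in> {A, B, C} \<Longrightarrow> F \<subseteq> G \<and> global_in R F \<and> exp (- L) \<le> \<mu> F / 2" and R: "1 \<le> R"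
    and half: "card SS = 2 * card G" and D: "10 * D\<^sup>2 \<le> card X" "real D \<le> L"
    and L: "(81 * (12 * R\<^sup>2 + 6000) * L) ^ 3 \<le> (1 / 10 ^ 4)\<^sup>2 * real (card X)"
    and w: "4 * w \<le> D" "4 * w + 5 \<le> card X" "10 ^ 6 \<le> 2 ^ w * (\<mu> A * \<mu> B * \<mu> C)"
  shows "\<bar>mean G (\<lambda>x. indicator A x * conv (indicator B) (indicator C) x) - \<mu> A * \<mu> B * \<mu> C\<bar>
    < 1 / 100 * (\<mu> A * \<mu> B * \<mu> C)"
proof -
  have pos: "0 < \<mu> F" if "F \<in> {A, B, C}" for F
    using sets [OF that] less_le_trans [OF exp_gt_zero, of "- L" "\<mu> F / 2"] by simp
  define P where "P = \<mu> A * \<mu> B * \<mu> C"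
  have P: "0 < P" using pos by (simp add: P_def)
  have sq: "mean G (\<lambda>x. (indicator F x)\<^sup>2) = \<mu> F" for F
  proof -
    have "(indicator F x :: real)\<^sup>2 = indicator F x" for x by (simp add: indicator_def)
    then show ?thesis by (simp add: \<mu>_def)
  qed
  define lev where "lev d = mean G (\<lambda>x. layer d (indicator A) x * conv (layer d (indicator B)) (layer d (indicator C)) x)" for d
  define high where "high = mean G (\<lambda>x. indicator A x * conv (indicator B) (\<lambda>y. indicator C y - proj D (indicator C) y) x)"
  have lev_le: "\<bar>lev d\<bar> \<le> 16 * P * (1 / 10 ^ 4) ^ d" if d: "d \<in> {1..D}" for d
  proof -
    have "d\<^sup>2 \<le> D\<^sup>2" using d by (intro power_mono) auto
    then have "10 * d\<^sup>2 \<le> card X" using D(1) by linarith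
    with d D(2) have d': "0 < d" "10 * d\<^sup>2 \<le> card X" "real d \<le> L" by auto
    define K where "K = 81 * (12 * R\<^sup>2 + 6000) * L"
    define S where "S i = (if i = 0 then A else if i = 1 then B else C)" for i :: nat
    define E where "E i = energy d (restr (layer d (indicator (S i))))" for i
    have K0: "0 \<le> K" using d' by (auto simp: K_def intro!: mult_nonneg_nonneg add_nonneg_nonneg)
    have "\<bar>lev d\<bar> \<le> 2 * sqrt ((real d / real (card X)) ^ d * E 0 * E 1 * E 2)"
      using trilinear_level_le [OF low_layer orth_layer [OF d'(1)] low_layer orth_layer [OF d'(1)] d'(1,2)]
      by (simp add: lev_def E_def S_def)
    also have "\<dots> \<le> 16 * (\<mu> (S 0) * \<mu> (S 1) * \<mu> (S 2)) * (1 / 10 ^ 4) ^ d"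
    proof (rule level_product_le [where y = K])
      fix i :: nat
      have "S i \<in> {A, B, C}" by (simp add: S_def)
      with sets have s: "S i \<subseteq> G" "global_in R (S i)" "exp (- L) \<le> mean G (indicator (S i)) / 2"
        unfolding \<mu>_def by blast+
      show "0 \<le> E i \<and> E i \<le> 4 * (\<mu> (S i))\<^sup>2 * (K / real d) ^ d"
        using energy_layer_global_le [OF s R half d'] energy_nonneg by (simp add: E_def \<mu>_def K_def)
      show "0 \<le> \<mu> (S i)" by (simp add: \<mu>_def mean_nonneg)
    qed (use K0 L d' w in \<open>auto simp: K_def\<close>)
    finally show ?thesis by (simp add: S_def P_def)
  qed
  have "\<bar>\<Sum>d\<in>{1..D}. lev d\<bar> \<le> (\<Sum>d\<in>{1..D}. 16 * P * (1 / 10 ^ 4) ^ d)"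
    by (rule order_trans [OF sum_abs sum_mono [OF lev_le]])
  also have "\<dots> = 16 * P * (\<Sum>d\<in>{1..D}. (1 / 10 ^ 4) ^ d)" by (simp only: sum_distrib_left)
  also have "\<dots> \<le> 16 * P * (2 * (1 / 10 ^ 4))"
    using P by (intro mult_left_mono geometric_tail_le) auto
  also have "\<dots> \<le> 1 / 200 * P" using P by simp
  finally have low: "\<bar>\<Sum>d\<in>{1..D}. lev d\<bar> \<le> 1 / 200 * P" .
  have high: "\<bar>high\<bar> \<le> 1 / 1000 * P"
  proof -
    have "2 ^ w * high\<^sup>2 \<le> \<mu> A * (\<mu> B * \<mu> C)"
      unfolding high_def using trilinear_high_le [OF w(1,2), of "indicator A" "indicator B" "indicator C"]
      by (simp only: sq)
    then have "2 ^ w * high\<^sup>2 \<le> P" by (simp add: P_def mult.assoc)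
    then have "P * (2 ^ w * high\<^sup>2) \<le> P * P" using P by (intro mult_left_mono) auto
    moreover have "10 ^ 6 * high\<^sup>2 \<le> 2 ^ w * P * high\<^sup>2"
      using w(3) by (intro mult_right_mono) (auto simp: P_def)
    ultimately have "10 ^ 6 * high\<^sup>2 \<le> P\<^sup>2" by (simp add: power2_eq_square mult_ac)
    then have "high\<^sup>2 \<le> (1 / 1000 * P)\<^sup>2" by (simp add: power_mult_distrib power_divide)
    then show ?thesis using P by (subst (asm) abs_le_square_iff [symmetric]) auto
  qed
  have "mean G (\<lambda>x. indicator A x * conv (indicator B) (indicator C) x) = P + (\<Sum>d\<in>{1..D}. lev d) + high"
    unfolding lev_def high_def P_def \<mu>_def by (rule trilinear_decomposition)
  then show ?thesis using low high P unfolding P_def [symmetric] abs_less_iff abs_le_iff by linarith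
qed

end

section \<open>Specialisation to the alternating group on {1..n} and choice of constants\<close>

declare One_nat_def [simp del]

lemma mean_indicator:
  assumes "finite A"
  shows "mean A (indicator B) = real (card (A \<inter> B)) / real (card A)"
proof -
  have "(\<Sum>x\<in>A. indicator B x) = (\<Sum>x\<in>A. if x \<in> B then 1 else 0 :: real)"
    by (intro sum.cong) (auto simp: indicator_def)
  then show ?thesis using assms by (simp add: mean_def sum.If_cases Int_def)
qed

lemma prob_pair_pmf_of_set:
  assumes "finite G" "G \<noteq> {}"
  shows "measure_pmf.prob (pair_pmf (pmf_of_set G) (pmf_of_set G)) {(a, b). a \<in> A \<and> b \<in> B \<and> f a b \<in> C}
    = mean G (\<lambda>x. indicator A x * mean G (\<lambda>y. indicator B y * indicator C (f x y)))"
proof -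
  have "measure_pmf.prob (pair_pmf (pmf_of_set G) (pmf_of_set G)) {(a, b). a \<in> A \<and> b \<in> B \<and> f a b \<in> C}
      = mean (G \<times> G) (indicator {(a, b). a \<in> A \<and> b \<in> B \<and> f a b \<in> C})"
  proof -
    have "pair_pmf (pmf_of_set G) (pmf_of_set G) = pmf_of_set (G \<times> G)"
      using assms by (intro pmf_eqI) (auto simp: pmf_pair pmf_of_set [OF assms(2,1)] indicator_def)
    then show ?thesis using assms by (simp add: mean_indicator measure_pmf_of_set)
  qed
  also have "\<dots> = mean (G \<times> G) (\<lambda>z. indicator A (fst z) * (indicator B (snd z) * indicator C (f (fst z) (snd z))))"
    by (rule mean_cong) (auto simp: indicator_def simp_implies_def)
  finally show ?thesis by (simp add: mean_Times mean_cmult)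
qed

lemma permutation_transfer_interval: "0 < n \<Longrightarrow> permutation_transfer {1..n}"
  by (intro permutation_transfer.intro even_permutations.intro finite_product.intro) auto

lemma G_interval: "0 < n \<Longrightarrow> even_permutations.G {1..n} = carrier (alt_group n)"
  by (auto simp: even_permutations.G_def [OF even_permutations.intro] alt_group_carrier)

lemma SS_interval: "0 < n \<Longrightarrow> permutation_transfer.SS {1..n} = carrier (sym_group n)"
  by (auto simp: permutation_transfer.SS_def [OF permutation_transfer_interval] sym_group_carrier)

text \<open>The L2 norm of an indicator is the square root of a density, so squaring replaces
  \<open>r\<close> with its square.\<close>

lemma global_in_interval:
  assumes n: "0 < n" and glob: "global_set n r A"
  shows "permutation_transfer.global_in {1..n} (r\<^sup>2) A"
proof -
  interpret permutation_transfer "{1..n}" by (rule permutation_transfer_interval [OF n])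
  have norm: "l2norm_on U (indicator A) = sqrt (mean U (indicator A))" if "finite U" "U \<noteq> {}" for U
  proof -
    have "\<bar>indicator A x :: real\<bar>\<^sup>2 = indicator A x" for x by (simp add: indicator_def)
    then show ?thesis using that by (simp add: l2norm_on_def measure_pmf_of_set mean_indicator)
  qed
  show ?thesis
    unfolding global_in_def
  proof (intro allI ballI)
    fix k I J assume IJ: "I \<in> dlists k {1..n}" "J \<in> dlists k {1..n}"
    define U where "U = {s \<in> SS. map s I = J}"
    have finU: "finite U" using finite_SS by (simp add: U_def)
    have neU: "U \<noteq> {}" using ex_permutes_map [OF IJ] by (auto simp: U_def SS_def)
    have "umvirate n I J = U"
      using IJ by (auto simp: umvirate_def U_def SS_interval [OF n] dlists_def list_eq_iff_nth_eq)
    moreover have "I \<in> tuples n k" "J \<in> tuples n k" using IJ by (auto simp: tuples_def dlists_def)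
    ultimately have "l2norm_on U (indicator A) \<le> r ^ k * l2norm_on SS (indicator A)"
      using glob unfolding global_set_def SS_interval [OF n] by metis
    then have "sqrt (mean U (indicator A)) \<le> r ^ k * sqrt (mean SS (indicator A))"
      by (simp add: norm finU neU finite_SS SS_nonempty)
    then have "(sqrt (mean U (indicator A)))\<^sup>2 \<le> (r ^ k * sqrt (mean SS (indicator A)))\<^sup>2"
      by (intro power_mono) (auto intro: mean_nonneg)
    then have le: "mean U (indicator A) \<le> (r\<^sup>2) ^ k * mean SS (indicator A)"
      by (simp add: power_mult_distrib mean_nonneg mult.commute flip: power_mult)
    have "(\<Sum>s\<in>SS. indicator A s * of_bool (map s I = J)) = (\<Sum>s\<in>U. indicator A s :: real)"
      unfolding U_def by (rule sum.mono_neutral_cong_right [OF finite_SS]) auto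
    moreover have "(\<Sum>s\<in>SS. of_bool (map s I = J)) = real (card U)"
      unfolding U_def using finite_SS by (simp add: sum.If_cases of_bool_def Int_def)
    ultimately have "mean SS (\<lambda>s. indicator A s * of_bool (map s I = J))
        = mean U (indicator A) * mean SS (\<lambda>s. of_bool (map s I = J))"
      using finU neU by (simp add: mean_def)
    then show "mean SS (\<lambda>s. indicator A s * of_bool (map s I = J))
        \<le> (r\<^sup>2) ^ k * mean SS (indicator A) * mean SS (\<lambda>s. of_bool (map s I = J))"
      using le by (simp add: mult_right_mono mean_nonneg)
  qed
qed

lemma alt_density_mean:
  assumes "A \<subseteq> carrier (alt_group n)" "finite (carrier (alt_group n))"
  shows "mean (carrier (alt_group n)) (indicator A) = alt_density n A"
  using assms by (simp add: mean_indicator alt_density_def Int_absorb1)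

text \<open>A proper subset of a group of order at most \<open>N!\<close> has density at most \<open>1 - 1/N!\<close>.\<close>

lemma alt_density_full:
  assumes A: "A \<subseteq> carrier (alt_group n)" and n: "0 < n" "n \<le> N"
    and c: "0 \<le> c" "c \<le> 1 / (2 * real N * fact N)" and dens: "exp (- c * real n powr (1 / 3)) \<le> alt_density n A"
  shows "A = carrier (alt_group n)"
proof (rule ccontr)
  assume "A \<noteq> carrier (alt_group n)"
  interpret permutation_transfer "{1..n}" by (rule permutation_transfer_interval [OF n(1)])
  define k where "k = card (carrier (alt_group n))"
  have G: "finite (carrier (alt_group n))" "carrier (alt_group n) \<noteq> {}"
    using finite_G G_nonempty by (simp_all add: G_interval [OF n(1)])
  have k0: "0 < k" using G by (simp add: k_def card_gt_0_iff)
  have kN: "real k \<le> fact N"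
  proof -
    have "k \<le> card {p. p permutes {1..n}}"
      unfolding k_def by (intro card_mono finite_permutations) (auto simp: alt_group_carrier)
    also have "\<dots> = fact n" by (simp add: card_permutations)
    also have "\<dots> \<le> fact N" using n by (simp add: fact_mono)
    finally have "real k \<le> real (fact N)" by (simp only: of_nat_le_iff)
    then show ?thesis by simp
  qed
  have "card A < k" unfolding k_def using A G \<open>A \<noteq> _\<close> by (intro psubset_card_mono) auto
  then have "real (card A) \<le> real k - 1" by linarith
  then have "alt_density n A \<le> (real k - 1) / real k"
    unfolding alt_density_def k_def by (intro divide_right_mono) auto
  also have "\<dots> = 1 - 1 / real k" using k0 by (simp add: field_simps)
  finally have le: "alt_density n A \<le> 1 - 1 / real k" .
  \<comment> \<open>For n <= N this crude bound is enough: c n^(1/3) <= 1 / (2 N!) < 1 / k, so the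
    density exceeds 1 - 1 / k.\<close>
  have "real n powr (1 / 3) \<le> real n powr 1" using n by (intro powr_mono) auto
  also have "\<dots> \<le> real N" using n by simp
  finally have "c * real n powr (1 / 3) \<le> 1 / (2 * real N * fact N) * real N"
    using c by (intro mult_mono) auto
  also have "\<dots> = 1 / (2 * fact N)" using n by simp
  also have "\<dots> < 1 / real k"
  proof (rule divide_strict_left_mono)
    show "real k < 2 * fact N" using kN k0 fact_gt_zero [of N, where 'a = real] by linarith
  qed (use k0 in auto)
  finally have "1 - 1 / real k < exp (- c * real n powr (1 / 3))"
    using exp_ge_add_one_self [of "- c * real n powr (1 / 3)"] by simp
  then show False using le dens by linarith
qed

lemma two_power_ge_exp: "exp (real w / 2) \<le> 2 ^ w"
proof -
  have "exp (real w / 2) = exp (1 / 2) ^ w" by (simp flip: exp_of_nat_mult)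
  also have "\<dots> \<le> 2 ^ w" by (intro power_mono exp_half_le2) simp
  finally show ?thesis .
qed

text \<open>\<open>\<delta>\<close> makes the constant of the level inequality times L equal to
  n^(1/3) / 10^3, whose cube is n / 10^9, a factor 10 below what the levels require. The bound on
  \<open>c\<close> makes all densities at least exp (- L / 100).\<close>

lemma alt_group_mixing:
  fixes \<delta> c :: real and n :: nat
  defines "\<delta> \<equiv> 1 / (10 ^ 3 * (81 * (12 * (100\<^sup>2)\<^sup>2 + 6000)))"
  assumes sets: "\<And>F. F \<in> {A, B, C} \<Longrightarrow> F \<subseteq> carrier (alt_group n) \<and> global_set n 100 F \<and>
      exp (- c * real n powr (1 / 3)) \<le> alt_density n F"
    and c: "c \<le> \<delta> / 100" and n: "300 \<le> \<delta> * real n powr (1 / 3)"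
  shows "\<bar>mean (carrier (alt_group n)) (\<lambda>x. indicator A x * mean (carrier (alt_group n)) (\<lambda>y. indicator B y * indicator C (x \<circ> y)))
      - alt_density n A * alt_density n B * alt_density n C\<bar> < 1 / 100 * (alt_density n A * alt_density n B * alt_density n C)"
proof -
  define L where "L = \<delta> * real n powr (1 / 3)"
  have L: "300 \<le> L" using n by (simp add: L_def)
  have n0: "0 < n" using n by (cases n) auto
  interpret permutation_transfer "{1..n}" by (rule permutation_transfer_interval [OF n0])
  have L3: "(81 * (12 * (100\<^sup>2)\<^sup>2 + 6000) * L) ^ 3 = (1 / 10 ^ 3) ^ 3 * real n"
  proof -
    have "81 * (12 * (100\<^sup>2)\<^sup>2 + 6000) * L = 1 / 10 ^ 3 * real n powr (1 / 3)"
      by (simp add: L_def \<delta>_def)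
    moreover have "(real n powr (1 / 3)) ^ 3 = real n" using n0 by (simp add: powr_power)
    ultimately show ?thesis by (simp only: power_mult_distrib)
  qed
  define D where "D = nat \<lfloor>L\<rfloor>"
  have D: "real D \<le> L" "L < real D + 1" using L by (auto simp: D_def)
  have D0: "0 < D" using D L by (intro Nat.gr0I) auto
  have nD: "10 * D\<^sup>2 \<le> n"
  proof -
    have "10 * (real D)\<^sup>2 \<le> L * L\<^sup>2" using L D by (intro mult_mono power_mono) auto
    also have "\<dots> = L ^ 3" by (simp add: power2_eq_square power3_eq_cube)
    also have "\<dots> \<le> (81 * (12 * (100\<^sup>2)\<^sup>2 + 6000) * L) ^ 3" using L by (intro power_mono) auto
    also have "\<dots> \<le> real n" unfolding L3 by (simp add: power_divide)
    finally have "real (10 * D\<^sup>2) \<le> real n" by simp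
    then show ?thesis by (simp only: of_nat_le_iff)
  qed
  define w where "w = D div 4"
  have w: "4 * w \<le> D" "D < 4 * w + 4" unfolding w_def by linarith+
  have "D + 5 \<le> 10 * D\<^sup>2" using D0 by (simp add: power2_eq_square) (induction D, auto)
  then have w2: "4 * w + 5 \<le> n" using w nD by linarith
  have n2: "2 \<le> n" using w2 by simp
  have half: "card SS = 2 * card G"
    using alt_group_card_carrier [OF n2] card_permutations [of "{1..n}" n]
    by (simp add: SS_def G_interval [OF n0])
  have mu: "mean G (indicator F) = alt_density n F" if "F \<in> {A, B, C}" for F
    using alt_density_mean [of F n] sets [OF that] finite_G by (simp add: G_interval [OF n0])
  have dens: "exp (- L / 100) \<le> alt_density n F" if "F \<in> {A, B, C}" for F
  proof -
    have "c * real n powr (1 / 3) \<le> \<delta> / 100 * real n powr (1 / 3)" using c by (intro mult_right_mono) auto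
    then have "exp (- L / 100) \<le> exp (- c * real n powr (1 / 3))" by (simp add: L_def)
    then show ?thesis using sets [OF that] by linarith
  qed
  have key: "10 ^ 6 \<le> 2 ^ w * (alt_density n A * alt_density n B * alt_density n C)"
  proof -
    have "(10 ^ 6 :: real) \<le> 2 ^ 20" by simp
    also have "\<dots> \<le> exp 1 ^ 20" using exp_ge_add_one_self [of 1] by (intro power_mono) auto
    also have "\<dots> = exp 20" by (simp flip: exp_of_nat_mult)
    \<comment> \<open>As w is about L / 4, the exponent is about L / 8 - 3 L / 100, which exceeds 20
      because of \<open>300 \<le> L\<close>.\<close>
    also have "\<dots> \<le> exp (real w / 2 + (- L / 100 + - L / 100 + - L / 100))"
    proof -
      have "real D < 4 * real w + 4" using w(2) by linarith
      then show ?thesis using D L by simp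
    qed
    also have "\<dots> = exp (real w / 2) * (exp (- L / 100) * exp (- L / 100) * exp (- L / 100))"
      by (simp only: exp_add)
    also have "\<dots> \<le> 2 ^ w * (alt_density n A * alt_density n B * alt_density n C)"
      by (intro mult_mono two_power_ge_exp dens mult_nonneg_nonneg) (auto simp: alt_density_def)
    finally show ?thesis .
  qed
  have "\<bar>mean G (\<lambda>x. indicator A x * conv (indicator B) (indicator C) x)
      - mean G (indicator A) * mean G (indicator B) * mean G (indicator C)\<bar>
      < 1 / 100 * (mean G (indicator A) * mean G (indicator B) * mean G (indicator C))"
  proof (rule mixing [where L = L and R = "100\<^sup>2" and D = D and w = w])
    fix F assume F: "F \<in> {A, B, C}"
    have "2 \<le> exp (99 / 100 * L)"
      using L by (intro order_trans [OF _ exp_ge_add_one_self]) simp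
    then have "exp (- L) * 2 \<le> exp (- L) * exp (99 / 100 * L)" by (intro mult_left_mono) simp_all
    also have "\<dots> = exp (- L / 100)" by (simp flip: exp_add)
    finally have "exp (- L) \<le> mean G (indicator F) / 2" using dens [OF F] mu [OF F] by simp
    then show "F \<subseteq> G \<and> global_in (100\<^sup>2) F \<and> exp (- L) \<le> mean G (indicator F) / 2"
      using sets [OF F] global_in_interval [OF n0, of 100 F] unfolding G_interval [OF n0] by blast
  next
    show "(81 * (12 * (100\<^sup>2)\<^sup>2 + 6000) * L) ^ 3 \<le> (1 / 10 ^ 4)\<^sup>2 * real (card {1..n})"
      unfolding L3 by (simp add: power_divide)
  next
    show "10 ^ 6 \<le> 2 ^ w * (mean G (indicator A) * mean G (indicator B) * mean G (indicator C))"
      using key by (simp add: mu)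
  qed (use half nD D w w2 in auto)
  then show ?thesis by (simp add: mu [unfolded G_interval [OF n0]] conv_def G_interval [OF n0])
qed

theorem theorem1p14:
  shows "\<exists>c::real. c > 0 \<and>
    (\<forall>n::nat. n > 0 \<longrightarrow>
      (\<forall>A B C :: (nat \<Rightarrow> nat) set.
         A \<subseteq> carrier (alt_group n) \<longrightarrow>
         B \<subseteq> carrier (alt_group n) \<longrightarrow>
         C \<subseteq> carrier (alt_group n) \<longrightarrow>
         global_set n 100 A \<longrightarrow> global_set n 100 B \<longrightarrow> global_set n 100 C \<longrightarrow>
         alt_density n A \<ge> exp (- c * real n powr (1 / 3)) \<longrightarrow>
         alt_density n B \<ge> exp (- c * real n powr (1 / 3)) \<longrightarrow>
         alt_density n C \<ge> exp (- c * real n powr (1 / 3)) \<longrightarrow>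
         (let p = measure_pmf.prob
                    (pair_pmf (pmf_of_set (carrier (alt_group n)))
                              (pmf_of_set (carrier (alt_group n))))
                    {(a, b). a \<in> A \<and> b \<in> B \<and> a \<otimes>\<^bsub>alt_group n\<^esub> b \<in> C}
          in (1 - 0.01) * (alt_density n A * alt_density n B * alt_density n C) < p \<and>
             p < (1 + 0.01) * (alt_density n A * alt_density n B * alt_density n C))))"
proof -
  define \<delta> :: real where "\<delta> = 1 / (10 ^ 3 * (81 * (12 * (100\<^sup>2)\<^sup>2 + 6000)))"
  \<comment> \<open>Beyond \<open>N\<close> the threshold 300 <= \<delta> n^(1/3) of
    \<open>alt_group_mixing\<close> is met; up to \<open>N\<close> the second entry in the minimum
    \<open>c\<close> forces the three sets to be the whole group.\<close>
  define N where "N = Suc (nat \<lceil>(300 / \<delta>) ^ 3\<rceil>)"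
  define c where "c = min (\<delta> / 100) (1 / (2 * real N * fact N))"
  have delta: "0 < \<delta>" by (simp add: \<delta>_def)
  have "0 < N" by (simp add: N_def)
  then have c: "0 < c" "c \<le> \<delta> / 100" "c \<le> 1 / (2 * real N * fact N)"
    using delta by (auto simp: c_def)
  have key: "(1 - 0.01) * (alt_density n A * alt_density n B * alt_density n C) < p \<and>
      p < (1 + 0.01) * (alt_density n A * alt_density n B * alt_density n C)"
    if n: "0 < n" and sets: "\<And>F. F \<in> {A, B, C} \<Longrightarrow> F \<subseteq> carrier (alt_group n) \<and> global_set n 100 F \<and>
        exp (- c * real n powr (1 / 3)) \<le> alt_density n F"
      and p: "p = measure_pmf.prob
        (pair_pmf (pmf_of_set (carrier (alt_group n))) (pmf_of_set (carrier (alt_group n))))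
        {(a, b). a \<in> A \<and> b \<in> B \<and> a \<otimes>\<^bsub>alt_group n\<^esub> b \<in> C}" for n A B C p
  proof -
    interpret permutation_transfer "{1..n}" by (rule permutation_transfer_interval [OF n])
    have fin: "finite (carrier (alt_group n))" and ne: "carrier (alt_group n) \<noteq> {}"
      using finite_G G_nonempty by (simp_all add: G_interval [OF n])
    have p': "p = mean (carrier (alt_group n))
        (\<lambda>x. indicator A x * mean (carrier (alt_group n)) (\<lambda>y. indicator B y * indicator C (x \<circ> y)))"
      unfolding p by (subst prob_pair_pmf_of_set [OF fin ne]) (simp add: alt_group_mult)
    show ?thesis
    proof (cases "n \<le> N")
      case True
      have full: "F = carrier (alt_group n)" if "F \<in> {A, B, C}" for F
        using alt_density_full [OF _ n True _ c(3)] sets [OF that] c(1) by simp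
      have ABC: "A = carrier (alt_group n)" "B = carrier (alt_group n)" "C = carrier (alt_group n)"
        using full by blast+
      have "p = 1"
        unfolding p' ABC using comp_in_G fin ne by (simp add: G_interval [OF n] mean_const)
      moreover have "alt_density n (carrier (alt_group n)) = 1"
        using fin ne by (simp add: alt_density_def)
      ultimately show ?thesis unfolding ABC by simp
    next
      case False
      have "(300 / \<delta>) ^ 3 \<le> real n"
        using False real_nat_ceiling_ge [of "(300 / \<delta>) ^ 3"] unfolding N_def by linarith
      also have "\<dots> = (real n powr (1 / 3)) ^ 3" using n by (simp add: powr_power)
      finally have "300 / \<delta> \<le> real n powr (1 / 3)" by (rule power_le_imp_le_base [of _ 2, unfolded Suc_eq_plus1, simplified]) simp
      then have large: "300 \<le> \<delta> * real n powr (1 / 3)" using delta by (simp add: field_simps)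
      have "\<bar>p - alt_density n A * alt_density n B * alt_density n C\<bar>
          < 1 / 100 * (alt_density n A * alt_density n B * alt_density n C)"
        unfolding p' by (rule alt_group_mixing [OF sets c(2) [unfolded \<delta>_def] large [unfolded \<delta>_def]])
      then show ?thesis unfolding abs_less_iff by simp
    qed
  qed
  show ?thesis
    unfolding Let_def by (rule exI [of _ c], rule conjI [OF c(1)], intro allI impI, rule key) auto
qed

end
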